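(* Let $n>1$, $m\ge1$. The map $$\pi: X=X_1\times\cdots\times X_m\longrightarrow U^{\le m},\qquad (x_1,\dots,x_m)\longmapsto M(x_1)\cdots M(x_m),$$ identifies the quotient of the product geometric crystal $X$ (a product of $m$ copies of the basic geometric crystal $X_M$ of type $A_{n-1}^{(1)}$) by the $S_m$ birational $R$-matrix action with the geometric crystal on $U^{\le m}$ defined by $$\varepsilon_k(Y)=\frac{y_{k+1,k+m+1}}{y_{k+1,k+m}},\quad \varphi_k(Y)=\frac{y_{k,k+m}}{y_{k+1,k+m}},\quad e_k^c(Y)=u_k\big((c-1)\varphi_k(Y)\big)\,Y\,u_{k+m}\big((c^{-1}-1)\varepsilon_k(Y)\big).$$ That is: these data make $U^{\le m}$ a geometric crystal; $\pi$ commutes with the geometric crystal structures, i.e. $\varepsilon_k\circ\pi=\varepsilon_k$, $\varphi_k\circ\pi=\varphi_k$ and $\pi\circ e_k^c=e_k^c\circ\pi$ (as rational functions/maps) for all $k\in\mathbb{Z}/n\mathbb{Z}$, $c\in\mathbb{C}^*$; and pullback along $\pi$ induces an isomorphism $\mathbb{C}(U^{\le m})\simeq\mathbb{C}(X)^{S_m}$.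
   Context: Upper indices are taken modulo $n$; $k\in\mathbb{Z}/n\mathbb{Z}$. **Affine geometric crystal of type $A_{n-1}^{(1)}$.** Let $(a_{ij})_{i,j\in\mathbb{Z}/n\mathbb{Z}}$ be the Cartan matrix: for $n>2$, $a_{ii}=2$, $a_{ij}=-1$ if $i-j\equiv\pm1\bmod n$, $a_{ij}=0$ otherwise; for $n=2$, $a_{11}=a_{22}=2$, $a_{12}=a_{21}=-2$. A geometric crystal is a complex algebraic variety $X$ with rational functions $\varepsilon_i,\gamma_i:X\to\mathbb{C}$ and rational $\mathbb{C}^*$-actions $e_i:(c,x)\mapsto e_i^c(x)$, such that (wherever both sides are defined): (1) the domain of $e_i^1$ is dense in $X$; (2) $\gamma_j(e_i^c(x))=c^{a_{ij}}\gamma_j(x)$; (3) $\varepsilon_i(e_i^c(x))=c^{-1}\varepsilon_i(x)$; (4) $e_i^ce_j^{c'}=e_j^{c'}e_i^c$ for $i\ne j$, $a_{ij}=0$; (5) $e_i^ce_j^{cc'}e_i^{c'}=e_j^{c'}e_i^{cc'}e_j^c$ for $i\ne j$, $a_{ij}=-1$. One sets $\varphi_i=\gamma_i\varepsilon_i$, and may specify $\varphi_i$ instead of $\gamma_i$. **Products.** For geometric crystals $X,X'$, the product $X\times X'$ is a geometric crystal with $$\varepsilon_k(x,x')=\frac{\varepsilon_k(x)\varepsilon_k(x')}{\varphi_k(x')+\varepsilon_k(x)},\quad \varphi_k(x,x')=\frac{\varphi_k(x)\varphi_k(x')}{\varepsilon_k(x)+\varphi_k(x')},\quad e_k^c(x,x')=(e_k^{c^+}x,\,e_k^{c/c^+}x'),\quad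 c^+=\frac{c\varphi_k(x')+\varepsilon_k(x)}{\varphi_k(x')+\varepsilon_k(x)}.$$ **The product crystal $X$.** The basic geometric crystal is $X_M=\{x=(x^{(1)},\dots,x^{(n)})\mid x^{(i)}\in\mathbb{C}^*\}$ with $\varepsilon_i(x)=x^{(i+1)}$, $\varphi_i(x)=x^{(i)}$, $\gamma_i(x)=x^{(i)}/x^{(i+1)}$ and $e_i^c$ multiplying $x^{(i)}$ by $c$ and $x^{(i+1)}$ by $c^{-1}$, fixing other coordinates. In $X=X_1\times\cdots\times X_m$ each $X_i\simeq X_M$, but with the indexing of coordinates shifted: $X_i=\{x_i=(x_i^{(i)},x_i^{(i+1)},\dots,x_i^{(i+n-1)})\}$, so that $\varphi_k(x_i)=x_i^{(k+i-1)}$, $\varepsilon_k(x_i)=x_i^{(k+i)}$, and $e_k^c$ on $X_i$ multiplies $x_i^{(k+i-1)}$ by $c$ and $x_i^{(k+i)}$ by $c^{-1}$. **Birational $R$-matrix action.** Let $\kappa_r(x_j,x_{j+1})=\sum_{s=0}^{n-1}\big(\prod_{t=1}^{s}x_{j+1}^{(r+t)}\prod_{t=s+1}^{n-1}x_j^{(r+t)}\big)$. $S_m$ acts on $\mathbb{C}(X)$ by field automorphisms over $\mathbb{C}$ with simple transpositions $s_j$ ($1\le j\le m-1$) acting by $$s_j(x_j^{(r)})=\frac{x_{j+1}^{(r+1)}\kappa_{r+1}(x_j,x_{j+1})}{\kappa_r(x_j,x_{j+1})},\qquad s_j(x_{j+1}^{(r)})=\frac{x_j^{(r-1)}\kappa_{r-1}(x_j,x_{j+1})}{\kappa_r(x_j,x_{j+1})},$$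 and $s_j(x_k^{(r)})=x_k^{(r)}$ for $k\ne j,j+1$. This action is by geometric crystal isomorphisms. **Quotient.** If $\Gamma$ is a group of crystal automorphisms of a geometric crystal $X$, a geometric crystal $X'$ is the quotient of $X$ by $\Gamma$ if there is a rational map $X\to X'$ commuting with the geometric crystal structure and inducing $\mathbb{C}(X')\simeq\mathbb{C}(X)^\Gamma$. **Loop group notation.** An element $g=(g_{ij})$ of $GL_n(\mathbb{C}((t)))$ with $g_{ij}=\sum_k g_{ij}^kt^k$ is identified with the infinite periodic matrix $Y=(y_{rs})_{r,s\in\mathbb{Z}}$, $y_{i+kn,j+k'n}=g_{ij}^{k'-k}$ ($1\le i,j\le n$). $U$ is the group of such $Y$ that are upper triangular with $1$'s on the main diagonal; $U^{\le m}\subset U$ consists of those with $y_{ij}=0$ for $j-i>m$ (so $U^{\le m}\simeq\mathbb{C}^{mn}$). For $k\in\mathbb{Z}/n\mathbb{Z}$, $a\in\mathbb{C}$, $u_k(a)\in U$ has $1$'s on the diagonal, $a$ at each position $(i,i+1)$ with $i\equiv k\bmod n$, and $0$ elsewhere. The whirl $M(x)$ of $x=(x^{(1)},\dots,x^{(n)})$ is the infinite periodic matrix with $M(x)_{i,i}=1$, $M(x)_{i,i+1}=x^{(i)}$, and all other entries $0$. *)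

theory Defs
  imports "HOL-Analysis.Analysis" "HOL-Algebra.QuotRing" "HOL-Algebra.Sym_Groups"
    "HOL-Algebra.Group_Action" "HOL-Library.Groups_Big_Fun" "HOL-Library.Monad_Syntax"
begin

section \<open>Varieties, rational maps, function fields\<close>

text \<open>
  Varieties are irreducible locally closed subsets \<open>V\<close> of an affine space \<open>'i \<Rightarrow> complex\<close>. The set
  \<open>'i\<close> of coordinates may be infinite, as long as finitely many coordinates generate all the others
  on \<open>V\<close>; thus \<open>n\<close>-tuples indexed by \<open>\<int>/n\<int>\<close> can be taken to be \<open>n\<close>-periodic functions on \<open>int\<close>, and
  periodic infinite matrices are points as they stand.
\<close>

type_synonym 'i pt = "'i \<Rightarrow> complex"

inductive_set polyfun :: "'i set \<Rightarrow> ('i pt \<Rightarrow> complex) set" for J :: "'i set" where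
  const: "(\<lambda>_. a) \<in> polyfun J"
| coord: "i \<in> J \<Longrightarrow> (\<lambda>x. x i) \<in> polyfun J"
| add: "f \<in> polyfun J \<Longrightarrow> g \<in> polyfun J \<Longrightarrow> (\<lambda>x. f x + g x) \<in> polyfun J"
| mult: "f \<in> polyfun J \<Longrightarrow> g \<in> polyfun J \<Longrightarrow> (\<lambda>x. f x * g x) \<in> polyfun J"

definition zariski :: "'i pt topology" where
  "zariski = topology_generated_by {{x. f x \<noteq> 0} | f. f \<in> polyfun UNIV}"

abbreviation zariski_on :: "'i pt set \<Rightarrow> 'i pt topology" where
  "zariski_on V \<equiv> subtopology zariski V"

definition variety :: "'i pt set \<Rightarrow> bool" where
  "variety V \<longleftrightarrow>
     (\<exists>A B. closedin zariski A \<and> openin zariski B \<and> V = A \<inter> B) \<and>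
     (\<exists>J. finite J \<and> (\<forall>i. \<exists>f\<in>polyfun J. \<forall>x\<in>V. x i = f x)) \<and>
     V \<noteq> {} \<and>
     (\<forall>S T. openin (zariski_on V) S \<and> openin (zariski_on V) T \<and> S \<noteq> {} \<and> T \<noteq> {} \<longrightarrow> S \<inter> T \<noteq> {})"

definition regular_on :: "'i pt set \<Rightarrow> ('i pt \<Rightarrow> complex) \<Rightarrow> bool" where
  "regular_on S g \<longleftrightarrow>
     (\<forall>x\<in>S. \<exists>p\<in>polyfun UNIV. \<exists>q\<in>polyfun UNIV.
        q x \<noteq> 0 \<and> (\<forall>y\<in>S. q y \<noteq> 0 \<longrightarrow> g y = p y / q y))"

text \<open>
  A rational function or map is a partial function which is regular on a nonempty open (hence, by
  irreducibility, dense) subset of the variety. The domain need not be the largest possible one;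
  \<open>rat_eq\<close> is equality as rational maps.
\<close>

definition rational_fun :: "'i pt set \<Rightarrow> ('i pt \<rightharpoonup> complex) \<Rightarrow> bool" where
  "rational_fun V f \<longleftrightarrow>
     openin (zariski_on V) (dom f) \<and> dom f \<noteq> {} \<and> regular_on (dom f) (\<lambda>x. the (f x))"

definition rational_map :: "'i pt set \<Rightarrow> 'j pt set \<Rightarrow> ('i pt \<rightharpoonup> 'j pt) \<Rightarrow> bool" where
  "rational_map V W f \<longleftrightarrow>
     openin (zariski_on V) (dom f) \<and> dom f \<noteq> {} \<and> ran f \<subseteq> W \<and>
     (\<forall>j. regular_on (dom f) (\<lambda>x. the (f x) j))"

definition rat_eq :: "'i pt set \<Rightarrow> ('i pt \<rightharpoonup> 'b) \<Rightarrow> ('i pt \<rightharpoonup> 'b) \<Rightarrow> bool" where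
  "rat_eq V f g \<longleftrightarrow>
     (\<exists>S. openin (zariski_on V) S \<and> S \<noteq> {} \<and> S \<subseteq> dom f \<inter> dom g \<and> (\<forall>x\<in>S. f x = g x))"

definition agree :: "('a \<rightharpoonup> 'b) \<Rightarrow> ('a \<rightharpoonup> 'b) \<Rightarrow> bool" where
  "agree f g \<longleftrightarrow> (\<forall>x \<in> dom f \<inter> dom g. f x = g x)"

definition padd :: "('a \<rightharpoonup> complex) \<Rightarrow> ('a \<rightharpoonup> complex) \<Rightarrow> 'a \<rightharpoonup> complex" where
  "padd f g = (\<lambda>x. do {a \<leftarrow> f x; b \<leftarrow> g x; Some (a + b)})"

definition pmult :: "('a \<rightharpoonup> complex) \<Rightarrow> ('a \<rightharpoonup> complex) \<Rightarrow> 'a \<rightharpoonup> complex" where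
  "pmult f g = (\<lambda>x. do {a \<leftarrow> f x; b \<leftarrow> g x; Some (a * b)})"

definition pdiv :: "('a \<rightharpoonup> complex) \<Rightarrow> ('a \<rightharpoonup> complex) \<Rightarrow> 'a \<rightharpoonup> complex" where
  "pdiv f g = (\<lambda>x. do {a \<leftarrow> f x; b \<leftarrow> g x; if b = 0 then None else Some (a / b)})"

definition rat_class :: "'i pt set \<Rightarrow> ('i pt \<rightharpoonup> complex) \<Rightarrow> ('i pt \<rightharpoonup> complex) set" where
  "rat_class V f = {h. rational_fun V h \<and> rat_eq V h f}"

definition function_field :: "'i pt set \<Rightarrow> ('i pt \<rightharpoonup> complex) set ring" where
  "function_field V =
     \<lparr> carrier = rat_class V ` {f. rational_fun V f},
       mult = (\<lambda>a b. \<Union>f\<in>a. \<Union>g\<in>b. rat_class V (pmult f g)),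
       one = rat_class V ((\<lambda>_. Some 1) |` V),
       zero = rat_class V ((\<lambda>_. Some 0) |` V),
       add = (\<lambda>a b. \<Union>f\<in>a. \<Union>g\<in>b. rat_class V (padd f g)) \<rparr>"

definition pullback ::
  "'i pt set \<Rightarrow> ('i pt \<rightharpoonup> 'j pt) \<Rightarrow> ('j pt \<rightharpoonup> complex) set \<Rightarrow> ('i pt \<rightharpoonup> complex) set" where
  "pullback V f a = (\<Union>g\<in>a. rat_class V (g \<circ>\<^sub>m f))"


section \<open>Geometric crystals of type \<open>A\<^sub>n\<^sub>-\<^sub>1\<^sup>(\<^sup>1\<^sup>)\<close>\<close>

text \<open>
  The index set \<open>\<int>/n\<int>\<close> is represented by \<open>int\<close>, with data that only depend on the residue. The
  function \<open>\<gamma>\<^sub>i\<close> is recovered from \<open>\<phi>\<^sub>i = \<gamma>\<^sub>i \<epsilon>\<^sub>i\<close>, and \<open>act C i c\<close> is \<open>e\<^sub>i\<^sup>c\<close>.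
\<close>

record 'i crystal =
  points :: "'i pt set"
  eps :: "int \<Rightarrow> 'i pt \<rightharpoonup> complex"
  phi :: "int \<Rightarrow> 'i pt \<rightharpoonup> complex"
  act :: "int \<Rightarrow> complex \<Rightarrow> 'i pt \<rightharpoonup> 'i pt"

definition gam :: "('i, 'z) crystal_scheme \<Rightarrow> int \<Rightarrow> 'i pt \<rightharpoonup> complex" where
  "gam C i = pdiv (phi C i) (eps C i)"

definition cartan :: "nat \<Rightarrow> int \<Rightarrow> int \<Rightarrow> int" where
  "cartan n i j =
     (if int n dvd i - j then 2
      else if n = 2 then -2
      else if int n dvd i - j - 1 \<or> int n dvd i - j + 1 then -1
      else 0)"

text \<open>\<open>\<complex>\<^sup>* \<times> V\<close>, with the additional coordinate \<open>None\<close>:\<close>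

definition Gm_times :: "'i pt set \<Rightarrow> 'i option pt set" where
  "Gm_times V = {z. z None \<noteq> 0 \<and> (\<lambda>i. z (Some i)) \<in> V}"

definition rational_Gm_action :: "'i pt set \<Rightarrow> (complex \<Rightarrow> 'i pt \<rightharpoonup> 'i pt) \<Rightarrow> bool" where
  "rational_Gm_action V e \<longleftrightarrow>
     rational_map (Gm_times V) V (\<lambda>z. e (z None) (\<lambda>i. z (Some i))) \<and>
     agree (e 1) Some \<and>
     (\<forall>c c'. c \<noteq> 0 \<longrightarrow> c' \<noteq> 0 \<longrightarrow> agree (e c \<circ>\<^sub>m e c') (e (c * c')))"

definition geometric_crystal :: "nat \<Rightarrow> 'i crystal \<Rightarrow> bool" where
  "geometric_crystal n C \<longleftrightarrow>
     variety (points C) \<and>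
     (\<forall>i. rational_fun (points C) (eps C i) \<and> rational_fun (points C) (gam C i) \<and>
          rational_Gm_action (points C) (act C i)) \<and>
     (\<forall>i. eps C (i + int n) = eps C i \<and> phi C (i + int n) = phi C i \<and>
          act C (i + int n) = act C i) \<and>
     (\<forall>i. Abstract_Topology.closure_of (zariski_on (points C)) (dom (act C i 1)) = points C) \<and>
     (\<forall>i j c. c \<noteq> 0 \<longrightarrow>
        agree (gam C j \<circ>\<^sub>m act C i c)
              (\<lambda>x. map_option (\<lambda>a. c powi cartan n i j * a) (gam C j x))) \<and>
     (\<forall>i c. c \<noteq> 0 \<longrightarrow>
        agree (eps C i \<circ>\<^sub>m act C i c) (\<lambda>x. map_option (\<lambda>a. inverse c * a) (eps C i x))) \<and>
     (\<forall>i j c c'. c \<noteq> 0 \<longrightarrow> c' \<noteq> 0 \<longrightarrow> cartan n i j = 0 \<longrightarrow>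
        agree (act C i c \<circ>\<^sub>m act C j c') (act C j c' \<circ>\<^sub>m act C i c)) \<and>
     (\<forall>i j c c'. c \<noteq> 0 \<longrightarrow> c' \<noteq> 0 \<longrightarrow> cartan n i j = -1 \<longrightarrow>
        agree (act C i c \<circ>\<^sub>m act C j (c * c') \<circ>\<^sub>m act C i c')
              (act C j c' \<circ>\<^sub>m act C i (c * c') \<circ>\<^sub>m act C j c))"

definition crystal_map :: "'i crystal \<Rightarrow> 'j crystal \<Rightarrow> ('i pt \<rightharpoonup> 'j pt) \<Rightarrow> bool" where
  "crystal_map C D f \<longleftrightarrow>
     rational_map (points C) (points D) f \<and>
     (\<forall>k. rat_eq (points C) (eps D k \<circ>\<^sub>m f) (eps C k) \<and>
          rat_eq (points C) (phi D k \<circ>\<^sub>m f) (phi C k) \<and>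
          (\<forall>c. c \<noteq> 0 \<longrightarrow> rat_eq (points C) (f \<circ>\<^sub>m act C k c) (act D k c \<circ>\<^sub>m f)))"

text \<open>Crystal automorphisms are birational, and identities between them hold up to \<open>rat_eq\<close>:\<close>

definition crystal_automorphism_group :: "'i crystal \<Rightarrow> ('i pt \<rightharpoonup> 'i pt) set \<Rightarrow> bool" where
  "crystal_automorphism_group C \<Gamma> \<longleftrightarrow>
     (\<forall>g\<in>\<Gamma>. crystal_map C C g) \<and>
     (\<exists>e\<in>\<Gamma>. rat_eq (points C) e Some) \<and>
     (\<forall>g\<in>\<Gamma>. \<forall>h\<in>\<Gamma>. \<exists>k\<in>\<Gamma>. rat_eq (points C) k (g \<circ>\<^sub>m h)) \<and>
     (\<forall>g\<in>\<Gamma>. \<exists>h\<in>\<Gamma>. rat_eq (points C) (g \<circ>\<^sub>m h) Some \<and> rat_eq (points C) (h \<circ>\<^sub>m g) Some)"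

definition invariants ::
  "'i pt set \<Rightarrow> ('i pt \<rightharpoonup> 'i pt) set \<Rightarrow> ('i pt \<rightharpoonup> complex) set set" where
  "invariants V \<Gamma> = {a \<in> carrier (function_field V). \<forall>g\<in>\<Gamma>. pullback V g a = a}"

definition is_quotient ::
  "nat \<Rightarrow> 'i crystal \<Rightarrow> ('i pt \<rightharpoonup> 'i pt) set \<Rightarrow> 'j crystal \<Rightarrow> ('i pt \<rightharpoonup> 'j pt) \<Rightarrow> bool" where
  "is_quotient n C \<Gamma> D f \<longleftrightarrow>
     geometric_crystal n C \<and> crystal_automorphism_group C \<Gamma> \<and>
     geometric_crystal n D \<and> crystal_map C D f \<and>
     pullback (points C) f \<in>
       ring_iso (function_field (points D))
                (function_field (points C)\<lparr>carrier := invariants (points C) \<Gamma>\<rparr>)"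


section \<open>The product crystal\<close>

text \<open>Points of a product are \<open>case_sum x x'\<close>. Note that \<open>act C k c\<close> is undefined for \<open>c = 0\<close>.\<close>

definition prod_crystal :: "'i crystal \<Rightarrow> 'j crystal \<Rightarrow> ('i + 'j) crystal" where
  "prod_crystal C D =
     (let l = (\<lambda>z i. z (Inl i)); r = (\<lambda>z j. z (Inr j)) in
      \<lparr> points = {case_sum x x' | x x'. x \<in> points C \<and> x' \<in> points D},
        eps = (\<lambda>k. pdiv (pmult (eps C k \<circ> l) (eps D k \<circ> r)) (padd (phi D k \<circ> r) (eps C k \<circ> l))),
        phi = (\<lambda>k. pdiv (pmult (phi C k \<circ> l) (phi D k \<circ> r)) (padd (eps C k \<circ> l) (phi D k \<circ> r))),
        act = (\<lambda>k c z. do {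
          e \<leftarrow> eps C k (l z);
          p \<leftarrow> phi D k (r z);
          if p + e = 0 then None else do {
            let cp = (c * p + e) / (p + e);
            y \<leftarrow> act C k cp (l z);
            y' \<leftarrow> act D k (c / cp) (r z);
            Some (case_sum y y')
          }
        }) \<rparr>)"

text \<open>Transport of a crystal structure along a map that is injective on its points.\<close>

definition transport :: "('i pt \<Rightarrow> 'j pt) \<Rightarrow> 'i crystal \<Rightarrow> 'j crystal" where
  "transport f C =
     (let V = f ` points C; g = inv_into (points C) f in
      \<lparr> points = V,
        eps = (\<lambda>k. (eps C k \<circ> g) |` V),
        phi = (\<lambda>k. (phi C k \<circ> g) |` V),
        act = (\<lambda>k c. (map_option f \<circ> act C k c \<circ> g) |` V) \<rparr>)"

text \<open>The crystal \<open>X\<^sub>i\<close>; the case \<open>i = 1\<close> is \<open>X\<^sub>M\<close>. The coordinate \<open>x\<^sub>i\<^sup>(\<^sup>r\<^sup>)\<close> is \<open>x r\<close>.\<close>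

definition basic_crystal :: "nat \<Rightarrow> nat \<Rightarrow> int crystal" where
  "basic_crystal n i =
     (let V = {x. \<forall>r. x r \<noteq> 0 \<and> x (r + int n) = x r} in
      \<lparr> points = V,
        eps = (\<lambda>k. (\<lambda>x. Some (x (k + int i))) |` V),
        phi = (\<lambda>k. (\<lambda>x. Some (x (k + int i - 1))) |` V),
        act = (\<lambda>k c. if c = 0 then Map.empty else
          (\<lambda>x. Some (\<lambda>r. if int n dvd r - (k + int i - 1) then c * x r
                       else if int n dvd r - (k + int i) then inverse c * x r
                       else x r)) |` V) \<rparr>)"

text \<open>
  \<open>X_crystal n m\<close> is \<open>(\<dots>(X\<^sub>1 \<times> X\<^sub>2) \<times> \<dots>) \<times> X\<^sub>m\<close>, where \<open>x\<^sub>i\<^sup>(\<^sup>r\<^sup>)\<close> is \<open>x (i, r)\<close> for \<open>1 \<le> i \<le> m\<close>; all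
  coordinates \<open>x (i, r)\<close> with other \<open>i\<close> are \<open>0\<close>. The value for \<open>m = 0\<close> is irrelevant.
\<close>

fun X_crystal :: "nat \<Rightarrow> nat \<Rightarrow> (nat \<times> int) crystal" where
  "X_crystal n 0 = undefined"
| "X_crystal n (Suc 0) =
     transport (\<lambda>y (i, r). if i = 1 then y r else 0) (basic_crystal n 1)"
| "X_crystal n (Suc (Suc m)) =
     transport (\<lambda>z (i, r). if i = Suc (Suc m) then z (Inr r) else z (Inl (i, r)))
       (prod_crystal (X_crystal n (Suc m)) (basic_crystal n (Suc (Suc m))))"


section \<open>The birational \<open>R\<close>-matrix action\<close>

definition kappa :: "nat \<Rightarrow> int \<Rightarrow> (int \<Rightarrow> complex) \<Rightarrow> (int \<Rightarrow> complex) \<Rightarrow> complex" where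
  "kappa n r a b =
     (\<Sum>s=0..n-1. (\<Prod>t=1..s. b (r + int t)) * (\<Prod>t=s+1..n-1. a (r + int t)))"

definition block :: "(nat \<times> int) pt \<Rightarrow> nat \<Rightarrow> int \<Rightarrow> complex" where
  "block x i = (\<lambda>r. x (i, r))"

definition R_coord :: "nat \<Rightarrow> nat \<Rightarrow> nat \<Rightarrow> int \<Rightarrow> (nat \<times> int) pt \<rightharpoonup> complex" where
  "R_coord n j i r = (\<lambda>x.
     let a = block x j; b = block x (j + 1); \<kappa> = (\<lambda>q. kappa n q a b) in
     if i = j then (if \<kappa> r = 0 then None else Some (b (r + 1) * \<kappa> (r + 1) / \<kappa> r))
     else if i = j + 1 then (if \<kappa> r = 0 then None else Some (a (r - 1) * \<kappa> (r - 1) / \<kappa> r))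
     else Some (x (i, r)))"

text \<open>
  An automorphism of \<open>\<complex>(X)\<close> over \<open>\<complex>\<close> is the pullback along a birational map, so the action of \<open>S\<^sub>m\<close> on
  \<open>\<complex>(X)\<close> is given by a family \<open>\<rho>\<close> of birational maps of \<open>X\<close>.
\<close>

definition R_matrix_action ::
  "nat \<Rightarrow> nat \<Rightarrow> ((nat \<Rightarrow> nat) \<Rightarrow> (nat \<times> int) pt \<rightharpoonup> (nat \<times> int) pt) \<Rightarrow> bool" where
  "R_matrix_action n m \<rho> \<longleftrightarrow>
     (let X = points (X_crystal n m); K = function_field X in
      (\<forall>w \<in> carrier (sym_group m). rational_map X X (\<rho> w) \<and> pullback X (\<rho> w) \<in> ring_iso K K) \<and>
      group_action (sym_group m) (carrier K) (\<lambda>w. restrict (pullback X (\<rho> w)) (carrier K)) \<and>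
      (\<forall>j\<in>{1..<m}. \<forall>i\<in>{1..m}. \<forall>r.
         pullback X (\<rho> (Transposition.transpose j (j + 1)))
             (rat_class X ((\<lambda>x. Some (x (i, r))) |` X)) =
           rat_class X (R_coord n j i r |` X)))"


section \<open>Unipotent loops\<close>

definition U_loop :: "nat \<Rightarrow> (int \<times> int) pt set" where
  "U_loop n = {Y. (\<forall>r s. Y (r + int n, s + int n) = Y (r, s)) \<and>
                  (\<forall>r. Y (r, r) = 1) \<and> (\<forall>r s. s < r \<longrightarrow> Y (r, s) = 0)}"

definition U_le :: "nat \<Rightarrow> nat \<Rightarrow> (int \<times> int) pt set" where
  "U_le n m = {Y \<in> U_loop n. \<forall>r s. s - r > int m \<longrightarrow> Y (r, s) = 0}"

definition mat_mult ::
  "(int \<times> int) pt \<Rightarrow> (int \<times> int) pt \<Rightarrow> (int \<times> int) pt" (infixl \<open>\<odot>\<close> 70) where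
  "A \<odot> B = (\<lambda>(r, s). Sum_any (\<lambda>k. A (r, k) * B (k, s)))"

definition u_mat :: "nat \<Rightarrow> int \<Rightarrow> complex \<Rightarrow> (int \<times> int) pt" where
  "u_mat n k a = (\<lambda>(r, s). if s = r then 1 else if s = r + 1 \<and> int n dvd r - k then a else 0)"

definition whirl :: "(int \<Rightarrow> complex) \<Rightarrow> (int \<times> int) pt" where
  "whirl x = (\<lambda>(r, s). if s = r then 1 else if s = r + 1 then x r else 0)"

primrec whirl_prod :: "nat \<Rightarrow> (nat \<times> int) pt \<Rightarrow> (int \<times> int) pt" where
  "whirl_prod 0 x = (\<lambda>(r, s). if s = r then 1 else 0)"
| "whirl_prod (Suc m) x = whirl_prod m x \<odot> whirl (block x (Suc m))"

definition proj :: "nat \<Rightarrow> nat \<Rightarrow> (nat \<times> int) pt \<rightharpoonup> (int \<times> int) pt" where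
  "proj n m = (\<lambda>x. Some (whirl_prod m x)) |` points (X_crystal n m)"

definition U_crystal :: "nat \<Rightarrow> nat \<Rightarrow> (int \<times> int) crystal" where
  "U_crystal n m =
     (let V = U_le n m;
          y = (\<lambda>r s. (\<lambda>Y. Some (Y (r, s))) |` V);
          \<epsilon> = (\<lambda>k. pdiv (y (k + 1) (k + int m + 1)) (y (k + 1) (k + int m)));
          \<phi> = (\<lambda>k. pdiv (y k (k + int m)) (y (k + 1) (k + int m))) in
      \<lparr> points = V, eps = \<epsilon>, phi = \<phi>,
        act = (\<lambda>k c Y. if c = 0 then None else do {
          e \<leftarrow> \<epsilon> k Y;
          f \<leftarrow> \<phi> k Y;
          Some (u_mat n k ((c - 1) * f) \<odot> Y \<odot> u_mat n (k + int m) ((inverse c - 1) * e))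
        }) \<rparr>)"

end

theory Submission
  imports Defs "Jordan_Normal_Form.Determinant"
begin

text \<open>
  The product of whirls \<open>Y = M(x\<^sub>1) \<cdots> M(x\<^sub>m)\<close> acts on the vectors \<open>v\<close> with \<open>v\<^sub>r\<^sub>+\<^sub>n = z v\<^sub>r\<close> with determinant
  \<open>\<Prod>\<^sub>i (1 - (-1)\<^sup>n z q\<^sub>i)\<close>, where \<open>q\<^sub>i = \<Prod>\<^sub>r x\<^sub>i\<^sup>(\<^sup>r\<^sup>)\<close>. Generically the \<open>q\<^sub>i\<close> are distinct, and \<open>x\<^sub>m\<close> can be read off the
  kernel of \<open>Y\<close> at the root belonging to \<open>q\<^sub>m\<close>; inductively, \<open>x\<close> is determined by \<open>Y\<close> and the ordered
  tuple of the \<open>q\<^sub>i\<close>. Since \<open>s\<^sub>j\<close> preserves \<open>Y\<close> and interchanges \<open>q\<^sub>j\<close> and \<open>q\<^sub>j\<^sub>+\<^sub>1\<close>, this yields the relations of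
  \<open>S\<^sub>m\<close>, and likewise, as \<open>e\<^sub>k\<^sup>c\<close> preserves every \<open>q\<^sub>i\<close> and \<open>\<pi>\<close> intertwines the \<open>e\<^sub>k\<^sup>c\<close> on both sides, that the
  action is by crystal automorphisms and that the crystal axioms on \<open>X\<close> follow from those on \<open>U\<^sup>\<le>\<^sup>m\<close>.

  For the fixed field, let \<open>K\<^sub>k\<close> be generated by the entries of \<open>M(x\<^sub>1) \<cdots> M(x\<^sub>k)\<close> and by
  \<open>x\<^sub>k\<^sub>+\<^sub>1, \<dots>, x\<^sub>m\<close>. By Cramer's rule for the kernel, \<open>K\<^sub>k\<^sub>-\<^sub>1 = K\<^sub>k(q\<^sub>k)\<close>, and \<open>q\<^sub>k\<close> is a root of a polynomial of degree
  \<open>k\<close> over \<open>K\<^sub>k\<close> with roots \<open>q\<^sub>1, \<dots>, q\<^sub>k\<close>, which \<open>S\<^sub>k\<close> permutes transitively. Hence an \<open>S\<^sub>k\<close>-invariant element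
  \<open>P(q\<^sub>k) / D(q\<^sub>k)\<close> of \<open>K\<^sub>k\<^sub>-\<^sub>1\<close>, with \<open>P\<close> and \<open>D\<close> of degree less than \<open>k\<close>, satisfies the equation \<open>P(q) = f D(q)\<close> at all
  \<open>k\<close> roots, and \<open>f\<close> is a quotient of coefficients, hence in \<open>K\<^sub>k\<close>. Descending to \<open>K\<^sub>m\<close>, an invariant function is
  rational in the entries of \<open>Y\<close>.
\<close>

text \<open>The crystal axioms are demanded at every point of the common domains
  (\<open>agree\<close>), while a factorization into whirls is unique only where the
  \<open>q_i\<close> are distinct. Identities on X are therefore shown at such points and spread by
  density. On U the operators multiply by unipotent matrices from both sides, so relations become
  identities between products of \<open>u_mat\<close>, valid wherever the denominators are nonzero;
  on X the nested parameters of the product rule would make the braid relation unwieldy.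

  The family \<open>\<rho>\<close> is arbitrary and known only through its pullbacks. Their
  bijectivity forces dominance, and the values prescribed on coordinates then pin down each
  \<open>\<rho> w\<close> up to \<open>rat_eq\<close>.

  Injectivity of C(U) into C(X) rests on dominance of the product of whirls. It is obtained by
  letting the last whirl grow: the top-degree part of a polynomial in the scale sees an arbitrary
  band above the diagonal.

  The descent to the fixed field runs through explicit linear algebra in the tower rather than a
  count of degrees, so each step exhibits a quotient of polynomials.\<close>

unbundle no vec_syntax

section \<open>The Zariski topology and generic points\<close>

lemma polyfun_uminus: "f \<in> polyfun J \<Longrightarrow> (\<lambda>x. - f x) \<in> polyfun J"
  using polyfun.mult[OF polyfun.const[of "-1"], of f J] by simp

lemma polyfun_diff: "f \<in> polyfun J \<Longrightarrow> g \<in> polyfun J \<Longrightarrow> (\<lambda>x. f x - g x) \<in> polyfun J"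
  using polyfun.add[OF _ polyfun_uminus, of f J g] by simp

lemma polyfun_sum: "(\<And>a. a \<in> A \<Longrightarrow> f a \<in> polyfun J) \<Longrightarrow> (\<lambda>x. \<Sum>a\<in>A. f a x) \<in> polyfun J"
  by (induction A rule: infinite_finite_induct) (auto intro: polyfun.intros)

lemma polyfun_prod: "(\<And>a. a \<in> A \<Longrightarrow> f a \<in> polyfun J) \<Longrightarrow> (\<lambda>x. \<Prod>a\<in>A. f a x) \<in> polyfun J"
  by (induction A rule: infinite_finite_induct) (auto intro: polyfun.intros)

lemma polyfun_power: "f \<in> polyfun J \<Longrightarrow> (\<lambda>x. f x ^ k) \<in> polyfun J"
  by (induction k) (auto intro: polyfun.intros)

lemma polyfun_coord: "(\<lambda>x. x i) \<in> polyfun UNIV"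
  by (rule polyfun.coord) simp

lemmas polyfun_intros = polyfun.const polyfun_coord polyfun.add polyfun.mult polyfun_uminus
  polyfun_diff polyfun_sum polyfun_prod polyfun_power

lemma polyfun_compose:
  assumes "f \<in> polyfun J" "\<And>i. i \<in> J \<Longrightarrow> (\<lambda>x. g x i) \<in> polyfun K"
  shows "(\<lambda>x. f (g x)) \<in> polyfun K"
  using assms by (induction rule: polyfun.induct) (auto intro: polyfun.intros)

text \<open>Restriction to a line turns a polynomial in arbitrarily many coordinates into a
  univariate one, with finitely many roots unless it vanishes. Irreducibility and the later scaling
  argument both rest on this.\<close>

lemma polyfun_line:
  assumes "f \<in> polyfun J"
  shows "\<exists>P. \<forall>t. f (\<lambda>i. a i + t * b i) = poly P t"
  using assms
proof (induction rule: polyfun.induct)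
  case (const c)
  show ?case by (rule exI[of _ "[:c:]"]) simp
next
  case (coord i)
  show ?case by (rule exI[of _ "[:a i, b i:]"]) simp
next
  case (add f g)
  then obtain P Q where "\<forall>t. f (\<lambda>i. a i + t * b i) = poly P t" "\<forall>t. g (\<lambda>i. a i + t * b i) = poly Q t"
    by blast
  then show ?case by (intro exI[of _ "P + Q"]) simp
next
  case (mult f g)
  then obtain P Q where "\<forall>t. f (\<lambda>i. a i + t * b i) = poly P t" "\<forall>t. g (\<lambda>i. a i + t * b i) = poly Q t"
    by blast
  then show ?case by (intro exI[of _ "P * Q"]) simp
qed

text \<open>A product of polynomials is nonzero exactly where both are, so the generating sets are
  already closed under intersection and form a base.\<close>

lemma openin_zariski_iff:
  "openin zariski S \<longleftrightarrow> (\<forall>x\<in>S. \<exists>f\<in>polyfun UNIV. f x \<noteq> 0 \<and> {y. f y \<noteq> 0} \<subseteq> S)"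
proof
  assume "openin zariski S"
  then have "generate_topology_on {{x. f x \<noteq> 0} | f. f \<in> polyfun UNIV} S"
    by (simp add: zariski_def openin_topology_generated_by_iff)
  then show "\<forall>x\<in>S. \<exists>f\<in>polyfun UNIV. f x \<noteq> 0 \<and> {y. f y \<noteq> 0} \<subseteq> S"
  proof induction
    case Empty
    then show ?case by simp
  next
    case (Int a b)
    show ?case
    proof
      fix x assume x: "x \<in> a \<inter> b"
      obtain f where f: "f \<in> polyfun UNIV" "f x \<noteq> 0" "{y. f y \<noteq> 0} \<subseteq> a" using Int x by blast
      obtain g where g: "g \<in> polyfun UNIV" "g x \<noteq> 0" "{y. g y \<noteq> 0} \<subseteq> b" using Int x by blast
      show "\<exists>f\<in>polyfun UNIV. f x \<noteq> 0 \<and> {y. f y \<noteq> 0} \<subseteq> a \<inter> b"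
        by (rule bexI[of _ "\<lambda>x. f x * g x"]) (use f g in \<open>auto intro: polyfun.intros\<close>)
    qed
  next
    case (UN K)
    show ?case
    proof
      fix x assume "x \<in> \<Union>K"
      then obtain k where k: "k \<in> K" "x \<in> k" by blast
      then obtain f where "f \<in> polyfun UNIV" "f x \<noteq> 0" "{y. f y \<noteq> 0} \<subseteq> k" using UN by blast
      then show "\<exists>f\<in>polyfun UNIV. f x \<noteq> 0 \<and> {y. f y \<noteq> 0} \<subseteq> \<Union>K" using k by blast
    qed
  qed auto
next
  assume S: "\<forall>x\<in>S. \<exists>f\<in>polyfun UNIV. f x \<noteq> 0 \<and> {y. f y \<noteq> 0} \<subseteq> S"
  let ?K = "{{x. f x \<noteq> 0} | f. f \<in> polyfun UNIV \<and> {x. f x \<noteq> 0} \<subseteq> S}"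
  have "generate_topology_on {{x. f x \<noteq> 0} | f. f \<in> polyfun UNIV} (\<Union>?K)"
    by (rule generate_topology_on.UN) (auto intro!: generate_topology_on.Basis)
  moreover have "\<Union>?K = S"
  proof
    show "\<Union>?K \<subseteq> S" by blast
    show "S \<subseteq> \<Union>?K"
    proof
      fix x assume "x \<in> S"
      then obtain f where "f \<in> polyfun UNIV" "f x \<noteq> 0" "{y. f y \<noteq> 0} \<subseteq> S" using S by blast
      then show "x \<in> \<Union>?K" by blast
    qed
  qed
  ultimately show "openin zariski S"
    by (simp add: zariski_def openin_topology_generated_by_iff)
qed

lemma topspace_zariski [simp]: "topspace zariski = UNIV"
proof -
  have "openin zariski UNIV"
    unfolding openin_zariski_iff using polyfun.const[of 1 UNIV] by fastforce
  then show ?thesis using openin_subset by blast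
qed

lemma openin_zariski_on_iff:
  "openin (zariski_on V) S \<longleftrightarrow>
     S \<subseteq> V \<and> (\<forall>x\<in>S. \<exists>f\<in>polyfun UNIV. f x \<noteq> 0 \<and> {y\<in>V. f y \<noteq> 0} \<subseteq> S)"
proof
  assume "openin (zariski_on V) S"
  then obtain T where T: "openin zariski T" "S = T \<inter> V" by (auto simp: openin_subtopology)
  then show "S \<subseteq> V \<and> (\<forall>x\<in>S. \<exists>f\<in>polyfun UNIV. f x \<noteq> 0 \<and> {y\<in>V. f y \<noteq> 0} \<subseteq> S)"
    unfolding openin_zariski_iff by blast
next
  assume S: "S \<subseteq> V \<and> (\<forall>x\<in>S. \<exists>f\<in>polyfun UNIV. f x \<noteq> 0 \<and> {y\<in>V. f y \<noteq> 0} \<subseteq> S)"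
  define T where "T = {x. \<exists>f\<in>polyfun UNIV. f x \<noteq> 0 \<and> {y\<in>V. f y \<noteq> 0} \<subseteq> S}"
  have "openin zariski T" unfolding openin_zariski_iff T_def by blast
  moreover have "S = T \<inter> V" using S unfolding T_def by blast
  ultimately show "openin (zariski_on V) S" by (auto simp: openin_subtopology)
qed

lemma openin_zariski_on_nonzero:
  "f \<in> polyfun UNIV \<Longrightarrow> openin (zariski_on V) {x\<in>V. f x \<noteq> 0}"
  unfolding openin_zariski_on_iff by blast

lemma closedin_zariski_zeros:
  assumes "F \<subseteq> polyfun UNIV"
  shows "closedin zariski {x. \<forall>f\<in>F. f x = 0}"
  unfolding closedin_def openin_zariski_iff using assms by auto

text \<open>Irreducibility tested on principal open sets only, and separated from the other clauses
  of \<open>variety\<close>: it is also applied to the linear space \<open>strict_band\<close>,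
  where only this clause is of use.\<close>

definition irreducible_set :: "'i pt set \<Rightarrow> bool" where
  "irreducible_set V \<longleftrightarrow> V \<noteq> {} \<and>
     (\<forall>f\<in>polyfun UNIV. \<forall>g\<in>polyfun UNIV. (\<exists>x\<in>V. f x \<noteq> 0) \<longrightarrow> (\<exists>x\<in>V. g x \<noteq> 0) \<longrightarrow>
        (\<exists>x\<in>V. f x \<noteq> 0 \<and> g x \<noteq> 0))"

lemma irreducible_set_inter:
  assumes "irreducible_set V" "openin (zariski_on V) S" "openin (zariski_on V) T" "S \<noteq> {}" "T \<noteq> {}"
  shows "S \<inter> T \<noteq> {}"
proof -
  obtain x y where xy: "x \<in> S" "y \<in> T" using assms by blast
  obtain f where f: "f \<in> polyfun UNIV" "f x \<noteq> 0" "{y\<in>V. f y \<noteq> 0} \<subseteq> S"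
    using assms(2) xy unfolding openin_zariski_on_iff by blast
  obtain g where g: "g \<in> polyfun UNIV" "g y \<noteq> 0" "{y\<in>V. g y \<noteq> 0} \<subseteq> T"
    using assms(3) xy unfolding openin_zariski_on_iff by blast
  have "x \<in> V" "y \<in> V" using xy assms openin_zariski_on_iff by blast+
  then obtain z where "z \<in> V" "f z \<noteq> 0" "g z \<noteq> 0"
    using assms(1) f g unfolding irreducible_set_def by meson
  then show ?thesis using f g by blast
qed

text \<open>Two points are joined by a line that leaves \<open>V\<close> in finitely many points only.\<close>

lemma irreducible_setI:
  assumes "V \<noteq> {}"
    and "\<And>x y. x \<in> V \<Longrightarrow> y \<in> V \<Longrightarrow>
      \<exists>H. H \<noteq> 0 \<and> (\<forall>t::complex. poly H t \<noteq> 0 \<longrightarrow> (\<lambda>i. x i + t * (y i - x i)) \<in> V)"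
  shows "irreducible_set V"
  unfolding irreducible_set_def
proof (intro conjI ballI impI)
  fix f g :: "'a pt \<Rightarrow> complex"
  assume fg: "f \<in> polyfun UNIV" "g \<in> polyfun UNIV" and "\<exists>x\<in>V. f x \<noteq> 0" "\<exists>x\<in>V. g x \<noteq> 0"
  then obtain x y where xy: "x \<in> V" "y \<in> V" "f x \<noteq> 0" "g y \<noteq> 0" by blast
  obtain H where H: "H \<noteq> 0" "\<And>t. poly H t \<noteq> 0 \<Longrightarrow> (\<lambda>i. x i + t * (y i - x i)) \<in> V"
    using assms(2)[OF xy(1,2)] by blast
  obtain P where P: "\<And>t. f (\<lambda>i. x i + t * (y i - x i)) = poly P t" using polyfun_line[OF fg(1)] by meson
  obtain Q where Q: "\<And>t. g (\<lambda>i. x i + t * (y i - x i)) = poly Q t" using polyfun_line[OF fg(2)] by meson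
  have "P \<noteq> 0" using P[of 0] xy by auto
  moreover have "Q \<noteq> 0" using Q[of 1] xy by auto
  ultimately have "P * Q * H \<noteq> 0" using H by simp
  then have "finite {t. poly (P * Q * H) t = 0}" by (rule poly_roots_finite)
  then have "\<exists>t. t \<notin> {t. poly (P * Q * H) t = 0}" using ex_new_if_finite infinite_UNIV_char_0 by blast
  then obtain t where "poly (P * Q * H) t \<noteq> 0" by auto
  then show "\<exists>x\<in>V. f x \<noteq> 0 \<and> g x \<noteq> 0"
    by (intro bexI[of _ "\<lambda>i. x i + t * (y i - x i)"]) (use P Q H(2)[of t] in auto)
qed (use assms in auto)

lemma variety_irreducible: "variety V \<Longrightarrow> irreducible_set V"
  unfolding irreducible_set_def
proof (intro conjI ballI impI)
  fix f g assume V: "variety V" and fg: "f \<in> polyfun UNIV" "g \<in> polyfun UNIV" and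
    ex: "\<exists>x\<in>V. f x \<noteq> 0" "\<exists>x\<in>V. g x \<noteq> 0"
  have "{x\<in>V. f x \<noteq> 0} \<inter> {x\<in>V. g x \<noteq> 0} \<noteq> {}"
    using V openin_zariski_on_nonzero[OF fg(1), of V] openin_zariski_on_nonzero[OF fg(2), of V] ex
    unfolding variety_def by blast
  then show "\<exists>x\<in>V. f x \<noteq> 0 \<and> g x \<noteq> 0" by blast
qed (simp add: variety_def)

section \<open>The filter of nonempty open subsets: statements that hold at a generic point\<close>

definition generic :: "'i pt set \<Rightarrow> 'i pt filter" where
  "generic V = (INF S\<in>{S. openin (zariski_on V) S \<and> S \<noteq> {}}. principal S)"

text \<open>Irreducibility makes the nonempty open sets closed under finite intersection, so they
  are a base of the filter. Shrinking of domains is thereby delegated to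
  \<open>eventually_elim\<close>.\<close>

lemma eventually_generic:
  assumes "irreducible_set V"
  shows "eventually P (generic V) \<longleftrightarrow> (\<exists>S. openin (zariski_on V) S \<and> S \<noteq> {} \<and> (\<forall>x\<in>S. P x))"
proof -
  have "openin (zariski_on V) V" using openin_topspace[of "zariski_on V"] by simp
  then have "{S. openin (zariski_on V) S \<and> S \<noteq> {}} \<noteq> {}"
    using assms unfolding irreducible_set_def by blast
  then have "eventually P (generic V) \<longleftrightarrow>
    (\<exists>S\<in>{S. openin (zariski_on V) S \<and> S \<noteq> {}}. eventually P (principal S))"
    unfolding generic_def
  proof (rule eventually_INF_base)
    fix S T assume "S \<in> {S. openin (zariski_on V) S \<and> S \<noteq> {}}" "T \<in> {S. openin (zariski_on V) S \<and> S \<noteq> {}}"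
    then show "\<exists>x\<in>{S. openin (zariski_on V) S \<and> S \<noteq> {}}. principal x \<le> inf (principal S) (principal T)"
      by (intro bexI[of _ "S \<inter> T"]) (use irreducible_set_inter[OF assms] in auto)
  qed
  then show ?thesis by (auto simp: eventually_principal)
qed

lemma eventually_generic_polyfun:
  assumes "irreducible_set V"
  shows "eventually P (generic V) \<longleftrightarrow>
    (\<exists>h\<in>polyfun UNIV. (\<exists>x\<in>V. h x \<noteq> 0) \<and> (\<forall>x\<in>V. h x \<noteq> 0 \<longrightarrow> P x))"
proof
  assume "eventually P (generic V)"
  then obtain S x where "openin (zariski_on V) S" "x \<in> S" "\<forall>x\<in>S. P x"
    using eventually_generic[OF assms] by blast
  then show "\<exists>h\<in>polyfun UNIV. (\<exists>x\<in>V. h x \<noteq> 0) \<and> (\<forall>x\<in>V. h x \<noteq> 0 \<longrightarrow> P x)"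
    unfolding openin_zariski_on_iff by blast
next
  assume "\<exists>h\<in>polyfun UNIV. (\<exists>x\<in>V. h x \<noteq> 0) \<and> (\<forall>x\<in>V. h x \<noteq> 0 \<longrightarrow> P x)"
  then obtain h where "h \<in> polyfun UNIV" "\<exists>x\<in>V. h x \<noteq> 0" "\<forall>x\<in>V. h x \<noteq> 0 \<longrightarrow> P x" by blast
  then show "eventually P (generic V)"
    unfolding eventually_generic[OF assms]
    by (intro exI[of _ "{x\<in>V. h x \<noteq> 0}"]) (use openin_zariski_on_nonzero in auto)
qed

lemma eventually_generic_in: "irreducible_set V \<Longrightarrow> eventually (\<lambda>x. x \<in> V) (generic V)"
  using polyfun.const[of 1 UNIV] unfolding eventually_generic_polyfun
  by (intro bexI[of _ "\<lambda>_. 1"]) (auto simp: irreducible_set_def)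

lemma generic_nonbot: "irreducible_set V \<Longrightarrow> generic V \<noteq> bot"
  by (auto simp: trivial_limit_def eventually_generic)

lemma eventually_generic_nonzero:
  assumes "irreducible_set V" "p \<in> polyfun UNIV" "x \<in> V" "p x \<noteq> 0"
  shows "eventually (\<lambda>x. p x \<noteq> 0) (generic V)"
  using assms by (auto simp: eventually_generic_polyfun)

lemma eventually_generic_open:
  assumes "irreducible_set V" "openin (zariski_on V) S" "S \<noteq> {}"
  shows "eventually (\<lambda>x. x \<in> S) (generic V)"
  using assms by (auto simp: eventually_generic)

lemma eventually_generic_ex:
  assumes "irreducible_set V" "eventually P (generic V)"
  shows "\<exists>x\<in>V. P x"
proof -
  have "eventually (\<lambda>x. P x \<and> x \<in> V) (generic V)"
    by (intro eventually_conj assms(2) eventually_generic_in[OF assms(1)])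
  then show ?thesis using generic_nonbot[OF assms(1)] eventually_happens by blast
qed

lemma rat_eq_iff:
  assumes "irreducible_set V"
  shows "rat_eq V f g \<longleftrightarrow> eventually (\<lambda>x. x \<in> dom f \<and> x \<in> dom g \<and> f x = g x) (generic V)"
  unfolding rat_eq_def eventually_generic[OF assms] by blast


section \<open>Regular functions\<close>

lemma regular_onI:
  assumes "\<And>x. x \<in> S \<Longrightarrow> \<exists>p\<in>polyfun UNIV. \<exists>q\<in>polyfun UNIV.
        q x \<noteq> 0 \<and> (\<forall>y\<in>S. q y \<noteq> 0 \<longrightarrow> g y = p y / q y)"
  shows "regular_on S g"
  using assms unfolding regular_on_def by blast

lemma regular_onE:
  assumes "regular_on S g" "x \<in> S"
  obtains p q where "p \<in> polyfun UNIV" "q \<in> polyfun UNIV" "q x \<noteq> 0"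
    "\<And>y. y \<in> S \<Longrightarrow> q y \<noteq> 0 \<Longrightarrow> g y = p y / q y"
proof -
  have "\<exists>p\<in>polyfun UNIV. \<exists>q\<in>polyfun UNIV. q x \<noteq> 0 \<and> (\<forall>y\<in>S. q y \<noteq> 0 \<longrightarrow> g y = p y / q y)"
    using assms unfolding regular_on_def by (rule bspec)
  then show ?thesis using that by auto
qed

lemma regular_on_cong: "(\<And>x. x \<in> S \<Longrightarrow> f x = g x) \<Longrightarrow> regular_on S f \<longleftrightarrow> regular_on S g"
  unfolding regular_on_def by simp

lemma regular_on_subset: "regular_on S f \<Longrightarrow> T \<subseteq> S \<Longrightarrow> regular_on T f"
  by (rule regular_onI, erule regular_onE, erule (1) subsetD) blast

lemma regular_on_polyfun: "p \<in> polyfun UNIV \<Longrightarrow> regular_on S p"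
  by (intro regular_onI bexI[of _ p] bexI[of _ "\<lambda>_. 1"]) (auto intro: polyfun.intros)

lemma regular_on_add:
  assumes "regular_on S f" "regular_on S g" shows "regular_on S (\<lambda>x. f x + g x)"
proof (rule regular_onI)
  fix x assume x: "x \<in> S"
  obtain p q where f: "p \<in> polyfun UNIV" "q \<in> polyfun UNIV" "q x \<noteq> 0"
    "\<And>y. y \<in> S \<Longrightarrow> q y \<noteq> 0 \<Longrightarrow> f y = p y / q y" by (rule regular_onE[OF assms(1) x]) (rule that, assumption+)
  obtain p' q' where g: "p' \<in> polyfun UNIV" "q' \<in> polyfun UNIV" "q' x \<noteq> 0"
    "\<And>y. y \<in> S \<Longrightarrow> q' y \<noteq> 0 \<Longrightarrow> g y = p' y / q' y" by (rule regular_onE[OF assms(2) x]) (rule that, assumption+)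
  show "\<exists>p\<in>polyfun UNIV. \<exists>q\<in>polyfun UNIV. q x \<noteq> 0 \<and> (\<forall>y\<in>S. q y \<noteq> 0 \<longrightarrow> f y + g y = p y / q y)"
    by (rule bexI[of _ "\<lambda>x. p x * q' x + p' x * q x"], rule bexI[of _ "\<lambda>x. q x * q' x"])
      (use f g in \<open>auto intro!: polyfun.intros simp: field_simps\<close>)
qed

lemma regular_on_mult:
  assumes "regular_on S f" "regular_on S g" shows "regular_on S (\<lambda>x. f x * g x)"
proof (rule regular_onI)
  fix x assume x: "x \<in> S"
  obtain p q where f: "p \<in> polyfun UNIV" "q \<in> polyfun UNIV" "q x \<noteq> 0"
    "\<And>y. y \<in> S \<Longrightarrow> q y \<noteq> 0 \<Longrightarrow> f y = p y / q y" by (rule regular_onE[OF assms(1) x]) (rule that, assumption+)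
  obtain p' q' where g: "p' \<in> polyfun UNIV" "q' \<in> polyfun UNIV" "q' x \<noteq> 0"
    "\<And>y. y \<in> S \<Longrightarrow> q' y \<noteq> 0 \<Longrightarrow> g y = p' y / q' y" by (rule regular_onE[OF assms(2) x]) (rule that, assumption+)
  show "\<exists>p\<in>polyfun UNIV. \<exists>q\<in>polyfun UNIV. q x \<noteq> 0 \<and> (\<forall>y\<in>S. q y \<noteq> 0 \<longrightarrow> f y * g y = p y / q y)"
    by (rule bexI[of _ "\<lambda>x. p x * p' x"], rule bexI[of _ "\<lambda>x. q x * q' x"])
      (use f g in \<open>auto intro!: polyfun.intros\<close>)
qed

lemma regular_on_inverse:
  assumes "regular_on S f" "\<And>x. x \<in> S \<Longrightarrow> f x \<noteq> 0" shows "regular_on S (\<lambda>x. inverse (f x))"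
proof (rule regular_onI)
  fix x assume x: "x \<in> S"
  obtain p q where f: "p \<in> polyfun UNIV" "q \<in> polyfun UNIV" "q x \<noteq> 0"
    "\<And>y. y \<in> S \<Longrightarrow> q y \<noteq> 0 \<Longrightarrow> f y = p y / q y" by (rule regular_onE[OF assms(1) x]) (rule that, assumption+)
  have "p x \<noteq> 0" using f(3,4) x assms(2) by (metis div_0)
  \<comment> \<open>The fraction q/p is expanded by q, so that a nonzero denominator guarantees that
    the representation of \<open>f\<close> is valid at y.\<close>
  then show "\<exists>p\<in>polyfun UNIV. \<exists>q\<in>polyfun UNIV. q x \<noteq> 0 \<and> (\<forall>y\<in>S. q y \<noteq> 0 \<longrightarrow> inverse (f y) = p y / q y)"
    by (intro bexI[of _ "\<lambda>x. q x * q x"] bexI[of _ "\<lambda>x. p x * q x"])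
      (use f in \<open>auto intro!: polyfun.intros\<close>)
qed

lemma regular_on_divide:
  assumes "regular_on S f" "regular_on S g" "\<And>x. x \<in> S \<Longrightarrow> g x \<noteq> 0"
  shows "regular_on S (\<lambda>x. f x / g x)"
  using regular_on_mult[OF assms(1) regular_on_inverse[OF assms(2,3)]] by (simp add: divide_inverse)

lemma regular_on_const: "regular_on S (\<lambda>_. a)"
  by (intro regular_on_polyfun polyfun.const)

lemma regular_on_diff: "regular_on S f \<Longrightarrow> regular_on S g \<Longrightarrow> regular_on S (\<lambda>x. f x - g x)"
  using regular_on_add[OF _ regular_on_mult[OF regular_on_const[of _ "-1"]], of S f g] by simp

lemma regular_on_compose_polyfun:
  assumes "p \<in> polyfun J" "\<And>j. j \<in> J \<Longrightarrow> regular_on S (\<lambda>x. f x j)"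
  shows "regular_on S (\<lambda>x. p (f x))"
  using assms
  by (induction rule: polyfun.induct) (auto intro: regular_on_const regular_on_add regular_on_mult)

lemma regular_on_compose:
  assumes "regular_on T g" "\<And>j. regular_on S (\<lambda>x. f x j)" "\<And>x. x \<in> S \<Longrightarrow> f x \<in> T"
  shows "regular_on S (\<lambda>x. g (f x))"
proof (rule regular_onI)
  fix x assume x: "x \<in> S"
  obtain p q where g: "p \<in> polyfun UNIV" "q \<in> polyfun UNIV" "q (f x) \<noteq> 0"
    "\<And>y. y \<in> T \<Longrightarrow> q y \<noteq> 0 \<Longrightarrow> g y = p y / q y"
    by (rule regular_onE[OF assms(1) assms(3)[OF x]]) (rule that, assumption+)
  have "regular_on S (\<lambda>x. p (f x))" "regular_on S (\<lambda>x. q (f x))"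
    using regular_on_compose_polyfun assms(2) g by blast+
  note r = this
  obtain p1 q1 where h1:
    "p1 \<in> polyfun UNIV" "q1 \<in> polyfun UNIV" "q1 x \<noteq> 0" "\<And>y. y \<in> S \<Longrightarrow> q1 y \<noteq> 0 \<Longrightarrow> p (f y) = p1 y / q1 y"
    by (rule regular_onE[OF r(1) x]) (rule that, assumption+)
  obtain p2 q2 where h2:
    "p2 \<in> polyfun UNIV" "q2 \<in> polyfun UNIV" "q2 x \<noteq> 0" "\<And>y. y \<in> S \<Longrightarrow> q2 y \<noteq> 0 \<Longrightarrow> q (f y) = p2 y / q2 y"
    by (rule regular_onE[OF r(2) x]) (rule that, assumption+)
  note h = h1 h2
  have "p2 x \<noteq> 0" using h g x by (metis div_0)
  \<comment> \<open>The quotient of p1/q1 by p2/q2, expanded by q2: a nonzero denominator then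
    certifies both representations at y.\<close>
  then show "\<exists>p\<in>polyfun UNIV. \<exists>q\<in>polyfun UNIV. q x \<noteq> 0 \<and> (\<forall>y\<in>S. q y \<noteq> 0 \<longrightarrow> g (f y) = p y / q y)"
    by (intro bexI[of _ "\<lambda>x. p1 x * q2 x * q2 x"] bexI[of _ "\<lambda>x. q1 x * p2 x * q2 x"])
      (use h g assms(3) in \<open>auto intro!: polyfun.intros\<close>)
qed

text \<open>Both parts of a local fraction are multiplied by a polynomial whose nonvanishing on V
  implies membership in S. The denominator then controls the domain as well.\<close>

lemma regular_on_openE:
  assumes "regular_on S g" "openin (zariski_on V) S" "x \<in> S"
  obtains p q where "p \<in> polyfun UNIV" "q \<in> polyfun UNIV" "q x \<noteq> 0"
    "\<And>y. y \<in> V \<Longrightarrow> q y \<noteq> 0 \<Longrightarrow> y \<in> S \<and> g y = p y / q y"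
proof -
  obtain p q where g: "p \<in> polyfun UNIV" "q \<in> polyfun UNIV" "q x \<noteq> 0"
    "\<And>y. y \<in> S \<Longrightarrow> q y \<noteq> 0 \<Longrightarrow> g y = p y / q y"
    by (rule regular_onE[OF assms(1,3)]) (rule that, assumption+)
  obtain h where h: "h \<in> polyfun UNIV" "h x \<noteq> 0" "{y\<in>V. h y \<noteq> 0} \<subseteq> S"
    using assms(2,3) unfolding openin_zariski_on_iff by blast
  show ?thesis
    by (rule that[of "\<lambda>x. p x * h x" "\<lambda>x. q x * h x"]) (use g h in \<open>auto intro: polyfun.intros\<close>)
qed

lemma openin_regular_nonzero:
  assumes "regular_on S g" "openin (zariski_on V) S"
  shows "openin (zariski_on V) {x\<in>S. g x \<noteq> 0}"
  unfolding openin_zariski_on_iff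
proof (intro conjI ballI)
  show "{x\<in>S. g x \<noteq> 0} \<subseteq> V" using assms(2) by (auto simp: openin_zariski_on_iff)
next
  fix x assume x: "x \<in> {x\<in>S. g x \<noteq> 0}"
  then obtain p q where "p \<in> polyfun UNIV" "q \<in> polyfun UNIV" "q x \<noteq> 0"
    "\<And>y. y \<in> V \<Longrightarrow> q y \<noteq> 0 \<Longrightarrow> y \<in> S \<and> g y = p y / q y"
    using regular_on_openE[OF assms] by blast
  moreover have "x \<in> V" using x assms(2) openin_zariski_on_iff by blast
  ultimately show "\<exists>f\<in>polyfun UNIV. f x \<noteq> 0 \<and> {y\<in>V. f y \<noteq> 0} \<subseteq> {x\<in>S. g x \<noteq> 0}"
    using x by (intro bexI[of _ "\<lambda>x. p x * q x"]) (auto intro: polyfun.intros)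
qed

lemma openin_regular_preimage:
  assumes "\<And>j. regular_on S (\<lambda>x. f x j)" "openin (zariski_on V) S" "openin (zariski_on W) T"
    "\<And>x. x \<in> S \<Longrightarrow> f x \<in> W"
  shows "openin (zariski_on V) {x\<in>S. f x \<in> T}"
proof (subst openin_subopen, intro ballI)
  fix x assume x: "x \<in> {x\<in>S. f x \<in> T}"
  then obtain h where h: "h \<in> polyfun UNIV" "h (f x) \<noteq> 0" "{y\<in>W. h y \<noteq> 0} \<subseteq> T"
    using assms(3) unfolding openin_zariski_on_iff by blast
  have "openin (zariski_on V) {x\<in>S. h (f x) \<noteq> 0}"
    by (intro openin_regular_nonzero regular_on_compose_polyfun[OF h(1)] assms)
  moreover have "{x\<in>S. h (f x) \<noteq> 0} \<subseteq> {x\<in>S. f x \<in> T}" using h assms(4) by blast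
  ultimately show "\<exists>U. openin (zariski_on V) U \<and> x \<in> U \<and> U \<subseteq> {x\<in>S. f x \<in> T}"
    using x h by blast
qed

text \<open>Identity theorem: the set where f and g differ is open, so if it were nonempty the two
  would differ generically.\<close>

lemma regular_on_eqI:
  assumes "irreducible_set V" "openin (zariski_on V) S" "regular_on S f" "regular_on S g"
    "eventually (\<lambda>x. x \<in> S \<longrightarrow> f x = g x) (generic V)" "x \<in> S"
  shows "f x = g x"
proof (rule ccontr)
  assume "f x \<noteq> g x"
  moreover have "openin (zariski_on V) {x\<in>S. f x - g x \<noteq> 0}"
    using assms by (intro openin_regular_nonzero regular_on_diff)
  ultimately have "eventually (\<lambda>x. x \<in> {x\<in>S. f x - g x \<noteq> 0}) (generic V)"
    using assms by (intro eventually_generic_open) auto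
  with assms(5) have "eventually (\<lambda>x. False) (generic V)" by eventually_elim auto
  then show False using generic_nonbot[OF assms(1)] by simp
qed


section \<open>Rational maps and function fields\<close>

lemma dom_map_comp: "dom (g \<circ>\<^sub>m f) = {x \<in> dom f. the (f x) \<in> dom g}"
  by (auto simp: map_comp_def split: option.splits)

lemma the_map_comp: "x \<in> dom f \<Longrightarrow> (g \<circ>\<^sub>m f) x = g (the (f x))"
  by (auto simp: map_comp_def split: option.splits)

lemma rational_map_in: "rational_map V W f \<Longrightarrow> x \<in> dom f \<Longrightarrow> the (f x) \<in> W"
  unfolding rational_map_def by (metis domD option.sel ranI subset_iff)

lemma rational_map_dom: "rational_map V W f \<Longrightarrow> openin (zariski_on V) (dom f)"
  unfolding rational_map_def by simp

lemma rational_fun_dom: "rational_fun V f \<Longrightarrow> openin (zariski_on V) (dom f)"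
  unfolding rational_fun_def by simp

lemma rational_map_regular:
  "rational_map V W f \<Longrightarrow> S \<subseteq> dom f \<Longrightarrow> regular_on S (\<lambda>x. the (f x) j)"
  unfolding rational_map_def by (rule regular_on_subset) simp_all

lemma rational_fun_regular:
  "rational_fun V f \<Longrightarrow> S \<subseteq> dom f \<Longrightarrow> regular_on S (\<lambda>x. the (f x))"
  unfolding rational_fun_def by (rule regular_on_subset) simp_all

lemma openin_dom_map_comp:
  assumes "rational_map V W f" "openin (zariski_on W) (dom g)"
  shows "openin (zariski_on V) (dom (g \<circ>\<^sub>m f))"
  unfolding dom_map_comp
  using assms rational_map_in[OF assms(1)] unfolding rational_map_def
  by (intro openin_regular_preimage[where W = W]) auto

lemma rational_map_comp:
  assumes "rational_map V W f" "rational_map W Z g" "dom (g \<circ>\<^sub>m f) \<noteq> {}"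
  shows "rational_map V Z (g \<circ>\<^sub>m f)"
  unfolding rational_map_def
proof (intro conjI allI)
  show "openin (zariski_on V) (dom (g \<circ>\<^sub>m f))"
    using openin_dom_map_comp assms rational_map_def by blast
  show "dom (g \<circ>\<^sub>m f) \<noteq> {}" by fact
  show "ran (g \<circ>\<^sub>m f) \<subseteq> Z"
    using assms(2) unfolding rational_map_def by (auto simp: map_comp_def ran_def split: option.splits)
  fix j
  have "regular_on (dom (g \<circ>\<^sub>m f)) (\<lambda>x. (\<lambda>y. the (g y) j) (the (f x)))"
    by (rule regular_on_compose[where T = "dom g"])
      (use rational_map_regular[OF assms(1)] rational_map_regular[OF assms(2)] in \<open>auto simp: dom_map_comp\<close>)
  then show "regular_on (dom (g \<circ>\<^sub>m f)) (\<lambda>x. the ((g \<circ>\<^sub>m f) x) j)"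
    by (rule regular_on_cong[THEN iffD1, rotated]) (auto simp: map_comp_def split: option.splits)
qed

lemma rational_fun_comp:
  assumes "rational_map V W f" "rational_fun W g" "dom (g \<circ>\<^sub>m f) \<noteq> {}"
  shows "rational_fun V (g \<circ>\<^sub>m f)"
  unfolding rational_fun_def
proof (intro conjI allI)
  show "openin (zariski_on V) (dom (g \<circ>\<^sub>m f))"
    using openin_dom_map_comp assms rational_fun_def by blast
  show "dom (g \<circ>\<^sub>m f) \<noteq> {}" by fact
  have "regular_on (dom (g \<circ>\<^sub>m f)) (\<lambda>x. (\<lambda>y. the (g y)) (the (f x)))"
    by (rule regular_on_compose[where T = "dom g"])
      (use rational_map_regular[OF assms(1)] rational_fun_regular[OF assms(2)] in \<open>auto simp: dom_map_comp\<close>)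
  then show "regular_on (dom (g \<circ>\<^sub>m f)) (\<lambda>x. the ((g \<circ>\<^sub>m f) x))"
    by (rule regular_on_cong[THEN iffD1, rotated]) (auto simp: map_comp_def split: option.splits)
qed

text \<open>Lifts generic equality to every point of the common domain, the form in which the
  crystal axioms are stated.\<close>

lemma rational_map_agree:
  assumes "irreducible_set V" "rational_map V W f" "rational_map V W' g"
    "\<And>j. \<forall>\<^sub>F x in generic V. x \<in> dom f \<inter> dom g \<longrightarrow> the (f x) j = the (g x) j"
  shows "agree f g"
  unfolding agree_def
proof
  fix x assume x: "x \<in> dom f \<inter> dom g"
  have "the (f x) = the (g x)"
  proof
    fix j
    show "the (f x) j = the (g x) j"
    proof (rule regular_on_eqI[OF assms(1), where S = "dom f \<inter> dom g" and f = "\<lambda>x. the (f x) j" and g = "\<lambda>x. the (g x) j"])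
      show "openin (zariski_on V) (dom f \<inter> dom g)" using assms(2,3) by (auto simp: rational_map_def)
      show "regular_on (dom f \<inter> dom g) (\<lambda>x. the (f x) j)" "regular_on (dom f \<inter> dom g) (\<lambda>x. the (g x) j)"
        using rational_map_regular[OF assms(2)] rational_map_regular[OF assms(3)] by auto
    qed (use assms(4) x in auto)
  qed
  then show "f x = g x" using x by auto
qed

lemma rational_map_eventually_dom:
  "irreducible_set V \<Longrightarrow> rational_map V W f \<Longrightarrow> \<forall>\<^sub>F x in generic V. x \<in> dom f"
  unfolding rational_map_def by (rule eventually_generic_open) auto

lemma rational_fun_eventually_dom:
  "irreducible_set V \<Longrightarrow> rational_fun V f \<Longrightarrow> \<forall>\<^sub>F x in generic V. x \<in> dom f"
  unfolding rational_fun_def by (rule eventually_generic_open) auto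

text \<open>Equality of all coordinates up to \<open>rat_eq\<close> suffices, although there are infinitely many.\<close>

lemma rational_map_rat_eqI:
  assumes "irreducible_set V" "rational_map V W f" "rational_map V W' g"
    "\<And>j. \<forall>\<^sub>F x in generic V. x \<in> dom f \<inter> dom g \<longrightarrow> the (f x) j = the (g x) j"
  shows "rat_eq V f g"
proof -
  have *: "agree f g" by (rule rational_map_agree[OF assms])
  show ?thesis unfolding rat_eq_iff[OF assms(1)]
    using rational_map_eventually_dom[OF assms(1,2)] rational_map_eventually_dom[OF assms(1,3)]
    by eventually_elim (use * in \<open>auto simp: agree_def\<close>)
qed

lemma rat_eq_refl: "irreducible_set V \<Longrightarrow> \<forall>\<^sub>F x in generic V. x \<in> dom f \<Longrightarrow> rat_eq V f f"
  by (simp add: rat_eq_iff)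

lemma rat_eq_sym: "rat_eq V f g \<Longrightarrow> rat_eq V g f"
  unfolding rat_eq_def by (metis inf_commute)

lemma rat_eq_trans:
  assumes "irreducible_set V" "rat_eq V f g" "rat_eq V g h" shows "rat_eq V f h"
  using assms(2,3) unfolding rat_eq_iff[OF assms(1)] by eventually_elim auto

lemma rat_class_cong:
  assumes "irreducible_set V" "rat_eq V f g" shows "rat_class V f = rat_class V g"
  using rat_eq_trans[OF assms(1)] rat_eq_sym assms(2) unfolding rat_class_def by blast

lemma rat_class_self: "irreducible_set V \<Longrightarrow> rational_fun V f \<Longrightarrow> f \<in> rat_class V f"
  unfolding rat_class_def using rat_eq_refl rational_fun_eventually_dom by blast

lemma rat_class_eqD:
  assumes "irreducible_set V" "rational_fun V f" "rat_class V f = rat_class V g" shows "rat_eq V f g"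
  using rat_class_self[OF assms(1,2)] assms(3) unfolding rat_class_def by blast

section \<open>Sums, products and quotients of rational functions\<close>

lemma dom_padd [simp]: "dom (padd f g) = dom f \<inter> dom g"
  by (auto simp: padd_def split: bind_splits)

lemma dom_pmult [simp]: "dom (pmult f g) = dom f \<inter> dom g"
  by (auto simp: pmult_def split: bind_splits)

lemma dom_pdiv: "dom (pdiv f g) = {x \<in> dom f \<inter> dom g. the (g x) \<noteq> 0}"
  by (auto simp: pdiv_def split: bind_splits if_splits)

lemma the_pdiv: "x \<in> dom f \<Longrightarrow> x \<in> dom g \<Longrightarrow> the (g x) \<noteq> 0 \<Longrightarrow> pdiv f g x = Some (the (f x) / the (g x))"
  by (auto simp: pdiv_def)

lemma
  assumes "irreducible_set V" "rational_fun V f" "rational_fun V g"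
  shows rational_fun_pmult: "rational_fun V (pmult f g)"
    and rational_fun_padd: "rational_fun V (padd f g)"
proof -
  have ne: "dom f \<inter> dom g \<noteq> {}"
    using irreducible_set_inter[OF assms(1)] assms(2,3) by (auto simp: rational_fun_def)
  have "regular_on (dom f \<inter> dom g) (\<lambda>x. the (f x) * the (g x))"
    "regular_on (dom f \<inter> dom g) (\<lambda>x. the (f x) + the (g x))"
    using rational_fun_regular[OF assms(2)] rational_fun_regular[OF assms(3)]
    by (auto intro!: regular_on_mult regular_on_add)
  then have "regular_on (dom f \<inter> dom g) (\<lambda>x. the (pmult f g x))"
    "regular_on (dom f \<inter> dom g) (\<lambda>x. the (padd f g x))"
    by - (erule regular_on_cong[THEN iffD1, rotated], auto simp: padd_def pmult_def)+
  then show "rational_fun V (pmult f g)" "rational_fun V (padd f g)"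
    using assms(2,3) ne by (auto simp: rational_fun_def)
qed

lemma rational_fun_pdiv:
  assumes "rational_fun V f" "rational_fun V g" "dom (pdiv f g) \<noteq> {}"
  shows "rational_fun V (pdiv f g)"
proof -
  have r: "regular_on (dom f \<inter> dom g) (\<lambda>x. the (f x))" "regular_on (dom f \<inter> dom g) (\<lambda>x. the (g x))"
    using rational_fun_regular[OF assms(1)] rational_fun_regular[OF assms(2)] by auto
  have "regular_on (dom (pdiv f g)) (\<lambda>x. the (f x) / the (g x))"
    by (intro regular_on_divide rational_fun_regular[OF assms(1)] rational_fun_regular[OF assms(2)])
      (auto simp: dom_pdiv)
  then have "regular_on (dom (pdiv f g)) (\<lambda>x. the (pdiv f g x))"
    by (rule regular_on_cong[THEN iffD1, rotated]) (auto simp: dom_pdiv the_pdiv)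
  moreover have "openin (zariski_on V) (dom (pdiv f g))"
    unfolding dom_pdiv using assms(1,2) by (intro openin_regular_nonzero r) (auto simp: rational_fun_def)
  ultimately show ?thesis using assms(3) by (simp add: rational_fun_def)
qed

lemma rat_eq_pmult:
  assumes "irreducible_set V" "rat_eq V f f'" "rat_eq V g g'"
  shows "rat_eq V (pmult f g) (pmult f' g')"
  using assms(2,3) unfolding rat_eq_iff[OF assms(1)]
  by eventually_elim (auto simp: pmult_def)

lemma rat_eq_padd:
  assumes "irreducible_set V" "rat_eq V f f'" "rat_eq V g g'"
  shows "rat_eq V (padd f g) (padd f' g')"
  using assms(2,3) unfolding rat_eq_iff[OF assms(1)]
  by eventually_elim (auto simp: padd_def)

section \<open>Arithmetic of classes in the function field\<close>

lemma carrier_function_field: "carrier (function_field V) = rat_class V ` {f. rational_fun V f}"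
  by (simp add: function_field_def)

lemma rational_fun_const: "irreducible_set V \<Longrightarrow> rational_fun V ((\<lambda>_. Some a) |` V)"
proof -
  have "openin (zariski_on V) V" using openin_topspace[of "zariski_on V"] by simp
  moreover have "regular_on V (\<lambda>x. the (((\<lambda>_. Some a) |` V) x))"
    by (rule regular_on_cong[THEN iffD1, OF _ regular_on_const[of V a]]) auto
  ultimately show "irreducible_set V \<Longrightarrow> rational_fun V ((\<lambda>_. Some a) |` V)"
    by (auto simp: rational_fun_def irreducible_set_def)
qed

lemma rational_fun_polyfun:
  "irreducible_set V \<Longrightarrow> p \<in> polyfun UNIV \<Longrightarrow> rational_fun V ((\<lambda>x. Some (p x)) |` V)"
proof -
  assume p: "irreducible_set V" "p \<in> polyfun UNIV"
  have "openin (zariski_on V) V" using openin_topspace[of "zariski_on V"] by simp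
  moreover have "regular_on V (\<lambda>x. the (((\<lambda>x. Some (p x)) |` V) x))"
    by (rule regular_on_cong[THEN iffD1, OF _ regular_on_polyfun[OF p(2)]]) auto
  ultimately show ?thesis
    using p by (auto simp: rational_fun_def irreducible_set_def)
qed

lemma function_field_mult:
  assumes "irreducible_set V" "rational_fun V f" "rational_fun V g"
  shows "rat_class V f \<otimes>\<^bsub>function_field V\<^esub> rat_class V g = rat_class V (pmult f g)"
proof -
  have "rat_class V (pmult f' g') = rat_class V (pmult f g)"
    if "f' \<in> rat_class V f" "g' \<in> rat_class V g" for f' g'
    using rat_class_cong[OF assms(1) rat_eq_pmult[OF assms(1)]] that unfolding rat_class_def by blast
  then have "(\<Union>f'\<in>rat_class V f. \<Union>g'\<in>rat_class V g. rat_class V (pmult f' g')) =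
      (\<Union>f'\<in>rat_class V f. \<Union>g'\<in>rat_class V g. rat_class V (pmult f g))"
    by simp
  then show ?thesis
    using rat_class_self[OF assms(1,2)] rat_class_self[OF assms(1,3)]
    by (simp add: function_field_def) blast
qed

lemma function_field_add:
  assumes "irreducible_set V" "rational_fun V f" "rational_fun V g"
  shows "rat_class V f \<oplus>\<^bsub>function_field V\<^esub> rat_class V g = rat_class V (padd f g)"
proof -
  have "rat_class V (padd f' g') = rat_class V (padd f g)"
    if "f' \<in> rat_class V f" "g' \<in> rat_class V g" for f' g'
    using rat_class_cong[OF assms(1) rat_eq_padd[OF assms(1)]] that unfolding rat_class_def by blast
  then have "(\<Union>f'\<in>rat_class V f. \<Union>g'\<in>rat_class V g. rat_class V (padd f' g')) =
      (\<Union>f'\<in>rat_class V f. \<Union>g'\<in>rat_class V g. rat_class V (padd f g))"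
    by simp
  then show ?thesis
    using rat_class_self[OF assms(1,2)] rat_class_self[OF assms(1,3)]
    by (simp add: function_field_def) blast
qed

section \<open>Dominant maps and their pullbacks\<close>

definition dominant :: "'i pt set \<Rightarrow> 'j pt set \<Rightarrow> ('i pt \<rightharpoonup> 'j pt) \<Rightarrow> bool" where
  "dominant V W f \<longleftrightarrow>
     (\<forall>h\<in>polyfun UNIV. (\<exists>y\<in>W. h y \<noteq> 0) \<longrightarrow> (\<exists>x\<in>dom f. h (the (f x)) \<noteq> 0))"

text \<open>The preimage of a nonempty principal open set is open and, by dominance, nonempty;
  generic statements on W therefore pull back to V.\<close>

lemma dominant_eventually:
  assumes "irreducible_set V" "irreducible_set W" "rational_map V W f" "dominant V W f"
    "eventually P (generic W)"
  shows "\<forall>\<^sub>F x in generic V. x \<in> dom f \<and> P (the (f x))"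
proof -
  obtain h where h: "h \<in> polyfun UNIV" "\<exists>y\<in>W. h y \<noteq> 0" "\<And>y. y \<in> W \<Longrightarrow> h y \<noteq> 0 \<Longrightarrow> P y"
    using assms(5) unfolding eventually_generic_polyfun[OF assms(2)] by blast
  have "\<forall>\<^sub>F x in generic V. x \<in> {x\<in>dom f. h (the (f x)) \<noteq> 0}"
    using assms h unfolding rational_map_def dominant_def
    by (intro eventually_generic_open openin_regular_nonzero regular_on_compose_polyfun[OF h(1)]) blast+
  then show ?thesis
    by eventually_elim (use h(3) rational_map_in[OF assms(3)] in auto)
qed

lemma dominant_rat_eq:
  assumes "irreducible_set V" "irreducible_set W" "rational_map V W f" "dominant V W f"
    "rat_eq W g g'"
  shows "rat_eq V (g \<circ>\<^sub>m f) (g' \<circ>\<^sub>m f)"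
  using dominant_eventually[OF assms(1-4) assms(5)[unfolded rat_eq_iff[OF assms(2)]]]
  unfolding rat_eq_iff[OF assms(1)] by eventually_elim (auto simp: map_comp_def split: option.splits)

lemma rat_eq_comp_left:
  assumes "irreducible_set V" "rat_eq V f f'" "\<forall>\<^sub>F x in generic V. x \<in> dom (g \<circ>\<^sub>m f)"
  shows "rat_eq V (g \<circ>\<^sub>m f) (g \<circ>\<^sub>m f')"
  using assms(2,3) unfolding rat_eq_iff[OF assms(1)]
  by eventually_elim (auto simp: map_comp_def split: option.splits)

lemma dominant_rational_fun:
  assumes "irreducible_set V" "irreducible_set W" "rational_map V W f" "dominant V W f" "rational_fun W g"
  shows "rational_fun V (g \<circ>\<^sub>m f)" "\<forall>\<^sub>F x in generic V. x \<in> dom (g \<circ>\<^sub>m f)"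
proof -
  show *: "\<forall>\<^sub>F x in generic V. x \<in> dom (g \<circ>\<^sub>m f)"
    using dominant_eventually[OF assms(1-4) rational_fun_eventually_dom[OF assms(2,5)]]
    unfolding dom_map_comp by simp
  then have "dom (g \<circ>\<^sub>m f) \<noteq> {}" using eventually_generic_ex[OF assms(1)] by blast
  then show "rational_fun V (g \<circ>\<^sub>m f)" using rational_fun_comp assms by blast
qed

lemma pullback_rat_class:
  assumes "irreducible_set V" "irreducible_set W" "rational_map V W f" "dominant V W f" "rational_fun W g"
  shows "pullback V f (rat_class W g) = rat_class V (g \<circ>\<^sub>m f)"
proof -
  have "rat_class V (g' \<circ>\<^sub>m f) = rat_class V (g \<circ>\<^sub>m f)" if "g' \<in> rat_class W g" for g'
    using that dominant_rat_eq[OF assms(1-4)] rat_class_cong[OF assms(1)] unfolding rat_class_def by blast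
  then show ?thesis
    unfolding pullback_def using rat_class_self[OF assms(2,5)] by blast
qed

lemma pullback_ring_hom:
  assumes "irreducible_set V" "irreducible_set W" "rational_map V W f" "dominant V W f"
  shows "pullback V f \<in> Ring.ring_hom (function_field W) (function_field V)"
proof (rule ring_hom_memI)
  note pb = pullback_rat_class[OF assms] and rf = dominant_rational_fun(1)[OF assms]
  fix a assume "a \<in> carrier (function_field W)"
  then obtain g where g: "rational_fun W g" "a = rat_class W g" by (auto simp: carrier_function_field)
  then show "pullback V f a \<in> carrier (function_field V)"
    using pb rf by (auto simp: carrier_function_field)
  fix b assume "b \<in> carrier (function_field W)"
  then obtain h where h: "rational_fun W h" "b = rat_class W h" by (auto simp: carrier_function_field)
  have 1: "pmult g h \<circ>\<^sub>m f = pmult (g \<circ>\<^sub>m f) (h \<circ>\<^sub>m f)" "padd g h \<circ>\<^sub>m f = padd (g \<circ>\<^sub>m f) (h \<circ>\<^sub>m f)"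
    by (auto simp: map_comp_def pmult_def padd_def split: option.splits)
  show "pullback V f (a \<otimes>\<^bsub>function_field W\<^esub> b) = pullback V f a \<otimes>\<^bsub>function_field V\<^esub> pullback V f b"
    using g h rf by (simp add: function_field_mult assms pb rational_fun_pmult 1)
  show "pullback V f (a \<oplus>\<^bsub>function_field W\<^esub> b) = pullback V f a \<oplus>\<^bsub>function_field V\<^esub> pullback V f b"
    using g h rf by (simp add: function_field_add assms pb rational_fun_padd 1)
next
  have "rat_eq V (((\<lambda>_. Some 1) |` W) \<circ>\<^sub>m f) ((\<lambda>_. Some 1) |` V)"
    unfolding rat_eq_iff[OF assms(1)]
    using rational_map_eventually_dom[OF assms(1,3)] eventually_generic_in[OF assms(1)]
    by eventually_elim (use rational_map_in[OF assms(3)] in \<open>force simp: map_comp_def split: option.splits\<close>)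
  then show "pullback V f \<one>\<^bsub>function_field W\<^esub> = \<one>\<^bsub>function_field V\<^esub>"
    using pullback_rat_class[OF assms rational_fun_const[OF assms(2)]] rat_class_cong[OF assms(1)]
    by (simp add: function_field_def)
qed

text \<open>Functions that are not \<open>rat_eq\<close> differ on a nonempty open set, whose
  preimage under a dominant map is generic, so their pullbacks differ too.\<close>

lemma pullback_inj_on:
  assumes "irreducible_set V" "irreducible_set W" "rational_map V W f" "dominant V W f"
  shows "inj_on (pullback V f) (carrier (function_field W))"
proof (rule inj_onI)
  note pb = pullback_rat_class[OF assms] and rf = dominant_rational_fun(1)[OF assms]
  fix a b assume "a \<in> carrier (function_field W)" "b \<in> carrier (function_field W)"
    and eq: "pullback V f a = pullback V f b"
  then obtain g h where g: "rational_fun W g" "a = rat_class W g" and h: "rational_fun W h" "b = rat_class W h"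
    by (auto simp: carrier_function_field)
  have "rat_eq V (g \<circ>\<^sub>m f) (h \<circ>\<^sub>m f)"
    using eq g h pb rf rat_class_eqD[OF assms(1)] by simp
  have "rat_eq W g h"
  proof (rule ccontr)
    assume n: "\<not> rat_eq W g h"
    let ?S = "dom g \<inter> dom h"
    have o: "openin (zariski_on W) ?S" using g h by (auto simp: rational_fun_def)
    have ne: "?S \<noteq> {}" using irreducible_set_inter[OF assms(2)] g h by (auto simp: rational_fun_def)
    have r: "regular_on ?S (\<lambda>x. the (g x) - the (h x))"
      using rational_fun_regular[OF g(1)] rational_fun_regular[OF h(1)] by (intro regular_on_diff) auto
    have "{x\<in>?S. the (g x) - the (h x) \<noteq> 0} \<noteq> {}"
    proof
      assume "{x\<in>?S. the (g x) - the (h x) \<noteq> 0} = {}"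
      then have "\<forall>x\<in>?S. g x = h x" by force
      then show False using n o ne unfolding rat_eq_def by blast
    qed
    then have "\<forall>\<^sub>F x in generic W. x \<in> {x\<in>?S. the (g x) - the (h x) \<noteq> 0}"
      by (intro eventually_generic_open assms openin_regular_nonzero r o)
    then have "\<forall>\<^sub>F x in generic V. x \<in> dom f \<and> the (f x) \<in> {x\<in>?S. the (g x) - the (h x) \<noteq> 0}"
      by (rule dominant_eventually[OF assms])
    moreover have "\<forall>\<^sub>F x in generic V. x \<in> dom f \<and> (g \<circ>\<^sub>m f) x = (h \<circ>\<^sub>m f) x"
      using \<open>rat_eq V (g \<circ>\<^sub>m f) (h \<circ>\<^sub>m f)\<close> unfolding rat_eq_iff[OF assms(1)]
      by eventually_elim (auto simp: dom_map_comp)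
    ultimately have "\<forall>\<^sub>F x in generic V. False"
      by eventually_elim (auto simp: map_comp_def)
    then show False using generic_nonbot[OF assms(1)] by simp
  qed
  then show "a = b" using g h rat_class_cong[OF assms(2)] by simp
qed

section \<open>Periodic functions\<close>

lemma periodic_add_mult:
  fixes f :: "int \<Rightarrow> 'a"
  assumes "\<And>r. f (r + int n) = f r"
  shows "f (r + int n * k) = f r"
proof (induction k rule: int_induct[of _ 0])
  case (step1 i)
  then show ?case using assms[of "r + int n * i"] by (simp add: algebra_simps)
next
  case (step2 i)
  then show ?case using assms[of "r + int n * (i - 1)"] by (simp add: algebra_simps)
qed simp

lemma periodic_dvd:
  fixes f :: "int \<Rightarrow> 'a"
  assumes "\<And>r. f (r + int n) = f r" "int n dvd r - s"
  shows "f r = f s"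
proof -
  obtain k where "r = s + int n * k" using assms(2) by (metis dvdE add.commute diff_add_cancel)
  then show ?thesis using periodic_add_mult[of f n, OF assms(1)] by simp
qed

lemma periodic_mod:
  fixes f :: "int \<Rightarrow> 'a"
  assumes "\<And>r. f (r + int n) = f r"
  shows "f r = f (r mod int n)"
  by (rule periodic_dvd[of f n, OF assms]) (simp add: minus_mod_eq_mult_div)

text \<open>Moving the window by one exchanges the factor \<open>a r\<close> for
  \<open>a (r + n)\<close>, which equals it and can be cancelled.\<close>

lemma periodic_window:
  fixes a :: "int \<Rightarrow> complex"
  assumes "\<And>r. a (r + int n) = a r" "\<And>r. a r \<noteq> 0"
  shows "(\<Prod>l<n. a (r + int l)) = (\<Prod>l<n. a (int l))"
proof -
  have step: "(\<Prod>l<n. a (r + 1 + int l)) = (\<Prod>l<n. a (r + int l))" for r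
  proof -
    have "a r * (\<Prod>l<n. a (r + 1 + int l)) = (\<Prod>l<Suc n. a (r + int l))"
      by (subst prod.lessThan_Suc_shift) (simp add: algebra_simps)
    also have "\<dots> = a r * (\<Prod>l<n. a (r + int l))" by (simp add: assms(1))
    finally show ?thesis using assms(2) by simp
  qed
  show ?thesis
  proof (induction r rule: int_induct[of _ 0])
    case (step1 i)
    then show ?case using step[of i] by simp
  next
    case (step2 i)
    then show ?case using step[of "i - 1"] by simp
  qed simp
qed


section \<open>Products of whirls\<close>

text \<open>\<open>Sum_any\<close> is 0 when the support is infinite, so an entry of a product has
  its meaning only together with a finite set that carries the support.\<close>

lemma mat_mult_eq_sum:
  assumes "finite S" "\<And>k. A (r, k) * B (k, s) \<noteq> 0 \<Longrightarrow> k \<in> S"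
  shows "(A \<odot> B) (r, s) = (\<Sum>k\<in>S. A (r, k) * B (k, s))"
  using assms by (auto simp: mat_mult_def intro: Sum_any.expand_superset)

definition upper :: "(int \<times> int) pt \<Rightarrow> bool" where
  "upper Y \<longleftrightarrow> (\<forall>r s. s < r \<longrightarrow> Y (r, s) = 0)"

lemma mat_mult_upper:
  assumes "upper A" "upper B" "{r..s} \<subseteq> S" "finite S"
  shows "(A \<odot> B) (r, s) = (\<Sum>k\<in>S. A (r, k) * B (k, s))"
proof (rule mat_mult_eq_sum[OF assms(4)])
  fix k assume "A (r, k) * B (k, s) \<noteq> 0"
  then have "\<not> k < r" "\<not> s < k" using assms(1,2) by (auto simp: upper_def)
  then show "k \<in> S" using assms(3) by auto
qed

lemma upper_mat_mult:
  assumes "upper A" "upper B" shows "upper (A \<odot> B)"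
  unfolding upper_def by (auto simp: mat_mult_upper[OF assms order_refl])

text \<open>For upper triangular matrices every inner index lies between r and s, so the double sums
  are finite and may be exchanged.\<close>

lemma mat_mult_assoc:
  assumes "upper A" "upper B" "upper C"
  shows "A \<odot> B \<odot> C = A \<odot> (B \<odot> C)"
proof (rule ext)
  fix p :: "int \<times> int"
  obtain r s where p: "p = (r, s)" by fastforce
  have "(A \<odot> B \<odot> C) (r, s) = (\<Sum>k\<in>{r..s}. (A \<odot> B) (r, k) * C (k, s))"
    by (rule mat_mult_upper) (use assms upper_mat_mult in auto)
  also have "\<dots> = (\<Sum>k\<in>{r..s}. \<Sum>l\<in>{r..s}. A (r, l) * B (l, k) * C (k, s))"
    by (intro sum.cong refl, subst mat_mult_upper[of A B _ _ "{r..s}"])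
      (use assms in \<open>auto simp: sum_distrib_right\<close>)
  also have "\<dots> = (\<Sum>l\<in>{r..s}. \<Sum>k\<in>{r..s}. A (r, l) * B (l, k) * C (k, s))"
    by (rule sum.swap)
  also have "\<dots> = (\<Sum>l\<in>{r..s}. A (r, l) * (B \<odot> C) (l, s))"
    by (intro sum.cong refl, subst mat_mult_upper[of B C _ _ "{r..s}"])
      (use assms in \<open>auto simp: sum_distrib_left mult.assoc\<close>)
  also have "\<dots> = (A \<odot> (B \<odot> C)) (r, s)"
    by (rule mat_mult_upper[symmetric]) (use assms upper_mat_mult in auto)
  finally show "(A \<odot> B \<odot> C) p = (A \<odot> (B \<odot> C)) p" using p by simp
qed

lemma upper_u_mat: "upper (u_mat n k a)"
  by (auto simp: upper_def u_mat_def)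

lemma upper_whirl: "upper (whirl x)"
  by (auto simp: upper_def whirl_def)

lemma u_mat_mult_left:
  "(u_mat n k a \<odot> Y) (r, s) = Y (r, s) + (if int n dvd r - k then a * Y (r + 1, s) else 0)"
  by (subst mat_mult_eq_sum[of "{r, r + 1}"]) (auto simp: u_mat_def split: if_splits)

lemma u_mat_mult_right:
  "(Y \<odot> u_mat n k a) (r, s) = Y (r, s) + (if int n dvd s - 1 - k then a * Y (r, s - 1) else 0)"
  by (subst mat_mult_eq_sum[of "{s, s - 1}"]) (auto simp: u_mat_def split: if_splits)

lemma whirl_mult_right: "(Y \<odot> whirl x) (r, s) = Y (r, s) + Y (r, s - 1) * x (s - 1)"
  by (subst mat_mult_eq_sum[of "{s, s - 1}"]) (auto simp: whirl_def split: if_splits)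

lemma whirl_prod_Suc:
  "whirl_prod (Suc m) x (r, s) = whirl_prod m x (r, s) + whirl_prod m x (r, s - 1) * x (Suc m, s - 1)"
  by (simp add: whirl_mult_right block_def)

declare whirl_prod.simps(2) [simp del]

lemma whirl_prod_lower: "s < r \<Longrightarrow> whirl_prod m x (r, s) = 0"
  by (induction m arbitrary: s) (auto simp: whirl_prod_Suc)

lemma whirl_prod_diag [simp]: "whirl_prod m x (r, r) = 1"
  by (induction m) (auto simp: whirl_prod_Suc whirl_prod_lower)

lemma whirl_prod_above: "s - r > int m \<Longrightarrow> whirl_prod m x (r, s) = 0"
  by (induction m arbitrary: s) (auto simp: whirl_prod_Suc)

lemma upper_whirl_prod: "upper (whirl_prod m x)"
  by (simp add: upper_def whirl_prod_lower)

text \<open>This is \<open>points (X_crystal n m)\<close> for m at least 1. Coordinates outside the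
  blocks 1, ..., m are 0 by convention, so that equality of points is equality of functions.\<close>

definition torus :: "nat \<Rightarrow> nat \<Rightarrow> (nat \<times> int) pt set" where
  "torus n m = {x. \<forall>i r. if 1 \<le> i \<and> i \<le> m then x (i, r) \<noteq> 0 \<and> x (i, r + int n) = x (i, r) else x (i, r) = 0}"

lemma torus_nonzero: "x \<in> torus n m \<Longrightarrow> 1 \<le> i \<Longrightarrow> i \<le> m \<Longrightarrow> x (i, r) \<noteq> 0"
  by (simp add: torus_def)

lemma torus_zero: "x \<in> torus n m \<Longrightarrow> \<not> (1 \<le> i \<and> i \<le> m) \<Longrightarrow> x (i, r) = 0"
  unfolding torus_def by (auto split: if_splits)

lemma torus_periodic: "x \<in> torus n m \<Longrightarrow> x (i, r + int n) = x (i, r)"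
  unfolding torus_def by (auto split: if_splits) metis+

lemma torus_dvd: "x \<in> torus n m \<Longrightarrow> int n dvd r - s \<Longrightarrow> x (i, r) = x (i, s)"
  by (rule periodic_dvd[of "\<lambda>r. x (i, r)"]) (auto simp: torus_periodic)

lemma whirl_prod_periodic:
  assumes "x \<in> torus n m"
  shows "whirl_prod j x (r + int n, s + int n) = whirl_prod j x (r, s)"
proof (induction j arbitrary: s)
  case (Suc j)
  show ?case
    using Suc[of s] Suc[of "s - 1"] torus_periodic[OF assms, of "Suc j" "s - 1"]
    by (simp add: whirl_prod_Suc algebra_simps)
qed simp

lemma whirl_prod_U_le: "x \<in> torus n m \<Longrightarrow> whirl_prod m x \<in> U_le n m"
  by (simp add: U_le_def U_loop_def whirl_prod_periodic whirl_prod_lower whirl_prod_above)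

lemma whirl_prod_cong:
  assumes "\<And>i r. 1 \<le> i \<Longrightarrow> i \<le> m \<Longrightarrow> x (i, r) = y (i, r)"
  shows "whirl_prod m x = whirl_prod m y"
  using assms
proof (induction m)
  case (Suc m)
  then have "whirl_prod m x = whirl_prod m y" "block x (Suc m) = block y (Suc m)"
    by (auto simp: block_def)
  then show ?case by (simp add: whirl_prod.simps(2))
qed simp

lemma whirl_prod_corner: "whirl_prod j x (k, k + int j) = (\<Prod>i=1..j. x (i, k + int i - 1))"
proof (induction j)
  case (Suc j)
  have "whirl_prod (Suc j) x (k, k + int (Suc j)) = whirl_prod j x (k, k + int j) * x (Suc j, k + int j)"
    by (simp add: whirl_prod_Suc whirl_prod_above)
  then show ?case by (simp only: Suc) (simp add: algebra_simps)
qed simp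

lemma whirl_prod_corner_nonzero:
  "x \<in> torus n m \<Longrightarrow> j \<le> m \<Longrightarrow> whirl_prod j x (k, k + int j) \<noteq> 0"
  by (auto simp: whirl_prod_corner torus_nonzero)

lemma polyfun_whirl_prod: "(\<lambda>x. whirl_prod j x (r, s)) \<in> polyfun UNIV"
  by (induction j arbitrary: s) (auto simp: whirl_prod_Suc intro!: polyfun_intros)

lemma torus_variety:
  assumes "n > 0" shows "variety (torus n m)"
proof -
  define A where "A = {x. \<forall>f \<in> (\<lambda>(i, r) x. x (i, r + int n) - x (i, r)) ` UNIV \<union>
    (\<lambda>(i, r) x. x (i, r)) ` {(i, r). \<not> (1 \<le> i \<and> i \<le> m)}. f x = (0 :: complex)}"
  define h :: "(nat \<times> int) pt \<Rightarrow> complex" where "h = (\<lambda>x. \<Prod>i=1..m. \<Prod>r<n. x (i, int r))"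
  have A_iff: "x \<in> A \<longleftrightarrow> (\<forall>i r. x (i, r + int n) = x (i, r)) \<and> (\<forall>i r. \<not> (1 \<le> i \<and> i \<le> m) \<longrightarrow> x (i, r) = 0)" for x
    unfolding A_def mem_Collect_eq ball_Un ball_simps by (simp add: split_beta)
  have A: "closedin zariski A"
    unfolding A_def by (rule closedin_zariski_zeros) (auto intro!: polyfun_intros)
  have B: "openin zariski {x. h x \<noteq> 0}"
    unfolding openin_zariski_iff
    by (intro ballI bexI[of _ h] conjI) (auto simp: h_def intro!: polyfun_intros)
  have AP: "x (i, r) = x (i, r mod int n)" if "x \<in> A" for x i r
  proof -
    have "x (i, r + int n) = x (i, r)" for r using that by (simp add: A_iff)
    then show ?thesis by (rule periodic_mod[of "\<lambda>r. x (i, r)"])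
  qed
  have V: "torus n m = A \<inter> {x. h x \<noteq> 0}"
  proof
    show "torus n m \<subseteq> A \<inter> {x. h x \<noteq> 0}"
    proof
      fix x assume x: "x \<in> torus n m"
      have "h x \<noteq> 0" unfolding h_def using torus_nonzero[OF x] by simp
      moreover have "x \<in> A"
        unfolding A_iff using torus_periodic[OF x] torus_zero[OF x] by blast
      ultimately show "x \<in> A \<inter> {x. h x \<noteq> 0}" by simp
    qed
    show "A \<inter> {x. h x \<noteq> 0} \<subseteq> torus n m"
    proof
      fix x assume x: "x \<in> A \<inter> {x. h x \<noteq> 0}"
      have "x (i, r) \<noteq> 0" if "1 \<le> i" "i \<le> m" for i r
      proof -
        have "nat (r mod int n) \<in> {..<n}" "int (nat (r mod int n)) = r mod int n"
          using assms by (auto simp: nat_less_iff)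
        moreover have "\<forall>r<n. x (i, int r) \<noteq> 0" using x that by (auto simp: h_def)
        ultimately have "x (i, r mod int n) \<noteq> 0" by (metis lessThan_iff)
        then show ?thesis using AP x by (metis IntD1)
      qed
      moreover have "x (i, r) = 0" if "\<not> (1 \<le> i \<and> i \<le> m)" for i r
        using x that A_iff by blast
      moreover have "x (i, r + int n) = x (i, r)" for i r
        using AP[of x i "r + int n"] AP[of x i r] x by simp
      ultimately show "x \<in> torus n m" by (auto simp: torus_def)
    qed
  qed
  have one: "(\<lambda>(i, r). if 1 \<le> i \<and> i \<le> m then 1 else 0) \<in> torus n m"
    by (auto simp: torus_def)
  have irr: "irreducible_set (torus n m)"
  proof (rule irreducible_setI)
    show "torus n m \<noteq> {}" using one by blast
    fix x y assume x: "x \<in> torus n m" and y: "y \<in> torus n m"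
    \<comment> \<open>A point of the line through x and y stays in the torus as long as none of its
      finitely many independent coordinates vanishes; \<open>H\<close> is the product of these
      coordinates as a polynomial in t.\<close>
    define H where "H = (\<Prod>i=1..m. \<Prod>r<n. [:x (i, int r), y (i, int r) - x (i, int r):])"
    have "H \<noteq> 0" using x by (auto simp: H_def torus_nonzero)
    moreover have "(\<lambda>i. x i + t * (y i - x i)) \<in> torus n m" if "poly H t \<noteq> 0" for t
    proof -
      have "(\<lambda>i. x i + t * (y i - x i)) \<in> A"
        unfolding A_iff using torus_periodic[OF x] torus_zero[OF x] torus_periodic[OF y] torus_zero[OF y]
        by simp
      moreover have "h (\<lambda>i. x i + t * (y i - x i)) = poly H t"
        by (simp add: h_def H_def poly_prod algebra_simps)
      ultimately show ?thesis using V that by auto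
    qed
    ultimately show "\<exists>H. H \<noteq> 0 \<and> (\<forall>t. poly H t \<noteq> 0 \<longrightarrow> (\<lambda>i. x i + t * (y i - x i)) \<in> torus n m)"
      by blast
  qed
  have fin: "\<exists>J. finite J \<and> (\<forall>p. \<exists>f\<in>polyfun J. \<forall>x\<in>torus n m. x p = f x)"
  proof (intro exI[of _ "{1..m} \<times> {0..<int n}"] conjI allI)
    fix p :: "nat \<times> int"
    obtain i r where p: "p = (i, r)" by fastforce
    show "\<exists>f\<in>polyfun ({1..m} \<times> {0..<int n}). \<forall>x\<in>torus n m. x p = f x"
    proof (cases "1 \<le> i \<and> i \<le> m")
      case True
      have "(\<lambda>x. x (i, r mod int n)) \<in> polyfun ({1..m} \<times> {0..<int n})"
        using True assms by (intro polyfun.coord) auto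
      moreover have "x p = x (i, r mod int n)" if "x \<in> torus n m" for x
        using that V AP[of x i r] p by simp
      ultimately show ?thesis by (intro bexI[of _ "\<lambda>x. x (i, r mod int n)"]) auto
    next
      case False
      then show ?thesis using p by (intro bexI[OF _ polyfun.const[of 0]]) (auto simp: torus_zero)
    qed
  qed simp
  show ?thesis
    unfolding variety_def
  proof (intro conjI)
    show "\<exists>A B. closedin zariski A \<and> openin zariski B \<and> torus n m = A \<inter> B" using A B V by blast
    show "\<forall>S T. openin (zariski_on (torus n m)) S \<and> openin (zariski_on (torus n m)) T \<and>
      S \<noteq> {} \<and> T \<noteq> {} \<longrightarrow> S \<inter> T \<noteq> {}"
      using irreducible_set_inter[OF irr] by blast
    show "torus n m \<noteq> {}" using one by blast
  qed (rule fin)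
qed


section \<open>Factorizations into whirls\<close>

definition norm_prod :: "nat \<Rightarrow> (nat \<times> int) pt \<Rightarrow> nat \<Rightarrow> complex" where
  "norm_prod n x i = (\<Prod>l<n. x (i, int l))"

lemma norm_prod_window:
  assumes "x \<in> torus n m" "1 \<le> i" "i \<le> m"
  shows "(\<Prod>l<n. x (i, r + int l)) = norm_prod n x i"
  unfolding norm_prod_def
  by (rule periodic_window[of "\<lambda>r. x (i, r)"]) (use assms torus_periodic torus_nonzero in auto)

lemma norm_prod_nonzero: "x \<in> torus n m \<Longrightarrow> 1 \<le> i \<Longrightarrow> i \<le> m \<Longrightarrow> norm_prod n x i \<noteq> 0"
  by (auto simp: norm_prod_def torus_nonzero)

lemma polyfun_norm_prod: "(\<lambda>x. norm_prod n x i) \<in> polyfun UNIV"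
  unfolding norm_prod_def by (intro polyfun_intros)

declare whirl_prod.simps(1) [simp del]

definition mat_vec :: "(int \<times> int) pt \<Rightarrow> (int \<Rightarrow> complex) \<Rightarrow> int \<Rightarrow> complex" where
  "mat_vec Y v r = Sum_any (\<lambda>s. Y (r, s) * v s)"

lemma mat_vec_sum:
  assumes "finite S" "\<And>s. Y (r, s) \<noteq> 0 \<Longrightarrow> s \<in> S"
  shows "mat_vec Y v r = (\<Sum>s\<in>S. Y (r, s) * v s)"
  unfolding mat_vec_def using assms by (intro Sum_any.expand_superset) auto

lemma mat_vec_whirl_prod:
  "mat_vec (whirl_prod m x) v r = (\<Sum>s\<in>{r..r + int m}. whirl_prod m x (r, s) * v s)"
proof (rule mat_vec_sum)
  fix s assume "whirl_prod m x (r, s) \<noteq> 0"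
  then show "s \<in> {r..r + int m}"
    using whirl_prod_lower[of s r m x] whirl_prod_above[of m s r x] by force
qed simp

lemma mat_vec_whirl_prod_0 [simp]: "mat_vec (whirl_prod 0 x) v = v"
  by (rule ext, unfold mat_vec_whirl_prod) (simp add: whirl_prod.simps(1))

lemma mat_vec_whirl_prod_Suc:
  "mat_vec (whirl_prod (Suc m) x) v = mat_vec (whirl_prod m x) (\<lambda>s. v s + x (Suc m, s) * v (s + 1))"
proof
  fix r
  have s: "{r..r + int (Suc m)} = insert (r + int m + 1) {r..r + int m}" by auto
  have s': "{r..r + int (Suc m)} = insert r {r + 1..r + 1 + int m}" by auto
  have "mat_vec (whirl_prod (Suc m) x) v r =
    (\<Sum>s\<in>{r..r + int (Suc m)}. whirl_prod m x (r, s) * v s) +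
    (\<Sum>s\<in>{r..r + int (Suc m)}. whirl_prod m x (r, s - 1) * x (Suc m, s - 1) * v s)"
    by (simp only: mat_vec_whirl_prod whirl_prod_Suc sum.distrib[symmetric] distrib_right)
  also have "(\<Sum>s\<in>{r..r + int (Suc m)}. whirl_prod m x (r, s) * v s) =
    (\<Sum>s\<in>{r..r + int m}. whirl_prod m x (r, s) * v s)"
    unfolding s by (subst sum.insert) (auto simp: whirl_prod_above)
  also have "(\<Sum>s\<in>{r..r + int (Suc m)}. whirl_prod m x (r, s - 1) * x (Suc m, s - 1) * v s) =
    (\<Sum>s\<in>{r..r + int m}. whirl_prod m x (r, s) * x (Suc m, s) * v (s + 1))"
    unfolding s' by (subst sum.insert)
      (auto simp: whirl_prod_lower intro!: sum.reindex_bij_witness[of _ "\<lambda>s. s + 1" "\<lambda>s. s - 1"])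
  finally show "mat_vec (whirl_prod (Suc m) x) v r =
    mat_vec (whirl_prod m x) (\<lambda>s. v s + x (Suc m, s) * v (s + 1)) r"
    by (simp add: mat_vec_whirl_prod sum.distrib[symmetric] algebra_simps)
qed

text \<open>For n-periodic a and l = n this ties \<open>u r\<close> to \<open>u (r + n)\<close> by
  (-1)^n times the product of a over a period. A kernel vector of a whirl thus has its multiplier
  prescribed by \<open>norm_prod\<close>.\<close>

lemma whirl_kernel:
  fixes a u :: "int \<Rightarrow> complex"
  assumes "\<And>r. u r + a r * u (r + 1) = 0"
  shows "u r = (-1) ^ l * (\<Prod>i<l. a (r + int i)) * u (r + int l)"
proof (induction l)
  case (Suc l)
  have "u (r + int l) = - a (r + int l) * u (r + int l + 1)"
    using assms[of "r + int l"] by (simp add: add_eq_0_iff)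
  then show ?case using Suc by (simp add: algebra_simps)
qed simp

text \<open>The last factor sends u to a vector with the same multiplier, which vanishes by
  induction; u is then a kernel vector of a single whirl, whose multiplier is excluded by
  hypothesis.\<close>

lemma whirl_prod_injective:
  assumes x: "x \<in> torus n m" and "j \<le> m"
    and "\<And>i. 1 \<le> i \<Longrightarrow> i \<le> j \<Longrightarrow> (-1) ^ n * norm_prod n x i * z \<noteq> 1"
    and "\<And>r. u (r + int n) = z * u r" and "\<And>r. mat_vec (whirl_prod j x) u r = 0"
  shows "u r = 0"
  using assms(2-)
proof (induction j arbitrary: u r)
  case 0
  then show ?case by simp
next
  case (Suc j)
  have "u s + x (Suc j, s) * u (s + 1) = 0" for s
  proof (rule Suc.IH[where u = "\<lambda>s. u s + x (Suc j, s) * u (s + 1)"])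
    fix r
    show "u (r + int n) + x (Suc j, r + int n) * u (r + int n + 1) = z * (u r + x (Suc j, r) * u (r + 1))"
      using Suc.prems(3)[of r] Suc.prems(3)[of "r + 1"] torus_periodic[OF x]
      by (simp add: algebra_simps)
    show "mat_vec (whirl_prod j x) (\<lambda>s. u s + x (Suc j, s) * u (s + 1)) r = 0"
      using Suc.prems(4) by (simp add: mat_vec_whirl_prod_Suc)
  qed (use Suc.prems in auto)
  then have k: "u s + x (Suc j, s) * u (s + 1) = 0" for s by simp
  have "u r = (-1) ^ n * norm_prod n x (Suc j) * z * u r"
    using whirl_kernel[of u "\<lambda>r. x (Suc j, r)", OF k, of r n]
      norm_prod_window[OF x, of "Suc j" r] Suc.prems(1,3) by (simp add: mult.assoc)
  then show ?case using Suc.prems(2)[of "Suc j"] by (metis mult_cancel_right1 le_refl le_add1 plus_1_eq_Suc)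
qed

lemma ex_whirl_kernel:
  fixes a :: "int \<Rightarrow> complex"
  assumes "\<And>r. a r \<noteq> 0"
  shows "\<exists>v. v 0 = 1 \<and> (\<forall>r. v r \<noteq> 0) \<and> (\<forall>r. v r + a r * v (r + 1) = 0)"
proof -
  \<comment> \<open>The recursion \<open>v r = - a r * v (r + 1)\<close> solved in both directions
    from v 0 = 1.\<close>
  define v where "v r = (if r \<ge> 0 then \<Prod>l<nat r. - 1 / a (int l) else \<Prod>l<nat (- r). - a (- 1 - int l))" for r
  have "v r + a r * v (r + 1) = 0" for r
  proof (cases "r \<ge> 0")
    case True
    then have "nat (r + 1) = Suc (nat r)" by simp
    then show ?thesis using True assms by (simp add: v_def)
  next
    case False
    define k where "k = nat (- r - 1)"
    have k: "r = - 1 - int k" "nat (- r) = Suc k" "nat (- (r + 1)) = k" using False by (auto simp: k_def)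
    \<comment> \<open>For k = 0 the argument r + 1 is 0 and falls under the first branch of
      \<open>v\<close>; both branches give the empty product there.\<close>
    have "v (r + 1) = (\<Prod>l<k. - a (- 1 - int l))"
      unfolding v_def k(3) by (cases k) (use k(1) in auto)
    moreover have "v r = - a r * (\<Prod>l<k. - a (- 1 - int l))"
      using False k by (simp add: v_def)
    ultimately show ?thesis by simp
  qed
  moreover have "v r \<noteq> 0" for r using assms by (auto simp: v_def)
  ultimately show ?thesis by (intro exI[of _ v]) (auto simp: v_def)
qed

text \<open>
  A product of whirls acts on the vectors \<open>v\<close> with \<open>v (r + n) = z * v r\<close>, with determinant
  \<open>\<Prod>i. 1 - (-1)^n * z * norm_prod n x i\<close>; if the factors of the determinant have distinct roots, the
  last factor of the product can be read off the kernel at its root.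
\<close>

lemma whirl_factorization_unique:
  assumes "x \<in> torus n m" "y \<in> torus n m" "n > 0"
    and "\<And>i. 1 \<le> i \<Longrightarrow> i \<le> m \<Longrightarrow> norm_prod n x i = norm_prod n y i"
    and "inj_on (norm_prod n x) {1..m}"
    and "whirl_prod m x = whirl_prod m y"
  shows "x = y"
proof -
  have "j \<le> m \<Longrightarrow> whirl_prod j x = whirl_prod j y \<Longrightarrow>
    1 \<le> i \<Longrightarrow> i \<le> j \<Longrightarrow> x (i, r) = y (i, r)" for i j r
  proof (induction j arbitrary: i r)
    case (Suc j)
    obtain v where v: "\<And>r. v r \<noteq> 0" "\<And>r. v r + x (Suc j, r) * v (r + 1) = 0"
      using ex_whirl_kernel[of "\<lambda>r. x (Suc j, r)"] torus_nonzero[OF assms(1)] Suc.prems(1) by auto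
    define q where "q = norm_prod n x (Suc j)"
    have q: "q \<noteq> 0" using norm_prod_nonzero[OF assms(1)] Suc.prems(1) by (simp add: q_def)
    have qp: "v (r + int n) = (-1) ^ n / q * v r" for r
    proof -
      have "v r = (-1) ^ n * q * v (r + int n)"
        using whirl_kernel[of v "\<lambda>r. x (Suc j, r)", OF v(2), of r n]
          norm_prod_window[OF assms(1), of "Suc j" r] Suc.prems(1) by (simp add: q_def)
      then show ?thesis using q by (simp add: field_simps)
    qed
    \<comment> \<open>\<open>v\<close> is killed by the last whirl of x, hence by the common
      product. Its image under the last whirl of y still has multiplier (-1)^n / q and is killed by
      the first j whirls of y, whose \<open>norm_prod\<close> differ from q; so this image vanishes
      and \<open>v\<close> is in the kernel of both last whirls.\<close>
    have "v s + y (Suc j, s) * v (s + 1) = 0" for s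
    proof (rule whirl_prod_injective[OF assms(2), where u = "\<lambda>s. v s + y (Suc j, s) * v (s + 1)"])
      show "j \<le> m" using Suc by simp
      show "(-1) ^ n * norm_prod n y i * ((-1) ^ n / q) \<noteq> 1" if "1 \<le> i" "i \<le> j" for i
      proof -
        have "norm_prod n y i \<noteq> q"
          using assms(4)[of i] inj_onD[OF assms(5), of i "Suc j"] that Suc.prems(1) by (auto simp: q_def)
        moreover have "(-1) ^ n * norm_prod n y i * ((-1) ^ n / q) = norm_prod n y i / q"
          by (simp add: field_simps flip: power_add)
        ultimately show ?thesis using q by (metis divide_eq_1_iff)
      qed
      show "v (r + int n) + y (Suc j, r + int n) * v (r + int n + 1) =
        (- 1) ^ n / q * (v r + y (Suc j, r) * v (r + 1))" for r
        using qp[of r] qp[of "r + 1"] torus_periodic[OF assms(2)] by (simp add: algebra_simps)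
      have "mat_vec (whirl_prod (Suc j) x) v r = 0" for r
        unfolding mat_vec_whirl_prod_Suc v(2) by (simp add: mat_vec_whirl_prod)
      then show "mat_vec (whirl_prod j y) (\<lambda>s. v s + y (Suc j, s) * v (s + 1)) r = 0" for r
        using Suc.prems(2) by (simp add: mat_vec_whirl_prod_Suc)
    qed
    then have last: "x (Suc j, s) = y (Suc j, s)" for s
      using v(1)[of "s + 1"] v(2)[of s] by (metis add_left_imp_eq mult_right_cancel)
    \<comment> \<open>The common last factor has 1 on the diagonal and is cancelled entry by entry
      along a row, starting from the diagonal.\<close>
    have "whirl_prod j x (r, s) = whirl_prod j y (r, s)" for r s
    proof (cases "s < r")
      case False
      then have "r \<le> s" by simp
      then show ?thesis
      proof (induction s rule: int_ge_induct)
        case (step s)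
        have "whirl_prod (Suc j) x (r, s + 1) = whirl_prod (Suc j) y (r, s + 1)" using Suc.prems(2) by simp
        then show ?case using step last by (simp add: whirl_prod_Suc)
      qed simp
    qed (simp add: whirl_prod_lower)
    then have "whirl_prod j x = whirl_prod j y" by auto
    then show ?case using Suc last by (cases "i = Suc j") auto
  qed simp
  then have "x (i, r) = y (i, r)" for i r
    using assms(6) torus_zero[OF assms(1)] torus_zero[OF assms(2)] by (cases "1 \<le> i \<and> i \<le> m") auto
  then show ?thesis by auto
qed

section \<open>The crystal of unipotent loops\<close>

lemma closure_of_open_irreducible:
  assumes "irreducible_set V" "openin (zariski_on V) S" "S \<noteq> {}"
  shows "Abstract_Topology.closure_of (zariski_on V) S = V"
proof -
  have "S \<subseteq> V" using assms(2) by (simp add: openin_zariski_on_iff)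
  moreover have "\<exists>y. y \<in> S \<and> y \<in> T" if "openin (zariski_on V) T" "x \<in> T" for x T
    using irreducible_set_inter[OF assms(1,2) that(1) assms(3)] that(2) by blast
  ultimately show ?thesis unfolding Abstract_Topology.closure_of_def by simp blast
qed

section \<open>The affine space of banded unipotent loops\<close>

lemma U_le_periodic: "Y \<in> U_le n m \<Longrightarrow> Y (r + int n, s + int n) = Y (r, s)"
  by (simp add: U_le_def U_loop_def)

lemma U_le_lower: "Y \<in> U_le n m \<Longrightarrow> s < r \<Longrightarrow> Y (r, s) = 0"
  by (simp add: U_le_def U_loop_def)

lemma U_le_diag: "Y \<in> U_le n m \<Longrightarrow> Y (r, r) = 1"
  by (simp add: U_le_def U_loop_def)

lemma U_le_above: "Y \<in> U_le n m \<Longrightarrow> s - r > int m \<Longrightarrow> Y (r, s) = 0"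
  by (simp add: U_le_def)

lemma U_le_upper: "Y \<in> U_le n m \<Longrightarrow> upper Y"
  by (simp add: upper_def U_le_lower)

lemma U_le_dvd:
  assumes "Y \<in> U_le n m" "int n dvd r - r'"
  shows "Y (r + a, r + b) = Y (r' + a, r' + b)"
proof (rule periodic_dvd[of "\<lambda>r. Y (r + a, r + b)"])
  fix r show "Y (r + int n + a, r + int n + b) = Y (r + a, r + b)"
    using U_le_periodic[OF assms(1), of "r + a" "r + b"] by (simp add: algebra_simps)
qed fact

lemma U_le_variety:
  assumes "n > 0" shows "variety (U_le n m)"
proof -
  define F :: "((int \<times> int) pt \<Rightarrow> complex) set" where
    "F = (\<lambda>(r, s) Y. Y (r + int n, s + int n) - Y (r, s)) ` UNIV \<union> (\<lambda>r Y. Y (r, r) - 1) ` UNIV \<union>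
      (\<lambda>(r, s) Y. Y (r, s)) ` {(r, s). s < r \<or> s - r > int m}"
  have V: "U_le n m = {Y. \<forall>f\<in>F. f Y = 0} \<inter> UNIV"
    unfolding F_def U_le_def U_loop_def ball_Un ball_simps by auto
  have A: "closedin zariski {Y. \<forall>f\<in>F. f Y = 0}"
    by (rule closedin_zariski_zeros) (auto simp: F_def intro!: polyfun_intros)
  have B: "openin zariski UNIV" using openin_topspace[of zariski] by simp
  have one: "(\<lambda>(r, s). if s = r then 1 else 0) \<in> U_le n m"
    by (auto simp: U_le_def U_loop_def)
  have irr: "irreducible_set (U_le n m)"
  proof (rule irreducible_setI)
    show "U_le n m \<noteq> {}" using one by blast
    fix x y assume "x \<in> U_le n m" "y \<in> U_le n m"
    then have "(\<lambda>i. x i + t * (y i - x i)) \<in> U_le n m" for t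
      by (simp add: U_le_def U_loop_def)
    then show "\<exists>H. H \<noteq> 0 \<and> (\<forall>t. poly H t \<noteq> 0 \<longrightarrow> (\<lambda>i. x i + t * (y i - x i)) \<in> U_le n m)"
      by (intro exI[of _ 1]) auto
  qed
  have fin: "\<exists>J. finite J \<and> (\<forall>p. \<exists>f\<in>polyfun J. \<forall>Y\<in>U_le n m. Y p = f Y)"
  proof (intro exI[of _ "{0..<int n} \<times> {0..int n + int m}"] conjI allI)
    fix p :: "int \<times> int"
    obtain r s where p: "p = (r, s)" by fastforce
    let ?J = "{0..<int n} \<times> {0..int n + int m}"
    show "\<exists>f\<in>polyfun ?J. \<forall>Y\<in>U_le n m. Y p = f Y"
    proof (cases "s < r \<or> s - r > int m")
      case True
      then show ?thesis using p
        by (intro bexI[OF _ polyfun.const[of 0]]) (auto simp: U_le_lower U_le_above)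
    next
      case False
      let ?q = "(r mod int n, r mod int n + (s - r))"
      have "0 \<le> r mod int n" "r mod int n < int n" using assms by auto
      then have "(\<lambda>Y. Y ?q) \<in> polyfun ?J" using False by (intro polyfun.coord) auto
      moreover have "Y p = Y ?q" if "Y \<in> U_le n m" for Y
        using U_le_dvd[OF that, of r "r mod int n" 0 "s - r"] p by (simp add: minus_mod_eq_mult_div)
      ultimately show ?thesis by (intro bexI[of _ "\<lambda>Y. Y ?q"]) auto
    qed
  qed simp
  show ?thesis
    unfolding variety_def
  proof (intro conjI)
    show "\<exists>A B. closedin zariski A \<and> openin zariski B \<and> U_le n m = A \<inter> B" using A B V by blast
    show "\<forall>S T. openin (zariski_on (U_le n m)) S \<and> openin (zariski_on (U_le n m)) T \<and>
      S \<noteq> {} \<and> T \<noteq> {} \<longrightarrow> S \<inter> T \<noteq> {}"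
      using irreducible_set_inter[OF irr] by blast
    show "U_le n m \<noteq> {}" using one by blast
  qed (rule fin)
qed

definition one_pt :: "nat \<Rightarrow> (nat \<times> int) pt" where
  "one_pt m = (\<lambda>(i, r). if 1 \<le> i \<and> i \<le> m then 1 else 0)"

lemma one_pt_torus: "one_pt m \<in> torus n m"
  by (auto simp: one_pt_def torus_def)

text \<open>With all coordinates 1 the entry recursion is Pascal's rule: the product is the j-th
  power of 1 plus the shift.\<close>

lemma whirl_prod_one_pt: "j \<le> m \<Longrightarrow> whirl_prod j (one_pt m) (r, r + int d) = of_nat (j choose d)"
proof (induction j arbitrary: d)
  case 0
  then show ?case by (cases d) (auto simp: whirl_prod.simps(1))
next
  case (Suc j)
  show ?case
  proof (cases d)
    case 0
    then show ?thesis by simp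
  next
    case d: (Suc d')
    have e: "r + int (Suc d') - 1 = r + int d'" by simp
    have o: "one_pt m (Suc j, s) = 1" for s using Suc.prems by (simp add: one_pt_def)
    have "j \<le> m" using Suc.prems by simp
    then show ?thesis unfolding d whirl_prod_Suc e o using Suc.IH[of "Suc d'"] Suc.IH[of d'] by simp
  qed
qed

text \<open>A common witness for all denominators: the all-ones product has entries m at distance m
  - 1 from the diagonal and 1 at distance m.\<close>

lemma U_generic_point:
  assumes "m \<ge> 1"
  shows "\<exists>Y\<in>U_le n m. \<forall>k. Y (k + 1, k + int m) \<noteq> 0 \<and> Y (k, k + int m) \<noteq> 0"
proof (intro bexI allI conjI)
  show "whirl_prod m (one_pt m) \<in> U_le n m" by (rule whirl_prod_U_le[OF one_pt_torus])
  fix k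
  have "k + 1 + int (m - 1) = k + int m" using assms by simp
  then have "whirl_prod m (one_pt m) (k + 1, k + int m) = of_nat (m choose (m - 1))"
    using whirl_prod_one_pt[OF order_refl, of m "k + 1" "m - 1"] by (simp only:)
  also have "m choose (m - 1) = m" using assms binomial_symmetric[of "m - 1" m] by simp
  finally show "whirl_prod m (one_pt m) (k + 1, k + int m) \<noteq> 0" using assms by simp
  show "whirl_prod m (one_pt m) (k, k + int m) \<noteq> 0" by (rule whirl_prod_corner_nonzero[OF one_pt_torus]) simp
qed

text \<open>The operator as a total function, so that composites can be treated by matrix algebra;
  outside the domain of \<open>act\<close> the division by 0 gives a value without meaning.\<close>

definition U_act :: "nat \<Rightarrow> nat \<Rightarrow> int \<Rightarrow> complex \<Rightarrow> (int \<times> int) pt \<Rightarrow> (int \<times> int) pt" where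
  "U_act n m k c Y = u_mat n k ((c - 1) * (Y (k, k + int m) / Y (k + 1, k + int m))) \<odot> Y \<odot>
     u_mat n (k + int m) ((inverse c - 1) * (Y (k + 1, k + int m + 1) / Y (k + 1, k + int m)))"

lemma U_crystal_points [simp]: "points (U_crystal n m) = U_le n m"
  by (simp add: U_crystal_def Let_def)

lemma U_crystal_eps: "eps (U_crystal n m) k Y =
  (if Y \<in> U_le n m \<and> Y (k + 1, k + int m) \<noteq> 0 then Some (Y (k + 1, k + int m + 1) / Y (k + 1, k + int m)) else None)"
  by (simp add: U_crystal_def pdiv_def restrict_map_def Let_def)

lemma U_crystal_phi: "phi (U_crystal n m) k Y =
  (if Y \<in> U_le n m \<and> Y (k + 1, k + int m) \<noteq> 0 then Some (Y (k, k + int m) / Y (k + 1, k + int m)) else None)"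
  by (simp add: U_crystal_def pdiv_def restrict_map_def Let_def)

lemma U_crystal_act: "act (U_crystal n m) k c Y =
  (if c \<noteq> 0 \<and> Y \<in> U_le n m \<and> Y (k + 1, k + int m) \<noteq> 0 then Some (U_act n m k c Y) else None)"
  by (simp add: U_crystal_def pdiv_def restrict_map_def Let_def U_act_def)

lemma U_crystal_gam: "gam (U_crystal n m) k Y =
  (if Y \<in> U_le n m \<and> Y (k + 1, k + int m) \<noteq> 0 \<and> Y (k + 1, k + int m + 1) \<noteq> 0
   then Some (Y (k, k + int m) / Y (k + 1, k + int m + 1)) else None)"
  by (simp add: gam_def pdiv_def U_crystal_eps U_crystal_phi)

section \<open>The effect of the operators on matrix entries\<close>

lemma dvd_diff_cong: "int n dvd a - b \<Longrightarrow> int n dvd a - c \<longleftrightarrow> int n dvd b - c"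
  using dvd_add_right_iff[of "int n" "a - b" "b - c"] by simp

lemma not_dvd_shift: "n > 1 \<Longrightarrow> int n dvd a \<Longrightarrow> \<not> int n dvd a + 1"
  "n > 1 \<Longrightarrow> int n dvd a \<Longrightarrow> \<not> int n dvd a - 1"
  by (auto simp: dvd_add_right_iff dvd_diff_right_iff zdvd1_eq)

lemma U_act_entry:
  "U_act n m k c Y (r, s) =
     Y (r, s) + (if int n dvd r - k then (c - 1) * (Y (k, k + int m) / Y (k + 1, k + int m)) * Y (r + 1, s) else 0) +
     (if int n dvd s - 1 - (k + int m) then (inverse c - 1) * (Y (k + 1, k + int m + 1) / Y (k + 1, k + int m)) *
       (Y (r, s - 1) + (if int n dvd r - k then
          (c - 1) * (Y (k, k + int m) / Y (k + 1, k + int m)) * Y (r + 1, s - 1) else 0)) else 0)"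
  unfolding U_act_def u_mat_mult_left u_mat_mult_right by simp

text \<open>The two unipotent factors could widen the band to distance m + 2. Their parameters are
  tuned so that the entries at distance m + 1 cancel, and distance m + 2 stays empty because k and k
  + 1 are different residues for n > 1.\<close>

lemma U_act_U_le:
  assumes "n > 1" "c \<noteq> 0" "Y \<in> U_le n m" "Y (k + 1, k + int m) \<noteq> 0"
  shows "U_act n m k c Y \<in> U_le n m"
proof -
  have "U_act n m k c Y (r + int n, s + int n) = U_act n m k c Y (r, s)" for r s
  proof -
    have "int n dvd r + int n - k \<longleftrightarrow> int n dvd r - k"
      "int n dvd s + int n - 1 - (k + int m) \<longleftrightarrow> int n dvd s - 1 - (k + int m)"
      by (auto intro!: dvd_diff_cong)
    moreover have "Y (r + int n, s + int n) = Y (r, s)" "Y (r + int n + 1, s + int n) = Y (r + 1, s)"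
      "Y (r + int n, s + int n - 1) = Y (r, s - 1)" "Y (r + int n + 1, s + int n - 1) = Y (r + 1, s - 1)"
      using U_le_periodic[OF assms(3), of r s] U_le_periodic[OF assms(3), of "r + 1" s]
        U_le_periodic[OF assms(3), of r "s - 1"] U_le_periodic[OF assms(3), of "r + 1" "s - 1"]
      by (simp_all add: algebra_simps)
    ultimately show ?thesis unfolding U_act_entry by simp
  qed
  moreover have "U_act n m k c Y (r, r) = 1" for r
    unfolding U_act_entry by (simp add: U_le_lower[OF assms(3)] U_le_diag[OF assms(3)])
  moreover have "U_act n m k c Y (r, s) = 0" if "s < r" for r s
    unfolding U_act_entry using that by (simp add: U_le_lower[OF assms(3)])
  moreover have "U_act n m k c Y (r, s) = 0" if "s - r > int m" for r s
  proof -
    have 0: "Y (r, s) = 0" using U_le_above[OF assms(3)] that by simp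
    have "s = r + int m + 1 \<or> s = r + int m + 2 \<or> s - r > int m + 2" using that by arith
    then consider "s = r + int m + 1" | "s = r + int m + 2" | "s - r > int m + 2" by blast
    then show ?thesis
    proof cases
      case 1
      then have e: "int n dvd s - 1 - (k + int m) \<longleftrightarrow> int n dvd r - k" by simp
      show ?thesis
      proof (cases "int n dvd r - k")
        case True
        have "Y (r + 1, s) = Y (k + 1, k + int m + 1)" "Y (r, s - 1) = Y (k, k + int m)"
          "Y (r + 1, s - 1) = Y (k + 1, k + int m)"
          using U_le_dvd[OF assms(3) True, of 1 "int m + 1"] U_le_dvd[OF assms(3) True, of 0 "int m"]
            U_le_dvd[OF assms(3) True, of 1 "int m"] 1 by (simp_all add: algebra_simps)
        \<comment> \<open>With t, d, w for the entries at (k, k+m), (k+1, k+m), (k+1, k+m+1), this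
          is (c - 1) t w / d + (1/c - 1) (w / d) c t = 0.\<close>
        then show ?thesis unfolding U_act_entry e using True 0 assms(2,4) by (simp add: field_simps)
      next
        case False
        then show ?thesis unfolding U_act_entry e using 0 by simp
      qed
    next
      case 2
      then have e: "s - 1 - (k + int m) = (r - k) + 1" by simp
      have "\<not> (int n dvd r - k \<and> int n dvd (r - k) + 1)"
        using not_dvd_shift(1)[OF assms(1), of "r - k"] by auto
      then show ?thesis unfolding U_act_entry e using 0 2 U_le_above[OF assms(3)] by auto
    next
      case 3
      then show ?thesis unfolding U_act_entry using 0 U_le_above[OF assms(3)] by simp
    qed
  qed
  ultimately show ?thesis by (simp add: U_le_def U_loop_def)
qed

text \<open>Source of the scaling axioms: \<gamma> at j is the quotient of the corner entries at j
  and j + 1, and \<epsilon> at k is the corner entry at k + 1 over an entry that the operator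
  fixes.\<close>

lemma U_act_corner:
  assumes "n > 1" "c \<noteq> 0" "Y \<in> U_le n m" "Y (k + 1, k + int m) \<noteq> 0"
  shows "U_act n m k c Y (j, j + int m) =
    (if int n dvd j - k then c else 1) * (if int n dvd j - k - 1 then inverse c else 1) * Y (j, j + int m)"
proof -
  have e: "j + int m - 1 - (k + int m) = j - k - 1" by simp
  have 0: "Y (j, j + int m) = Y (k + (j - k), k + (j - k) + int m)" by simp
  consider (1) "int n dvd j - k" "\<not> int n dvd j - k - 1" | (2) "\<not> int n dvd j - k" "int n dvd j - k - 1"
    | (3) "\<not> int n dvd j - k" "\<not> int n dvd j - k - 1"
    using not_dvd_shift(2)[OF assms(1), of "j - k"] by blast
  then show ?thesis
  proof cases
    case 1
    have "Y (j + 1, j + int m) = Y (k + 1, k + int m)" "Y (j, j + int m) = Y (k, k + int m)"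
      using U_le_dvd[OF assms(3) 1(1), of 1 "int m"] U_le_dvd[OF assms(3) 1(1), of 0 "int m"] by simp_all
    then show ?thesis unfolding U_act_entry e using 1 assms by (simp add: field_simps)
  next
    case 2
    then have d: "int n dvd j - (k + 1)" by (simp add: algebra_simps)
    have "Y (j, j + int m - 1) = Y (k + 1, k + int m)" "Y (j, j + int m) = Y (k + 1, k + int m + 1)"
      using U_le_dvd[OF assms(3) d, of 0 "int m - 1"] U_le_dvd[OF assms(3) d, of 0 "int m"]
      by (simp_all add: algebra_simps)
    then show ?thesis unfolding U_act_entry e using 2 assms by (simp add: field_simps)
  next
    case 3
    then show ?thesis unfolding U_act_entry e by simp
  qed
qed

lemma U_act_sub:
  "U_act n m k c Y (j + 1, j + int m) = Y (j + 1, j + int m) +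
     (if int n dvd j + 1 - k then (c - 1) * (Y (k, k + int m) / Y (k + 1, k + int m)) * Y (j + 2, j + int m) else 0) +
     (if int n dvd j - 1 - k then (inverse c - 1) * (Y (k + 1, k + int m + 1) / Y (k + 1, k + int m)) *
       (Y (j + 1, j + int m - 1) + (if int n dvd j + 1 - k then
          (c - 1) * (Y (k, k + int m) / Y (k + 1, k + int m)) * Y (j + 2, j + int m - 1) else 0)) else 0)"
proof -
  have "j + int m - 1 - (k + int m) = j - 1 - k" "j + 1 + 1 = j + 2" by simp_all
  then show ?thesis unfolding U_act_entry by (simp only:)
qed

lemma U_act_sub_self:
  assumes "n > 1" shows "U_act n m k c Y (k + 1, k + int m) = Y (k + 1, k + int m)"
  unfolding U_act_sub using not_dvd_shift[OF assms, of 0] by simp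

section \<open>Relations between the unipotent generators\<close>

lemma u_mat_mult_entry:
  "(u_mat n i a \<odot> u_mat n j b) (r, s) = u_mat n i a (r, s) +
     (if int n dvd s - 1 - j then b * u_mat n i a (r, s - 1) else 0)"
  by (rule u_mat_mult_right)

lemma u_mat_add:
  assumes "n > 1" shows "u_mat n k a \<odot> u_mat n k b = u_mat n k (a + b)"
proof (rule ext)
  fix p :: "int \<times> int"
  obtain r s where p: "p = (r, s)" by fastforce
  have "int n dvd r - k \<Longrightarrow> \<not> int n dvd 1 + r - k"
    using not_dvd_shift(1)[OF assms, of "r - k"] by (simp add: algebra_simps)
  then show "(u_mat n k a \<odot> u_mat n k b) p = u_mat n k (a + b) p"
    unfolding p u_mat_mult_entry by (auto simp: u_mat_def)
qed

lemma u_mat_commute: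
  assumes "\<not> int n dvd i - j - 1" "\<not> int n dvd i - j + 1"
  shows "u_mat n i a \<odot> u_mat n j b = u_mat n j b \<odot> u_mat n i a"
proof (rule ext)
  fix p :: "int \<times> int"
  obtain r s where p: "p = (r, s)" by fastforce
  have "\<not> (int n dvd r - i \<and> int n dvd 1 + r - j)"
    using assms(2) dvd_diff[of "int n" "1 + r - j" "r - i"] by (auto simp: algebra_simps)
  moreover have "\<not> (int n dvd r - j \<and> int n dvd 1 + r - i)"
    using assms(1) dvd_diff[of "int n" "r - j" "1 + r - i"] by (auto simp: algebra_simps)
  ultimately show "(u_mat n i a \<odot> u_mat n j b) p = (u_mat n j b \<odot> u_mat n i a) p"
    unfolding p u_mat_mult_entry by (auto simp: u_mat_def)
qed

text \<open>The braid relation in unipotent 3 x 3 matrices: the three hypotheses compare the entries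
  at (i, i+1), (i+1, i+2) and (i, i+2). For n > 2 the words leave no entry at distance 3, since i
  and i + 2 are different residues.\<close>

lemma u_mat_braid:
  assumes "n > 2" "a1 + a3 = b2" "a2 = b1 + b3" "a3 * a2 = b2 * b1"
  shows "u_mat n i a3 \<odot> u_mat n (i + 1) a2 \<odot> u_mat n i a1 =
    u_mat n (i + 1) b3 \<odot> u_mat n i b2 \<odot> u_mat n (i + 1) b1"
proof (rule ext)
  fix p :: "int \<times> int"
  obtain r s where p: "p = (r, s)" by fastforce
  have 1: "\<not> int n dvd 1" "\<not> int n dvd 2" using assms(1) by (auto dest: zdvd_imp_le)
  have d: "\<not> (int n dvd r - i \<and> int n dvd r + 1 - i)" "\<not> (int n dvd r - (i + 1) \<and> int n dvd r + 1 - (i + 1))"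
    "\<not> (int n dvd r - (i + 1) \<and> int n dvd r + 1 - i)" "\<not> (int n dvd r - (i + 1) \<and> int n dvd 1 + r - i)" for r
    using 1 dvd_diff[of "int n" "r + 1 - i" "r - i"] dvd_diff[of "int n" "r + 1 - i" "r - (i + 1)"] dvd_diff[of "int n" "1 + r - i" "r - (i + 1)"]
      dvd_diff[of "int n" "r + 1 - (i + 1)" "r - (i + 1)"] by (auto simp del: dvd_diff_right_iff)
  have e: "r + 1 - (i + 1) = r - i" "r + 2 - (i + 1) = r + 1 - i" by simp_all
  have ent: "(u_mat n x a \<odot> u_mat n y b \<odot> u_mat n z c) (r, s) =
    u_mat n x a (r, s) + (if int n dvd s - 1 - y then b * u_mat n x a (r, s - 1) else 0) +
    (if int n dvd s - 1 - z then c * (u_mat n x a (r, s - 1) +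
      (if int n dvd s - 1 - 1 - y then b * u_mat n x a (r, s - 1 - 1) else 0)) else 0)" for x y z a b c
    unfolding u_mat_mult_right by simp
  consider "s = r" | "s = r + 1" | "s = r + 2" | "s = r + 3" | "s < r \<or> s > r + 3" by linarith
  then show "(u_mat n i a3 \<odot> u_mat n (i + 1) a2 \<odot> u_mat n i a1) p =
    (u_mat n (i + 1) b3 \<odot> u_mat n i b2 \<odot> u_mat n (i + 1) b1) p"
  proof cases
    case 1
    then show ?thesis unfolding p ent by (simp add: u_mat_def)
  next
    case 2
    then show ?thesis unfolding p ent using assms d(1)[of r] d(2)[of r] d(3)[of r]
      by (auto simp: u_mat_def e algebra_simps)
  next
    case 3
    then show ?thesis unfolding p ent using assms d(1)[of r] d(2)[of r] d(3)[of r]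
      by (auto simp: u_mat_def e algebra_simps)
  next
    case 4
    then show ?thesis unfolding p ent using d[of r] d(1)[of "r + 1"] d(2)[of "r + 1"] d(3)[of "r + 1"]
      by (auto simp: u_mat_def)
  next
    case 5
    then show ?thesis unfolding p ent by (auto simp: u_mat_def)
  qed
qed

text \<open>In the application \<open>p\<close>, \<open>q\<close>, \<open>w\<close> are the corner
  entries at i, i+1, i+2; \<open>d\<close> and \<open>e\<close> lie just below the first two of them
  and \<open>E\<close> just below \<open>d\<close>. \<open>e1\<close>, \<open>d2\<close> are the
  denominators met along one side of the relation, \<open>d1\<close>, \<open>e2\<close> those along
  the other. The first three conclusions feed \<open>u_mat_braid\<close> for the left factors, the
  last three for the right factors.\<close>

lemma braid_parameters:
  fixes p q w d e E c c' :: complex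
  assumes "c \<noteq> 0" "c' \<noteq> 0" "d \<noteq> 0" "e \<noteq> 0"
    and e1: "e1 = e + (inverse c' - 1) * (q / d) * E" "e1 \<noteq> 0"
    and d2: "d2 = d + (c * c' - 1) * ((q / c') / e1) * E" "d2 \<noteq> 0"
    and d1: "d1 = d + (c - 1) * (q / e) * E" "d1 \<noteq> 0"
    and e2: "e2 = e + (inverse (c * c') - 1) * (c * q / d1) * E" "e2 \<noteq> 0"
  shows "(c' - 1) * (p / d) + (c - 1) * (c' * p / d2) = (c * c' - 1) * (p / d1)"
    "(c * c' - 1) * ((q / c') / e1) = (c - 1) * (q / e) + (c' - 1) * ((q / c') / e2)"
    "(c - 1) * (c' * p / d2) * ((c * c' - 1) * ((q / c') / e1)) = (c * c' - 1) * (p / d1) * ((c - 1) * (q / e))"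
    "(inverse c' - 1) * (q / d) + (inverse c - 1) * (c * q / d2) = (inverse (c * c') - 1) * (c * q / d1)"
    "(inverse (c * c') - 1) * (w / e1) = (inverse c - 1) * (w / e) + (inverse c' - 1) * ((w / c) / e2)"
    "(inverse c' - 1) * (q / d) * ((inverse (c * c') - 1) * (w / e1)) =
      (inverse (c * c') - 1) * (c * q / d1) * ((inverse c' - 1) * ((w / c) / e2))"
proof -
  \<comment> \<open>Numerators of \<open>e1 = N / (c' * d)\<close> and \<open>d1 = M / e\<close>.
    The remaining denominators involve the same two polynomials: \<open>d2 = c' * d * M / N\<close>
    and \<open>e2 = e * N / (c' * M)\<close>.\<close>
  define N where "N = c' * d * e + (1 - c') * q * E"
  define M where "M = d * e + (c - 1) * q * E"
  have e1': "e1 = N / (c' * d)" unfolding e1 N_def using assms(1-4) by (simp add: field_simps)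
  then have N: "N \<noteq> 0" using e1 by auto
  have d1': "d1 = M / e" unfolding d1 M_def using assms(1-4) by (simp add: field_simps)
  then have M: "M \<noteq> 0" using d1 by auto
  have "d2 = d * (N + (c * c' - 1) * q * E) / N"
    unfolding d2 e1' using assms(1-4) N by (simp add: field_simps)
  also have "N + (c * c' - 1) * q * E = c' * M" by (simp add: N_def M_def algebra_simps)
  finally have d2': "d2 = c' * d * M / N" by simp
  have "e2 = e * (c' * M + (1 - c * c') * q * E) / (c' * M)"
    unfolding e2 d1' using assms(1-4) M by (simp add: field_simps)
  also have "c' * M + (1 - c * c') * q * E = N" by (simp add: N_def M_def algebra_simps)
  finally have e2': "e2 = e * N / (c' * M)" .
  note * = e1' d1' d2' e2'
  \<comment> \<open>Four of the six conclusions come down to this identity; the other two rest on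
    \<open>d2 * e1 = d1 * e\<close> and \<open>d * e1 = d1 * e2\<close>.\<close>
  have r1: "(c' - 1) * M + (c - 1) * N = (c * c' - 1) * (d * e)" by (simp add: N_def M_def algebra_simps)
  show "(c' - 1) * (p / d) + (c - 1) * (c' * p / d2) = (c * c' - 1) * (p / d1)"
  proof -
    have "(c' - 1) * (p / d) + (c - 1) * (c' * p / d2) = p * ((c' - 1) * M + (c - 1) * N) / (d * M)"
      unfolding * using assms(1-4) N M by (simp add: field_simps)
    also have "\<dots> = (c * c' - 1) * (p / d1)"
      unfolding r1 * using assms(1-4) N M by (simp add: field_simps)
    finally show ?thesis .
  qed
  show "(c * c' - 1) * ((q / c') / e1) = (c - 1) * (q / e) + (c' - 1) * ((q / c') / e2)"
  proof -
    have "(c - 1) * (q / e) + (c' - 1) * ((q / c') / e2) = q * ((c' - 1) * M + (c - 1) * N) / (e * N)"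
      unfolding * using assms(1-4) N M by (simp add: field_simps)
    also have "\<dots> = (c * c' - 1) * ((q / c') / e1)"
      unfolding r1 * using assms(1-4) N M by (simp add: field_simps)
    finally show ?thesis by (rule sym)
  qed
  show "(c - 1) * (c' * p / d2) * ((c * c' - 1) * ((q / c') / e1)) = (c * c' - 1) * (p / d1) * ((c - 1) * (q / e))"
    unfolding * using assms(1-4) N M by (simp add: field_simps)
  show "(inverse c' - 1) * (q / d) + (inverse c - 1) * (c * q / d2) = (inverse (c * c') - 1) * (c * q / d1)"
  proof -
    have "(inverse c' - 1) * (q / d) + (inverse c - 1) * (c * q / d2) = - q * ((c' - 1) * M + (c - 1) * N) / (c' * d * M)"
      unfolding * using assms(1-4) N M by (simp add: field_simps)
    also have "\<dots> = (inverse (c * c') - 1) * (c * q / d1)"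
      unfolding r1 * using assms(1-4) N M by (simp add: field_simps)
    finally show ?thesis .
  qed
  show "(inverse (c * c') - 1) * (w / e1) = (inverse c - 1) * (w / e) + (inverse c' - 1) * ((w / c) / e2)"
  proof -
    have "(inverse c - 1) * (w / e) + (inverse c' - 1) * ((w / c) / e2) = - w * ((c' - 1) * M + (c - 1) * N) / (c * e * N)"
      unfolding * using assms(1-4) N M by (simp add: field_simps)
    also have "\<dots> = (inverse (c * c') - 1) * (w / e1)"
      unfolding r1 * using assms(1-4) N M by (simp add: field_simps)
    finally show ?thesis by (rule sym)
  qed
  show "(inverse c' - 1) * (q / d) * ((inverse (c * c') - 1) * (w / e1)) =
      (inverse (c * c') - 1) * (c * q / d1) * ((inverse c' - 1) * ((w / c) / e2))"
    unfolding * using assms(1-4) N M by (simp add: field_simps)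
qed

text \<open>Only the entry (k, k+m) and the two entries below it in its column enter the parameters
  of up to three consecutive operators; naming them keeps their indices from being
  rearranged.\<close>

definition top_entry :: "nat \<Rightarrow> (int \<times> int) pt \<Rightarrow> int \<Rightarrow> complex" where
  "top_entry m Y k = Y (k, k + int m)"

definition sub_entry :: "nat \<Rightarrow> (int \<times> int) pt \<Rightarrow> int \<Rightarrow> complex" where
  "sub_entry m Y k = Y (k + 1, k + int m)"

definition subsub_entry :: "nat \<Rightarrow> (int \<times> int) pt \<Rightarrow> int \<Rightarrow> complex" where
  "subsub_entry m Y k = Y (k + 2, k + int m)"

section \<open>Composites of two and three operators\<close>

lemma U_act_eq:
  "U_act n m k c Y = u_mat n k ((c - 1) * (top_entry m Y k / sub_entry m Y k)) \<odot> Y \<odot>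
     u_mat n (k + int m) ((inverse c - 1) * (top_entry m Y (k + 1) / sub_entry m Y k))"
  by (simp add: U_act_def top_entry_def sub_entry_def algebra_simps)

lemma top_entry_U_act:
  assumes "n > 1" "c \<noteq> 0" "Y \<in> U_le n m" "sub_entry m Y k \<noteq> 0"
  shows "top_entry m (U_act n m k c Y) j =
    (if int n dvd j - k then c else 1) * (if int n dvd j - k - 1 then inverse c else 1) * top_entry m Y j"
  using U_act_corner[OF assms(1-3)] assms(4) by (simp add: top_entry_def sub_entry_def)

lemma sub_entry_U_act_self:
  "n > 1 \<Longrightarrow> sub_entry m (U_act n m k c Y) k = sub_entry m Y k"
  by (simp add: sub_entry_def U_act_sub_self)

lemma sub_entry_U_act:
  assumes "\<not> (int n dvd j + 1 - k \<and> int n dvd j - 1 - k)"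
  shows "sub_entry m (U_act n m k c Y) j = sub_entry m Y j +
     (if int n dvd j + 1 - k then (c - 1) * (top_entry m Y k / sub_entry m Y k) * subsub_entry m Y j else 0) +
     (if int n dvd j - 1 - k then (inverse c - 1) * (top_entry m Y (k + 1) / sub_entry m Y k) *
       subsub_entry m Y (j - 1) else 0)"
proof -
  have e: "j - 1 + 2 = j + 1" "j - 1 + int m = j + int m - 1" "k + 1 + int m = k + int m + 1" by simp_all
  show ?thesis
    using assms unfolding sub_entry_def top_entry_def subsub_entry_def U_act_sub e by auto
qed

lemma subsub_entry_U_act:
  assumes "\<not> int n dvd j + 2 - k" "\<not> int n dvd j - 1 - k"
  shows "subsub_entry m (U_act n m k c Y) j = subsub_entry m Y j"
proof -
  have e: "j + int m - 1 - (k + int m) = j - 1 - k" by simp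
  show ?thesis using assms unfolding subsub_entry_def U_act_entry e by simp
qed

lemma mat_mult_sandwich:
  assumes "upper L" "upper L'" "upper Y" "upper R" "upper R'"
  shows "L' \<odot> (L \<odot> Y \<odot> R) \<odot> R' = (L' \<odot> L) \<odot> Y \<odot> (R \<odot> R')"
  using assms by (simp add: mat_mult_assoc upper_mat_mult)

text \<open>Collecting the unipotent factors on the two sides of Y turns a relation between
  operators into one identity between products of \<open>u_mat\<close> on the left and one, in
  reversed order, on the right.\<close>

lemma U_act_twice_eq:
  assumes "upper Y"
  shows "U_act n m j c' (U_act n m i c Y) =
    (u_mat n j ((c' - 1) * (top_entry m (U_act n m i c Y) j / sub_entry m (U_act n m i c Y) j)) \<odot>
     u_mat n i ((c - 1) * (top_entry m Y i / sub_entry m Y i))) \<odot> Y \<odot>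
    (u_mat n (i + int m) ((inverse c - 1) * (top_entry m Y (i + 1) / sub_entry m Y i)) \<odot>
     u_mat n (j + int m) ((inverse c' - 1) *
       (top_entry m (U_act n m i c Y) (j + 1) / sub_entry m (U_act n m i c Y) j)))"
  (is "?lhs = (?L' \<odot> ?L) \<odot> Y \<odot> (?R \<odot> ?R')")
proof -
  have 1: "U_act n m i c Y = ?L \<odot> Y \<odot> ?R" by (rule U_act_eq)
  have 2: "?lhs = ?L' \<odot> U_act n m i c Y \<odot> ?R'" by (rule U_act_eq)
  show ?thesis
    by (rule trans[OF 2 trans[OF arg_cong[OF 1, of "\<lambda>Z. ?L' \<odot> Z \<odot> ?R'"]]])
      (intro mat_mult_sandwich upper_u_mat assms)
qed

lemma U_act_thrice_eq:
  assumes "upper Y"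
  shows "U_act n m l c'' (U_act n m j c' (U_act n m i c Y)) =
    (u_mat n l ((c'' - 1) * (top_entry m (U_act n m j c' (U_act n m i c Y)) l /
        sub_entry m (U_act n m j c' (U_act n m i c Y)) l)) \<odot>
     (u_mat n j ((c' - 1) * (top_entry m (U_act n m i c Y) j / sub_entry m (U_act n m i c Y) j)) \<odot>
     u_mat n i ((c - 1) * (top_entry m Y i / sub_entry m Y i)))) \<odot> Y \<odot>
    (u_mat n (i + int m) ((inverse c - 1) * (top_entry m Y (i + 1) / sub_entry m Y i)) \<odot>
     u_mat n (j + int m) ((inverse c' - 1) *
       (top_entry m (U_act n m i c Y) (j + 1) / sub_entry m (U_act n m i c Y) j)) \<odot>
     u_mat n (l + int m) ((inverse c'' - 1) *
       (top_entry m (U_act n m j c' (U_act n m i c Y)) (l + 1) /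
        sub_entry m (U_act n m j c' (U_act n m i c Y)) l)))"
  (is "?lhs = (?L3 \<odot> (?L2 \<odot> ?L1)) \<odot> Y \<odot> (?R1 \<odot> ?R2 \<odot> ?R3)")
proof -
  have 1: "U_act n m j c' (U_act n m i c Y) = (?L2 \<odot> ?L1) \<odot> Y \<odot> (?R1 \<odot> ?R2)"
    by (rule U_act_twice_eq[OF assms])
  have 2: "?lhs = ?L3 \<odot> U_act n m j c' (U_act n m i c Y) \<odot> ?R3" by (rule U_act_eq)
  show ?thesis
    by (rule trans[OF 2 trans[OF arg_cong[OF 1, of "\<lambda>Z. ?L3 \<odot> Z \<odot> ?R3"]]])
      (intro mat_mult_sandwich upper_mat_mult upper_u_mat assms)
qed

lemma U_act_same:
  assumes "n > 1" "c \<noteq> 0" "c' \<noteq> 0" "Y \<in> U_le n m" "sub_entry m Y k \<noteq> 0"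
  shows "U_act n m k c (U_act n m k c' Y) = U_act n m k (c * c') Y"
proof -
  have nd: "\<not> int n dvd 1" "\<not> int n dvd - 1" using assms(1) by (auto dest: zdvd_imp_le)
  show ?thesis
    unfolding U_act_twice_eq[OF U_le_upper[OF assms(4)]] top_entry_U_act[OF assms(1,3,4,5)]
      sub_entry_U_act_self[OF assms(1)] u_mat_add[OF assms(1)] U_act_eq[of n m k "c * c'"]
    using assms nd by (simp add: algebra_simps add_divide_distrib[symmetric] diff_divide_distrib[symmetric])
qed

lemma U_act_commute:
  assumes "n > 1" "c \<noteq> 0" "c' \<noteq> 0" "Y \<in> U_le n m"
    and ij: "\<not> int n dvd i - j" "\<not> int n dvd i - j - 1" "\<not> int n dvd i - j + 1"
    and nz: "sub_entry m Y i \<noteq> 0" "sub_entry m Y j \<noteq> 0"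
  shows "U_act n m i c (U_act n m j c' Y) = U_act n m j c' (U_act n m i c Y)"
proof -
  note up = U_le_upper[OF assms(4)]
  have ij': "\<not> int n dvd j - i" "\<not> int n dvd j - i - 1" "\<not> int n dvd j - i + 1"
    "\<not> int n dvd i + 1 - j" "\<not> int n dvd i - 1 - j" "\<not> int n dvd j + 1 - i" "\<not> int n dvd j - 1 - i"
    using ij dvd_minus_iff[of "int n" "i - j"] dvd_minus_iff[of "int n" "i - j - 1"]
      dvd_minus_iff[of "int n" "i - j + 1"] by (simp_all add: algebra_simps)
  have t: "top_entry m (U_act n m j c' Y) i = top_entry m Y i" "top_entry m (U_act n m j c' Y) (i + 1) = top_entry m Y (i + 1)"
    "top_entry m (U_act n m i c Y) j = top_entry m Y j" "top_entry m (U_act n m i c Y) (j + 1) = top_entry m Y (j + 1)"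
    using top_entry_U_act[OF assms(1,2,4) nz(1)] top_entry_U_act[OF assms(1,3,4) nz(2)] ij ij' by simp_all
  have s: "sub_entry m (U_act n m j c' Y) i = sub_entry m Y i" "sub_entry m (U_act n m i c Y) j = sub_entry m Y j"
    using ij ij' by (simp_all add: sub_entry_U_act)
  have e: "i + int m - (j + int m) = i - j" by simp
  have c1: "u_mat n i a \<odot> u_mat n j b = u_mat n j b \<odot> u_mat n i a"
    "u_mat n (i + int m) a \<odot> u_mat n (j + int m) b = u_mat n (j + int m) b \<odot> u_mat n (i + int m) a" for a b
    by (rule u_mat_commute, use ij in \<open>simp_all add: e\<close>)+
  show ?thesis unfolding U_act_twice_eq[OF up] t s c1 ..
qed

lemma U_act_braid:
  assumes "n > 2" "c \<noteq> 0" "c' \<noteq> 0" "Y \<in> U_le n m"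
    and nz: "sub_entry m Y i \<noteq> 0" "sub_entry m Y (i + 1) \<noteq> 0"
      "sub_entry m (U_act n m i c' Y) (i + 1) \<noteq> 0"
      "sub_entry m (U_act n m (i + 1) (c * c') (U_act n m i c' Y)) i \<noteq> 0"
      "sub_entry m (U_act n m (i + 1) c Y) i \<noteq> 0"
      "sub_entry m (U_act n m i (c * c') (U_act n m (i + 1) c Y)) (i + 1) \<noteq> 0"
  shows "U_act n m i c (U_act n m (i + 1) (c * c') (U_act n m i c' Y)) =
    U_act n m (i + 1) c' (U_act n m i (c * c') (U_act n m (i + 1) c Y))"
proof -
  have n1: "n > 1" and cc: "c * c' \<noteq> 0" using assms by auto
  have nd: "\<not> int n dvd 1" "\<not> int n dvd - 1" "\<not> int n dvd 2" "\<not> int n dvd - 2"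
    using assms(1) by (auto dest: zdvd_imp_le)
  define p q w d e E where "p = top_entry m Y i" and "q = top_entry m Y (i + 1)" and "w = top_entry m Y (i + 2)"
    and "d = sub_entry m Y i" and "e = sub_entry m Y (i + 1)" and "E = subsub_entry m Y i"
  note defs = p_def q_def w_def d_def e_def E_def
  \<comment> \<open>\<open>Y1\<close>, \<open>Y2\<close> are the points visited on the left side of
    the relation, \<open>Z1\<close>, \<open>Z2\<close> those on the right side.\<close>
  define Y1 where "Y1 = U_act n m i c' Y"
  define Y2 where "Y2 = U_act n m (i + 1) (c * c') Y1"
  define Z1 where "Z1 = U_act n m (i + 1) c Y"
  define Z2 where "Z2 = U_act n m i (c * c') Z1"
  have V: "Y1 \<in> U_le n m" "Z1 \<in> U_le n m"
    unfolding Y1_def Z1_def using U_act_U_le[OF n1] assms(2-4) nz(1,2) by (auto simp: sub_entry_def)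
  note nz' = nz(3-6)[folded Y1_def Z1_def, folded Y2_def Z2_def]
  have tY1: "top_entry m Y1 i = c' * p" "top_entry m Y1 (i + 1) = q / c'" "top_entry m Y1 (i + 2) = w"
    using top_entry_U_act[OF n1 assms(3,4) nz(1)] nd by (simp_all add: Y1_def defs field_simps)
  have tZ1: "top_entry m Z1 i = p" "top_entry m Z1 (i + 1) = c * q" "top_entry m Z1 (i + 2) = w / c"
    using top_entry_U_act[OF n1 assms(2,4) nz(2)] nd by (simp_all add: Z1_def defs field_simps)
  have sY1: "sub_entry m Y1 i = d" "sub_entry m Y1 (i + 1) = e + (inverse c' - 1) * (q / d) * E"
    using sub_entry_U_act[of n "i + 1" i] sub_entry_U_act_self[OF n1] nd by (simp_all add: Y1_def defs)
  have sZ1: "sub_entry m Z1 (i + 1) = e" "sub_entry m Z1 i = d + (c - 1) * (q / e) * E"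
    using sub_entry_U_act[of n i "i + 1"] sub_entry_U_act_self[OF n1] nd by (simp_all add: Z1_def defs)
  \<comment> \<open>The entry at (i+2, i+m) is untouched by the first step on either side, because n
    divides neither 1 nor 2; this is why a single \<open>E\<close> appears in
    \<open>braid_parameters\<close>.\<close>
  have E1: "subsub_entry m Y1 i = E" "subsub_entry m Z1 i = E"
    using nd by (simp_all add: Y1_def Z1_def defs subsub_entry_U_act)
  have tY2: "top_entry m Y2 i = c' * p" "top_entry m Y2 (i + 1) = c * q"
    using top_entry_U_act[OF n1 cc V(1) nz'(1)] nd tY1 assms(2,3) by (simp_all add: Y2_def field_simps)
  have tZ2: "top_entry m Z2 (i + 1) = q / c'" "top_entry m Z2 (i + 2) = w / c"
    using top_entry_U_act[OF n1 cc V(2) nz'(3)] nd tZ1 assms(2,3) by (simp_all add: Z2_def field_simps)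
  have sY2: "sub_entry m Y2 i = d + (c * c' - 1) * ((q / c') / sub_entry m Y1 (i + 1)) * E"
    using sub_entry_U_act[of n i "i + 1"] nd sY1 tY1 E1 by (simp add: Y2_def)
  have sZ2: "sub_entry m Z2 (i + 1) = e + (inverse (c * c') - 1) * (c * q / sub_entry m Z1 i) * E"
    using sub_entry_U_act[of n "i + 1" i] nd sZ1 tZ1 E1 by (simp add: Z2_def)
  note bp = braid_parameters[OF assms(2,3) nz(1,2)[folded defs] sY1(2) nz'(1) sY2 nz'(2) sZ1(2) nz'(3) sZ2 nz'(4)]
  have i1: "i + 1 + int m = i + int m + 1" "i + 1 + 1 = i + 2" by simp_all
  show ?thesis
    unfolding U_act_thrice_eq[OF U_le_upper[OF assms(4)]]
    unfolding Y1_def[symmetric] Z1_def[symmetric]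
    unfolding Y2_def[symmetric] Z2_def[symmetric] i1
    unfolding tY1 tZ1 sY1(1) sZ1(1) tY2 tZ2
    unfolding defs[symmetric]
    unfolding u_mat_braid[OF assms(1) bp(1) bp(2) bp(3), unfolded mat_mult_assoc[OF upper_u_mat upper_u_mat upper_u_mat]]
    using u_mat_braid[OF assms(1) bp(4)[unfolded add.commute[of "(inverse c' - 1) * (q / d)"]]
      trans[OF bp(5) add.commute] bp(6), of "i + int m" w]
    by simp
qed

section \<open>The crystal axioms for unipotent loops\<close>

lemma cartan_cases:
  "cartan n i j = 0 \<Longrightarrow> \<not> int n dvd i - j \<and> \<not> int n dvd i - j - 1 \<and> \<not> int n dvd i - j + 1"
  "cartan n i j = -1 \<Longrightarrow> n \<noteq> 2 \<and> \<not> int n dvd i - j \<and> (int n dvd i - j - 1 \<or> int n dvd i - j + 1)"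
  by (auto simp: cartan_def split: if_splits)

text \<open>The residues j = i, j = i + 1 and j = i - 1 are mutually exclusive, except that the last
  two coincide for n = 2. Their factors then combine, which is the origin of the entry -2 in
  \<open>cartan\<close>.\<close>

lemma gam_scaling:
  fixes c :: complex
  assumes "n > 1" "c \<noteq> 0"
  shows "(if int n dvd j - i then c else 1) * (if int n dvd j - i - 1 then inverse c else 1) /
    ((if int n dvd j + 1 - i then c else 1) * (if int n dvd j + 1 - i - 1 then inverse c else 1)) =
    c powi cartan n i j"
proof -
  have d: "int n dvd i - j \<longleftrightarrow> int n dvd j - i" "int n dvd i - j - 1 \<longleftrightarrow> int n dvd j + 1 - i"
    "int n dvd i - j + 1 \<longleftrightarrow> int n dvd j - i - 1"
    using dvd_minus_iff[of "int n" "i - j"] dvd_minus_iff[of "int n" "i - j - 1"]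
      dvd_minus_iff[of "int n" "i - j + 1"] by (simp_all add: algebra_simps)
  have e: "j + 1 - i - 1 = j - i" by simp
  have x: "\<not> (int n dvd j - i \<and> int n dvd j - i - 1)" "\<not> (int n dvd j - i \<and> int n dvd j + 1 - i)"
    using not_dvd_shift[OF assms(1), of "j - i"] by (auto simp: algebra_simps)
  have two: "n = 2" if "int n dvd j - i - 1" "int n dvd j + 1 - i"
  proof -
    have "int n dvd 2" using dvd_diff[OF that(2,1)] by simp
    then show ?thesis using assms(1) by (auto dest: zdvd_imp_le)
  qed
  have two': "int n dvd j - i - 1 \<longleftrightarrow> int n dvd j + 1 - i" if "n = 2"
    using that by presburger
  have three: "int n dvd j - i \<or> int n dvd j + 1 - i" if "n = 2"
    using that by presburger
  have "(if a then c else 1) * (if b then inverse c else 1) / ((if b' then c else 1) * (if a then inverse c else 1)) =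
      c powi (if a then 2 else if n = 2 then -2 else if b' \<or> b then -1 else 0)"
    if h: "\<not> (a \<and> b)" "\<not> (a \<and> b')" "b \<Longrightarrow> b' \<Longrightarrow> n = 2" "n = 2 \<Longrightarrow> \<not> a \<Longrightarrow> b \<and> b'" for a b b'
  proof (cases a)
    case True
    then show ?thesis using h(1,2) assms(2) by (simp add: power_int_def power2_eq_square divide_inverse)
  next
    case False
    then consider "b" "b'" "n = 2" | "b" "\<not> b'" "n \<noteq> 2" | "\<not> b" "b'" "n \<noteq> 2" | "\<not> b" "\<not> b'" "n \<noteq> 2"
      using h by blast
    then show ?thesis using False assms(2)
      by cases (simp_all add: power_int_def power2_eq_square divide_inverse)
  qed
  note * = this
  have four: "int n dvd j - i - 1 \<and> int n dvd j + 1 - i" if "n = 2" "\<not> int n dvd j - i"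
    using two'[OF that(1)] three[OF that(1)] that(2) by simp
  show ?thesis
    unfolding cartan_def d e by (rule *[OF x two four])
qed

lemma geometric_crystal_U:
  assumes n: "n > 1" and m: "m \<ge> 1"
  shows "geometric_crystal n (U_crystal n m)"
proof -
  let ?V = "U_le n m" and ?C = "U_crystal n m"
  have V: "variety ?V" using U_le_variety n by simp
  note irr = variety_irreducible[OF V]
  obtain Y0 where Y0: "Y0 \<in> ?V" "\<And>k. Y0 (k + 1, k + int m) \<noteq> 0" "\<And>k. Y0 (k, k + int m) \<noteq> 0"
    using U_generic_point[OF m] by blast
  have e1: "k + 1 + int m = k + int m + 1" for k :: int by simp
  have dom_eps: "dom (eps ?C k) = {Y\<in>?V. sub_entry m Y k \<noteq> 0}"
    and dom_phi: "dom (phi ?C k) = {Y\<in>?V. sub_entry m Y k \<noteq> 0}" for k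
    by (auto simp: U_crystal_eps U_crystal_phi sub_entry_def split: if_splits)
  have dom_act: "dom (act ?C k c) = {Y\<in>?V. c \<noteq> 0 \<and> sub_entry m Y k \<noteq> 0}" for k c
    by (auto simp: U_crystal_act sub_entry_def split: if_splits)
  have act_Some: "act ?C k c Y = Some (U_act n m k c Y)" if "Y \<in> dom (act ?C k c)" for k c Y
    using that by (auto simp: U_crystal_act split: if_splits)
  have per: "Y (r + int n + a, r + int n + b) = Y (r + a, r + b)" if "Y \<in> ?V" for Y r a b
    using U_le_dvd[OF that, of "r + int n" r a b] by simp
  have pol: "rational_fun ?V ((\<lambda>Y. Some (Y p)) |` ?V)" for p
    by (rule rational_fun_polyfun[OF irr polyfun_coord])
  have eps_pdiv: "eps ?C k = pdiv ((\<lambda>Y. Some (Y (k + 1, k + int m + 1))) |` ?V) ((\<lambda>Y. Some (Y (k + 1, k + int m))) |` ?V)"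
    and phi_pdiv: "phi ?C k = pdiv ((\<lambda>Y. Some (Y (k, k + int m))) |` ?V) ((\<lambda>Y. Some (Y (k + 1, k + int m))) |` ?V)" for k
    by (simp_all add: U_crystal_def Let_def)
  have rat_eps: "rational_fun ?V (eps ?C k)" for k
  proof -
    have "Y0 \<in> dom (eps ?C k)" using Y0 by (simp add: dom_eps sub_entry_def)
    then show ?thesis unfolding eps_pdiv by (intro rational_fun_pdiv pol) auto
  qed
  have rat_phi: "rational_fun ?V (phi ?C k)" for k
  proof -
    have "Y0 \<in> dom (phi ?C k)" using Y0 by (simp add: dom_phi sub_entry_def)
    then show ?thesis unfolding phi_pdiv by (intro rational_fun_pdiv pol) auto
  qed
  have rat_gam: "rational_fun ?V (gam ?C k)" for k
  proof -
    have "gam ?C k Y0 \<noteq> None" using Y0(1) Y0(2)[of k] Y0(3)[of "k + 1"]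
      by (simp add: U_crystal_gam e1)
    then have "Y0 \<in> dom (gam ?C k)" by blast
    then show ?thesis unfolding gam_def by (intro rational_fun_pdiv rat_eps rat_phi) auto
  qed
  have rat_act: "rational_Gm_action ?V (act ?C k)" for k
    unfolding rational_Gm_action_def
  proof (intro conjI allI impI)
    let ?f = "\<lambda>z. act ?C k (z None) (\<lambda>i. z (Some i))"
    let ?S = "{z \<in> Gm_times ?V. z (Some (k + 1, k + int m)) \<noteq> 0}"
    have d: "dom ?f = ?S"
      by (auto simp: U_crystal_act Gm_times_def split: if_splits)
    have Sz: "\<And>z. z \<in> ?S \<Longrightarrow> z None \<noteq> 0" "\<And>z. z \<in> ?S \<Longrightarrow> z (Some (k + 1, k + int m)) \<noteq> 0"
      by (auto simp: Gm_times_def)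
    show "rational_map (Gm_times ?V) ?V ?f"
      unfolding rational_map_def d
    proof (intro conjI allI)
      show "openin (zariski_on (Gm_times ?V)) ?S"
        by (rule openin_zariski_on_nonzero[OF polyfun_coord])
      have "case_option 1 Y0 \<in> ?S" using Y0 by (simp add: Gm_times_def)
      then show "?S \<noteq> {}" by blast
      show "ran ?f \<subseteq> ?V"
        using U_act_U_le[OF n] by (auto simp: ran_def U_crystal_act split: if_splits)
      fix j :: "int \<times> int"
      obtain r s where j: "j = (r, s)" by fastforce
      have c: "regular_on ?S (\<lambda>z. z i)" for i by (rule regular_on_polyfun[OF polyfun_coord])
      have z: "regular_on ?S (\<lambda>z. 0)" by (rule regular_on_const)
      have f1: "regular_on ?S (\<lambda>z. (z None - 1) * (z (Some (k, k + int m)) / z (Some (k + 1, k + int m))))"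
        and f2: "regular_on ?S (\<lambda>z. (inverse (z None) - 1) * (z (Some (k + 1, k + int m + 1)) / z (Some (k + 1, k + int m))))"
        by (intro regular_on_mult regular_on_diff regular_on_divide regular_on_inverse regular_on_const c Sz; assumption)+
      have "regular_on ?S (\<lambda>z. U_act n m k (z None) (\<lambda>i. z (Some i)) (r, s))"
        unfolding U_act_entry
        by (cases "int n dvd r - k"; cases "int n dvd s - 1 - (k + int m)")
          (simp_all only: if_True if_False, (intro regular_on_add regular_on_mult[OF f1] regular_on_mult[OF f2] c z)+)
      then show "regular_on ?S (\<lambda>z. the (?f z) j)"
        by (rule regular_on_cong[THEN iffD1, rotated]) (auto simp: j U_crystal_act Gm_times_def)
    qed
    show "agree (act ?C k 1) Some"
      unfolding agree_def
    proof
      fix Y assume "Y \<in> dom (act ?C k 1) \<inter> dom Some"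
      then have Y: "Y \<in> dom (act ?C k 1)" by blast
      have "U_act n m k 1 Y = Y"
        by (rule ext) (auto simp: U_act_entry split_beta)
      then show "act ?C k 1 Y = Some Y" using act_Some[OF Y] by simp
    qed
    fix c c' :: complex assume c: "c \<noteq> 0" "c' \<noteq> 0"
    show "agree (act ?C k c \<circ>\<^sub>m act ?C k c') (act ?C k (c * c'))"
      unfolding agree_def
    proof
      fix Y assume "Y \<in> dom (act ?C k c \<circ>\<^sub>m act ?C k c') \<inter> dom (act ?C k (c * c'))"
      then have Y: "Y \<in> dom (act ?C k c')" "the (act ?C k c' Y) \<in> dom (act ?C k c)" "Y \<in> dom (act ?C k (c * c'))"
        by (auto simp: dom_map_comp)
      then show "(act ?C k c \<circ>\<^sub>m act ?C k c') Y = act ?C k (c * c') Y"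
        using U_act_same[OF n c, of Y m k] by (simp add: the_map_comp act_Some dom_act)
    qed
  qed
  have sub_act: "(U_act n m k c Y) (k + 1, k + int m) = Y (k + 1, k + int m)" for k c Y
    by (rule U_act_sub_self[OF n])
  have perC: "eps ?C (i + int n) = eps ?C i \<and> phi ?C (i + int n) = phi ?C i \<and> act ?C (i + int n) = act ?C i" for i
  proof (intro conjI ext)
    fix Y c
    have 1: "Y (i + int n + 1, i + int n + int m) = Y (i + 1, i + int m)"
      "Y (i + int n + 1, i + int n + int m + 1) = Y (i + 1, i + int m + 1)"
      "Y (i + int n, i + int n + int m) = Y (i, i + int m)" if "Y \<in> ?V"
      using per[OF that, of i 1 "int m"] per[OF that, of i 1 "int m + 1"] per[OF that, of i 0 "int m"]
      by (simp_all add: algebra_simps)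
    show "eps ?C (i + int n) Y = eps ?C i Y" using 1 by (auto simp: U_crystal_eps)
    show "phi ?C (i + int n) Y = phi ?C i Y" using 1 by (auto simp: U_crystal_phi)
    have "u_mat n (i + int n) a = u_mat n i a" "u_mat n (i + int n + int m) a = u_mat n (i + int m) a" for a
      unfolding u_mat_def using dvd_diff_cong[of n "r - (i + int n)" "r - i" 0 for r]
        dvd_diff_cong[of n "r - (i + int n + int m)" "r - (i + int m)" 0 for r] by (simp_all cong: if_cong)
    then show "act ?C (i + int n) c Y = act ?C i c Y"
      using 1 by (auto simp: U_crystal_act U_act_def)
  qed
  have per_act: "act ?C i = act ?C j" if "int n dvd i - j" for i j
    by (rule periodic_dvd[of "act ?C" n]) (use perC that in auto)
  have braid: "agree (act ?C i c \<circ>\<^sub>m act ?C (i + 1) (c * c') \<circ>\<^sub>m act ?C i c')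
      (act ?C (i + 1) c' \<circ>\<^sub>m act ?C i (c * c') \<circ>\<^sub>m act ?C (i + 1) c)"
    if "n > 2" "c \<noteq> 0" "c' \<noteq> 0" for i c c'
    unfolding agree_def
  proof
    fix Y assume "Y \<in> dom (act ?C i c \<circ>\<^sub>m act ?C (i + 1) (c * c') \<circ>\<^sub>m act ?C i c') \<inter>
      dom (act ?C (i + 1) c' \<circ>\<^sub>m act ?C i (c * c') \<circ>\<^sub>m act ?C (i + 1) c)"
    then have Y: "Y \<in> dom (act ?C i c')" "the (act ?C i c' Y) \<in> dom (act ?C (i + 1) (c * c'))"
      "the (act ?C (i + 1) (c * c') (the (act ?C i c' Y))) \<in> dom (act ?C i c)"
      "Y \<in> dom (act ?C (i + 1) c)" "the (act ?C (i + 1) c Y) \<in> dom (act ?C i (c * c'))"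
      "the (act ?C i (c * c') (the (act ?C (i + 1) c Y))) \<in> dom (act ?C (i + 1) c')"
      by (auto simp: dom_map_comp the_map_comp)
    have "U_act n m i c (U_act n m (i + 1) (c * c') (U_act n m i c' Y)) =
      U_act n m (i + 1) c' (U_act n m i (c * c') (U_act n m (i + 1) c Y))"
      by (rule U_act_braid[OF that])
        (use Y in \<open>simp_all add: act_Some\<close>, simp_all add: dom_act)
    then show "(act ?C i c \<circ>\<^sub>m act ?C (i + 1) (c * c') \<circ>\<^sub>m act ?C i c') Y =
      (act ?C (i + 1) c' \<circ>\<^sub>m act ?C i (c * c') \<circ>\<^sub>m act ?C (i + 1) c) Y"
      using Y by (simp add: the_map_comp act_Some)
  qed
  show ?thesis
    unfolding geometric_crystal_def U_crystal_points
  proof (intro conjI allI impI)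
    fix i show "Abstract_Topology.closure_of (zariski_on ?V) (dom (act ?C i 1)) = ?V"
    proof (rule closure_of_open_irreducible[OF irr])
      show "openin (zariski_on ?V) (dom (act ?C i 1))"
        unfolding dom_act sub_entry_def using openin_zariski_on_nonzero[OF polyfun_coord] by simp
      show "dom (act ?C i 1) \<noteq> {}" unfolding dom_act sub_entry_def using Y0 by auto
    qed
  next
    fix i j c assume c: "(c :: complex) \<noteq> 0"
    show "agree (gam ?C j \<circ>\<^sub>m act ?C i c) (\<lambda>x. map_option (\<lambda>a. c powi cartan n i j * a) (gam ?C j x))"
      unfolding agree_def
    proof
      fix Y assume "Y \<in> dom (gam ?C j \<circ>\<^sub>m act ?C i c) \<inter> dom (\<lambda>x. map_option (\<lambda>a. c powi cartan n i j * a) (gam ?C j x))"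
      then have Y: "Y \<in> dom (act ?C i c)" "the (act ?C i c Y) \<in> dom (gam ?C j)" "Y \<in> dom (gam ?C j)"
        by (auto simp: dom_map_comp)
      have g: "gam ?C j Y = Some (top_entry m Y j / top_entry m Y (j + 1))" if "Y \<in> dom (gam ?C j)" for Y
        using that by (auto simp: U_crystal_gam top_entry_def e1 split: if_splits)
      have s: "sub_entry m Y i \<noteq> 0" "Y \<in> ?V" using Y(1) by (auto simp: dom_act)
      have "(gam ?C j \<circ>\<^sub>m act ?C i c) Y = Some (top_entry m (U_act n m i c Y) j / top_entry m (U_act n m i c Y) (j + 1))"
        using Y g by (simp add: the_map_comp act_Some)
      also have "top_entry m (U_act n m i c Y) j / top_entry m (U_act n m i c Y) (j + 1) =
        c powi cartan n i j * (top_entry m Y j / top_entry m Y (j + 1))"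
        unfolding gam_scaling[OF n c, symmetric] top_entry_U_act[OF n c s(2,1)] by simp
      finally show "(gam ?C j \<circ>\<^sub>m act ?C i c) Y = map_option (\<lambda>a. c powi cartan n i j * a) (gam ?C j Y)"
        using g[OF Y(3)] by simp
    qed
  next
    fix i c assume c: "(c :: complex) \<noteq> 0"
    show "agree (eps ?C i \<circ>\<^sub>m act ?C i c) (\<lambda>x. map_option (\<lambda>a. inverse c * a) (eps ?C i x))"
      unfolding agree_def
    proof
      fix Y assume "Y \<in> dom (eps ?C i \<circ>\<^sub>m act ?C i c) \<inter> dom (\<lambda>x. map_option (\<lambda>a. inverse c * a) (eps ?C i x))"
      then have Y: "Y \<in> dom (act ?C i c)" "the (act ?C i c Y) \<in> dom (eps ?C i)" "Y \<in> dom (eps ?C i)"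
        by (auto simp: dom_map_comp)
      have g: "eps ?C i Y = Some (top_entry m Y (i + 1) / sub_entry m Y i)" if "Y \<in> dom (eps ?C i)" for Y
        using that by (auto simp: U_crystal_eps top_entry_def sub_entry_def e1 split: if_splits)
      have s: "sub_entry m Y i \<noteq> 0" "Y \<in> ?V" using Y(1) by (auto simp: dom_act)
      have nd: "\<not> int n dvd 1" using n by (auto dest: zdvd_imp_le)
      have "(eps ?C i \<circ>\<^sub>m act ?C i c) Y = Some (top_entry m (U_act n m i c Y) (i + 1) / sub_entry m (U_act n m i c Y) i)"
        using Y g by (simp add: the_map_comp act_Some)
      also have "top_entry m (U_act n m i c Y) (i + 1) / sub_entry m (U_act n m i c Y) i =
        inverse c * (top_entry m Y (i + 1) / sub_entry m Y i)"
        unfolding top_entry_U_act[OF n c s(2,1)] sub_entry_U_act_self[OF n] using nd by simp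
      finally show "(eps ?C i \<circ>\<^sub>m act ?C i c) Y = map_option (\<lambda>a. inverse c * a) (eps ?C i Y)"
        using g[OF Y(3)] by simp
    qed
  next
    fix i j c c' assume c: "(c :: complex) \<noteq> 0" "(c' :: complex) \<noteq> 0" and a: "cartan n i j = 0"
    show "agree (act ?C i c \<circ>\<^sub>m act ?C j c') (act ?C j c' \<circ>\<^sub>m act ?C i c)"
      unfolding agree_def
    proof
      fix Y assume "Y \<in> dom (act ?C i c \<circ>\<^sub>m act ?C j c') \<inter> dom (act ?C j c' \<circ>\<^sub>m act ?C i c)"
      then have Y: "Y \<in> dom (act ?C i c)" "the (act ?C i c Y) \<in> dom (act ?C j c')"
        "Y \<in> dom (act ?C j c')" "the (act ?C j c' Y) \<in> dom (act ?C i c)"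
        by (auto simp: dom_map_comp)
      have "U_act n m i c (U_act n m j c' Y) = U_act n m j c' (U_act n m i c Y)"
        using Y(1,3) cartan_cases(1)[OF a] by (intro U_act_commute[OF n c]) (auto simp: dom_act)
      then show "(act ?C i c \<circ>\<^sub>m act ?C j c') Y = (act ?C j c' \<circ>\<^sub>m act ?C i c) Y"
        using Y by (simp add: the_map_comp act_Some)
    qed
  next
    fix i j c c' assume c: "(c :: complex) \<noteq> 0" "(c' :: complex) \<noteq> 0" and a: "cartan n i j = -1"
    have n2: "n > 2" using cartan_cases(2)[OF a] n by simp
    \<comment> \<open>The residues of i and j are neighbours. Periodicity of \<open>act\<close>
      reduces to j = i + 1 or i = j + 1, and the second case is the first with the two sides and the
      two parameters exchanged.\<close>
    from cartan_cases(2)[OF a] consider "int n dvd i - (j + 1)" | "int n dvd j - (i + 1)"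
      using dvd_minus_iff[of "int n" "i - j + 1"] by (auto simp: algebra_simps)
    then show "agree (act ?C i c \<circ>\<^sub>m act ?C j (c * c') \<circ>\<^sub>m act ?C i c')
      (act ?C j c' \<circ>\<^sub>m act ?C i (c * c') \<circ>\<^sub>m act ?C j c)"
    proof cases
      case 1
      show ?thesis unfolding per_act[OF 1] using braid[OF n2 c(2,1), of j]
        unfolding agree_def by (metis inf_commute mult.commute)
    next
      case 2
      show ?thesis unfolding per_act[OF 2] by (rule braid[OF n2 c])
    qed
  qed (use V rat_eps rat_gam rat_act perC in auto)
qed

section \<open>The product crystal\<close>

text \<open>For j at least 1, \<open>corner x j (k + 1) / subcorner x j k\<close> and
  \<open>corner x j k / subcorner x j k\<close> are \<epsilon> and \<phi> at k of the product of the
  first j components.\<close>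

abbreviation corner :: "(nat \<times> int) pt \<Rightarrow> nat \<Rightarrow> int \<Rightarrow> complex" where
  "corner x j k \<equiv> top_entry j (whirl_prod j x) k"

abbreviation subcorner :: "(nat \<times> int) pt \<Rightarrow> nat \<Rightarrow> int \<Rightarrow> complex" where
  "subcorner x j k \<equiv> sub_entry j (whirl_prod j x) k"

lemma corner_0 [simp]: "corner x 0 k = 1"
  by (simp add: top_entry_def)

lemma subcorner_0 [simp]: "subcorner x 0 k = 0"
  by (simp add: sub_entry_def whirl_prod_lower)

lemma corner_Suc: "corner x (Suc j) k = corner x j k * x (Suc j, k + int j)"
  by (simp add: top_entry_def whirl_prod_Suc whirl_prod_above)

text \<open>Divided by \<open>subcorner x j k\<close>, the right side is the denominator \<phi>(x')
  + \<epsilon>(x) of the product rule, with x the first j components and x' the next one.\<close>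

lemma subcorner_Suc:
  "subcorner x (Suc j) k = corner x j (k + 1) + subcorner x j k * x (Suc j, k + int j)"
  by (simp add: top_entry_def sub_entry_def whirl_prod_Suc algebra_simps)

lemma corner_nonzero: "x \<in> torus n m \<Longrightarrow> j \<le> m \<Longrightarrow> corner x j k \<noteq> 0"
  unfolding top_entry_def by (rule whirl_prod_corner_nonzero)

lemma polyfun_corner: "(\<lambda>x. corner x j k) \<in> polyfun UNIV"
  unfolding top_entry_def by (rule polyfun_whirl_prod)

lemma polyfun_subcorner: "(\<lambda>x. subcorner x j k) \<in> polyfun UNIV"
  unfolding sub_entry_def by (rule polyfun_whirl_prod)

text \<open>
  With \<open>a = (c - 1) * \<phi>\<^sub>k\<close>, the factor \<open>chain k a x j\<close> is the parameter with which \<open>e\<^sub>k\<^sup>c\<close> acts on the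
  first \<open>j\<close> components of the product.
\<close>

definition chain :: "int \<Rightarrow> complex \<Rightarrow> (nat \<times> int) pt \<Rightarrow> nat \<Rightarrow> complex" where
  "chain k a x j = 1 + a * subcorner x j k / corner x j k"

text \<open>Component i is moved with the ratio of consecutive \<open>chain\<close> values: the
  nested c^+ of the product rule in telescoped form.\<close>

definition X_move :: "nat \<Rightarrow> int \<Rightarrow> complex \<Rightarrow> (nat \<times> int) pt \<Rightarrow> (nat \<times> int) pt" where
  "X_move n k a x = (\<lambda>(i, r).
     if int n dvd r - (k + int i - 1) then chain k a x i / chain k a x (i - 1) * x (i, r)
     else if int n dvd r - (k + int i) then chain k a x (i - 1) / chain k a x i * x (i, r)
     else x (i, r))"

lemma chain_0 [simp]: "chain k a x 0 = 1"
  by (simp add: chain_def)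

text \<open>A unipotent factor passes a whirl at the price of the basic crystal move with parameter
  q, and its residue rises by one. Only distances 1 and 2 from the diagonal carry content.\<close>

lemma whirl_u_mat:
  assumes n: "n > 1" and x: "\<And>r. x (r + int n) = x r" and q: "q \<noteq> 0"
    and y: "\<And>r. y r = (if int n dvd r - K then q * x r else if int n dvd r - (K + 1) then inverse q * x r else x r)"
  shows "whirl y \<odot> u_mat n (K + 1) ((1 - inverse q) * x (K + 1)) = u_mat n K ((q - 1) * x K) \<odot> whirl x"
proof (rule ext)
  fix p :: "int \<times> int"
  obtain r s where p: "p = (r, s)" by fastforce
  have nd: "\<not> int n dvd r - K \<or> \<not> int n dvd r - (K + 1)"
    using not_dvd_shift(2)[OF n, of "r - K"] by (auto simp: algebra_simps)
  have xK: "int n dvd r - K \<Longrightarrow> x r = x K" "int n dvd r - K \<Longrightarrow> x (r + 1) = x (K + 1)"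
    "int n dvd r - (K + 1) \<Longrightarrow> x r = x (K + 1)"
    using periodic_dvd[of x n, OF x] by (auto simp: algebra_simps)
  show "(whirl y \<odot> u_mat n (K + 1) ((1 - inverse q) * x (K + 1))) p = (u_mat n K ((q - 1) * x K) \<odot> whirl x) p"
  proof -
    consider "s = r" | "s = r + 1" | "s = r + 2" | "s \<noteq> r" "s \<noteq> r + 1" "s \<noteq> r + 2" by blast
    then show ?thesis
    proof cases
      case 1
      then show ?thesis unfolding p u_mat_mult_left u_mat_mult_right by (simp add: whirl_def)
    next
      case 2
      then show ?thesis unfolding p u_mat_mult_left u_mat_mult_right using nd xK
        by (auto simp: whirl_def y algebra_simps)
    next
      case 3
      have e: "r + 2 - 1 - (K + 1) = r - K" "r + 2 - 1 = r + 1" by simp_all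
      show ?thesis unfolding p 3 u_mat_mult_left u_mat_mult_right e using xK q
        by (auto simp: whirl_def y algebra_simps)
    next
      case 4
      then show ?thesis unfolding p u_mat_mult_left u_mat_mult_right by (simp add: whirl_def)
    qed
  qed
qed

text \<open>The exchange relation is iterated: the factor leaving component j enters component j +
  1. The incoming parameter has to be (q - 1) times a coordinate, and this forces q to be a ratio of
  \<open>chain\<close> values.\<close>

lemma whirl_prod_X_move:
  assumes n: "n > 1" and x: "x \<in> torus n m" and nz: "\<And>j. 1 \<le> j \<Longrightarrow> j \<le> m \<Longrightarrow> chain k a x j \<noteq> 0"
    and j: "j \<le> m"
  shows "whirl_prod j (X_move n k a x) \<odot> u_mat n (k + int j) (a * corner x j (k + 1) / (corner x j k * chain k a x j)) =
    u_mat n k a \<odot> whirl_prod j x"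
  using j
proof (induction j)
  case 0
  show ?case
    unfolding corner_0 chain_0
    by (rule ext) (auto simp: split_beta u_mat_mult_left u_mat_mult_right whirl_prod.simps(1) algebra_simps)
next
  case (Suc j)
  let ?b = "\<lambda>j. a * corner x j (k + 1) / (corner x j k * chain k a x j)"
  let ?q = "chain k a x (Suc j) / chain k a x j"
  have nz': "chain k a x j \<noteq> 0" "chain k a x (Suc j) \<noteq> 0" using nz[of j] nz[of "Suc j"] Suc.prems by (cases j; simp)+
  have A: "corner x j k \<noteq> 0" using corner_nonzero[OF x] Suc.prems by simp
  have p: "x (Suc j, k + int j) \<noteq> 0" using torus_nonzero[OF x] Suc.prems by simp
  \<comment> \<open>The increment of \<open>chain\<close> yields both the parameter entering the
    component (\<open>b0\<close>) and the one leaving it (\<open>b1\<close>).\<close>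
  have diff: "chain k a x (Suc j) - chain k a x j = a * corner x j (k + 1) / (corner x j k * x (Suc j, k + int j))"
    unfolding chain_def corner_Suc subcorner_Suc using A p by (simp add: field_simps)
  have b0: "(?q - 1) * x (Suc j, k + int j) = ?b j"
  proof -
    have "(?q - 1) * x (Suc j, k + int j) = (chain k a x (Suc j) - chain k a x j) * x (Suc j, k + int j) / chain k a x j"
      using nz' by (simp add: field_simps)
    then show ?thesis unfolding diff using A p nz' by (simp add: field_simps)
  qed
  have b1: "(1 - inverse ?q) * x (Suc j, k + int j + 1) = ?b (Suc j)"
  proof -
    have "(1 - inverse ?q) * x (Suc j, k + int j + 1) =
      (chain k a x (Suc j) - chain k a x j) * x (Suc j, k + int j + 1) / chain k a x (Suc j)"
      using nz' by (simp add: field_simps)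
    then show ?thesis unfolding diff corner_Suc using A p nz' by (simp add: field_simps)
  qed
  have K: "k + int (Suc j) = k + int j + 1" by simp
  have blk: "whirl (block (X_move n k a x) (Suc j)) \<odot> u_mat n (k + int j + 1) (?b (Suc j)) =
    u_mat n (k + int j) (?b j) \<odot> whirl (block x (Suc j))"
  proof -
    have "whirl (block (X_move n k a x) (Suc j)) \<odot>
        u_mat n (k + int j + 1) ((1 - inverse ?q) * block x (Suc j) (k + int j + 1)) =
      u_mat n (k + int j) ((?q - 1) * block x (Suc j) (k + int j)) \<odot> whirl (block x (Suc j))"
    proof (rule whirl_u_mat[OF n])
      show "block x (Suc j) (r + int n) = block x (Suc j) r" for r
        by (simp add: block_def torus_periodic[OF x])
      show "?q \<noteq> 0" using nz' by simp
      have e: "k + int (Suc j) - 1 = k + int j" "k + int (Suc j) = k + int j + 1" "Suc j - 1 = j" by simp_all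
      show "block (X_move n k a x) (Suc j) r =
        (if int n dvd r - (k + int j) then ?q * block x (Suc j) r
         else if int n dvd r - (k + int j + 1) then inverse ?q * block x (Suc j) r
         else block x (Suc j) r)" for r
        unfolding block_def X_move_def prod.case e by simp
    qed
    then show ?thesis unfolding b0[symmetric] b1[symmetric] by (simp add: block_def)
  qed
  have "whirl_prod (Suc j) (X_move n k a x) \<odot> u_mat n (k + int (Suc j)) (?b (Suc j)) =
    whirl_prod j (X_move n k a x) \<odot> (whirl (block (X_move n k a x) (Suc j)) \<odot> u_mat n (k + int j + 1) (?b (Suc j)))"
    unfolding K whirl_prod.simps(2) by (intro mat_mult_assoc upper_whirl_prod upper_whirl upper_u_mat)
  also have "\<dots> = whirl_prod j (X_move n k a x) \<odot> u_mat n (k + int j) (?b j) \<odot> whirl (block x (Suc j))"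
    unfolding blk by (intro mat_mult_assoc[symmetric] upper_whirl_prod upper_whirl upper_u_mat)
  also have "\<dots> = u_mat n k a \<odot> whirl_prod j x \<odot> whirl (block x (Suc j))"
    using Suc by simp
  also have "\<dots> = u_mat n k a \<odot> whirl_prod (Suc j) x"
    unfolding whirl_prod.simps(2) by (intro mat_mult_assoc upper_whirl_prod upper_whirl upper_u_mat)
  finally show ?case .
qed

text \<open>The initial parameter (c - 1) \<phi> is chosen to make this true; the parameters of the
  components then multiply to c.\<close>

lemma chain_last:
  assumes "x \<in> torus n m" "subcorner x m k \<noteq> 0"
  shows "chain k ((c - 1) * (corner x m k / subcorner x m k)) x m = c"
  using assms corner_nonzero[OF assms(1), of m k] by (simp add: chain_def)

lemma u_mat_cancel: "n > 1 \<Longrightarrow> W \<odot> u_mat n k b = Z \<Longrightarrow> upper W \<Longrightarrow> W = Z \<odot> u_mat n k (- b)"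
proof -
  assume a: "n > 1" "W \<odot> u_mat n k b = Z" "upper W"
  have "Z \<odot> u_mat n k (- b) = W \<odot> u_mat n k (b + - b)"
    using a u_mat_add[OF a(1), of k b "- b"] mat_mult_assoc[OF a(3) upper_u_mat upper_u_mat] by metis
  also have "\<dots> = W" by (rule ext) (auto simp: split_beta u_mat_mult_right)
  finally show "W = Z \<odot> u_mat n k (- b)" by simp
qed

lemma whirl_prod_X_move_last:
  assumes n: "n > 1" and x: "x \<in> torus n m" and s: "subcorner x m k \<noteq> 0" and c: "c \<noteq> 0"
    and a: "a = (c - 1) * (corner x m k / subcorner x m k)"
    and nz: "\<And>j. 1 \<le> j \<Longrightarrow> j \<le> m \<Longrightarrow> chain k a x j \<noteq> 0"
  shows "whirl_prod m (X_move n k a x) = U_act n m k c (whirl_prod m x)"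
proof -
  let ?b = "a * corner x m (k + 1) / (corner x m k * chain k a x m)"
  have "whirl_prod m (X_move n k a x) = u_mat n k a \<odot> whirl_prod m x \<odot> u_mat n (k + int m) (- ?b)"
    by (rule u_mat_cancel[OF n whirl_prod_X_move[OF n x nz order_refl] upper_whirl_prod])
  \<comment> \<open>Since \<open>chain\<close> ends at c, the factor left over on the right has
    exactly the parameter (1/c - 1) \<epsilon> of the operator on U.\<close>
  also have "- ?b = (inverse c - 1) * (corner x m (k + 1) / subcorner x m k)"
    using chain_last[OF x s, of c] s c corner_nonzero[OF x order_refl, of k] by (simp add: a field_simps)
  finally show ?thesis unfolding U_act_eq a .
qed

lemma X_move_torus:
  assumes "x \<in> torus n m" and nz: "\<And>j. 1 \<le> j \<Longrightarrow> j \<le> m \<Longrightarrow> chain k a x j \<noteq> 0"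
  shows "X_move n k a x \<in> torus n m"
  unfolding torus_def
proof (intro CollectI allI)
  fix i r
  have d: "int n dvd r + int n - (k + int i - 1) \<longleftrightarrow> int n dvd r - (k + int i - 1)"
    "int n dvd r + int n - (k + int i) \<longleftrightarrow> int n dvd r - (k + int i)"
    by (auto intro!: dvd_diff_cong)
  have nz': "1 \<le> i \<Longrightarrow> i \<le> m \<Longrightarrow> chain k a x i \<noteq> 0 \<and> chain k a x (i - 1) \<noteq> 0"
    using nz[of i] nz[of "i - 1"] by (cases "i = 1") auto
  show "if 1 \<le> i \<and> i \<le> m then X_move n k a x (i, r) \<noteq> 0 \<and> X_move n k a x (i, r + int n) = X_move n k a x (i, r)
    else X_move n k a x (i, r) = 0"
    unfolding X_move_def prod.case d torus_periodic[OF assms(1)]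
    using nz' torus_nonzero[OF assms(1), of i r] torus_zero[OF assms(1), of i r] by auto
qed

lemma norm_prod_X_move:
  assumes n: "n > 1" and x: "x \<in> torus n m" and nz: "\<And>j. 1 \<le> j \<Longrightarrow> j \<le> m \<Longrightarrow> chain k a x j \<noteq> 0"
    and i: "1 \<le> i" "i \<le> m"
  shows "norm_prod n (X_move n k a x) i = norm_prod n x i"
proof -
  \<comment> \<open>A window starting at this residue has the two rescaled coordinates as its first
    two members; their scaling factors are inverse to each other.\<close>
  let ?K = "k + int i - 1" and ?y = "X_move n k a x"
  have nz': "chain k a x i \<noteq> 0" "chain k a x (i - 1) \<noteq> 0"
    using nz[of i] nz[of "i - 1"] i by (cases "i = 1"; auto)+
  have s: "{..<n} = insert 0 (insert 1 {2..<n})" using n by auto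
  have big: "?y (i, ?K + int l) = x (i, ?K + int l)" if "l \<in> {2..<n}" for l
  proof -
    have "\<not> int n dvd int l" "\<not> int n dvd int l - 1"
      using that by (auto dest: zdvd_imp_le)
    then show ?thesis by (simp add: X_move_def)
  qed
  have nd: "\<not> int n dvd 1" using n by (auto dest: zdvd_imp_le)
  have "norm_prod n ?y i = (\<Prod>l<n. ?y (i, ?K + int l))"
    using norm_prod_window[OF X_move_torus[OF x nz] i] by simp
  also have "\<dots> = ?y (i, ?K) * (?y (i, ?K + 1) * (\<Prod>l\<in>{2..<n}. ?y (i, ?K + int l)))"
    unfolding s by simp
  also have "(\<Prod>l\<in>{2..<n}. ?y (i, ?K + int l)) = (\<Prod>l\<in>{2..<n}. x (i, ?K + int l))"
    by (rule prod.cong[OF refl big])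
  also have "?y (i, ?K) * (?y (i, ?K + 1) * (\<Prod>l\<in>{2..<n}. x (i, ?K + int l))) =
    x (i, ?K) * (x (i, ?K + 1) * (\<Prod>l\<in>{2..<n}. x (i, ?K + int l)))"
    using nz' nd by (simp add: X_move_def)
  also have "\<dots> = (\<Prod>l<n. x (i, ?K + int l))" unfolding s by simp
  also have "\<dots> = norm_prod n x i" by (rule norm_prod_window[OF x i])
  finally show ?thesis .
qed

text \<open>The points at which all denominators of the iterated product rule are nonzero, one for
  each partial product.\<close>

definition X_domain :: "nat \<Rightarrow> nat \<Rightarrow> int \<Rightarrow> (nat \<times> int) pt set" where
  "X_domain n m k = {x \<in> torus n m. \<forall>j\<in>{1..m}. subcorner x j k \<noteq> 0}"

definition X_param :: "nat \<Rightarrow> int \<Rightarrow> complex \<Rightarrow> (nat \<times> int) pt \<Rightarrow> complex" where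
  "X_param m k c x = (c - 1) * (corner x m k / subcorner x m k)"

text \<open>A closed form of the iterated product in terms of partial products of whirls. It is
  proved equal to \<open>X_crystal n m\<close>, domains included, so that nested
  \<open>transport\<close> and \<open>prod_crystal\<close> can be forgotten.\<close>

definition X_explicit :: "nat \<Rightarrow> nat \<Rightarrow> (nat \<times> int) crystal" where
  "X_explicit n m =
     \<lparr> points = torus n m,
       eps = (\<lambda>k x. if x \<in> X_domain n m k then Some (corner x m (k + 1) / subcorner x m k) else None),
       phi = (\<lambda>k x. if x \<in> X_domain n m k then Some (corner x m k / subcorner x m k) else None),
       act = (\<lambda>k c x. if c \<noteq> 0 \<and> x \<in> X_domain n m k \<and> (\<forall>j\<in>{1..m}. chain k (X_param m k c x) x j \<noteq> 0)
         then Some (X_move n k (X_param m k c x) x) else None) \<rparr>"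

section \<open>Identification of the iterated product with its closed form\<close>

lemma transport_inverse:
  assumes "\<forall>x\<in>points C. h (f x) = x"
  shows "points (transport f C) = f ` points C"
    and "eps (transport f C) = (\<lambda>k y. if y \<in> f ` points C then eps C k (h y) else None)"
    and "phi (transport f C) = (\<lambda>k y. if y \<in> f ` points C then phi C k (h y) else None)"
    and "act (transport f C) = (\<lambda>k c y. if y \<in> f ` points C then map_option f (act C k c (h y)) else None)"
proof -
  have "inj_on f (points C)" using assms by (metis inj_onI)
  then have i: "y \<in> f ` points C \<Longrightarrow> inv_into (points C) f y = h y" for y
    using assms by (auto simp: inv_into_f_f)
  show "points (transport f C) = f ` points C"
    "eps (transport f C) = (\<lambda>k y. if y \<in> f ` points C then eps C k (h y) else None)"
    "phi (transport f C) = (\<lambda>k y. if y \<in> f ` points C then phi C k (h y) else None)"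
    "act (transport f C) = (\<lambda>k c y. if y \<in> f ` points C then map_option f (act C k c (h y)) else None)"
    by (auto simp: transport_def Let_def restrict_map_def i intro!: ext)
qed

lemma X_crystal_1: "X_crystal n (Suc 0) = X_explicit n (Suc 0)"
proof -
  let ?f = "\<lambda>y :: int \<Rightarrow> complex. \<lambda>(i :: nat, r). if i = 1 then y r else 0"
  let ?B = "basic_crystal n 1"
  define h :: "(nat \<times> int) pt \<Rightarrow> int \<Rightarrow> complex" where "h x = (\<lambda>r. x (1, r))" for x
  have hf: "\<forall>y\<in>points ?B. h (?f y) = y" by (simp add: h_def)
  note tr = transport_inverse[of ?B h ?f, OF hf]
  have B: "points ?B = {x. \<forall>r. x r \<noteq> 0 \<and> x (r + int n) = x r}"
    by (simp add: basic_crystal_def Let_def)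
  have im: "?f ` points ?B = torus n 1"
  proof
    show "?f ` points ?B \<subseteq> torus n 1" unfolding B by (auto simp: torus_def)
    show "torus n 1 \<subseteq> ?f ` points ?B"
    proof
      fix x assume x: "x \<in> torus n 1"
      have "x = ?f (h x)" using torus_zero[OF x] by (auto simp: h_def)
      moreover have "h x \<in> points ?B"
        using torus_nonzero[OF x] torus_periodic[OF x] unfolding B by (auto simp: h_def)
      ultimately show "x \<in> ?f ` points ?B" by blast
    qed
  qed
  have hB: "h x \<in> points ?B" if "x \<in> torus n 1" for x
    using torus_nonzero[OF that] torus_periodic[OF that] unfolding B by (auto simp: h_def)
  have sub: "subcorner x 1 k = 1" and cor: "corner x 1 k = x (1, k)" for x k
    using subcorner_Suc[where j = 0] corner_Suc[where j = 0] by simp_all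
  have dom: "X_domain n 1 k = torus n 1" for k
    using sub by (auto simp: X_domain_def)
  have chain: "chain k (X_param 1 k c x) x 1 = c" if "x \<in> torus n 1" for k c x
    unfolding X_param_def using chain_last[OF that, of k c] sub by simp
  have e: "eps ?B k y = Some (y (k + 1))" "phi ?B k y = Some (y k)" if "y \<in> points ?B" for k y
    using that unfolding B by (simp_all add: basic_crystal_def Let_def)
  have a: "act ?B k c y = (if c = 0 then None else Some (\<lambda>r. if int n dvd r - k then c * y r
     else if int n dvd r - (k + 1) then inverse c * y r else y r))" if "y \<in> points ?B" for k c y
  proof -
    have "k + int 1 - 1 = k" "k + int 1 = k + 1" by simp_all
    then show ?thesis using that unfolding B
      by (simp add: basic_crystal_def Let_def restrict_map_def cong: if_cong)
  qed
  have mv: "X_move n k (X_param 1 k c x) x = ?f (\<lambda>r. if int n dvd r - k then c * h x r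
     else if int n dvd r - (k + 1) then inverse c * h x r else h x r)" if "x \<in> torus n 1" for x k c
  proof (rule ext)
    fix p :: "nat \<times> int"
    obtain i r where p: "p = (i, r)" by fastforce
    show "X_move n k (X_param 1 k c x) x p = ?f (\<lambda>r. if int n dvd r - k then c * h x r
     else if int n dvd r - (k + 1) then inverse c * h x r else h x r) p"
    proof (cases "i = 1")
      case True
      then show ?thesis using chain[OF that] by (simp add: p X_move_def h_def divide_inverse)
    next
      case False
      then have "x (i, r) = 0" using torus_zero[OF that, of i r] by auto
      then show ?thesis using False by (simp add: p X_move_def)
    qed
  qed
  have "points (X_crystal n (Suc 0)) = points (X_explicit n (Suc 0))"
    unfolding X_crystal.simps tr(1) im by (simp add: X_explicit_def)
  moreover have "eps (X_crystal n (Suc 0)) = eps (X_explicit n (Suc 0))"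
    unfolding X_crystal.simps tr(2) im
    using dom e(1)[OF hB] sub cor by (auto simp: X_explicit_def h_def intro!: ext)
  moreover have "phi (X_crystal n (Suc 0)) = phi (X_explicit n (Suc 0))"
    unfolding X_crystal.simps tr(3) im
    using dom e(2)[OF hB] sub cor by (auto simp: X_explicit_def h_def intro!: ext)
  moreover have "act (X_crystal n (Suc 0)) = act (X_explicit n (Suc 0))"
    unfolding X_crystal.simps tr(4) im
    using dom a[OF hB] chain mv by (auto simp: X_explicit_def intro!: ext)
  ultimately show ?thesis by simp
qed

lemma X_crystal_Suc_Suc:
  assumes IH: "X_crystal n (Suc m) = X_explicit n (Suc m)"
  shows "X_crystal n (Suc (Suc m)) = X_explicit n (Suc (Suc m))"
proof -
  define M where "M = Suc m"
  let ?f = "\<lambda>z :: nat \<times> int + int \<Rightarrow> complex. \<lambda>(i, r). if i = Suc M then z (Inr r) else z (Inl (i, r))"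
  let ?A = "X_explicit n M" and ?B = "basic_crystal n (Suc M)"
  let ?P = "prod_crystal ?A ?B"
  define tr where "tr x = (\<lambda>(i, r). if i \<le> M then x (i, r) else 0)" for x :: "(nat \<times> int) pt"
  define h where "h x = case_sum (tr x) (block x (Suc M))" for x
  have B: "points ?B = {x. \<forall>r. x r \<noteq> 0 \<and> x (r + int n) = x r}"
    by (simp add: basic_crystal_def Let_def)
  have A: "points ?A = torus n M" by (simp add: X_explicit_def)
  have P: "points ?P = {case_sum x x' | x x'. x \<in> torus n M \<and> x' \<in> points ?B}"
    by (simp add: prod_crystal_def Let_def A)
  have PE: "\<exists>x x'. z = case_sum x x' \<and> x \<in> torus n M \<and> x' \<in> points ?B" if "z \<in> points ?P" for z
    using that unfolding P by (elim CollectE)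
  have hf: "h (?f z) = z" if "z \<in> points ?P" for z
  proof -
    from PE[OF that] obtain x x' where z: "z = case_sum x x'" "x \<in> torus n M" by (elim exE conjE)
    have "tr (?f z) = x" using torus_zero[OF z(2)] by (auto simp: tr_def z)
    moreover have "block (?f z) (Suc M) = x'" by (auto simp: block_def z)
    ultimately show ?thesis by (simp add: h_def z)
  qed
  have trT: "tr x \<in> torus n M" if "x \<in> torus n (Suc M)" for x
    using torus_nonzero[OF that] torus_zero[OF that] torus_periodic[OF that]
    by (auto simp: torus_def tr_def)
  have blB: "block x (Suc M) \<in> points ?B" if "x \<in> torus n (Suc M)" for x
    using torus_nonzero[OF that] torus_periodic[OF that] by (auto simp: B block_def)
  have fh: "?f (h x) = x" if "x \<in> torus n (Suc M)" for x
    using torus_zero[OF that] by (auto simp: h_def tr_def block_def)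
  have im: "?f ` points ?P = torus n (Suc M)"
  proof
    show "?f ` points ?P \<subseteq> torus n (Suc M)"
    proof
      fix w assume "w \<in> ?f ` points ?P"
      then obtain z where wz: "w = ?f z" and z: "z \<in> points ?P" by (elim imageE)
      from PE[OF z] obtain x x' where z': "z = case_sum x x'" and x: "x \<in> torus n M" and x': "x' \<in> points ?B"
        by (elim exE conjE)
      note w = wz[unfolded z']
      show "w \<in> torus n (Suc M)"
        using torus_nonzero[OF x] torus_zero[OF x] torus_periodic[OF x] x'
        unfolding w torus_def B by auto
    qed
    show "torus n (Suc M) \<subseteq> ?f ` points ?P"
    proof
      fix x assume x: "x \<in> torus n (Suc M)"
      have "h x \<in> points ?P"
        unfolding P h_def
        by (rule CollectI, rule exI, rule exI, rule conjI[OF refl conjI[OF trT[OF x] blB[OF x]]])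
      then show "x \<in> ?f ` points ?P" by (rule image_eqI[rotated]) (rule fh[OF x, symmetric])
    qed
  qed
  have W: "whirl_prod j (tr x) = whirl_prod j x" if "j \<le> M" for j x
    by (rule whirl_prod_cong) (use that in \<open>auto simp: tr_def\<close>)
  have eB: "eps ?B k y = Some (y (k + int (Suc M)))" "phi ?B k y = Some (y (k + int M))" if "y \<in> points ?B" for k y
    using that unfolding B by (simp_all add: basic_crystal_def Let_def)
  have aB: "act ?B k c y = (if c = 0 then None else Some (\<lambda>r. if int n dvd r - (k + int M) then c * y r
     else if int n dvd r - (k + int (Suc M)) then inverse c * y r else y r))" if "y \<in> points ?B" for k c y
    using that unfolding B by (simp add: basic_crystal_def Let_def)
  \<comment> \<open>The denominator of the outermost product is \<open>subcorner\<close> for Suc M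
    over \<open>subcorner\<close> for M, so it accounts for the one new condition.\<close>
  have dom: "x \<in> X_domain n (Suc M) k \<longleftrightarrow> tr x \<in> X_domain n M k \<and>
      x (Suc M, k + int M) + corner x M (k + 1) / subcorner x M k \<noteq> 0" if x: "x \<in> torus n (Suc M)" for x k
  proof -
    have "tr x \<in> X_domain n M k \<longleftrightarrow> (\<forall>j\<in>{1..M}. subcorner x j k \<noteq> 0)"
      using trT[OF x] W by (auto simp: X_domain_def)
    moreover have "M \<in> {1..M}" by (simp add: M_def)
    moreover have "subcorner x (Suc M) k \<noteq> 0 \<longleftrightarrow> x (Suc M, k + int M) + corner x M (k + 1) / subcorner x M k \<noteq> 0"
      if "subcorner x M k \<noteq> 0"
      unfolding subcorner_Suc using that by (simp add: field_simps)
    ultimately show ?thesis using x by (auto simp: X_domain_def atLeastAtMostSuc_conv)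
  qed
  have eA: "eps ?A k (tr x) = (if tr x \<in> X_domain n M k then Some (corner x M (k + 1) / subcorner x M k) else None)"
    "phi ?A k (tr x) = (if tr x \<in> X_domain n M k then Some (corner x M k / subcorner x M k) else None)" for x k
    by (simp_all add: X_explicit_def W)
  have sM: "subcorner x M k \<noteq> 0" if "tr x \<in> X_domain n M k" for x k
  proof -
    have "M \<in> {1..M}" by (simp add: M_def)
    then have "subcorner (tr x) M k \<noteq> 0" using that unfolding X_domain_def by blast
    then show ?thesis by (simp add: W)
  qed
  have eP: "eps ?P k (h x) = (if x \<in> X_domain n (Suc M) k then Some (corner x (Suc M) (k + 1) / subcorner x (Suc M) k) else None)"
    and pP: "phi ?P k (h x) = (if x \<in> X_domain n (Suc M) k then Some (corner x (Suc M) k / subcorner x (Suc M) k) else None)"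
    if x: "x \<in> torus n (Suc M)" for x k
  proof -
    let ?e = "corner x M (k + 1) / subcorner x M k" and ?p = "x (Suc M, k + int M)"
    have v: "(\<lambda>i. h x (Inl i)) = tr x" "(\<lambda>i. h x (Inr i)) = block x (Suc M)" by (simp_all add: h_def)
    have "eps ?P k (h x) = (if x \<in> X_domain n (Suc M) k then Some (?e * x (Suc M, k + int (Suc M)) / (?p + ?e)) else None)"
      unfolding dom[OF x] using eA[of k x] eB[OF blB[OF x]]
      by (simp add: prod_crystal_def Let_def pdiv_def pmult_def padd_def v block_def)
    moreover have "?e * x (Suc M, k + int (Suc M)) / (?p + ?e) = corner x (Suc M) (k + 1) / subcorner x (Suc M) k"
      if "x \<in> X_domain n (Suc M) k"
      using sM[of x k] that dom[OF x, of k] unfolding corner_Suc subcorner_Suc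
      by (simp add: field_simps)
    ultimately show "eps ?P k (h x) = (if x \<in> X_domain n (Suc M) k then Some (corner x (Suc M) (k + 1) / subcorner x (Suc M) k) else None)"
      by simp
    have "phi ?P k (h x) = (if x \<in> X_domain n (Suc M) k then Some (corner x M k / subcorner x M k * ?p / (?e + ?p)) else None)"
      unfolding dom[OF x] using eA[of k x] eB[OF blB[OF x]]
      by (simp add: prod_crystal_def Let_def pdiv_def pmult_def padd_def v block_def add.commute)
    moreover have "corner x M k / subcorner x M k * ?p / (?e + ?p) = corner x (Suc M) k / subcorner x (Suc M) k"
      if "x \<in> X_domain n (Suc M) k"
      using sM[of x k] that dom[OF x, of k] unfolding corner_Suc subcorner_Suc
      by (simp add: field_simps)
    ultimately show "phi ?P k (h x) = (if x \<in> X_domain n (Suc M) k then Some (corner x (Suc M) k / subcorner x (Suc M) k) else None)"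
      by simp
  qed
  have aP: "map_option ?f (act ?P k c (h x)) =
      (if c \<noteq> 0 \<and> x \<in> X_domain n (Suc M) k \<and> (\<forall>j\<in>{1..Suc M}. chain k (X_param (Suc M) k c x) x j \<noteq> 0)
         then Some (X_move n k (X_param (Suc M) k c x) x) else None)"
    if x: "x \<in> torus n (Suc M)" for x k c
  proof (cases "x \<in> X_domain n (Suc M) k")
    case False
    have v: "(\<lambda>i. h x (Inl i)) = tr x" "(\<lambda>i. h x (Inr i)) = block x (Suc M)" by (simp_all add: h_def)
    show ?thesis
      using False eA[of k x] eB[OF blB[OF x]] unfolding dom[OF x]
      by (simp add: prod_crystal_def Let_def v block_def)
  next
    case True
    let ?e = "corner x M (k + 1) / subcorner x M k" and ?p = "x (Suc M, k + int M)"
    let ?cp = "(c * ?p + ?e) / (?p + ?e)"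
    have v: "(\<lambda>i. h x (Inl i)) = tr x" "(\<lambda>i. h x (Inr i)) = block x (Suc M)" by (simp_all add: h_def)
    have D: "tr x \<in> X_domain n M k" "?p + ?e \<noteq> 0" using True dom[OF x] by auto
    \<comment> \<open>With c^+ from the product rule, (c^+ - 1) \<phi> of the first M components
      equals (c - 1) \<phi> of all of them. Hence both levels share one initial parameter, and their
      \<open>chain\<close> values coincide.\<close>
    have par: "X_param M k ?cp (tr x) = X_param (Suc M) k c x"
    proof -
      have s: "subcorner x (Suc M) k = subcorner x M k * (?p + ?e)"
        unfolding subcorner_Suc using sM[OF D(1)] by (simp add: field_simps)
      have "(c * p + e) / (p + e) - 1 = (c - 1) * p / (p + e)" if "p + e \<noteq> 0" for p e
        using that by (simp add: field_simps)
      from this[OF D(2)] have "?cp - 1 = (c - 1) * ?p / (?p + ?e)" .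
      then have "X_param M k ?cp (tr x) = (c - 1) * ?p / (?p + ?e) * (corner x M k / subcorner x M k)"
        by (simp add: X_param_def W)
      also have "\<dots> = (c - 1) * (corner x M k * ?p / (subcorner x M k * (?p + ?e)))"
        by (simp add: mult_ac)
      finally show ?thesis unfolding X_param_def s corner_Suc .
    qed
    define a where "a = X_param (Suc M) k c x"
    have ch: "chain k a (tr x) j = chain k a x j" if "j \<le> M" for j by (simp add: chain_def W that)
    have xM: "x \<in> torus n (Suc M)" "subcorner x (Suc M) k \<noteq> 0" using x True by (auto simp: X_domain_def)
    \<comment> \<open>So \<open>chain\<close> equals c^+ after M components and c after all, and the
      new component is moved with c / c^+.\<close>
    have chM: "chain k a x M = ?cp" "chain k a x (Suc M) = c"
    proof -
      have "subcorner (tr x) M k \<noteq> 0" using sM[OF D(1)] by (simp add: W)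
      then have "chain k (X_param M k ?cp (tr x)) (tr x) M = ?cp"
        unfolding X_param_def by (rule chain_last[OF trT[OF x]])
      then show "chain k a x M = ?cp" unfolding par a_def[symmetric] ch[OF order_refl] .
      show "chain k a x (Suc M) = c" unfolding a_def X_param_def by (rule chain_last[OF xM])
    qed
    have M1: "M \<in> {1..M}" by (simp add: M_def)
    have "act ?P k c (h x) = (do {
          y \<leftarrow> act ?A k ?cp (tr x);
          y' \<leftarrow> act ?B k (c / ?cp) (block x (Suc M));
          Some (case_sum y y')
        })"
      using D eA[of k x] eB[OF blB[OF x]]
      by (simp add: prod_crystal_def Let_def v block_def)
    also have "act ?A k ?cp (tr x) = (if \<forall>j\<in>{1..M}. chain k a x j \<noteq> 0 then Some (X_move n k a (tr x)) else None)"
      using D(1) chM(1) M1 by (auto simp: X_explicit_def par a_def[symmetric] ch)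
    also have "act ?B k (c / ?cp) (block x (Suc M)) = (if c / ?cp = 0 then None else
        Some (\<lambda>r. X_move n k a x (Suc M, r)))"
      unfolding aB[OF blB[OF x]] unfolding chM(1)[symmetric] using chM(2)
      by (auto simp: X_move_def block_def intro!: ext)
    finally have e: "act ?P k c (h x) = (if (\<forall>j\<in>{1..M}. chain k a x j \<noteq> 0) \<and> c / ?cp \<noteq> 0
      then Some (case_sum (X_move n k a (tr x)) (\<lambda>r. X_move n k a x (Suc M, r))) else None)"
      by auto
    \<comment> \<open>For c^+ = 0 the quotient \<open>c / ?cp\<close> is 0 by convention and the
      move is undefined on both sides; exact equality of the domains depends on this case.\<close>
    have cond: "(\<forall>j\<in>{1..M}. chain k a x j \<noteq> 0) \<and> c / ?cp \<noteq> 0 \<longleftrightarrow>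
      c \<noteq> 0 \<and> (\<forall>j\<in>{1..Suc M}. chain k a x j \<noteq> 0)"
      unfolding chM(1)[symmetric] using chM(2) M1 by (auto simp: atLeastAtMostSuc_conv)
    have "?f (case_sum (X_move n k a (tr x)) (\<lambda>r. X_move n k a x (Suc M, r))) = X_move n k a x"
    proof (rule ext)
      fix p :: "nat \<times> int"
      obtain i r where p: "p = (i, r)" by fastforce
      consider "i = Suc M" | "i \<le> M" | "i > Suc M" by linarith
      then show "?f (case_sum (X_move n k a (tr x)) (\<lambda>r. X_move n k a x (Suc M, r))) p = X_move n k a x p"
      proof cases
        case 2
        then have "tr x (i, r) = x (i, r)" "i \<noteq> Suc M" by (auto simp: tr_def)
        then show ?thesis using ch[of i] ch[of "i - 1"] 2 by (simp add: p X_move_def)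
      next
        case 3
        then have "tr x (i, r) = 0" "x (i, r) = 0" "i \<noteq> Suc M" using torus_zero[OF x, of i r] by (auto simp: tr_def)
        then show ?thesis by (simp add: p X_move_def)
      qed (simp add: p)
    qed
    then show ?thesis using True e unfolding a_def[symmetric] cond by simp
  qed
  define F P where "F = ?f" and "P = ?P"
  note im' = im[folded F_def P_def] and eP' = eP[folded P_def] and pP' = pP[folded P_def]
    and aP' = aP[folded F_def P_def]
  have hF: "\<forall>z\<in>points P. h (F z) = z"
    using hf unfolding F_def P_def by (intro ballI)
  note t = transport_inverse[of P h F, OF hF]
  have Xs: "X_crystal n (Suc (Suc m)) = transport F P"
    unfolding F_def P_def using IH by (simp add: M_def)
  have Xe: "x \<in> X_domain n (Suc M) k \<Longrightarrow> x \<in> torus n (Suc M)" for x k by (simp add: X_domain_def)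
  have "points (X_crystal n (Suc (Suc m))) = points (X_explicit n (Suc M))"
  proof -
    have "points (X_explicit n (Suc M)) = torus n (Suc M)" by (simp add: X_explicit_def)
    then show ?thesis unfolding Xs using t(1) im' by simp
  qed
  moreover have "eps (X_crystal n (Suc (Suc m))) = eps (X_explicit n (Suc M))"
    unfolding Xs t(2) im' using eP' Xe by (auto simp: X_explicit_def intro!: ext)
  moreover have "phi (X_crystal n (Suc (Suc m))) = phi (X_explicit n (Suc M))"
    unfolding Xs t(3) im' using pP' Xe by (auto simp: X_explicit_def intro!: ext)
  moreover have "act (X_crystal n (Suc (Suc m))) = act (X_explicit n (Suc M))"
  proof (intro ext)
    fix k c x
    show "act (X_crystal n (Suc (Suc m))) k c x = act (X_explicit n (Suc M)) k c x"
    proof (cases "x \<in> torus n (Suc M)")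
      case True
      then show ?thesis unfolding Xs t(4) im' using aP'[OF True, of k c] by (simp add: X_explicit_def)
    next
      case False
      then show ?thesis unfolding Xs t(4) im' using Xe by (auto simp: X_explicit_def)
    qed
  qed
  ultimately show ?thesis by (simp add: M_def)
qed

lemma X_crystal_explicit: "m \<ge> 1 \<Longrightarrow> X_crystal n m = X_explicit n m"
proof (induction m rule: nat_induct_at_least)
  case base
  then show ?case using X_crystal_1 by simp
next
  case (Suc m)
  then obtain m' where "m = Suc m'" by (cases m) auto
  then show ?case using Suc X_crystal_Suc_Suc by simp
qed

section \<open>Transfer of the crystal axioms along the product of whirls\<close>

lemma X_act_U:
  assumes n: "n > 1" and "act (X_explicit n m) k c x = Some x'" and m: "m \<ge> 1"
  shows "x \<in> torus n m" "x' \<in> torus n m" "act (U_crystal n m) k c (whirl_prod m x) = Some (whirl_prod m x')"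
    "\<And>i. 1 \<le> i \<Longrightarrow> i \<le> m \<Longrightarrow> norm_prod n x' i = norm_prod n x i"
proof -
  have h: "c \<noteq> 0" "x \<in> X_domain n m k" "\<And>j. 1 \<le> j \<Longrightarrow> j \<le> m \<Longrightarrow> chain k (X_param m k c x) x j \<noteq> 0"
    "x' = X_move n k (X_param m k c x) x"
    using assms(2) by (auto simp: X_explicit_def split: if_splits)
  show x: "x \<in> torus n m" using h(2) by (simp add: X_domain_def)
  show "x' \<in> torus n m" unfolding h(4) by (rule X_move_torus[OF x h(3)])
  have s: "subcorner x m k \<noteq> 0" using h(2) m by (simp add: X_domain_def)
  have "whirl_prod m x' = U_act n m k c (whirl_prod m x)"
    unfolding h(4) by (rule whirl_prod_X_move_last[OF n x s h(1) X_param_def h(3)])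
  then show "act (U_crystal n m) k c (whirl_prod m x) = Some (whirl_prod m x')"
    using h(1) whirl_prod_U_le[OF x] s by (simp add: U_crystal_act sub_entry_def)
  show "norm_prod n x' i = norm_prod n x i" if "1 \<le> i" "i \<le> m" for i
    unfolding h(4) by (rule norm_prod_X_move[OF n x h(3) that])
qed

lemma X_eps_U:
  assumes "m \<ge> 1" "eps (X_explicit n m) k x = Some v"
  shows "eps (U_crystal n m) k (whirl_prod m x) = Some v"
  using assms whirl_prod_U_le[of x n m]
  by (auto simp: X_explicit_def U_crystal_eps X_domain_def top_entry_def sub_entry_def algebra_simps split: if_splits)

lemma X_phi_U:
  assumes "m \<ge> 1" "phi (X_explicit n m) k x = Some v"
  shows "phi (U_crystal n m) k (whirl_prod m x) = Some v"
  using assms whirl_prod_U_le[of x n m]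
  by (auto simp: X_explicit_def U_crystal_phi X_domain_def top_entry_def sub_entry_def split: if_splits)

lemma X_gam_U:
  assumes "m \<ge> 1" "gam (X_explicit n m) k x = Some v"
  shows "gam (U_crystal n m) k (whirl_prod m x) = Some v"
proof -
  obtain a b where ab: "phi (X_explicit n m) k x = Some a" "eps (X_explicit n m) k x = Some b" "b \<noteq> 0" "v = a / b"
    using assms(2) by (auto simp: gam_def pdiv_def split: bind_splits if_splits)
  show ?thesis
    using X_phi_U[OF assms(1) ab(1)] X_eps_U[OF assms(1) ab(2)] ab(3,4) by (simp add: gam_def pdiv_def)
qed

text \<open>A point in the domain of the operator for each nonzero c, as a rational map must have a
  nonempty domain.\<close>

lemma X_act_point:
  assumes n: "n > 1" and c: "c \<noteq> 0" and m: "m \<ge> 1"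
  shows "\<exists>x\<in>X_domain n m k. \<forall>j\<in>{1..m}. chain k (X_param m k c x) x j \<noteq> 0"
proof -
  \<comment> \<open>\<open>p j\<close> is 1 + y + ... + y^(j-1), the value of
    \<open>subcorner\<close> at the point built below; \<open>p m + (c - 1) p j\<close> is the
    numerator of \<open>chain\<close> there.\<close>
  define p :: "nat \<Rightarrow> complex poly" where "p j = (\<Sum>i<j. monom 1 i)" for j
  have p0: "poly (p j) 0 = 1" if j1: "j \<ge> 1" for j
  proof -
    obtain j' where "j = Suc j'" using j1 by (cases j) auto
    then have "poly (p j) 0 = 1 + (\<Sum>i<j'. 0)"
      unfolding p_def poly_sum by (simp add: sum.lessThan_Suc_shift poly_monom del: sum.lessThan_Suc)
    then show ?thesis by simp
  qed
  define H where "H = [:0, 1:] * (\<Prod>j=1..m. p j * (p m + Polynomial.smult (c - 1) (p j)))"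
  have "p j * (p m + Polynomial.smult (c - 1) (p j)) \<noteq> 0" if "j \<in> {1..m}" for j
  proof -
    have "poly (p j * (p m + Polynomial.smult (c - 1) (p j))) 0 = c" using p0[of j] p0[of m] that m by simp
    then show ?thesis using c by (metis poly_0)
  qed
  then have "H \<noteq> 0" by (simp add: H_def)
  then have "finite {y. poly H y = 0}" by (rule poly_roots_finite)
  then have "\<exists>y. y \<notin> {y. poly H y = 0}" using ex_new_if_finite infinite_UNIV_char_0 by blast
  then obtain y where y: "poly H y \<noteq> 0" by auto
  have y0: "y \<noteq> 0" and py: "\<And>j. j \<in> {1..m} \<Longrightarrow> poly (p j) y \<noteq> 0 \<and> poly (p m) y + (c - 1) * poly (p j) y \<noteq> 0"
    using y by (auto simp: H_def poly_prod)
  \<comment> \<open>Every component has \<phi> = 1 and \<epsilon> = y at k, so the corners are 1 at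
    k and y^j at k + 1.\<close>
  define x :: "(nat \<times> int) pt" where "x = (\<lambda>(i, r). if 1 \<le> i \<and> i \<le> m then
    (if int n dvd r - (k + int i - 1) then 1 else if int n dvd r - (k + int i) then y else 1) else 0)"
  have x: "x \<in> torus n m"
    unfolding torus_def
  proof (intro CollectI allI)
    fix i r
    have d: "int n dvd r + int n - (k + int i - 1) \<longleftrightarrow> int n dvd r - (k + int i - 1)"
      "int n dvd r + int n - (k + int i) \<longleftrightarrow> int n dvd r - (k + int i)"
      by (auto intro!: dvd_diff_cong)
    show "if 1 \<le> i \<and> i \<le> m then x (i, r) \<noteq> 0 \<and> x (i, r + int n) = x (i, r) else x (i, r) = 0"
      unfolding x_def prod.case d using y0 by auto
  qed
  have nd: "\<not> int n dvd 1" using n by (auto dest: zdvd_imp_le)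
  have v: "x (Suc j, k + int j) = 1" "x (Suc j, k + int j + 1) = y" if "j < m" for j
    using that nd by (simp_all add: x_def)
  have cor: "corner x j k = 1" "corner x j (k + 1) = y ^ j" if "j \<le> m" for j
    using that by (induction j) (use v in \<open>auto simp: corner_Suc algebra_simps\<close>)
  have sub: "subcorner x j k = poly (p j) y" if "j \<le> m" for j
    using that by (induction j) (use v cor in \<open>auto simp: subcorner_Suc p_def poly_monom algebra_simps\<close>)
  have "x \<in> X_domain n m k" using x sub py by (auto simp: X_domain_def)
  moreover have "chain k (X_param m k c x) x j \<noteq> 0" if "j \<in> {1..m}" for j
  proof -
    have "chain k (X_param m k c x) x j = (poly (p m) y + (c - 1) * poly (p j) y) / poly (p m) y"
      using that m py[of m] by (simp add: chain_def X_param_def cor sub field_simps)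
    then show ?thesis using py[OF that] py[of m] m by simp
  qed
  ultimately show ?thesis by blast
qed

lemma eventually_norm_prod_inj:
  assumes "n > 0"
  shows "\<forall>\<^sub>F x in generic (torus n m). inj_on (norm_prod n x) {1..m}"
proof -
  have irr: "irreducible_set (torus n m)" using torus_variety[OF assms] variety_irreducible by blast
  define h :: "(nat \<times> int) pt \<Rightarrow> complex" where
    "h = (\<lambda>x. \<Prod>i=1..m. \<Prod>j\<in>{1..m} - {i}. norm_prod n x i - norm_prod n x j)"
  \<comment> \<open>Component i is constantly i, with \<open>norm_prod\<close> equal to i^n; these
    are distinct.\<close>
  define x :: "(nat \<times> int) pt" where "x = (\<lambda>(i, r). if 1 \<le> i \<and> i \<le> m then of_nat i else 0)"
  have "x \<in> torus n m" by (auto simp: torus_def x_def)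
  moreover have "norm_prod n x i = of_nat (i ^ n)" if "i \<in> {1..m}" for i
    using that by (simp add: norm_prod_def x_def)
  then have "norm_prod n x i \<noteq> norm_prod n x j" if "i \<in> {1..m}" "j \<in> {1..m}" "i \<noteq> j" for i j
    using that assms power_eq_iff_eq_base[of n i j] by (simp del: of_nat_power)
  then have "h x \<noteq> 0" by (auto simp: h_def)
  moreover have "h \<in> polyfun UNIV"
    unfolding h_def by (intro polyfun_intros polyfun_norm_prod)
  ultimately have "\<forall>\<^sub>F x in generic (torus n m). h x \<noteq> 0" using eventually_generic_nonzero[OF irr] by blast
  then show ?thesis
  proof eventually_elim
    case (elim x)
    show ?case
    proof (rule inj_onI, rule ccontr)
      fix i j assume ij: "i \<in> {1..m}" "j \<in> {1..m}" "norm_prod n x i = norm_prod n x j" "i \<noteq> j"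
      then have "(\<Prod>j\<in>{1..m} - {i}. norm_prod n x i - norm_prod n x j) = 0"
        by (intro prod_zero finite_Diff finite_atLeastAtMost bexI[of _ j]) auto
      then have "h x = 0" unfolding h_def by (rule prod_zero[OF finite_atLeastAtMost bexI[OF _ ij(1)]])
      then show False using elim by simp
    qed
  qed
qed

definition X_morphism :: "nat \<Rightarrow> nat \<Rightarrow> ((nat \<times> int) pt \<rightharpoonup> (nat \<times> int) pt) \<Rightarrow> bool" where
  "X_morphism n m F \<longleftrightarrow> (dom F = {} \<or> rational_map (torus n m) (torus n m) F) \<and>
     (\<forall>x x'. F x = Some x' \<longrightarrow> x \<in> torus n m \<and> x' \<in> torus n m \<and>
       (\<forall>i\<in>{1..m}. norm_prod n x' i = norm_prod n x i))"

lemma X_morphism_comp: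
  assumes "X_morphism n m F" "X_morphism n m G" shows "X_morphism n m (G \<circ>\<^sub>m F)"
  unfolding X_morphism_def
proof (intro conjI allI impI)
  show "dom (G \<circ>\<^sub>m F) = {} \<or> rational_map (torus n m) (torus n m) (G \<circ>\<^sub>m F)"
  proof (cases "dom (G \<circ>\<^sub>m F) = {}")
    case False
    then have "dom F \<noteq> {}" "dom G \<noteq> {}" by (auto simp: dom_map_comp)
    then show ?thesis using assms False rational_map_comp unfolding X_morphism_def by blast
  qed simp
next
  fix x x' assume "(G \<circ>\<^sub>m F) x = Some x'"
  then obtain y where "F x = Some y" "G y = Some x'" by (auto simp: map_comp_def split: option.splits)
  then show "x \<in> torus n m" "x' \<in> torus n m" "\<forall>i\<in>{1..m}. norm_prod n x' i = norm_prod n x i"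
    using assms unfolding X_morphism_def by (blast, blast, metis)
qed

text \<open>Where the \<open>norm_prod\<close> are distinct, equal products of whirls and equal
  \<open>norm_prod\<close> force equal points; regularity extends this to the whole common
  domain.\<close>

lemma X_morphism_agree:
  assumes n: "n > 0" and F: "X_morphism n m F" and G: "X_morphism n m G"
    and W: "\<And>x x1 x2. F x = Some x1 \<Longrightarrow> G x = Some x2 \<Longrightarrow> whirl_prod m x1 = whirl_prod m x2"
  shows "agree F G"
proof (cases "dom F = {} \<or> dom G = {}")
  case False
  have irr: "irreducible_set (torus n m)" using torus_variety[OF n] variety_irreducible by blast
  have r: "rational_map (torus n m) (torus n m) F" "rational_map (torus n m) (torus n m) G"
    using False F G by (auto simp: X_morphism_def)
  show ?thesis
  proof (rule rational_map_agree[OF irr r])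
    fix j
    show "\<forall>\<^sub>F x in generic (torus n m). x \<in> dom F \<inter> dom G \<longrightarrow> the (F x) j = the (G x) j"
      using eventually_norm_prod_inj[OF n]
    proof eventually_elim
      case (elim x)
      show ?case
      proof
        assume "x \<in> dom F \<inter> dom G"
        then obtain x1 x2 where x: "F x = Some x1" "G x = Some x2" by auto
        have 1: "x1 \<in> torus n m" "x2 \<in> torus n m" "\<forall>i\<in>{1..m}. norm_prod n x1 i = norm_prod n x i"
          "\<forall>i\<in>{1..m}. norm_prod n x2 i = norm_prod n x i"
          using F G x unfolding X_morphism_def by blast+
        have "inj_on (norm_prod n x1) {1..m}"
          using elim 1(3) inj_on_cong[of "{1..m}" "norm_prod n x1" "norm_prod n x"] by simp
        then have "x1 = x2"
          by (intro whirl_factorization_unique[OF 1(1,2) n]) (use 1(3,4) W[OF x] in auto)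
        then show "the (F x) j = the (G x) j" using x by simp
      qed
    qed
  qed
qed (auto simp: agree_def)

text \<open>Composition with the section x -> (c, x) of the product of the multiplicative group with
  V.\<close>

lemma rational_map_slice:
  assumes "rational_map (Gm_times V) W (\<lambda>z. e (z None) (\<lambda>i. z (Some i)))" "c \<noteq> 0"
    "dom (e c) \<subseteq> V" "dom (e c) \<noteq> {}"
  shows "rational_map V W (e c)"
proof -
  let ?F = "\<lambda>z. e (z None) (\<lambda>i. z (Some i))"
  let ?s = "\<lambda>x. case_option c x"
  have F: "?F (?s x) = e c x" for x by simp
  have sreg: "regular_on S (\<lambda>x. ?s x j)" for S j
    by (cases j) (auto intro: regular_on_const regular_on_polyfun polyfun_coord)
  have VV: "openin (zariski_on V) V" using openin_topspace[of "zariski_on V"] by simp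
  have sV: "x \<in> V \<Longrightarrow> ?s x \<in> Gm_times V" for x using assms(2) by (simp add: Gm_times_def)
  have d: "dom (e c) = {x\<in>V. ?s x \<in> dom ?F}" using assms(3) by auto
  show ?thesis
    unfolding rational_map_def
  proof (intro conjI allI)
    show "openin (zariski_on V) (dom (e c))"
      unfolding d by (rule openin_regular_preimage[OF sreg VV rational_map_dom[OF assms(1)] sV])
    show "ran (e c) \<subseteq> W"
    proof
      fix y assume "y \<in> ran (e c)"
      then obtain x where "e c x = Some y" by (auto simp: ran_def)
      then have "?F (?s x) = Some y" by simp
      then show "y \<in> W" using assms(1) unfolding rational_map_def by (meson ranI subsetD)
    qed
    fix j
    have "regular_on (dom (e c)) (\<lambda>x. (\<lambda>z. the (?F z) j) (?s x))"
      by (rule regular_on_compose[OF rational_map_regular[OF assms(1) order_refl] sreg]) (use d in auto)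
    then show "regular_on (dom (e c)) (\<lambda>x. the (e c x) j)" by simp
  qed fact
qed

lemma geometric_crystalD:
  assumes "geometric_crystal n C"
  shows "rational_Gm_action (points C) (act C i)"
    and "c \<noteq> 0 \<Longrightarrow>
        agree (gam C j \<circ>\<^sub>m act C i c) (\<lambda>x. map_option (\<lambda>a. c powi cartan n i j * a) (gam C j x))"
    and "c \<noteq> 0 \<Longrightarrow>
        agree (eps C i \<circ>\<^sub>m act C i c) (\<lambda>x. map_option (\<lambda>a. inverse c * a) (eps C i x))"
    and "c \<noteq> 0 \<Longrightarrow> c' \<noteq> 0 \<Longrightarrow> cartan n i j = 0 \<Longrightarrow>
        agree (act C i c \<circ>\<^sub>m act C j c') (act C j c' \<circ>\<^sub>m act C i c)"
    and "c \<noteq> 0 \<Longrightarrow> c' \<noteq> 0 \<Longrightarrow> cartan n i j = -1 \<Longrightarrow>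
        agree (act C i c \<circ>\<^sub>m act C j (c * c') \<circ>\<^sub>m act C i c')
              (act C j c' \<circ>\<^sub>m act C i (c * c') \<circ>\<^sub>m act C j c)"
  using assms unfolding geometric_crystal_def by (simp_all only: simp_thms)

lemma rational_Gm_actionD:
  assumes "rational_Gm_action V e"
  shows "c \<noteq> 0 \<Longrightarrow> c' \<noteq> 0 \<Longrightarrow> agree (e c \<circ>\<^sub>m e c') (e (c * c'))"
  using assms unfolding rational_Gm_action_def by (simp only: simp_thms)

lemma geometric_crystal_X:
  assumes n: "n > 1" and m: "m \<ge> 1"
  shows "geometric_crystal n (X_explicit n m)"
    and "c \<noteq> 0 \<Longrightarrow> rational_map (torus n m) (torus n m) (act (X_explicit n m) k c)"
    and "rational_fun (torus n m) (eps (X_explicit n m) k)"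
    and "rational_fun (torus n m) (phi (X_explicit n m) k)"
proof -
  let ?T = "torus n m" and ?C = "X_explicit n m" and ?U = "U_crystal n m" and ?W = "whirl_prod m"
  have n0: "n > 0" using n by simp
  have V: "variety ?T" by (rule torus_variety[OF n0])
  note irr = variety_irreducible[OF V]
  have mm: "m \<in> {1..m}" using m by simp
  have pts: "points ?C = ?T" by (simp add: X_explicit_def)
  have Xo: "openin (zariski_on ?T) (X_domain n m k)" for k
  proof -
    have "X_domain n m k = {x\<in>?T. (\<Prod>j=1..m. subcorner x j k) \<noteq> 0}" by (auto simp: X_domain_def)
    then show ?thesis
      by (simp only: openin_zariski_on_nonzero[OF polyfun_prod[OF polyfun_subcorner]])
  qed
  have Xne: "X_domain n m k \<noteq> {}" for k using X_act_point[OF n _ m, of 1 k] by auto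
  have Xs: "x \<in> X_domain n m k \<Longrightarrow> j \<in> {1..m} \<Longrightarrow> subcorner x j k \<noteq> 0"
    and Xt: "x \<in> X_domain n m k \<Longrightarrow> x \<in> ?T" for x k j by (auto simp: X_domain_def)
  have de: "dom (eps ?C k) = X_domain n m k" and dp: "dom (phi ?C k) = X_domain n m k" for k
    by (auto simp: X_explicit_def split: if_splits)
  have da: "dom (act ?C k c) = {x \<in> X_domain n m k. c \<noteq> 0 \<and> (\<forall>j\<in>{1..m}. chain k (X_param m k c x) x j \<noteq> 0)}" for k c
    by (auto simp: X_explicit_def split: if_splits)
  show rat_eps: "rational_fun ?T (eps ?C k)" for k
    unfolding rational_fun_def de
  proof (intro conjI Xo Xne)
    have "regular_on (X_domain n m k) (\<lambda>x. corner x m (k + 1) / subcorner x m k)"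
      by (intro regular_on_divide regular_on_polyfun polyfun_corner polyfun_subcorner Xs[OF _ mm])
    then show "regular_on (X_domain n m k) (\<lambda>x. the (eps ?C k x))"
      by (rule regular_on_cong[THEN iffD1, rotated]) (simp add: X_explicit_def)
  qed
  show rat_phi: "rational_fun ?T (phi ?C k)" for k
    unfolding rational_fun_def dp
  proof (intro conjI Xo Xne)
    have "regular_on (X_domain n m k) (\<lambda>x. corner x m k / subcorner x m k)"
      by (intro regular_on_divide regular_on_polyfun polyfun_corner polyfun_subcorner Xs[OF _ mm])
    then show "regular_on (X_domain n m k) (\<lambda>x. the (phi ?C k x))"
      by (rule regular_on_cong[THEN iffD1, rotated]) (simp add: X_explicit_def)
  qed
  have rat_gam: "rational_fun ?T (gam ?C k)" for k
    unfolding gam_def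
  proof (rule rational_fun_pdiv[OF rat_phi rat_eps])
    obtain x where x: "x \<in> X_domain n m k" using Xne by blast
    have "the (eps ?C k x) \<noteq> 0"
      using x corner_nonzero[OF Xt[OF x] order_refl] Xs[OF x mm] by (simp add: X_explicit_def)
    then have "x \<in> dom (pdiv (phi ?C k) (eps ?C k))" using x by (simp add: dom_pdiv de dp)
    then show "dom (pdiv (phi ?C k) (eps ?C k)) \<noteq> {}" by blast
  qed
  have rat_act: "rational_map (Gm_times ?T) ?T (\<lambda>z. act ?C k (z None) (\<lambda>i. z (Some i)))" for k
  proof -
    let ?f = "\<lambda>z. act ?C k (z None) (\<lambda>i. z (Some i))"
    let ?p = "\<lambda>z :: (nat \<times> int) option pt. \<lambda>i. z (Some i)"
    \<comment> \<open>On \<open>S1\<close> the denominators are nonzero, so the \<open>chain\<close>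
      values are regular functions there; only then can \<open>S\<close> be cut out by their
      nonvanishing.\<close>
    define S1 where "S1 = {z \<in> Gm_times ?T. (\<Prod>j=1..m. subcorner (?p z) j k) \<noteq> 0}"
    define g where "g j z = chain k (X_param m k (z None) (?p z)) (?p z) j" for j and z :: "(nat \<times> int) option pt"
    define S where "S = {z \<in> S1. (\<Prod>j=1..m. g j z) \<noteq> 0}"
    have pp: "(\<lambda>z. f (?p z)) \<in> polyfun UNIV" if "f \<in> polyfun UNIV" for f :: "(nat \<times> int) pt \<Rightarrow> complex"
      using that by (rule polyfun_compose) (rule polyfun_coord)
    have S1: "openin (zariski_on (Gm_times ?T)) S1"
      unfolding S1_def by (rule openin_zariski_on_nonzero[OF polyfun_prod[OF pp[OF polyfun_subcorner]]])
    have S1T: "?p z \<in> ?T" "z None \<noteq> 0" if "z \<in> S1" for z using that by (auto simp: S1_def Gm_times_def)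
    have S1s: "subcorner (?p z) j k \<noteq> 0" if "z \<in> S1" "j \<in> {1..m}" for z j using that by (auto simp: S1_def)
    have S1X: "z \<in> S1 \<longleftrightarrow> z None \<noteq> 0 \<and> ?p z \<in> X_domain n m k" for z
      by (auto simp: S1_def X_domain_def Gm_times_def)
    have greg: "regular_on S1 (g j)" if "j \<le> m" for j
      unfolding g_def chain_def X_param_def
      by (intro regular_on_add regular_on_divide regular_on_mult regular_on_diff regular_on_const
          regular_on_polyfun pp polyfun_corner polyfun_subcorner polyfun_coord S1s[OF _ mm])
        (use corner_nonzero[OF S1T(1)] that in auto)
    have preg: "regular_on S1 (\<lambda>z. \<Prod>j\<in>A. g j z)" if "A \<subseteq> {1..m}" for A
      using finite_subset[OF that finite_atLeastAtMost] that
      by (induction A rule: finite_induct) (auto intro!: regular_on_const regular_on_mult greg)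
    have So: "openin (zariski_on (Gm_times ?T)) S"
      unfolding S_def by (rule openin_regular_nonzero[OF preg[OF order_refl] S1])
    have Sg: "g j z \<noteq> 0" if "z \<in> S" "j \<le> m" for z j
      using that by (cases "j = 0") (auto simp: S_def g_def)
    have d: "dom ?f = S"
    proof (rule Set.set_eqI)
      fix z
      show "z \<in> dom ?f \<longleftrightarrow> z \<in> S"
        unfolding S_def mem_Collect_eq S1X using da[of k "z None"] by (auto simp: g_def)
    qed
    have SS1: "S \<subseteq> S1" by (auto simp: S_def)
    have greg': "regular_on S (g j)" if "j \<le> m" for j by (rule regular_on_subset[OF greg[OF that] SS1])
    show ?thesis
      unfolding rational_map_def d
    proof (intro conjI allI So)
      obtain x where x: "x \<in> X_domain n m k" "\<forall>j\<in>{1..m}. chain k (X_param m k 1 x) x j \<noteq> 0"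
        using X_act_point[OF n _ m, of 1 k] by auto
      then have "act ?C k 1 x \<noteq> None" by (simp add: X_explicit_def)
      then have "case_option 1 x \<in> dom ?f" by (simp add: domIff)
      then show "S \<noteq> {}" using d by blast
      show "ran ?f \<subseteq> ?T" using X_act_U(2)[OF n _ m] by (auto simp: ran_def)
      fix p :: "nat \<times> int"
      obtain i r where p: "p = (i, r)" by fastforce
      have val: "the (?f z) = X_move n k (X_param m k (z None) (?p z)) (?p z)" if "z \<in> S" for z
        using that unfolding d[symmetric] by (auto simp: X_explicit_def split: if_splits)
      show "regular_on S (\<lambda>z. the (?f z) p)"
      proof (cases "1 \<le> i \<and> i \<le> m")
        case True
        have c: "regular_on S (\<lambda>z. z (Some (i, r)))" by (rule regular_on_polyfun[OF polyfun_coord])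
        have i: "i \<le> m" "i - 1 \<le> m" using True by auto
        have "regular_on S (\<lambda>z. if int n dvd r - (k + int i - 1) then g i z / g (i - 1) z * z (Some (i, r))
          else if int n dvd r - (k + int i) then g (i - 1) z / g i z * z (Some (i, r)) else z (Some (i, r)))"
          using c regular_on_mult[OF regular_on_divide[OF greg'[OF i(1)] greg'[OF i(2)] Sg[OF _ i(2)]] c]
            regular_on_mult[OF regular_on_divide[OF greg'[OF i(2)] greg'[OF i(1)] Sg[OF _ i(1)]] c]
          by (cases "int n dvd r - (k + int i - 1)"; cases "int n dvd r - (k + int i)")
            (simp_all only: if_True if_False)
        then show ?thesis
          by (rule regular_on_cong[THEN iffD1, rotated]) (simp add: val p X_move_def g_def)
      next
        case False
        have "the (?f z) p = 0" if "z \<in> S" for z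
          unfolding val[OF that] p X_move_def prod.case
          using torus_zero[OF S1T(1) False, of z r] that SS1 by auto
        then show ?thesis using regular_on_cong[of S "\<lambda>z. the (?f z) p" "\<lambda>_. 0"] regular_on_const by blast
      qed
    qed
  qed
  show ract: "rational_map ?T ?T (act ?C k c)" if "c \<noteq> 0" for k c
  proof (rule rational_map_slice[where e = "act ?C k", OF rat_act that])
    show "dom (act ?C k c) \<subseteq> ?T" by (auto simp: da X_domain_def)
    show "dom (act ?C k c) \<noteq> {}" using X_act_point[OF n that m, of k] that by (auto simp: da)
  qed
  have mor: "X_morphism n m (act ?C k c)" if "c \<noteq> 0" for k c
    unfolding X_morphism_def using ract[OF that] X_act_U[OF n _ m] by auto
  \<comment> \<open>Composites on X lie over the corresponding composites on U, so a relation on U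
    makes both sides of the relation on X have the same product of whirls.\<close>
  have lift: "act ?U k c (?W x) = Some (?W x')" if "act ?C k c x = Some x'" for k c x x'
    by (rule X_act_U(3)[OF n that m])
  have compE: "\<exists>y. F x = Some y \<and> G y = Some z" if "(G \<circ>\<^sub>m F) x = Some z" for F G :: "(nat \<times> int) pt \<rightharpoonup> (nat \<times> int) pt" and x z
    using that by (auto simp: map_comp_def split: option.splits)
  have lift2: "(act ?U k c \<circ>\<^sub>m act ?U l d) (?W x) = Some (?W x')" if "(act ?C k c \<circ>\<^sub>m act ?C l d) x = Some x'" for k c l d x x'
    using compE[OF that] lift by (auto simp: map_comp_def)
  have lift3: "(act ?U k c \<circ>\<^sub>m act ?U l d \<circ>\<^sub>m act ?U p q) (?W x) = Some (?W x')"
    if "(act ?C k c \<circ>\<^sub>m act ?C l d \<circ>\<^sub>m act ?C p q) x = Some x'" for k c l d p q x x'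
    using compE[OF that] lift lift2 by (auto simp: map_comp_def)
  have agD: "a = b" if "agree F G" "F y = Some a" "G y = Some b" for F G :: "(int \<times> int) pt \<rightharpoonup> 'a" and y a b
  proof -
    have "y \<in> dom F \<inter> dom G" using that by auto
    then have "F y = G y" using that(1) unfolding agree_def by blast
    then show ?thesis using that(2,3) by simp
  qed
  have GU: "geometric_crystal n ?U" by (rule geometric_crystal_U[OF n m])
  have per: "int n dvd a - b \<Longrightarrow> x \<in> ?T \<Longrightarrow> corner x j a = corner x j b"
    "int n dvd a - b \<Longrightarrow> x \<in> ?T \<Longrightarrow> subcorner x j a = subcorner x j b" for a b x j
  proof -
    assume d: "int n dvd a - b" and x: "x \<in> ?T"
    have w: "whirl_prod j x (a + u, a + v) = whirl_prod j x (b + u, b + v)" for u v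
    proof (rule periodic_dvd[of "\<lambda>r. whirl_prod j x (r + u, r + v)", OF _ d])
      fix r show "whirl_prod j x (r + int n + u, r + int n + v) = whirl_prod j x (r + u, r + v)"
        using whirl_prod_periodic[OF x, of j "r + u" "r + v"] by (simp add: algebra_simps)
    qed
    show "corner x j a = corner x j b" using w[of 0 "int j"] by (simp add: top_entry_def)
    show "subcorner x j a = subcorner x j b" using w[of 1 "int j"] by (simp add: sub_entry_def)
  qed
  have perC: "eps ?C (i + int n) = eps ?C i \<and> phi ?C (i + int n) = phi ?C i \<and> act ?C (i + int n) = act ?C i" for i
  proof -
    have d: "int n dvd i + int n - i" "int n dvd i + int n + 1 - (i + 1)" by simp_all
    have D: "X_domain n m (i + int n) = X_domain n m i" using per(2)[OF d(1)] by (auto simp: X_domain_def)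
    have q: "X_param m (i + int n) c x = X_param m i c x" if "x \<in> ?T" for c x
      using per[OF d(1) that] by (simp add: X_param_def)
    have ch: "chain (i + int n) a x j = chain i a x j" if "x \<in> ?T" for a x j
      using per[OF d(1) that] by (simp add: chain_def)
    have mv: "X_move n (i + int n) a x = X_move n i a x" if "x \<in> ?T" for a x
    proof (rule ext)
      fix p :: "nat \<times> int"
      obtain l r where p: "p = (l, r)" by fastforce
      have "int n dvd r - (i + int n + int l - 1) \<longleftrightarrow> int n dvd r - (i + int l - 1)"
        "int n dvd r - (i + int n + int l) \<longleftrightarrow> int n dvd r - (i + int l)"
        using dvd_diff_cong[of n "r - (i + int n + int l - 1)" "r - (i + int l - 1)" 0]
          dvd_diff_cong[of n "r - (i + int n + int l)" "r - (i + int l)" 0] by simp_all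
      then show "X_move n (i + int n) a x p = X_move n i a x p"
        unfolding p X_move_def prod.case ch[OF that] by simp
    qed
    show ?thesis
      using per(1)[OF d(2)] per[OF d(1)] q ch mv Xt
      by (auto simp: X_explicit_def D intro!: ext)
  qed
  show "geometric_crystal n ?C"
    unfolding geometric_crystal_def pts
  proof (intro conjI allI impI)
    fix i
    show "rational_Gm_action ?T (act ?C i)"
      unfolding rational_Gm_action_def
    proof (intro conjI allI impI rat_act)
      show "agree (act ?C i 1) Some"
        unfolding agree_def
      proof
        fix x assume "x \<in> dom (act ?C i 1) \<inter> dom Some"
        then have "act ?C i 1 x = Some (X_move n i (X_param m i 1 x) x)"
          by (auto simp: X_explicit_def split: if_splits)
        moreover have "X_move n i 0 x = x" by (rule ext) (auto simp: X_move_def chain_def)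
        ultimately show "act ?C i 1 x = Some x" by (simp add: X_param_def)
      qed
      fix c c' :: complex assume c: "c \<noteq> 0" "c' \<noteq> 0"
      have "agree (act ?U i c \<circ>\<^sub>m act ?U i c') (act ?U i (c * c'))"
        by (rule rational_Gm_actionD[OF geometric_crystalD(1)[OF GU] c])
      note ag = this
      show "agree (act ?C i c \<circ>\<^sub>m act ?C i c') (act ?C i (c * c'))"
      proof (rule X_morphism_agree[OF n0])
        fix x x1 x2
        assume a1: "(act ?C i c \<circ>\<^sub>m act ?C i c') x = Some x1" and a2: "(act ?C i (c * c')) x = Some x2"
        show "?W x1 = ?W x2" by (rule agD[OF ag lift2[OF a1] lift[OF a2]])
      qed (intro X_morphism_comp mor; use c in simp)+
    qed
    show "Abstract_Topology.closure_of (zariski_on ?T) (dom (act ?C i 1)) = ?T"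
      using ract[of 1 i] unfolding rational_map_def by (intro closure_of_open_irreducible[OF irr]) auto
  next
    fix i j c assume c: "(c :: complex) \<noteq> 0"
    have ag: "agree (gam ?U j \<circ>\<^sub>m act ?U i c) (\<lambda>x. map_option (\<lambda>a. c powi cartan n i j * a) (gam ?U j x))"
      by (rule geometric_crystalD(2)[OF GU c])
    show "agree (gam ?C j \<circ>\<^sub>m act ?C i c) (\<lambda>x. map_option (\<lambda>a. c powi cartan n i j * a) (gam ?C j x))"
      unfolding agree_def
    proof
      fix x assume "x \<in> dom (gam ?C j \<circ>\<^sub>m act ?C i c) \<inter> dom (\<lambda>x. map_option (\<lambda>a. c powi cartan n i j * a) (gam ?C j x))"
      then obtain x' v w where x: "act ?C i c x = Some x'" "gam ?C j x' = Some v" "gam ?C j x = Some w"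
        by (auto simp: map_comp_def split: option.splits)
      have "v = c powi cartan n i j * w"
        by (rule agD[OF ag, of "?W x"]) (use lift[OF x(1)] X_gam_U[OF m x(2)] X_gam_U[OF m x(3)] in \<open>auto simp: map_comp_def\<close>)
      then show "(gam ?C j \<circ>\<^sub>m act ?C i c) x = map_option (\<lambda>a. c powi cartan n i j * a) (gam ?C j x)"
        using x by (simp add: map_comp_def)
    qed
  next
    fix i c assume c: "(c :: complex) \<noteq> 0"
    have ag: "agree (eps ?U i \<circ>\<^sub>m act ?U i c) (\<lambda>x. map_option (\<lambda>a. inverse c * a) (eps ?U i x))"
      by (rule geometric_crystalD(3)[OF GU c])
    show "agree (eps ?C i \<circ>\<^sub>m act ?C i c) (\<lambda>x. map_option (\<lambda>a. inverse c * a) (eps ?C i x))"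
      unfolding agree_def
    proof
      fix x assume "x \<in> dom (eps ?C i \<circ>\<^sub>m act ?C i c) \<inter> dom (\<lambda>x. map_option (\<lambda>a. inverse c * a) (eps ?C i x))"
      then obtain x' v w where x: "act ?C i c x = Some x'" "eps ?C i x' = Some v" "eps ?C i x = Some w"
        by (auto simp: map_comp_def split: option.splits)
      have "v = inverse c * w"
        by (rule agD[OF ag, of "?W x"]) (use lift[OF x(1)] X_eps_U[OF m x(2)] X_eps_U[OF m x(3)] in \<open>auto simp: map_comp_def\<close>)
      then show "(eps ?C i \<circ>\<^sub>m act ?C i c) x = map_option (\<lambda>a. inverse c * a) (eps ?C i x)"
        using x by (simp add: map_comp_def)
    qed
  next
    fix i j c c' assume c: "(c :: complex) \<noteq> 0" "(c' :: complex) \<noteq> 0" and a: "cartan n i j = 0"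
    have "agree (act ?U i c \<circ>\<^sub>m act ?U j c') (act ?U j c' \<circ>\<^sub>m act ?U i c)"
      by (rule geometric_crystalD(4)[OF GU c a])
    note ag = this
    show "agree (act ?C i c \<circ>\<^sub>m act ?C j c') (act ?C j c' \<circ>\<^sub>m act ?C i c)"
    proof (rule X_morphism_agree[OF n0])
      fix x x1 x2
      assume a1: "(act ?C i c \<circ>\<^sub>m act ?C j c') x = Some x1" and a2: "(act ?C j c' \<circ>\<^sub>m act ?C i c) x = Some x2"
      show "?W x1 = ?W x2" by (rule agD[OF ag lift2[OF a1] lift2[OF a2]])
    qed (intro X_morphism_comp mor; use c in simp)+
  next
    fix i j c c' assume c: "(c :: complex) \<noteq> 0" "(c' :: complex) \<noteq> 0" and a: "cartan n i j = -1"
    have "agree (act ?U i c \<circ>\<^sub>m act ?U j (c * c') \<circ>\<^sub>m act ?U i c')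
      (act ?U j c' \<circ>\<^sub>m act ?U i (c * c') \<circ>\<^sub>m act ?U j c)"
      by (rule geometric_crystalD(5)[OF GU c a])
    note ag = this
    show "agree (act ?C i c \<circ>\<^sub>m act ?C j (c * c') \<circ>\<^sub>m act ?C i c')
      (act ?C j c' \<circ>\<^sub>m act ?C i (c * c') \<circ>\<^sub>m act ?C j c)"
    proof (rule X_morphism_agree[OF n0])
      fix x x1 x2
      assume a1: "(act ?C i c \<circ>\<^sub>m act ?C j (c * c') \<circ>\<^sub>m act ?C i c') x = Some x1" and a2: "(act ?C j c' \<circ>\<^sub>m act ?C i (c * c') \<circ>\<^sub>m act ?C j c) x = Some x2"
      show "?W x1 = ?W x2" by (rule agD[OF ag lift3[OF a1] lift3[OF a2]])
    qed (intro X_morphism_comp mor; use c in simp)+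
  qed (use V rat_eps rat_gam perC in auto)
qed

lemma rational_map_whirl_prod:
  assumes "n > 0"
  shows "rational_map (torus n m) (U_le n m) ((\<lambda>x. Some (whirl_prod m x)) |` torus n m)"
proof -
  have "openin (zariski_on (torus n m)) (torus n m)" using openin_topspace[of "zariski_on (torus n m)"] by simp
  moreover have "torus n m \<noteq> {}" using torus_variety[OF assms] by (auto simp: variety_def)
  moreover have "regular_on (torus n m) (\<lambda>x. the (((\<lambda>x. Some (whirl_prod m x)) |` torus n m) x) j)" for j
    by (rule regular_on_cong[THEN iffD1, OF _ regular_on_polyfun[OF polyfun_whirl_prod[of m "fst j" "snd j"]]]) simp
  moreover have "dom ((\<lambda>x. Some (whirl_prod m x)) |` torus n m) = torus n m" by auto
  moreover have "ran ((\<lambda>x. Some (whirl_prod m x)) |` torus n m) \<subseteq> U_le n m"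
    using whirl_prod_U_le by (auto simp: ran_def restrict_map_def)
  ultimately show ?thesis by (simp only: rational_map_def) simp
qed

lemma crystal_map_proj:
  assumes n: "n > 1" and m: "m \<ge> 1"
  shows "crystal_map (X_crystal n m) (U_crystal n m) (proj n m)"
proof -
  let ?T = "torus n m" and ?C = "X_explicit n m" and ?U = "U_crystal n m"
  let ?f = "(\<lambda>x. Some (whirl_prod m x)) |` torus n m"
  have n0: "n > 0" using n by simp
  note irr = variety_irreducible[OF torus_variety[OF n0, of m]]
  have pts: "points ?C = ?T" by (simp add: X_explicit_def)
  have pf: "proj n m = ?f" by (simp add: proj_def X_crystal_explicit[OF m] pts)
  have some: "\<exists>v. F x = Some v" if "x \<in> dom F" for F :: "'a \<rightharpoonup> 'b" and x using that by auto
  have inT: "x \<in> ?T" if "eps ?C k x = Some v" for x v k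
    using that by (auto simp: X_explicit_def X_domain_def split: if_splits)
  have inT': "x \<in> ?T" if "phi ?C k x = Some v" for x v k
    using that by (auto simp: X_explicit_def X_domain_def split: if_splits)
  show ?thesis
    unfolding crystal_map_def X_crystal_explicit[OF m] pts U_crystal_points pf
  proof (intro conjI allI impI)
    show "rational_map ?T (U_le n m) ?f" by (rule rational_map_whirl_prod[OF n0])
    fix k
    show "rat_eq ?T (eps ?U k \<circ>\<^sub>m ?f) (eps ?C k)"
      unfolding rat_eq_iff[OF irr]
      using rational_fun_eventually_dom[OF irr geometric_crystal_X(3)[OF n m, of k]]
    proof eventually_elim
      case (elim x)
      then obtain v where v: "eps ?C k x = Some v" by auto
      then show ?case using X_eps_U[OF m v] inT[OF v] by (simp add: dom_map_comp domIff map_comp_def)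
    qed
    show "rat_eq ?T (phi ?U k \<circ>\<^sub>m ?f) (phi ?C k)"
      unfolding rat_eq_iff[OF irr]
      using rational_fun_eventually_dom[OF irr geometric_crystal_X(4)[OF n m, of k]]
    proof eventually_elim
      case (elim x)
      then obtain v where v: "phi ?C k x = Some v" by auto
      then show ?case using X_phi_U[OF m v] inT'[OF v] by (simp add: dom_map_comp domIff map_comp_def)
    qed
    fix c assume c: "(c :: complex) \<noteq> 0"
    show "rat_eq ?T (?f \<circ>\<^sub>m act ?C k c) (act ?U k c \<circ>\<^sub>m ?f)"
      unfolding rat_eq_iff[OF irr]
      using rational_map_eventually_dom[OF irr geometric_crystal_X(2)[OF n m c, of k]]
    proof eventually_elim
      case (elim x)
      then obtain v where v: "act ?C k c x = Some v" by auto
      then show ?case using X_act_U[OF n v m] by (simp add: dom_map_comp domIff map_comp_def)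
    qed
  qed
qed

section \<open>The birational R-matrix\<close>

lemma kappa_identity:
  assumes a: "\<And>r. a (r + int n) = a r" and b: "\<And>r. b (r + int n) = b r" and n: "n > 0"
  shows "a r * kappa n r a b - b (r + 1) * kappa n (r + 1) a b =
    (\<Prod>t=1..n. a (r + int t)) - (\<Prod>t=1..n. b (r + int t))"
proof -
  \<comment> \<open>\<open>F s\<close> has s factors b followed by n - s factors a. The two terms on
    the left are F 0 + ... + F (n-1) and F 1 + ... + F n, so their difference telescopes.\<close>
  define F where "F s = (\<Prod>t=1..s. b (r + int t)) * (\<Prod>t=s+1..n. a (r + int t))" for s
  obtain N where N: "n = Suc N" using n by (cases n) auto
  have "a r * kappa n r a b = (\<Sum>s=0..N. F s)"
    unfolding kappa_def N diff_Suc_1 sum_distrib_left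
  proof (rule sum.cong[OF refl])
    fix s assume s: "s \<in> {0..N}"
    have "(\<Prod>t=s+1..Suc N. a (r + int t)) = (\<Prod>t=s+1..N. a (r + int t)) * a (r + int n)"
      using s by (simp add: N)
    then show "a r * ((\<Prod>t=1..s. b (r + int t)) * (\<Prod>t=s+1..N. a (r + int t))) = F s"
      unfolding F_def N[symmetric] a by simp
  qed
  moreover have "b (r + 1) * kappa n (r + 1) a b = (\<Sum>s=0..N. F (Suc s))"
    unfolding kappa_def N diff_Suc_1 sum_distrib_left
  proof (rule sum.cong[OF refl])
    fix s assume "s \<in> {0..N}"
    have 1: "(\<Prod>t=1..Suc s. b (r + int t)) = b (r + 1) * (\<Prod>t=1..s. b (r + 1 + int t))"
      by (subst prod.atLeast_Suc_atMost, simp, subst prod.shift_bounds_cl_Suc_ivl) (simp add: algebra_simps)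
    have 2: "(\<Prod>t=Suc s+1..n. a (r + int t)) = (\<Prod>t=s+1..N. a (r + 1 + int t))"
      unfolding N using prod.shift_bounds_cl_Suc_ivl[of "\<lambda>t. a (r + int t)" "s + 1" N] by (simp add: algebra_simps)
    show "b (r + 1) * ((\<Prod>t=1..s. b (r + 1 + int t)) * (\<Prod>t=s+1..N. a (r + 1 + int t))) = F (Suc s)"
      unfolding F_def 1 2 by simp
  qed
  moreover have "(\<Sum>s=0..N. F s) - (\<Sum>s=0..N. F (Suc s)) = F 0 - F (Suc N)"
    using sum_telescope[of F N] by (simp add: atLeast0AtMost sum_subtractf)
  ultimately show ?thesis by (simp add: F_def N)
qed

lemma kappa_periodic:
  assumes "\<And>r. a (r + int n) = a r" "\<And>r. b (r + int n) = b r"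
  shows "kappa n (r + int n) a b = kappa n r a b"
proof -
  have "a (r + int n + int t) = a (r + int t)" "b (r + int n + int t) = b (r + int t)" for t
    using assms(1)[of "r + int t"] assms(2)[of "r + int t"] by (simp_all add: algebra_simps)
  then show ?thesis by (simp add: kappa_def)
qed

section \<open>The birational involutions \<open>s_j\<close>\<close>

definition R_kappa :: "nat \<Rightarrow> nat \<Rightarrow> (nat \<times> int) pt \<Rightarrow> int \<Rightarrow> complex" where
  "R_kappa n j x r = kappa n r (block x j) (block x (j + 1))"

definition R_fun :: "nat \<Rightarrow> nat \<Rightarrow> (nat \<times> int) pt \<Rightarrow> (nat \<times> int) pt" where
  "R_fun n j x = (\<lambda>(i, r).
     if i = j then x (j + 1, r + 1) * R_kappa n j x (r + 1) / R_kappa n j x r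
     else if i = j + 1 then x (j, r - 1) * R_kappa n j x (r - 1) / R_kappa n j x r
     else x (i, r))"

definition R_domain :: "nat \<Rightarrow> nat \<Rightarrow> nat \<Rightarrow> (nat \<times> int) pt set" where
  "R_domain n m j = {x \<in> torus n m. \<forall>r. R_kappa n j x r \<noteq> 0}"

lemma R_kappa_periodic: "x \<in> torus n m \<Longrightarrow> R_kappa n j x (r + int n) = R_kappa n j x r"
  unfolding R_kappa_def by (rule kappa_periodic) (simp_all add: block_def torus_periodic)

lemma norm_prod_shift:
  assumes "x \<in> torus n m" "1 \<le> j" "j \<le> m"
  shows "(\<Prod>t=1..n. x (j, r + int t)) = norm_prod n x j"
proof -
  have "(\<Prod>t=1..n. x (j, r + int t)) = (\<Prod>l<n. x (j, r + 1 + int l))"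
    by (rule prod.reindex_bij_witness[of _ Suc "\<lambda>t. t - 1"]) (auto simp: algebra_simps)
  then show ?thesis using norm_prod_window[OF assms] by simp
qed

lemma R_kappa_identity:
  assumes "x \<in> torus n m" "1 \<le> j" "j < m" "n > 0"
  shows "x (j, r) * R_kappa n j x r - x (j + 1, r + 1) * R_kappa n j x (r + 1) =
    norm_prod n x j - norm_prod n x (j + 1)"
  using kappa_identity[of "block x j" n "block x (j + 1)" r] assms
    norm_prod_shift[OF assms(1), of j r] norm_prod_shift[OF assms(1), of "j + 1" r]
  by (simp add: R_kappa_def block_def torus_periodic[OF assms(1)])

lemma R_fun_torus:
  assumes "x \<in> R_domain n m j" "1 \<le> j" "j < m"
  shows "R_fun n j x \<in> torus n m"
proof -
  have x: "x \<in> torus n m" "\<And>r. R_kappa n j x r \<noteq> 0" using assms(1) by (auto simp: R_domain_def)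
  have p: "x (i, r + int n + 1) = x (i, r + 1)" "x (i, r + int n - 1) = x (i, r - 1)" for i r
    using torus_periodic[OF x(1), of i "r + 1"] torus_periodic[OF x(1), of i "r - 1"]
    by (simp_all add: algebra_simps)
  have q: "R_kappa n j x (r + int n + 1) = R_kappa n j x (r + 1)" "R_kappa n j x (r + int n - 1) = R_kappa n j x (r - 1)" for r
    using R_kappa_periodic[OF x(1), of j "r + 1"] R_kappa_periodic[OF x(1), of j "r - 1"]
    by (simp_all add: algebra_simps)
  show ?thesis
    unfolding torus_def
  proof (intro CollectI allI)
    fix i r
    show "if 1 \<le> i \<and> i \<le> m then R_fun n j x (i, r) \<noteq> 0 \<and> R_fun n j x (i, r + int n) = R_fun n j x (i, r)
      else R_fun n j x (i, r) = 0"
      unfolding R_fun_def prod.case p q R_kappa_periodic[OF x(1)] torus_periodic[OF x(1)]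
      using torus_nonzero[OF x(1)] torus_zero[OF x(1), of i r] x(2) assms(2,3) by auto
  qed
qed

text \<open>Over a full period the quotients of \<open>R_kappa\<close> cancel, and the coordinates
  of the other component remain.\<close>

lemma norm_prod_R_fun:
  assumes "x \<in> R_domain n m j" "1 \<le> j" "j < m"
  shows "norm_prod n (R_fun n j x) i = norm_prod n x (Transposition.transpose j (j + 1) i)"
proof -
  have x: "x \<in> torus n m" "\<And>r. R_kappa n j x r \<noteq> 0" using assms(1) by (auto simp: R_domain_def)
  have k: "(\<Prod>l<n. R_kappa n j x (r + int l)) = (\<Prod>l<n. R_kappa n j x (int l))" for r
    by (rule periodic_window[of "R_kappa n j x" n, OF R_kappa_periodic[OF x(1)] x(2)])
  have k0: "(\<Prod>l<n. R_kappa n j x (int l)) \<noteq> 0" using x(2) by simp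
  have a: "(\<Prod>l<n. x (j + 1, r + int l)) = norm_prod n x (j + 1)" "(\<Prod>l<n. x (j, r + int l)) = norm_prod n x j" for r
    using norm_prod_window[OF x(1)] assms(2,3) by simp_all
  consider "i = j" | "i = j + 1" | "i \<noteq> j" "i \<noteq> j + 1" by blast
  then show ?thesis
  proof cases
    case 1
    have "norm_prod n (R_fun n j x) j = (\<Prod>l<n. x (j + 1, 1 + int l)) * (\<Prod>l<n. R_kappa n j x (1 + int l)) / (\<Prod>l<n. R_kappa n j x (int l))"
      by (simp add: norm_prod_def R_fun_def prod.distrib prod_dividef add.commute)
    then show ?thesis unfolding a k using 1 k0 by simp
  next
    case 2
    have "norm_prod n (R_fun n j x) (j + 1) = (\<Prod>l<n. x (j, -1 + int l)) * (\<Prod>l<n. R_kappa n j x (-1 + int l)) / (\<Prod>l<n. R_kappa n j x (int l))"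
      by (simp add: norm_prod_def R_fun_def prod.distrib prod_dividef)
    then show ?thesis unfolding a k using 2 k0 by simp
  next
    case 3
    then show ?thesis by (simp add: norm_prod_def R_fun_def)
  qed
qed

text \<open>A product M(a) M(b) depends only on the sums a_r + b_r and the products a_r b_{r+1}. The
  products are visibly preserved; the sums are because the right side of
  \<open>R_kappa_identity\<close> does not depend on r.\<close>

lemma whirl_prod_R_fun:
  assumes "x \<in> R_domain n m j" "1 \<le> j" "j < m" "n > 0"
  shows "k \<noteq> j \<Longrightarrow> whirl_prod k (R_fun n j x) = whirl_prod k x"
proof (induction k)
  case 0
  then show ?case by (simp add: whirl_prod.simps(1))
next
  case (Suc k)
  have x: "x \<in> torus n m" "\<And>r. R_kappa n j x r \<noteq> 0" using assms(1) by (auto simp: R_domain_def)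
  consider "Suc k < j" | "k = j" | "k > j" using Suc.prems by linarith
  then show ?case
  proof cases
    case 1
    then show ?thesis by (intro whirl_prod_cong) (auto simp: R_fun_def)
  next
    case 3
    then have "block (R_fun n j x) (Suc k) = block x (Suc k)" by (auto simp: block_def R_fun_def)
    then show ?thesis using 3 Suc.IH by (simp add: whirl_prod.simps(2))
  next
    case 2
    obtain j' where j': "j = Suc j'" using assms(2) by (cases j) auto
    let ?y = "R_fun n j x"
    have W: "whirl_prod j' ?y = whirl_prod j' x"
      by (rule whirl_prod_cong) (auto simp: R_fun_def j')
    have s: "?y (j, r) + ?y (j + 1, r) = x (j, r) + x (j + 1, r)" for r
    proof -
      have "x (j, r) * R_kappa n j x r - x (j + 1, r + 1) * R_kappa n j x (r + 1) =
        x (j, r - 1) * R_kappa n j x (r - 1) - x (j + 1, r) * R_kappa n j x r"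
        using R_kappa_identity[OF x(1) assms(2-4), of r] R_kappa_identity[OF x(1) assms(2-4), of "r - 1"] by simp
      then have "x (j + 1, r + 1) * R_kappa n j x (r + 1) + x (j, r - 1) * R_kappa n j x (r - 1) =
        (x (j, r) + x (j + 1, r)) * R_kappa n j x r"
        by (simp add: algebra_simps)
      then show ?thesis using x(2)[of r] by (simp add: R_fun_def add_divide_distrib[symmetric])
    qed
    have p: "?y (j, r) * ?y (j + 1, r + 1) = x (j, r) * x (j + 1, r + 1)" for r
      using x(2) by (simp add: R_fun_def)
    have "whirl_prod (Suc (Suc j')) ?y (r, s) = whirl_prod (Suc (Suc j')) x (r, s)" for r s
    proof -
      have e: "whirl_prod (Suc (Suc j')) z (r, s) = whirl_prod j' z (r, s) +
        whirl_prod j' z (r, s - 1) * (z (j, s - 1) + z (j + 1, s - 1)) +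
        whirl_prod j' z (r, s - 1 - 1) * (z (j, s - 1 - 1) * z (j + 1, s - 1))" for z
        by (simp add: whirl_prod_Suc j' algebra_simps)
      have p': "?y (j, s - 1 - 1) * ?y (j + 1, s - 1) = x (j, s - 1 - 1) * x (j + 1, s - 1)"
        using p[of "s - 1 - 1"] by simp
      show ?thesis unfolding e W s p' ..
    qed
    then show ?thesis using 2 j' by auto
  qed
qed

text \<open>The point is that \<open>R_kappa\<close> takes the same values at x and at its image.
  Their difference \<open>d\<close> satisfies a homogeneous first-order recursion; one turn around
  the period gives q_{j+1} d = q_j d, so d = 0.\<close>

lemma R_fun_involutive:
  assumes x: "x \<in> R_domain n m j" and j: "1 \<le> j" "j < m" and n: "n > 0"
    and ne: "norm_prod n x j \<noteq> norm_prod n x (j + 1)"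
  shows "R_fun n j x \<in> R_domain n m j" "R_fun n j (R_fun n j x) = x"
proof -
  have x': "x \<in> torus n m" "\<And>r. R_kappa n j x r \<noteq> 0" using x by (auto simp: R_domain_def)
  let ?y = "R_fun n j x"
  have y: "?y \<in> torus n m" by (rule R_fun_torus[OF x j])
  have ny: "norm_prod n ?y j = norm_prod n x (j + 1)" "norm_prod n ?y (j + 1) = norm_prod n x j"
    using norm_prod_R_fun[OF x j] by simp_all
  define d where "d r = R_kappa n j ?y r - R_kappa n j x r" for r
  \<comment> \<open>By the formulas for s_j, the products of the new coordinates with the old
    \<open>R_kappa\<close> are the terms of the identity for x with the two components exchanged.
    The old and the new \<open>R_kappa\<close> thus solve the same inhomogeneous equation.\<close>
  have rel: "?y (j, r) * d r = ?y (j + 1, r + 1) * d (r + 1)" for r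
  proof -
    have "?y (j, r) * R_kappa n j x r - ?y (j + 1, r + 1) * R_kappa n j x (r + 1) =
      norm_prod n x (j + 1) - norm_prod n x j"
      using R_kappa_identity[OF x'(1) j n, of r] x'(2) by (simp add: R_fun_def algebra_simps)
    moreover have "?y (j, r) * R_kappa n j ?y r - ?y (j + 1, r + 1) * R_kappa n j ?y (r + 1) =
      norm_prod n x (j + 1) - norm_prod n x j"
      using R_kappa_identity[OF y j n, of r] ny by simp
    moreover have "a' - a = b' - b" if "a - b = c" "a' - b' = c" for a b c a' b' :: complex
      using that by (auto simp: algebra_simps)
    ultimately show ?thesis unfolding d_def right_diff_distrib by blast
  qed
  have it: "(\<Prod>l<N. ?y (j, r + int l)) * d r = (\<Prod>l<N. ?y (j + 1, r + 1 + int l)) * d (r + int N)" for r N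
  proof (induction N)
    case (Suc N)
    have "(\<Prod>l<Suc N. ?y (j, r + int l)) * d r = ?y (j, r + int N) * ((\<Prod>l<N. ?y (j + 1, r + 1 + int l)) * d (r + int N))"
      using Suc by simp
    also have "\<dots> = (\<Prod>l<N. ?y (j + 1, r + 1 + int l)) * (?y (j, r + int N) * d (r + int N))" by simp
    also have "\<dots> = (\<Prod>l<Suc N. ?y (j + 1, r + 1 + int l)) * d (r + int (Suc N))"
      unfolding rel by (simp add: algebra_simps)
    finally show ?case .
  qed simp
  have k: "R_kappa n j ?y r = R_kappa n j x r" for r
  proof -
    have "d (r + int n) = d r" by (simp add: d_def R_kappa_periodic[OF x'(1)] R_kappa_periodic[OF y])
    moreover have "(\<Prod>l<n. ?y (j, r + int l)) = norm_prod n x (j + 1)" "(\<Prod>l<n. ?y (j + 1, r + 1 + int l)) = norm_prod n x j"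
      using norm_prod_window[OF y, of j r] norm_prod_window[OF y, of "j + 1" "r + 1"] j ny by simp_all
    ultimately have "norm_prod n x (j + 1) * d r = norm_prod n x j * d r" using it[where N = n and r = r] by simp
    then have "d r = 0" using ne by simp
    then show ?thesis by (simp add: d_def)
  qed
  then show "?y \<in> R_domain n m j" using y x'(2) by (simp add: R_domain_def)
  show "R_fun n j ?y = x"
  proof (rule ext)
    fix p :: "nat \<times> int"
    obtain i r where p: "p = (i, r)" by fastforce
    show "R_fun n j ?y p = x p"
      using k x'(2) by (auto simp: p R_fun_def)
  qed
qed

definition R_map :: "nat \<Rightarrow> nat \<Rightarrow> nat \<Rightarrow> (nat \<times> int) pt \<rightharpoonup> (nat \<times> int) pt" where
  "R_map n m j = (\<lambda>x. Some (R_fun n j x)) |` R_domain n m j"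

lemma polyfun_R_kappa: "(\<lambda>x. R_kappa n j x r) \<in> polyfun UNIV"
  unfolding R_kappa_def kappa_def block_def by (intro polyfun_intros)

lemma R_domain_open:
  assumes "n > 0"
  shows "openin (zariski_on (torus n m)) (R_domain n m j)" "1 \<le> j \<Longrightarrow> j < m \<Longrightarrow> one_pt m \<in> R_domain n m j"
proof -
  have "R_domain n m j = {x \<in> torus n m. (\<Prod>l<n. R_kappa n j x (int l)) \<noteq> 0}"
  proof (intro Set.set_eqI iffI)
    fix x assume x: "x \<in> {x \<in> torus n m. (\<Prod>l<n. R_kappa n j x (int l)) \<noteq> 0}"
    have "R_kappa n j x r \<noteq> 0" for r
    proof -
      have "R_kappa n j x r = R_kappa n j x (r mod int n)"
        using x by (intro periodic_mod[of "R_kappa n j x"] R_kappa_periodic[of x n m]) auto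
      also have "r mod int n = int (nat (r mod int n))" using assms by simp
      finally have e: "R_kappa n j x r = R_kappa n j x (int (nat (r mod int n)))" .
      have "nat (r mod int n) < n" using assms by (simp add: nat_less_iff)
      moreover have "\<forall>l\<in>{..<n}. R_kappa n j x (int l) \<noteq> 0" using x by simp
      ultimately show ?thesis unfolding e by blast
    qed
    then show "x \<in> R_domain n m j" using x by (auto simp: R_domain_def)
  qed (auto simp: R_domain_def)
  then show "openin (zariski_on (torus n m)) (R_domain n m j)"
    by (simp only: openin_zariski_on_nonzero[OF polyfun_prod[OF polyfun_R_kappa]])
  show "one_pt m \<in> R_domain n m j" if "1 \<le> j" "j < m"
  proof -
    have "R_kappa n j (one_pt m) r = of_nat n" for r
      using that assms by (simp add: R_kappa_def kappa_def block_def one_pt_def)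
    then show ?thesis using assms one_pt_torus by (simp add: R_domain_def)
  qed
qed

lemma rational_map_R:
  assumes "n > 0" "1 \<le> j" "j < m"
  shows "rational_map (torus n m) (torus n m) (R_map n m j)"
proof -
  have d: "dom (R_map n m j) = R_domain n m j" by (auto simp: R_map_def)
  have nz: "\<And>x r. x \<in> R_domain n m j \<Longrightarrow> R_kappa n j x r \<noteq> 0" by (simp add: R_domain_def)
  show ?thesis
    unfolding rational_map_def d
  proof (intro conjI allI)
    show "openin (zariski_on (torus n m)) (R_domain n m j)" by (rule R_domain_open[OF assms(1)])
    show "R_domain n m j \<noteq> {}" using R_domain_open(2)[OF assms] by blast
    show "ran (R_map n m j) \<subseteq> torus n m"
      using R_fun_torus[OF _ assms(2,3)] by (auto simp: R_map_def ran_def restrict_map_def split: if_splits)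
    fix p :: "nat \<times> int"
    obtain i r where p: "p = (i, r)" by fastforce
    have c: "regular_on (R_domain n m j) (\<lambda>x. x q)" for q by (rule regular_on_polyfun[OF polyfun_coord])
    have "regular_on (R_domain n m j) (\<lambda>x. R_fun n j x (i, r))"
    proof -
      have "regular_on (R_domain n m j) (\<lambda>x. x (j + 1, r + 1) * R_kappa n j x (r + 1) / R_kappa n j x r)"
        "regular_on (R_domain n m j) (\<lambda>x. x (j, r - 1) * R_kappa n j x (r - 1) / R_kappa n j x r)"
        by (intro c regular_on_divide regular_on_mult regular_on_polyfun[OF polyfun_R_kappa] nz; assumption)+
      then show ?thesis using c[of "(i, r)"] by (cases "i = j"; cases "i = j + 1") (simp_all add: R_fun_def)
    qed
    then show "regular_on (R_domain n m j) (\<lambda>x. the (R_map n m j x) p)"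
      by (rule regular_on_cong[THEN iffD1, rotated]) (simp add: R_map_def p)
  qed
qed

text \<open>A generic y is the image of \<open>R_fun n j y\<close>, by involutivity.\<close>

lemma dominant_R:
  assumes n: "n > 0" and j: "1 \<le> j" "j < m"
  shows "dominant (torus n m) (torus n m) (R_map n m j)"
  unfolding dominant_def
proof (intro ballI impI)
  note irr = variety_irreducible[OF torus_variety[OF n, of m]]
  fix h assume h: "h \<in> polyfun UNIV" "\<exists>y\<in>torus n m. h y \<noteq> 0"
  have d: "dom (R_map n m j) = R_domain n m j" by (auto simp: R_map_def)
  have "\<forall>\<^sub>F x in generic (torus n m). h x \<noteq> 0" using h eventually_generic_nonzero[OF irr] by blast
  moreover have "\<forall>\<^sub>F x in generic (torus n m). x \<in> R_domain n m j"
    using rational_map_eventually_dom[OF irr rational_map_R[OF assms]] d by simp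
  moreover note eventually_norm_prod_inj[OF n, of m]
  ultimately have "\<forall>\<^sub>F x in generic (torus n m). h x \<noteq> 0 \<and> x \<in> R_domain n m j \<and> inj_on (norm_prod n x) {1..m}"
    by eventually_elim simp
  then obtain y where y: "h y \<noteq> 0" "y \<in> R_domain n m j" "inj_on (norm_prod n y) {1..m}"
    using eventually_generic_ex[OF irr] by blast
  have "norm_prod n y j \<noteq> norm_prod n y (j + 1)"
    using inj_onD[OF y(3), of j "j + 1"] j by auto
  note i = R_fun_involutive[OF y(2) j n this]
  have "R_fun n j y \<in> dom (R_map n m j)" using i(1) d by simp
  moreover have "h (the (R_map n m j (R_fun n j y))) \<noteq> 0" using i y(1) by (simp add: R_map_def)
  ultimately show "\<exists>x\<in>dom (R_map n m j). h (the (R_map n m j x)) \<noteq> 0" by blast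
qed

text \<open>
  Generically, a point is determined by its image under the product of whirls together with the values
  of \<open>norm_prod\<close>, which \<open>S\<^sub>m\<close> permutes; this characterizes the action up to \<open>rat_eq\<close>.
\<close>

definition permuting :: "nat \<Rightarrow> nat \<Rightarrow> (nat \<Rightarrow> nat) \<Rightarrow> ((nat \<times> int) pt \<rightharpoonup> (nat \<times> int) pt) \<Rightarrow> bool" where
  "permuting n m w F \<longleftrightarrow> rational_map (torus n m) (torus n m) F \<and> dominant (torus n m) (torus n m) F \<and>
     (\<forall>\<^sub>F x in generic (torus n m). x \<in> dom F \<and> whirl_prod m (the (F x)) = whirl_prod m x \<and>
        (\<forall>i\<in>{1..m}. norm_prod n (the (F x)) i = norm_prod n x (w i)))"

section \<open>Uniqueness and composition of permuting maps\<close>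

lemma torus_irreducible: "n > 0 \<Longrightarrow> irreducible_set (torus n m)"
  by (rule variety_irreducible[OF torus_variety])

lemma permutingD:
  assumes "permuting n m w F"
  shows "rational_map (torus n m) (torus n m) F" "dominant (torus n m) (torus n m) F"
    "\<forall>\<^sub>F x in generic (torus n m). x \<in> dom F \<and> whirl_prod m (the (F x)) = whirl_prod m x \<and>
        (\<forall>i\<in>{1..m}. norm_prod n (the (F x)) i = norm_prod n x (w i))"
  using assms by (auto simp: permuting_def)

lemma permuting_eventually:
  assumes "n > 0" "permuting n m w F" "\<forall>\<^sub>F x in generic (torus n m). P x"
  shows "\<forall>\<^sub>F x in generic (torus n m). x \<in> dom F \<and> P (the (F x))"
  by (rule dominant_eventually[OF torus_irreducible torus_irreducible permutingD(1,2)[OF assms(2)] assms(3)])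
    (rule assms(1))+

lemma permuting_rat_eq:
  assumes n: "n > 0" and "permuting n m w F" "permuting n m w G"
  shows "rat_eq (torus n m) F G"
  unfolding rat_eq_iff[OF torus_irreducible[OF n]]
  using permutingD(3)[OF assms(2)] permutingD(3)[OF assms(3)]
    permuting_eventually[OF n assms(2) eventually_norm_prod_inj[OF n]]
proof eventually_elim
  case (elim x)
  then have d: "x \<in> dom F" "x \<in> dom G" by blast+
  have "the (F x) = the (G x)"
    by (rule whirl_factorization_unique[OF rational_map_in[OF permutingD(1)[OF assms(2)] d(1)]
          rational_map_in[OF permutingD(1)[OF assms(3)] d(2)] n]) (use elim in auto)
  then show ?case using d by auto
qed

lemma permuting_cong:
  assumes n: "n > 0" and F: "permuting n m w F" and e: "rat_eq (torus n m) F G"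
    and G: "rational_map (torus n m) (torus n m) G" "dominant (torus n m) (torus n m) G"
  shows "permuting n m w G"
  unfolding permuting_def
proof (intro conjI G)
  show "\<forall>\<^sub>F x in generic (torus n m). x \<in> dom G \<and> whirl_prod m (the (G x)) = whirl_prod m x \<and>
        (\<forall>i\<in>{1..m}. norm_prod n (the (G x)) i = norm_prod n x (w i))"
    using permutingD(3)[OF F] e[unfolded rat_eq_iff[OF torus_irreducible[OF n]]]
    by eventually_elim auto
qed

lemma dominant_comp:
  assumes "irreducible_set V" "irreducible_set W" "rational_map V W f" "rational_map W Z g"
    "dominant V W f" "dominant W Z g"
  shows "dominant V Z (g \<circ>\<^sub>m f)"
  unfolding dominant_def
proof (intro ballI impI)
  fix h assume h: "h \<in> polyfun UNIV" "\<exists>y\<in>Z. h y \<noteq> 0"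
  have "openin (zariski_on W) {x\<in>dom g. h (the (g x)) \<noteq> 0}"
    by (intro openin_regular_nonzero regular_on_compose_polyfun[OF h(1)] rational_map_regular[OF assms(4)]
        rational_map_dom[OF assms(4)] order_refl)
  moreover have "{x\<in>dom g. h (the (g x)) \<noteq> 0} \<noteq> {}" using assms(6) h unfolding dominant_def by blast
  ultimately have "\<forall>\<^sub>F x in generic W. x \<in> {x\<in>dom g. h (the (g x)) \<noteq> 0}"
    by (rule eventually_generic_open[OF assms(2)])
  from dominant_eventually[OF assms(1-3,5) this]
  obtain x where x: "x \<in> dom f" "the (f x) \<in> dom g" "h (the (g (the (f x)))) \<noteq> 0"
    using eventually_generic_ex[OF assms(1)] by blast
  then show "\<exists>x\<in>dom (g \<circ>\<^sub>m f). h (the ((g \<circ>\<^sub>m f) x)) \<noteq> 0"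
    by (intro bexI[of _ x]) (simp_all add: dom_map_comp the_map_comp)
qed

lemma rational_map_comp_dominant:
  assumes "irreducible_set V" "irreducible_set W" "rational_map V W f" "rational_map W Z g" "dominant V W f"
  shows "rational_map V Z (g \<circ>\<^sub>m f)"
proof (rule rational_map_comp[OF assms(3,4)])
  show "dom (g \<circ>\<^sub>m f) \<noteq> {}"
    using eventually_generic_ex[OF assms(1)
        dominant_eventually[OF assms(1-3,5) rational_map_eventually_dom[OF assms(2,4)]]]
    by (auto simp: dom_map_comp)
qed

text \<open>Indices are pulled back: position i after \<open>G\<close> is position w' i before it,
  hence w (w' i) before \<open>F\<close>. Composition of maps thus reverses that of permutations,
  and pullback to functions restores the order.\<close>

lemma permuting_comp:
  assumes n: "n > 0" and F: "permuting n m w F" and G: "permuting n m w' G" and w': "w' permutes {1..m}"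
  shows "permuting n m (w \<circ> w') (G \<circ>\<^sub>m F)"
  unfolding permuting_def
proof (intro conjI)
  note irr = torus_irreducible[OF n, of m]
  show "rational_map (torus n m) (torus n m) (G \<circ>\<^sub>m F)"
    by (rule rational_map_comp_dominant[OF irr irr permutingD(1)[OF F] permutingD(1)[OF G] permutingD(2)[OF F]])
  show "dominant (torus n m) (torus n m) (G \<circ>\<^sub>m F)"
    by (rule dominant_comp[OF irr irr permutingD(1)[OF F] permutingD(1)[OF G] permutingD(2)[OF F] permutingD(2)[OF G]])
  show "\<forall>\<^sub>F x in generic (torus n m). x \<in> dom (G \<circ>\<^sub>m F) \<and> whirl_prod m (the ((G \<circ>\<^sub>m F) x)) = whirl_prod m x \<and>
      (\<forall>i\<in>{1..m}. norm_prod n (the ((G \<circ>\<^sub>m F) x)) i = norm_prod n x ((w \<circ> w') i))"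
    using permutingD(3)[OF F] permuting_eventually[OF n F permutingD(3)[OF G]]
  proof eventually_elim
    case (elim x)
    have "w' i \<in> {1..m}" if "i \<in> {1..m}" for i using permutes_in_image[OF w'] that by blast
    then show ?case using elim by (simp add: dom_map_comp the_map_comp)
  qed
qed

lemma permuting_id:
  assumes n: "n > 0" shows "permuting n m id (Some |` torus n m)"
proof -
  have o: "openin (zariski_on (torus n m)) (torus n m)" using openin_topspace[of "zariski_on (torus n m)"] by simp
  have d: "dom (Some |` torus n m) = torus n m" by auto
  have r: "regular_on (torus n m) (\<lambda>x. the ((Some |` torus n m) x) j)" for j
    by (rule regular_on_cong[THEN iffD1, OF _ regular_on_polyfun[OF polyfun_coord[of j]]]) simp
  have "rational_map (torus n m) (torus n m) (Some |` torus n m)"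
    unfolding rational_map_def d using o r torus_irreducible[OF n, of m]
    by (auto simp: irreducible_set_def ran_def restrict_map_def split: if_splits)
  moreover have "dominant (torus n m) (torus n m) (Some |` torus n m)"
    unfolding dominant_def d by (auto simp: restrict_map_def)
  moreover have "\<forall>\<^sub>F x in generic (torus n m). x \<in> torus n m"
    by (rule eventually_generic_in[OF torus_irreducible[OF n]])
  then have "\<forall>\<^sub>F x in generic (torus n m). x \<in> dom (Some |` torus n m) \<and>
      whirl_prod m (the ((Some |` torus n m) x)) = whirl_prod m x \<and>
      (\<forall>i\<in>{1..m}. norm_prod n (the ((Some |` torus n m) x)) i = norm_prod n x (id i))"
    unfolding d by eventually_elim simp
  ultimately show ?thesis by (simp add: permuting_def)
qed

lemma permuting_R:
  assumes n: "n > 0" and j: "1 \<le> j" "j < m"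
  shows "permuting n m (Transposition.transpose j (j + 1)) (R_map n m j)"
proof -
  have d: "dom (R_map n m j) = R_domain n m j" by (auto simp: R_map_def)
  have "\<forall>\<^sub>F x in generic (torus n m). x \<in> dom (R_map n m j)"
    by (rule rational_map_eventually_dom[OF torus_irreducible[OF n] rational_map_R[OF assms]])
  then have "\<forall>\<^sub>F x in generic (torus n m). x \<in> dom (R_map n m j) \<and>
      whirl_prod m (the (R_map n m j x)) = whirl_prod m x \<and>
      (\<forall>i\<in>{1..m}. norm_prod n (the (R_map n m j x)) i = norm_prod n x (Transposition.transpose j (j + 1) i))"
  proof eventually_elim
    case (elim x)
    then have x: "x \<in> R_domain n m j" by (simp add: d)
    then show ?case
      using norm_prod_R_fun[OF x j] whirl_prod_R_fun[OF x j n, of m] j elim by (simp add: R_map_def)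
  qed
  then show ?thesis unfolding permuting_def using rational_map_R[OF assms] dominant_R[OF assms] by blast
qed

text \<open>Induction over products of adjacent transpositions, the generators on which the
  birational action is given.\<close>

lemma permutes_adjacent_induct [consumes 1, case_names id adjacent comp]:
  assumes "w permutes {1..m::nat}" and id: "P id"
    and adj: "\<And>j. 1 \<le> j \<Longrightarrow> j < m \<Longrightarrow> P (Transposition.transpose j (j + 1))"
    and comp: "\<And>v w. v permutes {1..m} \<Longrightarrow> w permutes {1..m} \<Longrightarrow> P v \<Longrightarrow> P w \<Longrightarrow> P (v \<circ> w)"
  shows "P w"
proof -
  have tp: "Transposition.transpose a b permutes {1..m}" if "a \<in> {1..m}" "b \<in> {1..m}" for a b
    using that by (rule permutes_swap_id)
  have less: "P (Transposition.transpose a (a + Suc d))" if "1 \<le> a" "a + Suc d \<le> m" for a d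
    using that
  proof (induction d)
    case 0
    then show ?case using adj[of a] by simp
  next
    case (Suc d)
    let ?b = "a + Suc d"
    \<comment> \<open>Conjugation by an adjacent transposition lengthens the exchanged interval by
      one.\<close>
    have e: "Transposition.transpose a (a + Suc (Suc d)) =
      Transposition.transpose ?b (?b + 1) \<circ> Transposition.transpose a ?b \<circ> Transposition.transpose ?b (?b + 1)"
      by (auto simp: fun_eq_iff Transposition.transpose_def)
    show ?case unfolding e using Suc
      by (intro comp permutes_compose tp adj Suc.IH) auto
  qed
  have "P (Transposition.transpose a b)" if ab: "a \<in> {1..m}" "b \<in> {1..m}" "a \<noteq> b" for a b
  proof -
    consider "a < b" | "b < a" using ab(3) by linarith
    then show ?thesis
    proof cases
      case 1
      then obtain d where "b = a + Suc d" by (metis less_imp_Suc_add add_Suc_right)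
      then show ?thesis using less[of a d] ab by simp
    next
      case 2
      then obtain d where "a = b + Suc d" by (metis less_imp_Suc_add add_Suc_right)
      then show ?thesis using less[of b d] ab by (simp add: transpose_commute)
    qed
  qed
  note sw = this
  from assms(1) finite_atLeastAtMost[of 1 m] show ?thesis
  proof (induction w rule: permutes_induct)
    case id
    then show ?case by (rule assms(2))
  next
    case (swap a b p)
    then show ?case using comp[OF tp] sw by blast
  qed
qed

lemma ex_permuting:
  assumes n: "n > 0" and "w permutes {1..m}" shows "\<exists>F. permuting n m w F"
  using assms(2)
proof (induction w rule: permutes_adjacent_induct)
  case id
  then show ?case using permuting_id[OF n] by blast
next
  case (adjacent j)
  then show ?case using permuting_R[OF n] by blast
next
  case (comp v w)
  then show ?case using permuting_comp[OF n] by blast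
qed

lemma permuting_ring_iso:
  assumes n: "n > 0" and w: "w permutes {1..m}" and F: "permuting n m w F"
  shows "pullback (torus n m) F \<in> ring_iso (function_field (torus n m)) (function_field (torus n m))"
proof -
  let ?T = "torus n m" and ?K = "function_field (torus n m)"
  note irr = torus_irreducible[OF n, of m]
  note pF = irr irr permutingD(1,2)[OF F]
  have hom: "pullback ?T F \<in> Ring.ring_hom ?K ?K" by (rule pullback_ring_hom[OF pF])
  have "bij_betw (pullback ?T F) (carrier ?K) (carrier ?K)"
    unfolding bij_betw_def
  proof (intro conjI pullback_inj_on[OF pF] subset_antisym subsetI)
    fix a assume "a \<in> pullback ?T F ` carrier ?K"
    then show "a \<in> carrier ?K" using ring_hom_memE(1)[OF hom] by blast
  next
    fix a assume "a \<in> carrier ?K"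
    then obtain f where f: "rational_fun ?T f" "a = rat_class ?T f" by (auto simp: carrier_function_field)
    \<comment> \<open>A map \<open>G\<close> for the inverse permutation supplies the preimage: the
      composite of f with \<open>G\<close> pulls back to f along \<open>F\<close>.\<close>
    have iw: "inv_into UNIV w permutes {1..m}" by (rule permutes_inv[OF w])
    obtain G where G: "permuting n m (inv_into UNIV w) G" using ex_permuting[OF n iw] by blast
    have "permuting n m id (G \<circ>\<^sub>m F)"
      using permuting_comp[OF n F G iw] permutes_inv_o(1)[OF w] by simp
    then have e: "rat_eq ?T (G \<circ>\<^sub>m F) (Some |` ?T)" by (rule permuting_rat_eq[OF n _ permuting_id[OF n]])
    have g: "rational_fun ?T (f \<circ>\<^sub>m G)"
      by (rule dominant_rational_fun(1)[OF irr irr permutingD(1,2)[OF G] f(1)])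
    have "rat_eq ?T ((f \<circ>\<^sub>m G) \<circ>\<^sub>m F) f"
      unfolding rat_eq_iff[OF irr]
      using e[unfolded rat_eq_iff[OF irr]] rational_fun_eventually_dom[OF irr f(1)] eventually_generic_in[OF irr]
    proof eventually_elim
      case (elim x)
      then have "(G \<circ>\<^sub>m F) x = Some x" by simp
      then have "((f \<circ>\<^sub>m G) \<circ>\<^sub>m F) x = f x"
        by (auto simp: map_comp_def split: option.splits)
      then show ?case using elim by (simp add: domIff)
    qed
    then have "pullback ?T F (rat_class ?T (f \<circ>\<^sub>m G)) = a"
      unfolding pullback_rat_class[OF pF g] f(2) by (rule rat_class_cong[OF irr])
    moreover have "rat_class ?T (f \<circ>\<^sub>m G) \<in> carrier ?K" using g by (auto simp: carrier_function_field)
    ultimately show "a \<in> pullback ?T F ` carrier ?K" by blast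
  qed
  with hom show ?thesis by (simp add: ring_iso_def)
qed

section \<open>Existence and rigidity of the action on the function field\<close>

lemma coord_rational: "n > 0 \<Longrightarrow> rational_fun (torus n m) ((\<lambda>x. Some (x p)) |` torus n m)"
  by (rule rational_fun_polyfun[OF torus_irreducible polyfun_coord])

lemma R_coord_R_map:
  assumes n: "n > 0" and j: "1 \<le> j" "j < m"
  shows "rat_eq (torus n m) (((\<lambda>x. Some (x (i, r))) |` torus n m) \<circ>\<^sub>m R_map n m j) (R_coord n j i r |` torus n m)"
  unfolding rat_eq_iff[OF torus_irreducible[OF n]]
  using rational_map_eventually_dom[OF torus_irreducible[OF n] rational_map_R[OF n j]]
proof eventually_elim
  case (elim x)
  then have x: "x \<in> R_domain n m j" by (simp add: R_map_def)
  then have x': "x \<in> torus n m" "R_kappa n j x r \<noteq> 0" by (auto simp: R_domain_def)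
  have v: "R_coord n j i r x = Some (R_fun n j x (i, r))"
    using x'(2) unfolding R_coord_def R_fun_def R_kappa_def Let_def by (simp add: block_def)
  have "R_map n m j x = Some (R_fun n j x)" using x by (simp add: R_map_def)
  then have e1: "(((\<lambda>x. Some (x (i, r))) |` torus n m) \<circ>\<^sub>m R_map n m j) x = Some (R_fun n j x (i, r))"
    using R_fun_torus[OF x j] by (simp add: map_comp_def)
  have e2: "(R_coord n j i r |` torus n m) x = Some (R_fun n j x (i, r))" using v x'(1) by simp
  show ?case by (intro conjI, rule domI, rule e1, rule domI, rule e2, rule trans[OF e1 e2[symmetric]])
qed

text \<open>Any choice of permuting maps will do. Two maps for the same permutation are
  \<open>rat_eq\<close>, so the choice is multiplicative up to \<open>rat_eq\<close>, and exactly
  multiplicative on classes.\<close>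

lemma ex_R_matrix_action:
  assumes n: "n > 0" and m: "m \<ge> 1"
  shows "\<exists>\<rho>. R_matrix_action n m \<rho>"
proof -
  let ?T = "torus n m" and ?K = "function_field (torus n m)" and ?G = "sym_group m"
  note irr = torus_irreducible[OF n, of m]
  define \<rho> where "\<rho> w = (SOME F. permuting n m w F)" for w
  have \<rho>: "permuting n m w (\<rho> w)" if "w permutes {1..m}" for w
    unfolding \<rho>_def by (rule someI_ex[OF ex_permuting[OF n that]])
  let ?\<phi> = "\<lambda>w. restrict (pullback ?T (\<rho> w)) (carrier ?K)"
  have pb: "pullback ?T (\<rho> w) (rat_class ?T f) = rat_class ?T (f \<circ>\<^sub>m \<rho> w)" if "w permutes {1..m}" "rational_fun ?T f" for w f
    by (rule pullback_rat_class[OF irr irr permutingD(1,2)[OF \<rho>[OF that(1)]] that(2)])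
  have pr: "rational_fun ?T (f \<circ>\<^sub>m \<rho> w)" "\<forall>\<^sub>F x in generic ?T. x \<in> dom (f \<circ>\<^sub>m \<rho> w)"
    if "w permutes {1..m}" "rational_fun ?T f" for w f
    using dominant_rational_fun[OF irr irr permutingD(1,2)[OF \<rho>[OF that(1)]] that(2)] by simp_all
  have iso: "pullback ?T (\<rho> w) \<in> ring_iso ?K ?K" if "w permutes {1..m}" for w
    by (rule permuting_ring_iso[OF n that \<rho>[OF that]])
  have bij: "?\<phi> w \<in> Bij (carrier ?K)" if "w permutes {1..m}" for w
  proof -
    have "bij_betw (pullback ?T (\<rho> w)) (carrier ?K) (carrier ?K)"
      using iso[OF that] by (simp add: ring_iso_def)
    then have "bij_betw (?\<phi> w) (carrier ?K) (carrier ?K)"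
      by (rule bij_betw_cong[THEN iffD1, rotated]) simp
    then show ?thesis by (simp add: Bij_def)
  qed
  have comp: "?\<phi> (v \<circ> w) = compose (carrier ?K) (?\<phi> v) (?\<phi> w)"
    if v: "v permutes {1..m}" and w: "w permutes {1..m}" for v w
  proof (rule ext)
    fix a
    show "?\<phi> (v \<circ> w) a = compose (carrier ?K) (?\<phi> v) (?\<phi> w) a"
    proof (cases "a \<in> carrier ?K")
      case True
      then obtain f where f: "rational_fun ?T f" "a = rat_class ?T f" by (auto simp: carrier_function_field)
      have vw: "v \<circ> w permutes {1..m}" by (rule permutes_compose[OF w v])
      have "rat_eq ?T (\<rho> (v \<circ> w)) (\<rho> w \<circ>\<^sub>m \<rho> v)"
        by (rule permuting_rat_eq[OF n \<rho>[OF vw] permuting_comp[OF n \<rho>[OF v] \<rho>[OF w] w]])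
      then have "rat_eq ?T (f \<circ>\<^sub>m \<rho> (v \<circ> w)) (f \<circ>\<^sub>m (\<rho> w \<circ>\<^sub>m \<rho> v))"
        by (rule rat_eq_comp_left[OF irr _ pr(2)[OF vw f(1)]])
      moreover have "f \<circ>\<^sub>m (\<rho> w \<circ>\<^sub>m \<rho> v) = (f \<circ>\<^sub>m \<rho> w) \<circ>\<^sub>m \<rho> v"
        by (auto simp: map_comp_def split: option.splits)
      ultimately have "rat_class ?T (f \<circ>\<^sub>m \<rho> (v \<circ> w)) = rat_class ?T ((f \<circ>\<^sub>m \<rho> w) \<circ>\<^sub>m \<rho> v)"
        using rat_class_cong[OF irr] by simp
      moreover have "rat_class ?T (f \<circ>\<^sub>m \<rho> w) \<in> carrier ?K"
        using pr(1)[OF w f(1)] by (auto simp: carrier_function_field)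
      ultimately show ?thesis
        using True pb[OF w f(1)] pb[OF v pr(1)[OF w f(1)]] pb[OF vw f(1)] by (simp add: compose_def f(2))
    qed (simp add: compose_def)
  qed
  have act: "group_action ?G (carrier ?K) ?\<phi>"
  proof -
    have "?\<phi> \<in> hom ?G (BijGroup (carrier ?K))"
      by (rule homI) (use bij comp in \<open>simp_all add: sym_group_def BijGroup_def\<close>)
    then show ?thesis
      by (intro group_action.intro group_hom.intro group_hom_axioms.intro sym_group_is_group group_BijGroup)
  qed
  have "R_matrix_action n m \<rho>"
    unfolding R_matrix_action_def Let_def X_crystal_explicit[OF m]
  proof (simp only: X_explicit_def crystal.simps, intro conjI ballI allI act)
    fix w assume "w \<in> carrier ?G"
    then have w: "w permutes {1..m}" by (simp add: sym_group_def)
    show "rational_map ?T ?T (\<rho> w)" by (rule permutingD(1)[OF \<rho>[OF w]])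
    show "pullback ?T (\<rho> w) \<in> ring_iso ?K ?K" by (rule iso[OF w])
  next
    fix j i r assume "j \<in> {1..<m}" "i \<in> {1..m}"
    then have j: "1 \<le> j" "j < m" by auto
    let ?s = "Transposition.transpose j (j + 1)" and ?c = "(\<lambda>x. Some (x (i, r))) |` ?T"
    have s: "?s permutes {1..m}" by (rule permutes_swap_id) (use j in auto)
    have e: "rat_eq ?T (\<rho> ?s) (R_map n m j)" by (rule permuting_rat_eq[OF n \<rho>[OF s] permuting_R[OF n j]])
    have "rat_eq ?T (?c \<circ>\<^sub>m \<rho> ?s) (?c \<circ>\<^sub>m R_map n m j)"
      by (rule rat_eq_comp_left[OF irr e pr(2)[OF s coord_rational[OF n]]])
    then have "rat_eq ?T (?c \<circ>\<^sub>m \<rho> ?s) (R_coord n j i r |` ?T)"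
      by (rule rat_eq_trans[OF irr _ R_coord_R_map[OF n j]])
    then show "pullback ?T (\<rho> ?s) (rat_class ?T ?c) = rat_class ?T (R_coord n j i r |` ?T)"
      unfolding pb[OF s coord_rational[OF n]] by (rule rat_class_cong[OF irr])
  qed
  then show ?thesis by blast
qed

text \<open>If a polynomial h that is nonzero somewhere on V vanished along the image, h and 0 would
  have the same composite with f. Their pullbacks would then share a member, against
  injectivity.\<close>

lemma injective_pullback_dominant:
  assumes irr: "irreducible_set V" and f: "rational_map V V f"
    and inj: "inj_on (pullback V f) (carrier (function_field V))"
    and cl: "\<And>a. a \<in> carrier (function_field V) \<Longrightarrow> pullback V f a \<in> carrier (function_field V)"
  shows "dominant V V f"
  unfolding dominant_def
proof (intro ballI impI, rule ccontr)
  fix h assume h: "h \<in> polyfun UNIV" "\<exists>y\<in>V. h y \<noteq> 0" and no: "\<not> (\<exists>x\<in>dom f. h (the (f x)) \<noteq> 0)"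
  let ?h = "(\<lambda>x. Some (h x)) |` V" and ?z = "(\<lambda>_. Some 0) |` V"
  note rh = rational_fun_polyfun[OF irr h(1)] and rz = rational_fun_const[OF irr, of 0]
  have fne: "dom f \<noteq> {}" using f by (simp add: rational_map_def)
  have comp: "?h \<circ>\<^sub>m f = ?z \<circ>\<^sub>m f"
  proof
    fix x show "(?h \<circ>\<^sub>m f) x = (?z \<circ>\<^sub>m f) x"
    proof (cases "f x")
      case (Some y)
      have "h y = 0" using no domI[of f, OF Some] Some by (metis option.sel)
      moreover have "y \<in> V" using rational_map_in[OF f domI[of f, OF Some]] Some by simp
      ultimately show ?thesis using Some by (simp add: map_comp_def)
    qed (simp add: map_comp_def)
  qed
  have d: "dom (?z \<circ>\<^sub>m f) = dom f" using rational_map_in[OF f] by (auto simp: dom_map_comp)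
  have q: "rational_fun V (?z \<circ>\<^sub>m f)" by (rule rational_fun_comp[OF f rz]) (use fne in \<open>simp only: d not_False_eq_True\<close>)
  have self: "(g \<circ>\<^sub>m f) \<in> pullback V f (rat_class V g)" if "rational_fun V g" "rational_fun V (g \<circ>\<^sub>m f)" for g
    unfolding pullback_def using rat_class_self[OF irr that(1)] rat_class_self[OF irr that(2)] by blast
  have m1: "?z \<circ>\<^sub>m f \<in> pullback V f (rat_class V ?h)" using self[OF rh] q unfolding comp by simp
  have m2: "?z \<circ>\<^sub>m f \<in> pullback V f (rat_class V ?z)" by (rule self[OF rz q])
  have K: "rat_class V ?h \<in> carrier (function_field V)" "rat_class V ?z \<in> carrier (function_field V)"
    using rh rz by (auto simp: carrier_function_field)
  \<comment> \<open>\<open>pullback\<close> is a union over representatives and is not yet known to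
    be the class of a composite. Since its value is assumed to lie in the carrier, any one member
    determines it.\<close>
  have cls: "a = rat_class V g" if "a \<in> carrier (function_field V)" "g \<in> a" for a g
    using that rat_class_cong[OF irr, of g] by (force simp: carrier_function_field rat_class_def)
  have "pullback V f (rat_class V ?h) = pullback V f (rat_class V ?z)"
    using cls[OF cl[OF K(1)] m1] cls[OF cl[OF K(2)] m2] by simp
  then have "rat_class V ?h = rat_class V ?z" using inj_onD[OF inj _ K] by blast
  then have "rat_eq V ?h ?z" by (rule rat_class_eqD[OF irr rh])
  then have "\<forall>\<^sub>F x in generic V. h x = 0"
    unfolding rat_eq_iff[OF irr] by eventually_elim (auto simp: restrict_map_def split: if_splits)
  moreover have "\<forall>\<^sub>F x in generic V. h x \<noteq> 0" using h eventually_generic_nonzero[OF irr] by blast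
  ultimately have "\<forall>\<^sub>F x in generic V. False" by eventually_elim simp
  then show False using generic_nonbot[OF irr] by simp
qed

lemma rational_map_coords_rat_eq:
  assumes irr: "irreducible_set (torus n m)" and F: "rational_map (torus n m) (torus n m) F"
    and G: "rational_map (torus n m) (torus n m) G"
    and c: "\<And>i r. 1 \<le> i \<Longrightarrow> i \<le> m \<Longrightarrow> rat_eq (torus n m) (((\<lambda>x. Some (x (i, r))) |` torus n m) \<circ>\<^sub>m F)
      (((\<lambda>x. Some (x (i, r))) |` torus n m) \<circ>\<^sub>m G)"
  shows "rat_eq (torus n m) F G"
proof (rule rational_map_rat_eqI[OF irr F G])
  fix p :: "nat \<times> int"
  obtain i r where p: "p = (i, r)" by fastforce
  show "\<forall>\<^sub>F x in generic (torus n m). x \<in> dom F \<inter> dom G \<longrightarrow> the (F x) p = the (G x) p"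
  proof (cases "1 \<le> i \<and> i \<le> m")
    case True
    then have "1 \<le> i" "i \<le> m" by auto
    from c[OF this, of r, unfolded rat_eq_iff[OF irr]] show ?thesis
      by eventually_elim
        (use rational_map_in[OF F] rational_map_in[OF G] in \<open>force simp: map_comp_def p split: option.splits\<close>)
  next
    case False
    have "the (F x) p = the (G x) p" if "x \<in> dom F \<inter> dom G" for x
      using torus_zero[OF rational_map_in[OF F] False] torus_zero[OF rational_map_in[OF G] False] that by (simp add: p)
    then show ?thesis by simp
  qed
qed

text \<open>The conditions on \<rho> concern classes only, but the coordinate classes determine a
  map up to \<open>rat_eq\<close>. Unit law, prescribed values and composition law of the action
  handle the three cases of the induction over adjacent transpositions.\<close>

lemma R_matrix_action_permuting:
  assumes n: "n > 0" and m: "m \<ge> 1" and A: "R_matrix_action n m \<rho>" and w: "w permutes {1..m}"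
  shows "permuting n m w (\<rho> w)"
proof -
  let ?T = "torus n m" and ?K = "function_field (torus n m)" and ?G = "sym_group m"
  let ?\<phi> = "\<lambda>w. restrict (pullback ?T (\<rho> w)) (carrier ?K)"
  note irr = torus_irreducible[OF n, of m]
  have pts: "points (X_crystal n m) = ?T" by (simp add: X_crystal_explicit[OF m] X_explicit_def)
  note A' = A[unfolded R_matrix_action_def Let_def pts]
  have G: "carrier ?G = {w. w permutes {1..m}}" by (simp add: sym_group_def)
  have rat: "rational_map ?T ?T (\<rho> w)" and iso: "pullback ?T (\<rho> w) \<in> ring_iso ?K ?K" if "w permutes {1..m}" for w
    using A'[THEN conjunct1, THEN bspec, of w] that G by simp_all
  have act: "group_action ?G (carrier ?K) ?\<phi>" using A' by (elim conjE)
  have co: "pullback ?T (\<rho> (Transposition.transpose j (j + 1))) (rat_class ?T ((\<lambda>x. Some (x (i, r))) |` ?T)) =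
      rat_class ?T (R_coord n j i r |` ?T)" if "j \<in> {1..<m}" "i \<in> {1..m}" for j i r
    using A'[THEN conjunct2, THEN conjunct2, THEN bspec, OF that(1), THEN bspec, OF that(2)] by simp
  have dmn: "dominant ?T ?T (\<rho> w)" if "w permutes {1..m}" for w
  proof (rule injective_pullback_dominant[OF irr rat[OF that]])
    show "inj_on (pullback ?T (\<rho> w)) (carrier ?K)"
      using iso[OF that] by (simp add: ring_iso_def bij_betw_def)
    show "pullback ?T (\<rho> w) a \<in> carrier ?K" if "a \<in> carrier ?K" for a
      using iso[OF \<open>w permutes {1..m}\<close>] that by (auto simp: ring_iso_def bij_betw_def)
  qed
  let ?c = "\<lambda>i r. (\<lambda>x. Some (x (i, r))) |` ?T"
  have cr: "rational_fun ?T (?c i r)" for i r by (rule coord_rational[OF n])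
  have cK: "rat_class ?T (?c i r) \<in> carrier ?K" for i r using cr by (auto simp: carrier_function_field)
  have pb: "pullback ?T (\<rho> w) (rat_class ?T f) = rat_class ?T (f \<circ>\<^sub>m \<rho> w)"
    and pr: "rational_fun ?T (f \<circ>\<^sub>m \<rho> w)"
    if "w permutes {1..m}" "rational_fun ?T f" for w f
    using pullback_rat_class[OF irr irr rat[OF that(1)] dmn[OF that(1)] that(2)]
      dominant_rational_fun(1)[OF irr irr rat[OF that(1)] dmn[OF that(1)] that(2)] by simp_all
  show ?thesis
    using w
  proof (induction w rule: permutes_adjacent_induct)
    case id
    have idp: "id permutes {1..m}" by (rule permutes_id)
    have "rat_eq ?T (Some |` ?T) (\<rho> id)"
    proof (rule rational_map_coords_rat_eq[OF irr permutingD(1)[OF permuting_id[OF n]] rat[OF idp]])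
      fix i r
      have "restrict (\<lambda>a. a) (carrier ?K) = ?\<phi> id"
        using group_action.id_eq_one[OF act] by (simp only: sym_group_one)
      from fun_cong[OF this, of "rat_class ?T (?c i r)"]
      have "pullback ?T (\<rho> id) (rat_class ?T (?c i r)) = rat_class ?T (?c i r)"
        using cK[of i r] by (simp only: restrict_apply' if_True)
      then have "rat_class ?T (?c i r \<circ>\<^sub>m \<rho> id) = rat_class ?T (?c i r)"
        using cK[of i r] pb[OF idp cr[of i r]] by simp
      then have e: "rat_eq ?T (?c i r \<circ>\<^sub>m \<rho> id) (?c i r)" by (rule rat_class_eqD[OF irr pr[OF idp cr]])
      have "?c i r \<circ>\<^sub>m (Some |` ?T) = ?c i r"
        by (auto simp: map_comp_def restrict_map_def)
      then show "rat_eq ?T (?c i r \<circ>\<^sub>m (Some |` ?T)) (?c i r \<circ>\<^sub>m \<rho> id)" using rat_eq_sym[OF e] by simp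
    qed
    then show ?case by (rule permuting_cong[OF n permuting_id[OF n] _ rat[OF idp] dmn[OF idp]])
  next
    case (adjacent j)
    let ?s = "Transposition.transpose j (j + 1)"
    have s: "?s permutes {1..m}" by (rule permutes_swap_id) (use adjacent in auto)
    have "rat_eq ?T (R_map n m j) (\<rho> ?s)"
    proof (rule rational_map_coords_rat_eq[OF irr rational_map_R[OF n adjacent] rat[OF s]])
      fix i r assume i: "1 \<le> i" "i \<le> m"
      have "rat_class ?T (?c i r \<circ>\<^sub>m \<rho> ?s) = rat_class ?T (R_coord n j i r |` ?T)"
        using co[of j i r] adjacent i pb[OF s cr[of i r]] by simp
      then have "rat_eq ?T (?c i r \<circ>\<^sub>m \<rho> ?s) (R_coord n j i r |` ?T)" by (rule rat_class_eqD[OF irr pr[OF s cr]])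
      then show "rat_eq ?T (?c i r \<circ>\<^sub>m R_map n m j) (?c i r \<circ>\<^sub>m \<rho> ?s)"
        using rat_eq_trans[OF irr R_coord_R_map[OF n adjacent]] rat_eq_sym by blast
    qed
    then show ?case by (rule permuting_cong[OF n permuting_R[OF n adjacent] _ rat[OF s] dmn[OF s]])
  next
    case (comp v w)
    have vw: "v \<circ> w permutes {1..m}" by (rule permutes_compose[OF comp(2,1)])
    have P: "permuting n m (v \<circ> w) (\<rho> w \<circ>\<^sub>m \<rho> v)" by (rule permuting_comp[OF n comp(3,4,2)])
    have "rat_eq ?T (\<rho> w \<circ>\<^sub>m \<rho> v) (\<rho> (v \<circ> w))"
    proof (rule rational_map_coords_rat_eq[OF irr permutingD(1)[OF P] rat[OF vw]])
      fix i r
      have "?\<phi> (v \<circ> w) (rat_class ?T (?c i r)) = ?\<phi> v (?\<phi> w (rat_class ?T (?c i r)))"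
        using group_action.composition_rule[OF act cK[of i r], of v w] comp(1,2) by (simp add: G sym_group_mult)
      moreover have "rat_class ?T (?c i r \<circ>\<^sub>m \<rho> w) \<in> carrier ?K"
        using pr[OF comp(2) cr[of i r]] by (auto simp: carrier_function_field)
      ultimately have "rat_class ?T (?c i r \<circ>\<^sub>m \<rho> (v \<circ> w)) = rat_class ?T ((?c i r \<circ>\<^sub>m \<rho> w) \<circ>\<^sub>m \<rho> v)"
        using cK[of i r] pb[OF vw cr[of i r]] pb[OF comp(2) cr[of i r]] pb[OF comp(1) pr[OF comp(2) cr[of i r]]] by simp
      then have e: "rat_eq ?T (?c i r \<circ>\<^sub>m \<rho> (v \<circ> w)) ((?c i r \<circ>\<^sub>m \<rho> w) \<circ>\<^sub>m \<rho> v)"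
        by (rule rat_class_eqD[OF irr pr[OF vw cr]])
      have "(?c i r \<circ>\<^sub>m \<rho> w) \<circ>\<^sub>m \<rho> v = ?c i r \<circ>\<^sub>m (\<rho> w \<circ>\<^sub>m \<rho> v)"
        by (auto simp: map_comp_def split: option.splits)
      then show "rat_eq ?T (?c i r \<circ>\<^sub>m (\<rho> w \<circ>\<^sub>m \<rho> v)) (?c i r \<circ>\<^sub>m \<rho> (v \<circ> w))"
        using rat_eq_sym[OF e] by simp
    qed
    then show ?case by (rule permuting_cong[OF n P _ rat[OF vw] dmn[OF vw]])
  qed
qed

section \<open>Compatibility of permuting maps with the crystal structure\<close>

lemma corner_X_move:
  assumes n: "n > 1" and x: "x \<in> torus n m" and nz: "\<And>j. 1 \<le> j \<Longrightarrow> j \<le> m \<Longrightarrow> chain k a x j \<noteq> 0"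
    and j: "j \<le> m"
  shows "corner (X_move n k a x) j k = chain k a x j * corner x j k"
    and "subcorner (X_move n k a x) j k = subcorner x j k"
proof -
  have nd: "\<not> int n dvd 1" "\<not> int n dvd - 1" using n by (auto dest: zdvd_imp_le)
  note * = whirl_prod_X_move[OF n x nz j]
  have "corner (X_move n k a x) j k = corner x j k + a * subcorner x j k"
    using fun_cong[OF *, of "(k, k + int j)"] nd
    by (simp add: u_mat_mult_left u_mat_mult_right top_entry_def sub_entry_def)
  then show "corner (X_move n k a x) j k = chain k a x j * corner x j k"
    using corner_nonzero[OF x j, of k] by (simp add: chain_def distrib_right)
  show "subcorner (X_move n k a x) j k = subcorner x j k"
    using fun_cong[OF *, of "(k + 1, k + int j)"] nd
    by (simp add: u_mat_mult_left u_mat_mult_right sub_entry_def)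
qed

text \<open>The law for products of parameters speaks only of points where all terms are defined.
  That the operator for 1/c is defined at the moved point has to be shown first, and holds because
  every \<open>chain\<close> value is inverted.\<close>

lemma X_act_inverse:
  assumes n: "n > 1" and m: "m \<ge> 1" and a: "act (X_explicit n m) k c x = Some x'"
  shows "act (X_explicit n m) k (inverse c) x' = Some x"
proof -
  let ?C = "X_explicit n m"
  have h: "c \<noteq> 0" "x \<in> X_domain n m k" "\<And>j. 1 \<le> j \<Longrightarrow> j \<le> m \<Longrightarrow> chain k (X_param m k c x) x j \<noteq> 0"
    "x' = X_move n k (X_param m k c x) x"
    using a by (auto simp: X_explicit_def split: if_splits)
  have x: "x \<in> torus n m" "x' \<in> torus n m" using X_act_U[OF n a m] by simp_all
  define p where "p = X_param m k c x"
  have nz: "chain k p x j \<noteq> 0" if "1 \<le> j" "j \<le> m" for j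
    using h(3)[OF that] by (simp add: p_def)
  have mv: "corner x' j k = chain k p x j * corner x j k" "subcorner x' j k = subcorner x j k" if "j \<le> m" for j
    unfolding h(4) p_def[symmetric] by (rule corner_X_move[OF n x(1) nz that]; assumption)+
  have s: "subcorner x m k \<noteq> 0" using h(2) m by (simp add: X_domain_def)
  have cm: "chain k p x m = c" unfolding p_def X_param_def by (rule chain_last[OF x(1) s])
  \<comment> \<open>The move multiplies \<phi> by c, and (1/c - 1) c = -(c - 1), so the initial
    parameter changes sign.\<close>
  have p': "X_param m k (inverse c) x' = - p"
  proof -
    have "X_param m k (inverse c) x' = (inverse c - 1) * (c * corner x m k / subcorner x m k)"
      unfolding X_param_def mv[OF order_refl] cm ..
    also have "\<dots> = - p" using h(1) s by (simp add: p_def X_param_def field_simps)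
    finally show ?thesis .
  qed
  have ch: "chain k (- p) x' j = inverse (chain k p x j)" if "1 \<le> j" "j \<le> m" for j
  proof -
    let ?A = "corner x j k" and ?D = "subcorner x j k"
    define Q where "Q = ?A + p * ?D"
    have A: "?A \<noteq> 0" by (rule corner_nonzero[OF x(1) that(2)])
    have q: "chain k p x j = Q / ?A" using A by (simp add: chain_def Q_def add_divide_distrib)
    then have Q: "Q \<noteq> 0" using nz[OF that] by auto
    have "chain k (- p) x' j = 1 - p * ?D / Q"
      unfolding chain_def[of k "- p"] mv[OF that(2)] q using A by simp
    also have "\<dots> = ?A / Q" using Q by (simp add: diff_divide_eq_iff) (simp add: Q_def)
    finally show ?thesis by (simp add: q)
  qed
  have "x' \<in> X_domain n m k" using h(2) x(2) mv(2) by (simp add: X_domain_def)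
  then have "x' \<in> dom (act ?C k (inverse c))"
    using h(1) ch h(3)[folded p_def] by (auto simp: X_explicit_def p')
  then obtain x'' where x'': "act ?C k (inverse c) x' = Some x''" by blast
  have g: "rational_Gm_action (torus n m) (act ?C k)"
    using geometric_crystalD(1)[OF geometric_crystal_X(1)[OF n m], of k] by (simp add: X_explicit_def)
  have one: "act ?C k 1 x = Some x"
  proof -
    have d: "act ?C k 1 x = Some (X_move n k 0 x)"
      using h(2) by (simp add: X_explicit_def X_param_def chain_def)
    moreover have "agree (act ?C k 1) Some" using g unfolding rational_Gm_action_def by (elim conjE)
    ultimately show ?thesis unfolding agree_def by (metis IntI domI)
  qed
  have "agree (act ?C k (inverse c) \<circ>\<^sub>m act ?C k c) (act ?C k (inverse c * c))"
    by (rule rational_Gm_actionD[OF g]) (use h(1) in auto)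
  moreover have "(act ?C k (inverse c) \<circ>\<^sub>m act ?C k c) x = Some x''" using a x'' by (simp add: map_comp_def)
  ultimately have "Some x'' = Some x"
    using one h(1) unfolding agree_def by (metis IntI domI left_inverse)
  then show ?thesis using x'' by simp
qed

lemma dominant_X_act:
  assumes n: "n > 1" and m: "m \<ge> 1" and c: "c \<noteq> 0"
  shows "dominant (torus n m) (torus n m) (act (X_explicit n m) k c)"
  unfolding dominant_def
proof (intro ballI impI)
  let ?C = "X_explicit n m"
  have "n > 0" using n by simp
  note irr = torus_irreducible[OF this, of m]
  fix h assume h: "h \<in> polyfun UNIV" "\<exists>y\<in>torus n m. h y \<noteq> 0"
  have "inverse c \<noteq> 0" using c by simp
  note r = rational_map_eventually_dom[OF irr geometric_crystal_X(2)[OF n m this]]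
  have "\<forall>\<^sub>F x in generic (torus n m). h x \<noteq> 0" using h eventually_generic_nonzero[OF irr] by blast
  with r[of k] have "\<forall>\<^sub>F x in generic (torus n m). x \<in> dom (act ?C k (inverse c)) \<and> h x \<noteq> 0"
    by eventually_elim simp
  then obtain y where y: "y \<in> dom (act ?C k (inverse c))" "h y \<noteq> 0"
    using eventually_generic_ex[OF irr] by blast
  then obtain x where x: "act ?C k (inverse c) y = Some x" by blast
  have "act ?C k c x = Some y" using X_act_inverse[OF n m x] by simp
  then show "\<exists>x\<in>dom (act ?C k c). h (the (act ?C k c x)) \<noteq> 0" using y(2) by (intro bexI[of _ x]) auto
qed

text \<open>\<epsilon> and \<phi> depend only on the product of whirls, which is preserved. For the
  operators, both composites have the same product of whirls and the same \<open>norm_prod\<close>,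
  permuted by w, so generic uniqueness of the factorization applies.\<close>

lemma permuting_crystal_map:
  assumes n: "n > 1" and m: "m \<ge> 1" and F: "permuting n m w F" and w: "w permutes {1..m}"
  shows "crystal_map (X_crystal n m) (X_crystal n m) F"
proof -
  let ?T = "torus n m" and ?C = "X_explicit n m"
  have n0: "n > 0" using n by simp
  note irr = torus_irreducible[OF n0, of m]
  have pts: "points ?C = ?T" by (simp add: X_explicit_def)
  note ratF = permutingD(1)[OF F] and domF = permutingD(2)[OF F]
  note ev = permutingD(3)[OF F]
  show ?thesis
    unfolding crystal_map_def X_crystal_explicit[OF m] pts
  proof (intro conjI allI impI ratF)
    fix k
    show "rat_eq ?T (eps ?C k \<circ>\<^sub>m F) (eps ?C k)"
      unfolding rat_eq_iff[OF irr]
      using ev permuting_eventually[OF n0 F rational_fun_eventually_dom[OF irr geometric_crystal_X(3)[OF n m, of k]]]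
        rational_fun_eventually_dom[OF irr geometric_crystal_X(3)[OF n m, of k]]
    proof eventually_elim
      case (elim x)
      then obtain y a b where y: "F x = Some y" "eps ?C k y = Some a" "eps ?C k x = Some b"
        by (auto simp: dom_def)
      then have "a = b" using X_eps_U[OF m y(2)] X_eps_U[OF m y(3)] elim by simp
      then show ?case using y by (simp add: dom_map_comp domIff map_comp_def)
    qed
    show "rat_eq ?T (phi ?C k \<circ>\<^sub>m F) (phi ?C k)"
      unfolding rat_eq_iff[OF irr]
      using ev permuting_eventually[OF n0 F rational_fun_eventually_dom[OF irr geometric_crystal_X(4)[OF n m, of k]]]
        rational_fun_eventually_dom[OF irr geometric_crystal_X(4)[OF n m, of k]]
    proof eventually_elim
      case (elim x)
      then obtain y a b where y: "F x = Some y" "phi ?C k y = Some a" "phi ?C k x = Some b"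
        by (auto simp: dom_def)
      then have "a = b" using X_phi_U[OF m y(2)] X_phi_U[OF m y(3)] elim by simp
      then show ?case using y by (simp add: dom_map_comp domIff map_comp_def)
    qed
    fix c assume c: "(c :: complex) \<noteq> 0"
    show "rat_eq ?T (F \<circ>\<^sub>m act ?C k c) (act ?C k c \<circ>\<^sub>m F)"
      unfolding rat_eq_iff[OF irr]
      \<comment> \<open>The properties of \<open>F\<close> are also used at the moved point; they
        hold there generically because the operator is dominant.\<close>
      using ev permuting_eventually[OF n0 F eventually_norm_prod_inj[OF n0]]
        dominant_eventually[OF irr irr geometric_crystal_X(2)[OF n m c] dominant_X_act[OF n m c] ev, of k]
        permuting_eventually[OF n0 F rational_map_eventually_dom[OF irr geometric_crystal_X(2)[OF n m c]], of k]
    proof eventually_elim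
      case (elim x)
      then obtain y z y' z' where y: "F x = Some y" "act ?C k c x = Some z" "F z = Some z'" "act ?C k c y = Some y'"
        by (auto simp: dom_def)
      note Uz = X_act_U[OF n y(2) m] and Uy = X_act_U[OF n y(4) m]
      have W: "whirl_prod m y' = whirl_prod m z'" using elim y Uz(3) Uy(3) by simp
      have "norm_prod n y' i = norm_prod n z' i" if "1 \<le> i" "i \<le> m" for i
        using elim y Uz(4)[of "w i"] Uy(4)[OF that] that permutes_in_image[OF w, of i] by simp
      moreover have "inj_on (norm_prod n y') {1..m}"
        using elim y Uy(4) inj_on_cong[of "{1..m}" "norm_prod n y'" "norm_prod n y"] by simp
      moreover have "z' \<in> ?T" using rational_map_in[OF ratF, of z] y(3) by (simp add: domI)
      ultimately have "y' = z'" using whirl_factorization_unique[OF Uy(2) _ n0 _ _ W] by blast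
      then show ?case using y by (simp add: dom_map_comp domIff map_comp_def)
    qed
  qed
qed

section \<open>Dominance of the product of whirls\<close>

text \<open>A version of \<open>polyfun_line\<close> in which the direction z varies: the
  coefficients depend polynomially on z and the degree is bounded uniformly, so a top degree over a
  whole family of directions makes sense.\<close>

lemma polyfun_expand:
  assumes "f \<in> polyfun J"
  shows "\<exists>P W. (\<forall>k. (\<lambda>z. coeff (P z) k) \<in> polyfun UNIV) \<and> (\<forall>z. degree (P z) \<le> W) \<and>
    (\<forall>z s. f (\<lambda>i. a i + s * z i) = poly (P z) s)"
  using assms
proof (induction rule: polyfun.induct)
  case (const c)
  show ?case
    by (rule exI[of _ "\<lambda>_. [:c:]"], rule exI[of _ 0]) (auto simp: polyfun.const)
next
  case (coord i)
  have "(\<lambda>z. coeff [:a i, z i:] k) \<in> polyfun UNIV" for k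
    by (cases k; cases "k - 1") (auto simp: coeff_pCons polyfun.const polyfun_coord split: nat.split)
  then show ?case
    by (intro exI[of _ "\<lambda>z. [:a i, z i:]"] exI[of _ 1]) auto
next
  case (add f g)
  then obtain P Q V W where
    "\<forall>k. (\<lambda>z. coeff (P z) k) \<in> polyfun UNIV" "\<forall>z. degree (P z) \<le> V" "\<forall>z s. f (\<lambda>i. a i + s * z i) = poly (P z) s"
    "\<forall>k. (\<lambda>z. coeff (Q z) k) \<in> polyfun UNIV" "\<forall>z. degree (Q z) \<le> W" "\<forall>z s. g (\<lambda>i. a i + s * z i) = poly (Q z) s"
    by blast
  note PQ = this
  have "degree (P z + Q z) \<le> max V W" for z
    using PQ(2,5) by (intro degree_add_le) (auto simp: le_max_iff_disj)
  then show ?case using PQ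
    by (intro exI[of _ "\<lambda>z. P z + Q z"] exI[of _ "max V W"]) (auto intro: polyfun.add)
next
  case (mult f g)
  then obtain P Q V W where
    PQ: "\<forall>k. (\<lambda>z. coeff (P z) k) \<in> polyfun UNIV" "\<forall>z. degree (P z) \<le> V" "\<forall>z s. f (\<lambda>i. a i + s * z i) = poly (P z) s"
    "\<forall>k. (\<lambda>z. coeff (Q z) k) \<in> polyfun UNIV" "\<forall>z. degree (Q z) \<le> W" "\<forall>z s. g (\<lambda>i. a i + s * z i) = poly (Q z) s"
    by blast
  have "degree (P z * Q z) \<le> V + W" for z
    using PQ(2,5) degree_mult_le[of "P z" "Q z"] by (meson add_mono order_trans)
  moreover have "(\<lambda>z. coeff (P z * Q z) k) \<in> polyfun UNIV" for k
    unfolding coeff_mult using PQ by (intro polyfun_sum polyfun.mult) auto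
  ultimately show ?case using PQ
    by (intro exI[of _ "\<lambda>z. P z * Q z"] exI[of _ "V + W"]) auto
qed

text \<open>\<open>U_le\<close> is the identity plus this linear space; its elements are the
  directions of lines through the identity.\<close>

definition strict_band :: "nat \<Rightarrow> nat \<Rightarrow> (int \<times> int) pt set" where
  "strict_band n m = {Z. (\<forall>r s. Z (r + int n, s + int n) = Z (r, s)) \<and>
     (\<forall>r s. s - r < 1 \<or> s - r > int m \<longrightarrow> Z (r, s) = 0)}"

lemma strict_band_irreducible: "irreducible_set (strict_band n m)"
proof (rule irreducible_setI)
  have "(\<lambda>_. 0) \<in> strict_band n m" by (simp add: strict_band_def)
  then show "strict_band n m \<noteq> {}" by blast
  fix x y assume "x \<in> strict_band n m" "y \<in> strict_band n m"
  then have "(\<lambda>i. x i + t * (y i - x i)) \<in> strict_band n m" for t by (simp add: strict_band_def)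
  then show "\<exists>H. H \<noteq> 0 \<and> (\<forall>t. poly H t \<noteq> 0 \<longrightarrow> (\<lambda>i. x i + t * (y i - x i)) \<in> strict_band n m)"
    by (intro exI[of _ 1]) auto
qed

text \<open>
  Scaling the last factor \<open>whirl x\<close> by \<open>s\<close>, the entries above the diagonal of \<open>Y' \<odot> whirl (s * x)\<close>
  have leading term \<open>s * Z\<close>, where \<open>Z (r, t) = Y' (r, t - 1) * x (t - 1)\<close> runs over all strict bands without
  zeros on the first superdiagonal.
\<close>

lemma whirl_factor_exists:
  assumes n: "n > 0" and f: "f \<in> polyfun UNIV" and Y: "Y \<in> U_le n (Suc m)" "f Y \<noteq> 0"
  shows "\<exists>Y'\<in>U_le n m. \<exists>x. (\<forall>r. x r \<noteq> 0 \<and> x (r + int n) = x r) \<and> f (Y' \<odot> whirl x) \<noteq> 0"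
proof -
  let ?I = "\<lambda>(r, s). if s = r then 1 else 0 :: complex" and ?B = "strict_band n (Suc m)"
  note irr = strict_band_irreducible[of n "Suc m"]
  obtain P W where P: "\<And>k. (\<lambda>z. coeff (P z) k) \<in> polyfun UNIV" "\<And>z. degree (P z) \<le> W"
    "\<And>z s. f (\<lambda>i. ?I i + s * z i) = poly (P z) s"
    using polyfun_expand[OF f, of ?I] by blast
  have YI: "(\<lambda>i. Y i - ?I i) \<in> ?B"
    using Y(1) by (auto simp: strict_band_def U_le_def U_loop_def)
  have "poly (P (\<lambda>i. Y i - ?I i)) 1 \<noteq> 0" using Y(2) P(3)[of 1 "\<lambda>i. Y i - ?I i", symmetric] by simp
  then have "P (\<lambda>i. Y i - ?I i) \<noteq> 0" by auto
  then obtain k0 where "coeff (P (\<lambda>i. Y i - ?I i)) k0 \<noteq> 0" by (meson leading_coeff_0_iff)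
  then have ex: "\<exists>k. \<exists>Z\<in>?B. coeff (P Z) k \<noteq> 0" using YI by blast
  have bd: "k \<le> W" if "\<exists>Z\<in>?B. coeff (P Z) k \<noteq> 0" for k
    using that P(2) le_degree order_trans by blast
  \<comment> \<open>The largest degree in s that occurs along any direction in the strict bands; the
    other candidates are bounded by \<open>W\<close>.\<close>
  define K where "K = (GREATEST k. \<exists>Z\<in>?B. coeff (P Z) k \<noteq> 0)"
  have K: "\<exists>Z\<in>?B. coeff (P Z) K \<noteq> 0"
    unfolding K_def using ex bd by (rule GreatestI_ex_nat)
  have above: "coeff (P Z) k = 0" if "Z \<in> ?B" "k > K" for Z k
    using that Greatest_le_nat[of "\<lambda>k. \<exists>Z\<in>?B. coeff (P Z) k \<noteq> 0" k W] bd unfolding K_def by force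
  define h :: "(int \<times> int) pt \<Rightarrow> complex" where "h = (\<lambda>Z. \<Prod>l<n. Z (int l, int l + 1))"
  have h: "h \<in> polyfun UNIV" unfolding h_def by (intro polyfun_intros)
  have "(\<lambda>(r, s). if s = r + 1 then 1 else 0) \<in> ?B" "h (\<lambda>(r, s). if s = r + 1 then 1 else 0) \<noteq> 0"
    by (auto simp: strict_band_def h_def)
  then have "\<exists>Z\<in>?B. h Z \<noteq> 0" by blast
  \<comment> \<open>Irreducibility yields one direction with a nonzero coefficient in degree
    \<open>K\<close> and no zero on the first superdiagonal.\<close>
  with irr K P(1) h have "\<exists>Z\<in>?B. coeff (P Z) K \<noteq> 0 \<and> h Z \<noteq> 0"
    unfolding irreducible_set_def by meson
  then obtain Z where Z: "Z \<in> ?B" "coeff (P Z) K \<noteq> 0" "h Z \<noteq> 0" by blast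
  define x where "x r = Z (r, r + 1)" for r
  have Zp: "Z (r + int n, s + int n) = Z (r, s)" for r s using Z(1) by (simp add: strict_band_def)
  have xp: "x (r + int n) = x r" for r using Zp[of r "r + 1"] by (simp add: x_def algebra_simps)
  have x0: "x r \<noteq> 0" for r
  proof -
    have "x r = x (r mod int n)" by (rule periodic_mod[of x n]) (rule xp)
    also have "r mod int n = int (nat (r mod int n))" using n by simp
    finally have e: "x r = x (int (nat (r mod int n)))" .
    have "nat (r mod int n) < n" using n by (simp add: nat_less_iff)
    moreover have "\<forall>l\<in>{..<n}. x (int l) \<noteq> 0" using Z(3) by (simp add: h_def x_def)
    ultimately show ?thesis unfolding e by blast
  qed
  \<comment> \<open>Solves Z (r, s) = Y' (r, s-1) x (s-1); the choice of x as the first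
    superdiagonal of Z puts 1 on the diagonal of Y'.\<close>
  define Y' where "Y' = (\<lambda>(r, s). Z (r, s + 1) / x s)"
  have Zz: "Z (r, s) = 0" if "s - r < 1 \<or> s - r > int (Suc m)" for r s
    using Z(1) that unfolding strict_band_def by blast
  have Y': "Y' \<in> U_le n m"
    unfolding U_le_def U_loop_def
  proof (intro CollectI conjI allI impI)
    fix r s
    have "s + int n + 1 = s + 1 + int n" by simp
    then show "Y' (r + int n, s + int n) = Y' (r, s)"
      using Zp[of r "s + 1"] xp by (simp only: Y'_def prod.case)
    show "Y' (r, r) = 1" using x0 by (simp add: Y'_def x_def)
    show "s < r \<Longrightarrow> Y' (r, s) = 0" using Zz[of "s + 1" r] by (simp add: Y'_def)
    show "s - r > int m \<Longrightarrow> Y' (r, s) = 0" using Zz[of "s + 1" r] by (simp add: Y'_def)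
  qed
  \<comment> \<open>The lower-order error: with t = 1/s, the product of Y' and the scaled whirl is
    the identity plus s (Z + t N).\<close>
  define N where "N = (\<lambda>i. Y' i - ?I i)"
  have N: "N \<in> ?B"
    using Y' by (auto simp: N_def strict_band_def U_le_def U_loop_def)
  have ZN: "(\<lambda>i. Z i + t * N i) \<in> ?B" for t using Z(1) N by (simp add: strict_band_def)
  have "\<exists>C. \<forall>t. coeff (P (\<lambda>i. Z i + t * N i)) k = poly C t" for k
    by (rule polyfun_line[OF P(1)])
  then obtain C where C: "\<And>k t. coeff (P (\<lambda>i. Z i + t * N i)) k = poly (C k) t" by metis
  \<comment> \<open>The value of f divided by s^K, as a polynomial in t = 1/s. Its value at 0 is the
    nonzero top coefficient for Z, so it is nonzero for some t other than 0.\<close>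
  define G where "G = (\<Sum>k\<le>K. C k * monom 1 (K - k))"
  have G: "poly G t = (\<Sum>k\<le>K. coeff (P (\<lambda>i. Z i + t * N i)) k * t ^ (K - k))" for t
    by (simp add: G_def poly_sum poly_monom C)
  have "poly G 0 = (\<Sum>k\<le>K. if k = K then coeff (P Z) k else 0)"
    unfolding G by (rule sum.cong) auto
  then have "poly G 0 \<noteq> 0" using Z(2) by simp
  then have "[:0, 1:] * G \<noteq> 0" by auto
  then have "finite {t. poly ([:0, 1:] * G) t = 0}" by (rule poly_roots_finite)
  then have "\<exists>t. t \<notin> {t. poly ([:0, 1:] * G) t = 0}" using ex_new_if_finite infinite_UNIV_char_0 by blast
  then obtain t where t: "t \<noteq> 0" "poly G t \<noteq> 0" by auto
  define s where "s = inverse t"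
  have "poly (P (\<lambda>i. Z i + t * N i)) s = (\<Sum>k\<le>K. coeff (P (\<lambda>i. Z i + t * N i)) k * s ^ k)"
  proof -
    have "degree (P (\<lambda>i. Z i + t * N i)) \<le> K"
      using above[OF ZN[of t]] by (intro degree_le) auto
    from arg_cong[OF poly_as_sum_of_monoms'[OF this], of "\<lambda>p. poly p s"] show ?thesis
      by (simp only: poly_sum poly_monom)
  qed
  also have "\<dots> = s ^ K * poly G t"
    unfolding G sum_distrib_left
  proof (rule sum.cong[OF refl])
    fix k assume "k \<in> {..K}"
    then have "s ^ K = s ^ k * s ^ (K - k)" by (simp flip: power_add)
    moreover have "s ^ (K - k) * t ^ (K - k) = 1" using t by (simp add: s_def flip: power_mult_distrib)
    ultimately show "coeff (P (\<lambda>i. Z i + t * N i)) k * s ^ k =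
      s ^ K * (coeff (P (\<lambda>i. Z i + t * N i)) k * t ^ (K - k))"
      by (simp add: mult_ac)
  qed
  finally have nz: "poly (P (\<lambda>i. Z i + t * N i)) s \<noteq> 0" using t by (simp add: s_def)
  have "(Y' \<odot> whirl (\<lambda>r. s * x r)) = (\<lambda>i. ?I i + s * (Z i + t * N i))"
  proof (rule ext)
    fix p :: "int \<times> int"
    obtain r u where p: "p = (r, u)" by fastforce
    have "Y' (r, u - 1) * x (u - 1) = Z (r, u)" using x0 by (simp add: Y'_def)
    then show "(Y' \<odot> whirl (\<lambda>r. s * x r)) p = ?I p + s * (Z p + t * N p)"
      unfolding p whirl_mult_right using t by (simp add: N_def s_def algebra_simps)
  qed
  then have "f (Y' \<odot> whirl (\<lambda>r. s * x r)) \<noteq> 0" using nz P(3) by simp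
  moreover have "\<forall>r. s * x r \<noteq> 0 \<and> s * x (r + int n) = s * x r" using x0 xp t by (simp add: s_def)
  ultimately show ?thesis using Y' by (intro bexI[OF _ Y'] exI[of _ "\<lambda>r. s * x r"]) auto
qed

text \<open>Once a suitable last factor is fixed, f is a polynomial in the product of the remaining
  factors, and induction applies to that polynomial.\<close>

lemma whirl_prod_dominant:
  assumes n: "n > 0"
  shows "f \<in> polyfun UNIV \<Longrightarrow> Y \<in> U_le n m \<Longrightarrow> f Y \<noteq> 0 \<Longrightarrow> \<exists>x\<in>torus n m. f (whirl_prod m x) \<noteq> 0"
proof (induction m arbitrary: f Y)
  case 0
  have "Y = (\<lambda>(r, s). if s = r then 1 else 0)"
  proof (rule ext)
    fix p :: "int \<times> int"
    obtain r s where p: "p = (r, s)" by fastforce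
    show "Y p = (case p of (r, s) \<Rightarrow> if s = r then 1 else 0)"
      using U_le_diag[OF 0(2)] U_le_lower[OF 0(2), of s r] U_le_above[OF 0(2), of s r]
      by (cases "s < r"; cases "s = r") (auto simp: p)
  qed
  moreover have "(\<lambda>_. 0) \<in> torus n 0" by (simp add: torus_def)
  ultimately show ?case using 0(3) by (auto simp: whirl_prod.simps(1))
next
  case (Suc m)
  obtain Y' x where Y': "Y' \<in> U_le n m" and x: "\<And>r. x r \<noteq> 0" "\<And>r. x (r + int n) = x r"
    and nz: "f (Y' \<odot> whirl x) \<noteq> 0"
    using whirl_factor_exists[OF n Suc.prems] by blast
  have "(\<lambda>Z. f (Z \<odot> whirl x)) \<in> polyfun UNIV"
  proof (rule polyfun_compose[OF Suc.prems(1)])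
    fix p :: "int \<times> int"
    obtain r s where p: "p = (r, s)" by fastforce
    show "(\<lambda>Z. (Z \<odot> whirl x) p) \<in> polyfun UNIV"
      unfolding p whirl_mult_right by (intro polyfun_intros)
  qed
  from Suc.IH[OF this Y' nz] obtain y where y: "y \<in> torus n m" "f (whirl_prod m y \<odot> whirl x) \<noteq> 0" by blast
  define z where "z = (\<lambda>(i, r). if i = Suc m then x r else y (i, r))"
  have "z \<in> torus n (Suc m)"
    using torus_nonzero[OF y(1)] torus_zero[OF y(1)] torus_periodic[OF y(1)] x
    by (auto simp: torus_def z_def)
  moreover have "whirl_prod m z = whirl_prod m y" by (rule whirl_prod_cong) (auto simp: z_def)
  moreover have "block z (Suc m) = x" by (auto simp: block_def z_def)
  ultimately show ?case using y(2) by (intro bexI[of _ z]) (simp_all add: whirl_prod.simps(2))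
qed

lemma dominant_proj:
  assumes "n > 0"
  shows "dominant (torus n m) (U_le n m) ((\<lambda>x. Some (whirl_prod m x)) |` torus n m)"
  unfolding dominant_def
proof (intro ballI impI)
  fix h assume "h \<in> polyfun UNIV" "\<exists>y\<in>U_le n m. h y \<noteq> 0"
  then obtain x where "x \<in> torus n m" "h (whirl_prod m x) \<noteq> 0" using whirl_prod_dominant[OF assms] by blast
  then show "\<exists>x\<in>dom ((\<lambda>x. Some (whirl_prod m x)) |` torus n m). h (the (((\<lambda>x. Some (whirl_prod m x)) |` torus n m) x)) \<noteq> 0"
    by (intro bexI[of _ x]) auto
qed


section \<open>Generated algebras and their fraction fields\<close>

inductive_set alg :: "('i pt \<Rightarrow> complex) set \<Rightarrow> ('i pt \<Rightarrow> complex) set" for F where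
  const: "(\<lambda>_. a) \<in> alg F"
| gen: "f \<in> F \<Longrightarrow> f \<in> alg F"
| add: "f \<in> alg F \<Longrightarrow> g \<in> alg F \<Longrightarrow> (\<lambda>x. f x + g x) \<in> alg F"
| mult: "f \<in> alg F \<Longrightarrow> g \<in> alg F \<Longrightarrow> (\<lambda>x. f x * g x) \<in> alg F"

lemma alg_polyfun:
  assumes "F \<subseteq> polyfun UNIV" "f \<in> alg F" shows "f \<in> polyfun UNIV"
  using assms(2,1) by (induction rule: alg.induct) (auto intro: polyfun.intros)

lemma alg_uminus: "f \<in> alg F \<Longrightarrow> (\<lambda>x. - f x) \<in> alg F"
  using alg.mult[OF alg.const[of "-1"], of f F] by simp

lemma alg_sum: "(\<And>a. a \<in> A \<Longrightarrow> f a \<in> alg F) \<Longrightarrow> (\<lambda>x. \<Sum>a\<in>A. f a x) \<in> alg F"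
  by (induction A rule: infinite_finite_induct) (auto intro: alg.intros)

text \<open>The fraction field of \<open>alg F\<close>, represented by total functions up to generic
  equality, so that field elements can be handled pointwise.\<close>

definition rat_over :: "'i pt set \<Rightarrow> ('i pt \<Rightarrow> complex) set \<Rightarrow> ('i pt \<Rightarrow> complex) set" where
  "rat_over V F = {f. \<exists>p\<in>alg F. \<exists>d\<in>alg F. \<forall>\<^sub>F x in generic V. d x \<noteq> 0 \<and> f x = p x / d x}"

lemma rat_overI:
  "p \<in> alg F \<Longrightarrow> d \<in> alg F \<Longrightarrow> \<forall>\<^sub>F x in generic V. d x \<noteq> 0 \<and> f x = p x / d x \<Longrightarrow> f \<in> rat_over V F"
  unfolding rat_over_def by blast

lemma rat_overE:
  assumes "f \<in> rat_over V F"
  obtains p d where "p \<in> alg F" "d \<in> alg F" "\<forall>\<^sub>F x in generic V. d x \<noteq> 0 \<and> f x = p x / d x"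
  using assms unfolding rat_over_def by blast

lemma alg_rat_over: "f \<in> alg F \<Longrightarrow> f \<in> rat_over V F"
  by (rule rat_overI[OF _ alg.const[of 1]]) auto

lemma rat_over_const: "(\<lambda>_. a) \<in> rat_over V F"
  by (rule alg_rat_over[OF alg.const])

lemma rat_over_cong:
  assumes "f \<in> rat_over V F" "\<forall>\<^sub>F x in generic V. f x = g x" shows "g \<in> rat_over V F"
  using assms(1)
proof (rule rat_overE)
  fix p d assume "p \<in> alg F" "d \<in> alg F" "\<forall>\<^sub>F x in generic V. d x \<noteq> 0 \<and> f x = p x / d x"
  note p = this
  show ?thesis
  proof (rule rat_overI[OF p(1,2)])
    show "\<forall>\<^sub>F x in generic V. d x \<noteq> 0 \<and> g x = p x / d x"
      using p(3) assms(2) by eventually_elim simp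
  qed
qed

lemma rat_over_add:
  assumes "f \<in> rat_over V F" "g \<in> rat_over V F" shows "(\<lambda>x. f x + g x) \<in> rat_over V F"
  using assms(1)
proof (rule rat_overE)
  fix p d assume p: "p \<in> alg F" "d \<in> alg F" "\<forall>\<^sub>F x in generic V. d x \<noteq> 0 \<and> f x = p x / d x"
  show ?thesis
    using assms(2)
  proof (rule rat_overE)
    fix q e assume q: "q \<in> alg F" "e \<in> alg F" "\<forall>\<^sub>F x in generic V. e x \<noteq> 0 \<and> g x = q x / e x"
    have "(\<lambda>x. p x * e x + q x * d x) \<in> alg F" "(\<lambda>x. d x * e x) \<in> alg F" by (intro alg.intros p q)+
    then show ?thesis
    proof (rule rat_overI)
      show "\<forall>\<^sub>F x in generic V. d x * e x \<noteq> 0 \<and> f x + g x = (p x * e x + q x * d x) / (d x * e x)"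
        using p(3) q(3) by eventually_elim (simp add: field_simps)
    qed
  qed
qed

lemma rat_over_mult:
  assumes "f \<in> rat_over V F" "g \<in> rat_over V F" shows "(\<lambda>x. f x * g x) \<in> rat_over V F"
  using assms(1)
proof (rule rat_overE)
  fix p d assume p: "p \<in> alg F" "d \<in> alg F" "\<forall>\<^sub>F x in generic V. d x \<noteq> 0 \<and> f x = p x / d x"
  show ?thesis
    using assms(2)
  proof (rule rat_overE)
    fix q e assume q: "q \<in> alg F" "e \<in> alg F" "\<forall>\<^sub>F x in generic V. e x \<noteq> 0 \<and> g x = q x / e x"
    have "(\<lambda>x. p x * q x) \<in> alg F" "(\<lambda>x. d x * e x) \<in> alg F" by (intro alg.intros p q)+
    then show ?thesis
    proof (rule rat_overI)
      show "\<forall>\<^sub>F x in generic V. d x * e x \<noteq> 0 \<and> f x * g x = (p x * q x) / (d x * e x)"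
        using p(3) q(3) by eventually_elim simp
    qed
  qed
qed

text \<open>On an irreducible set a polynomial is generically zero or generically nonzero; this is
  what makes \<open>rat_over\<close> a field.\<close>

lemma polyfun_dichotomy:
  assumes "irreducible_set V" "p \<in> polyfun UNIV"
  shows "(\<forall>\<^sub>F x in generic V. p x \<noteq> 0) \<or> (\<forall>\<^sub>F x in generic V. p x = 0)"
proof (cases "\<exists>x\<in>V. p x \<noteq> 0")
  case True
  then show ?thesis using eventually_generic_nonzero[OF assms] by blast
next
  case False
  have "\<forall>\<^sub>F x in generic V. p x = 0"
    using eventually_generic_in[OF assms(1)] by eventually_elim (use False in auto)
  then show ?thesis by simp
qed

lemma rat_over_dichotomy:
  assumes "irreducible_set V" "F \<subseteq> polyfun UNIV" "f \<in> rat_over V F"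
  shows "(\<forall>\<^sub>F x in generic V. f x \<noteq> 0) \<or> (\<forall>\<^sub>F x in generic V. f x = 0)"
  using assms(3)
proof (rule rat_overE)
  fix p d assume p: "p \<in> alg F" "d \<in> alg F" "\<forall>\<^sub>F x in generic V. d x \<noteq> 0 \<and> f x = p x / d x"
  from polyfun_dichotomy[OF assms(1) alg_polyfun[OF assms(2) p(1)]] show ?thesis
  proof
    assume "\<forall>\<^sub>F x in generic V. p x \<noteq> 0"
    with p(3) have "\<forall>\<^sub>F x in generic V. f x \<noteq> 0" by eventually_elim simp
    then show ?thesis by simp
  next
    assume "\<forall>\<^sub>F x in generic V. p x = 0"
    with p(3) have "\<forall>\<^sub>F x in generic V. f x = 0" by eventually_elim simp
    then show ?thesis by simp
  qed
qed

lemma rat_over_inverse: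
  assumes "irreducible_set V" "F \<subseteq> polyfun UNIV" "f \<in> rat_over V F"
  shows "(\<lambda>x. inverse (f x)) \<in> rat_over V F"
  using assms(3)
proof (rule rat_overE)
  fix p d assume p: "p \<in> alg F" "d \<in> alg F" "\<forall>\<^sub>F x in generic V. d x \<noteq> 0 \<and> f x = p x / d x"
  from polyfun_dichotomy[OF assms(1) alg_polyfun[OF assms(2) p(1)]] show ?thesis
  proof
    assume e: "\<forall>\<^sub>F x in generic V. p x \<noteq> 0"
    show ?thesis
    proof (rule rat_overI[OF p(2,1)])
      show "\<forall>\<^sub>F x in generic V. p x \<noteq> 0 \<and> inverse (f x) = d x / p x"
        using p(3) e by eventually_elim simp
    qed
  next
    \<comment> \<open>Here f is generically 0, and so is its inverse by convention.\<close>
    assume e: "\<forall>\<^sub>F x in generic V. p x = 0"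
    have "\<forall>\<^sub>F x in generic V. 0 = inverse (f x)" using p(3) e by eventually_elim simp
    then show ?thesis by (rule rat_over_cong[OF rat_over_const])
  qed
qed

lemma rat_over_divide:
  assumes "irreducible_set V" "F \<subseteq> polyfun UNIV" "f \<in> rat_over V F" "g \<in> rat_over V F"
  shows "(\<lambda>x. f x / g x) \<in> rat_over V F"
  unfolding divide_inverse by (intro rat_over_mult rat_over_inverse assms)

lemma rat_over_uminus: "f \<in> rat_over V F \<Longrightarrow> (\<lambda>x. - f x) \<in> rat_over V F"
  using rat_over_mult[OF rat_over_const[of "-1"], of f V F] by simp

lemma rat_over_sum: "(\<And>a. a \<in> A \<Longrightarrow> f a \<in> rat_over V F) \<Longrightarrow> (\<lambda>x. \<Sum>a\<in>A. f a x) \<in> rat_over V F"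
  by (induction A rule: infinite_finite_induct) (auto intro: rat_over_const rat_over_add)

lemma rat_over_prod: "(\<And>a. a \<in> A \<Longrightarrow> f a \<in> rat_over V F) \<Longrightarrow> (\<lambda>x. \<Prod>a\<in>A. f a x) \<in> rat_over V F"
  by (induction A rule: infinite_finite_induct) (auto intro: rat_over_const rat_over_mult)

lemma rat_over_power: "f \<in> rat_over V F \<Longrightarrow> (\<lambda>x. f x ^ k) \<in> rat_over V F"
  by (induction k) (auto intro: rat_over_const rat_over_mult)

lemma rat_over_trans:
  assumes "irreducible_set V" "F \<subseteq> polyfun UNIV" "f \<in> rat_over V G" "\<And>g. g \<in> G \<Longrightarrow> g \<in> rat_over V F"
  shows "f \<in> rat_over V F"
  using assms(3)
proof (rule rat_overE)
  fix p d assume p: "p \<in> alg G" "d \<in> alg G" "\<forall>\<^sub>F x in generic V. d x \<noteq> 0 \<and> f x = p x / d x"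
  have a: "h \<in> rat_over V F" if "h \<in> alg G" for h
    using that by induction (auto intro: rat_over_const rat_over_add rat_over_mult assms(4))
  have "\<forall>\<^sub>F x in generic V. p x / d x = f x" using p(3) by eventually_elim simp
  then show ?thesis by (rule rat_over_cong[OF rat_over_divide[OF assms(1,2) a[OF p(1)] a[OF p(2)]]])
qed

text \<open>Since q satisfies a monic equation of degree K over B, the span of 1, q, ..., q^(K-1)
  with coefficients in \<open>alg B\<close> is closed under multiplication by q, hence under all
  products.\<close>

lemma alg_insert_reduce:
  assumes e: "\<And>j. e j \<in> alg B" and q: "\<And>x. x \<in> S \<Longrightarrow> q x ^ K = (\<Sum>j<K. e j x * q x ^ j)" and K: "K \<ge> 1"
    and f: "f \<in> alg (insert q B)"
  shows "\<exists>p. (\<forall>j. p j \<in> alg B) \<and> (\<forall>x\<in>S. f x = (\<Sum>j<K. p j x * q x ^ j))"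
proof -
  have mono: "g \<in> alg B \<Longrightarrow> \<exists>p. (\<forall>j. p j \<in> alg B) \<and> (\<forall>x\<in>S. g x = (\<Sum>j<K. p j x * q x ^ j))" for g
  proof (intro exI[of _ "\<lambda>j x. if j = 0 then g x else 0"] conjI allI ballI)
    fix j assume "g \<in> alg B"
    then show "(\<lambda>x. if j = 0 then g x else 0) \<in> alg B" by (cases "j = 0") (auto intro: alg.const)
  next
    fix x
    have "(\<Sum>j<K. (if j = 0 then g x else 0) * q x ^ j) = (\<Sum>j<K. if j = 0 then g x else 0)"
      by (rule sum.cong) auto
    then show "g x = (\<Sum>j<K. (if j = 0 then g x else 0) * q x ^ j)" using K by (simp add: sum.delta)
  qed
  have plus: "\<exists>p. (\<forall>j. p j \<in> alg B) \<and> (\<forall>x\<in>S. f x + g x = (\<Sum>j<K. p j x * q x ^ j))"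
    if fg: "\<exists>p. (\<forall>j. p j \<in> alg B) \<and> (\<forall>x\<in>S. f x = (\<Sum>j<K. p j x * q x ^ j))"
      "\<exists>p. (\<forall>j. p j \<in> alg B) \<and> (\<forall>x\<in>S. g x = (\<Sum>j<K. p j x * q x ^ j))" for f g
  proof -
    obtain a b where ab: "\<forall>j. a j \<in> alg B" "\<forall>x\<in>S. f x = (\<Sum>j<K. a j x * q x ^ j)"
      "\<forall>j. b j \<in> alg B" "\<forall>x\<in>S. g x = (\<Sum>j<K. b j x * q x ^ j)" using fg by blast
    show ?thesis
      by (rule exI[of _ "\<lambda>j x. a j x + b j x"])
        (use ab in \<open>auto intro: alg.add simp: distrib_right sum.distrib\<close>)
  qed
  have scale: "\<exists>p. (\<forall>j. p j \<in> alg B) \<and> (\<forall>x\<in>S. c x * f x = (\<Sum>j<K. p j x * q x ^ j))"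
    if c: "c \<in> alg B" and fp: "\<exists>p. (\<forall>j. p j \<in> alg B) \<and> (\<forall>x\<in>S. f x = (\<Sum>j<K. p j x * q x ^ j))" for c f
  proof -
    obtain a where a: "\<forall>j. a j \<in> alg B" "\<forall>x\<in>S. f x = (\<Sum>j<K. a j x * q x ^ j)" using fp by blast
    show ?thesis
      by (rule exI[of _ "\<lambda>j x. c x * a j x"])
        (use a c in \<open>auto intro: alg.mult simp: sum_distrib_left mult.assoc\<close>)
  qed
  have sum: "\<exists>p. (\<forall>j. p j \<in> alg B) \<and> (\<forall>x\<in>S. (\<Sum>i\<in>A. f i x) = (\<Sum>j<K. p j x * q x ^ j))"
    if "finite A" "\<And>i. i \<in> A \<Longrightarrow> \<exists>p. (\<forall>j. p j \<in> alg B) \<and> (\<forall>x\<in>S. f i x = (\<Sum>j<K. p j x * q x ^ j))"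
    for A :: "nat set" and f
    using that
  proof (induction A rule: finite_induct)
    case empty
    then show ?case using mono[OF alg.const[of 0]] by simp
  next
    case (insert i A)
    then show ?case using plus[of "f i" "\<lambda>x. \<Sum>i\<in>A. f i x"] by simp
  qed
  have timesq: "\<exists>p. (\<forall>j. p j \<in> alg B) \<and> (\<forall>x\<in>S. q x * f x = (\<Sum>j<K. p j x * q x ^ j))"
    if fp: "\<exists>p. (\<forall>j. p j \<in> alg B) \<and> (\<forall>x\<in>S. f x = (\<Sum>j<K. p j x * q x ^ j))" for f
  proof -
    obtain a where a: "\<And>j. a j \<in> alg B" "\<And>x. x \<in> S \<Longrightarrow> f x = (\<Sum>j<K. a j x * q x ^ j)" using fp by blast
    obtain L where L: "K = Suc L" using K by (cases K) auto
    \<comment> \<open>Multiplication by q shifts the coefficients, and the overflow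
      \<open>a L * q ^ K\<close> is rewritten by the monic equation.\<close>
    define b where "b j x = (if j = 0 then 0 else a (j - 1) x) + a L x * e j x" for j x
    have "b j \<in> alg B" for j
      unfolding b_def by (cases "j = 0") (auto intro!: alg.add alg.mult alg.const a(1) e)
    moreover have "q x * f x = (\<Sum>j<K. b j x * q x ^ j)" if x: "x \<in> S" for x
    proof -
      have "q x * f x = (\<Sum>j<L. a j x * q x ^ Suc j) + a L x * q x ^ K"
        unfolding a(2)[OF x] L by (simp add: algebra_simps sum_distrib_left)
      also have "(\<Sum>j<L. a j x * q x ^ Suc j) = (\<Sum>j<K. (if j = 0 then 0 else a (j - 1) x) * q x ^ j)"
        unfolding L by (simp add: sum.lessThan_Suc_shift del: sum.lessThan_Suc)
      also have "a L x * q x ^ K = (\<Sum>j<K. a L x * e j x * q x ^ j)"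
        unfolding q[OF x] by (simp add: sum_distrib_left mult.assoc)
      finally show ?thesis by (simp add: b_def distrib_right sum.distrib)
    qed
    ultimately show ?thesis by blast
  qed
  have pow: "\<exists>p. (\<forall>j. p j \<in> alg B) \<and> (\<forall>x\<in>S. q x ^ l * f x = (\<Sum>j<K. p j x * q x ^ j))"
    if "\<exists>p. (\<forall>j. p j \<in> alg B) \<and> (\<forall>x\<in>S. f x = (\<Sum>j<K. p j x * q x ^ j))" for l f
  proof (induction l)
    case (Suc l)
    then show ?case using timesq[OF Suc] by (simp add: mult.assoc)
  qed (use that in simp)
  show ?thesis
    using f
  proof induction
    case (const a)
    then show ?case by (rule mono[OF alg.const])
  next
    case (gen f)
    show ?case
    proof (cases "f = q")
      case True
      then show ?thesis using timesq[OF mono[OF alg.const[of 1]]] by simp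
    next
      case False
      then show ?thesis using gen by (intro mono alg.gen) auto
    qed
  next
    case (add f g)
    then show ?case by (intro plus)
  next
    case (mult f g)
    obtain a where a: "\<And>j. a j \<in> alg B" "\<And>x. x \<in> S \<Longrightarrow> f x = (\<Sum>j<K. a j x * q x ^ j)" using mult.IH by blast
    have "\<exists>p. (\<forall>j. p j \<in> alg B) \<and> (\<forall>x\<in>S. (\<Sum>i<K. a i x * (q x ^ i * g x)) = (\<Sum>j<K. p j x * q x ^ j))"
      by (rule sum[OF finite_lessThan]) (intro scale a(1) pow mult.IH)
    then show ?case using a(2) by (simp add: sum_distrib_right mult.assoc)
  qed
qed

section \<open>Whirls as matrices over the loop parameter\<close>

text \<open>The matrix of \<open>whirl (block x i)\<close> on the vectors \<open>v\<close> with \<open>v (r + n) = z * v r\<close>.\<close>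

definition whirl_mat :: "nat \<Rightarrow> (nat \<times> int) pt \<Rightarrow> nat \<Rightarrow> complex \<Rightarrow> complex mat" where
  "whirl_mat n x i z = mat n n (\<lambda>(r, s). if r = s then 1 else if s = Suc r then x (i, int r)
     else if r = n - 1 \<and> s = 0 then z * x (i, int r) else 0)"

primrec whirl_mat_prod :: "nat \<Rightarrow> (nat \<times> int) pt \<Rightarrow> nat \<Rightarrow> complex \<Rightarrow> complex mat" where
  "whirl_mat_prod n x 0 z = 1\<^sub>m n"
| "whirl_mat_prod n x (Suc k) z = whirl_mat_prod n x k z * whirl_mat n x (Suc k) z"

lemma whirl_mat_carrier [simp]: "whirl_mat n x i z \<in> carrier_mat n n"
  by (simp add: whirl_mat_def)

lemma whirl_mat_dim [simp]: "dim_row (whirl_mat n x i z) = n" "dim_col (whirl_mat n x i z) = n"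
  by (simp_all add: whirl_mat_def)

lemma whirl_mat_prod_carrier [simp]: "whirl_mat_prod n x k z \<in> carrier_mat n n"
  by (induction k) auto

lemma whirl_mat_prod_dim [simp]: "dim_row (whirl_mat_prod n x k z) = n" "dim_col (whirl_mat_prod n x k z) = n"
  using whirl_mat_prod_carrier by (rule carrier_matD)+

text \<open>Column 0 has entries only in rows 0 and n - 1, and both minors are triangular.\<close>

lemma det_whirl_mat:
  assumes n: "n > 1"
  shows "det (whirl_mat n x i z) = 1 - (-1) ^ n * z * norm_prod n x i"
proof -
  let ?A = "whirl_mat n x i z"
  obtain N where N: "n = Suc N" "N > 0" using n by (cases n) auto
  have c0: "cofactor ?A 0 0 = 1"
  proof -
    have "det (mat_delete ?A 0 0) = prod_list (diag_mat (mat_delete ?A 0 0))"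
      by (rule det_upper_triangular[of _ N]) (auto simp: upper_triangular_def mat_delete_def whirl_mat_def N)
    also have "diag_mat (mat_delete ?A 0 0) = map (\<lambda>_. 1) [0..<N]"
      unfolding diag_mat_def by (auto simp: mat_delete_def whirl_mat_def N)
    also have "prod_list (map (\<lambda>_. 1 :: complex) [0..<N]) = 1" by (induction N) auto
    finally show ?thesis by (simp add: cofactor_def)
  qed
  have c1: "cofactor ?A N 0 = (-1) ^ N * (\<Prod>l<N. x (i, int l))"
  proof -
    have "det (mat_delete ?A N 0) = prod_list (diag_mat (mat_delete ?A N 0))"
      by (rule det_lower_triangular[of N]) (auto simp: mat_delete_def whirl_mat_def N)
    also have "diag_mat (mat_delete ?A N 0) = map (\<lambda>l. x (i, int l)) [0..<N]"
      unfolding diag_mat_def by (auto simp: mat_delete_def whirl_mat_def N)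
    finally show ?thesis by (simp add: cofactor_def prod.distinct_set_conv_list[symmetric] atLeast0LessThan)
  qed
  have "det ?A = (\<Sum>r<n. ?A $$ (r, 0) * cofactor ?A r 0)"
    by (rule laplace_expansion_column) (use n in auto)
  also have "\<dots> = (\<Sum>r\<in>{0, N}. ?A $$ (r, 0) * cofactor ?A r 0)"
    by (rule sum.mono_neutral_right) (auto simp: N whirl_mat_def)
  also have "\<dots> = 1 + z * x (i, int N) * ((-1) ^ N * (\<Prod>l<N. x (i, int l)))"
    using N c0 c1 by (simp add: whirl_mat_def)
  also have "\<dots> = 1 - (-1) ^ n * z * norm_prod n x i"
    by (simp add: norm_prod_def N)
  finally show ?thesis .
qed

lemma det_whirl_mat_prod:
  assumes n: "n > 1"
  shows "det (whirl_mat_prod n x k z) = (\<Prod>i=1..k. 1 - (-1) ^ n * z * norm_prod n x i)"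
proof (induction k)
  case (Suc k)
  have "det (whirl_mat_prod n x (Suc k) z) = det (whirl_mat_prod n x k z) * det (whirl_mat n x (Suc k) z)"
    unfolding whirl_mat_prod.simps by (rule det_mult[OF whirl_mat_prod_carrier whirl_mat_carrier])
  then show ?case using Suc det_whirl_mat[OF n] by simp
qed simp

lemma whirl_mat_column:
  assumes "B \<in> carrier_mat n n" "r < n" "s < n" "n > 1"
  shows "(B * whirl_mat n x i z) $$ (r, s) = B $$ (r, s) +
    (if s = 0 then B $$ (r, n - 1) * (z * x (i, int (n - 1))) else B $$ (r, s - 1) * x (i, int (s - 1)))"
proof -
  let ?M = "whirl_mat n x i z"
  have "(B * ?M) $$ (r, s) = (\<Sum>l\<in>{0..<n}. B $$ (r, l) * ?M $$ (l, s))"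
    using assms by (auto simp: scalar_prod_def intro!: sum.cong)
  also have "\<dots> = (\<Sum>l\<in>{s, if s = 0 then n - 1 else s - 1}. B $$ (r, l) * ?M $$ (l, s))"
    by (rule sum.mono_neutral_right) (use assms in \<open>auto simp: whirl_mat_def\<close>)
  also have "\<dots> = B $$ (r, s) +
    (if s = 0 then B $$ (r, n - 1) * (z * x (i, int (n - 1))) else B $$ (r, s - 1) * x (i, int (s - 1)))"
    using assms by (auto simp: whirl_mat_def)
  finally show ?thesis .
qed

text \<open>Link between the infinite periodic matrix and its form over the loop parameter: columns
  that differ by l periods are added with weight z^l. The width k of the band bounds l.\<close>

lemma whirl_mat_prod_entry:
  assumes n: "n > 1" and x: "x \<in> torus n m" and r: "r < n"
  shows "s < n \<Longrightarrow> whirl_mat_prod n x k z $$ (r, s) =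
    (\<Sum>l\<le>k. whirl_prod k x (int r, int s + int l * int n) * z ^ l)"
proof (induction k arbitrary: s)
  case 0
  then show ?case using r by (simp add: whirl_prod.simps(1))
next
  case (Suc k)
  let ?W = "\<lambda>l s. whirl_prod k x (int r, s + int l * int n)"
  have far: "?W (Suc k) (int t) = 0" if "t < n" for t
  proof (rule whirl_prod_above)
    have "int (Suc k) * int n \<ge> int k + int n"
      using n mult_mono[of 1 "int n" "int k" "int k"] by (simp add: algebra_simps)
    then show "int t + int (Suc k) * int n - int r > int k" using r that by linarith
  qed
  have first: "(\<Sum>l\<le>Suc k. ?W l (int s) * z ^ l) = whirl_mat_prod n x k z $$ (r, s)"
    using Suc.IH[OF Suc.prems] far[OF Suc.prems] by simp
  have xs: "x (Suc k, int t + int l * int n) = x (Suc k, int t)" for t l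
    by (rule torus_dvd[OF x]) simp
  have second: "(\<Sum>l\<le>Suc k. ?W l (int s - 1) * x (Suc k, int s + int l * int n - 1) * z ^ l) =
    (if s = 0 then whirl_mat_prod n x k z $$ (r, n - 1) * (z * x (Suc k, int (n - 1)))
     else whirl_mat_prod n x k z $$ (r, s - 1) * x (Suc k, int (s - 1)))"
  proof (cases "s = 0")
    case False
    then have e: "int s - 1 = int (s - 1)" "int s + int l * int n - 1 = int (s - 1) + int l * int n" for l by auto
    have s1: "s - 1 < n" using Suc.prems by simp
    show ?thesis
      unfolding e xs using False Suc.IH[OF s1] far[OF s1] by (simp add: sum_distrib_left sum_distrib_right mult_ac)
  next
    case True
    \<comment> \<open>Column -1 is column n - 1 one period earlier, so the sum shifts by one in l
      and gains a factor z.\<close>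
    have e: "int s - 1 + int (Suc l) * int n = int (n - 1) + int l * int n"
      "int s + int (Suc l) * int n - 1 = int (n - 1) + int l * int n" for l
      using True n by (simp_all add: algebra_simps of_nat_diff)
    have n1: "n - 1 < n" using n by simp
    have "(\<Sum>l\<le>Suc k. ?W l (int s - 1) * x (Suc k, int s + int l * int n - 1) * z ^ l) =
      (\<Sum>l\<le>k. ?W (Suc l) (int s - 1) * x (Suc k, int s + int (Suc l) * int n - 1) * z ^ Suc l)"
      using True by (subst sum.atMost_Suc_shift) (simp add: whirl_prod_lower)
    also have "\<dots> = (\<Sum>l\<le>k. ?W l (int (n - 1)) * z ^ l) * (z * x (Suc k, int (n - 1)))"
      unfolding e xs by (simp add: sum_distrib_left sum_distrib_right mult_ac)
    finally show ?thesis using True Suc.IH[OF n1] by simp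
  qed
  have "(\<Sum>l\<le>Suc k. whirl_prod (Suc k) x (int r, int s + int l * int n) * z ^ l) =
    (\<Sum>l\<le>Suc k. ?W l (int s) * z ^ l) +
    (\<Sum>l\<le>Suc k. ?W l (int s - 1) * x (Suc k, int s + int l * int n - 1) * z ^ l)"
    unfolding sum.distrib[symmetric] whirl_prod_Suc
    by (rule sum.cong[OF refl]) (simp add: algebra_simps)
  then show ?case
    unfolding first second whirl_mat_prod.simps
    using whirl_mat_column[OF whirl_mat_prod_carrier r Suc.prems n] by simp
qed

lemma whirl_mat_mult_vec:
  assumes "v \<in> carrier_vec n" "r < n" "n > 1"
  shows "vec_index (whirl_mat n x i z *\<^sub>v v) r = vec_index v r +
    (if Suc r < n then x (i, int r) * vec_index v (Suc r) else z * x (i, int r) * vec_index v 0)"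
proof -
  let ?M = "whirl_mat n x i z"
  have "vec_index (?M *\<^sub>v v) r = (\<Sum>l\<in>{0..<n}. ?M $$ (r, l) * vec_index v l)"
    using assms by (simp add: scalar_prod_def whirl_mat_def)
  also have "\<dots> = (\<Sum>l\<in>{r, if Suc r < n then Suc r else 0}. ?M $$ (r, l) * vec_index v l)"
    by (rule sum.mono_neutral_right) (use assms in \<open>auto simp: whirl_mat_def\<close>)
  also have "\<dots> = vec_index v r +
    (if Suc r < n then x (i, int r) * vec_index v (Suc r) else z * x (i, int r) * vec_index v 0)"
    using assms by (auto simp: whirl_mat_def)
  finally show ?thesis .
qed

text \<open>
  Replacing one equation of a homogeneous system with one-dimensional solution space by \<open>v\<^sub>0 = 1\<close> makes
  it uniquely solvable, so that Cramer's rule expresses the solution rationally in the coefficients.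
\<close>

definition pin_row :: "nat \<Rightarrow> nat \<Rightarrow> complex mat \<Rightarrow> complex mat" where
  "pin_row n i A = mat n n (\<lambda>(r, s). if r = i then (if s = 0 then 1 else 0) else A $$ (r, s))"

lemma pin_row_carrier [simp]: "pin_row n i A \<in> carrier_mat n n"
  by (simp add: pin_row_def)

lemma pin_row_mult_vec:
  assumes "A \<in> carrier_mat n n" "v \<in> carrier_vec n" "r < n"
  shows "vec_index (pin_row n i A *\<^sub>v v) r = (if r = i then vec_index v 0 else vec_index (A *\<^sub>v v) r)"
proof (cases "r = i")
  case True
  have "vec_index (pin_row n i A *\<^sub>v v) r = (\<Sum>l\<in>{0..<n}. (if l = 0 then 1 else 0) * vec_index v l)"
    using assms True by (simp add: scalar_prod_def pin_row_def)
  also have "\<dots> = (\<Sum>l\<in>{0..<n}. if l = 0 then vec_index v l else 0)" by (rule sum.cong) auto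
  also have "\<dots> = vec_index v 0" using assms by (simp add: sum.delta)
  finally show ?thesis using True by simp
next
  case False
  then show ?thesis using assms by (simp add: scalar_prod_def pin_row_def)
qed

text \<open>\<open>v\<close> solves the pinned system with right side the i-th unit vector;
  multiplication by the adjugate gives Cramer's rule in a form without division.\<close>

lemma pin_row_solution:
  assumes A: "A \<in> carrier_mat n n" and v: "v \<in> carrier_vec n" "A *\<^sub>v v = 0\<^sub>v n" "vec_index v 0 = 1"
    and i: "i < n" and s: "s < n"
  shows "det (pin_row n i A) * vec_index v s = cofactor (pin_row n i A) i s"
proof -
  let ?P = "pin_row n i A"
  have Pv: "?P *\<^sub>v v = unit_vec n i"
  proof (rule eq_vecI)
    fix r assume "r < dim_vec (unit_vec n i :: complex vec)"
    then have r: "r < n" by simp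
    show "vec_index (?P *\<^sub>v v) r = vec_index (unit_vec n i) r"
      unfolding pin_row_mult_vec[OF A v(1) r] using v r i by (auto simp: unit_vec_def)
  qed (simp add: pin_row_def)
  have "adj_mat ?P *\<^sub>v (?P *\<^sub>v v) = (adj_mat ?P * ?P) *\<^sub>v v"
    by (rule assoc_mult_mat_vec[symmetric]) (use adj_mat(1)[of ?P n] v in auto)
  also have "\<dots> = det ?P \<cdot>\<^sub>v v"
  proof -
    have "(\<Sum>l = 0..<n. d * (if l = r then 1 else 0) * vec_index v l) = d * vec_index v r" if "r < n" for d r
      by (subst sum.remove[of _ r]) (use that in auto)
    then show ?thesis unfolding adj_mat(3)[OF pin_row_carrier] using v(1)
      by (intro eq_vecI) (auto simp: scalar_prod_def)
  qed
  finally have "vec_index (adj_mat ?P *\<^sub>v unit_vec n i) s = det ?P * vec_index v s"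
    unfolding Pv using v(1) s by simp
  moreover have "vec_index (adj_mat ?P *\<^sub>v unit_vec n i) s = adj_mat ?P $$ (s, i)"
    using adj_mat(1)[OF pin_row_carrier, of n i A] i s
    by (simp add: scalar_prod_right_unit[of _ n])
  moreover have "adj_mat ?P $$ (s, i) = cofactor ?P i s"
    using i s by (simp add: adj_mat_def pin_row_def)
  ultimately show ?thesis by simp
qed

text \<open>A left kernel vector w with w_i nonzero exhibits row i as a combination of the others,
  so replacing this row loses no equation. A kernel vector of the pinned matrix is then one of A
  with first entry 0, hence zero.\<close>

lemma pin_row_det_nonzero:
  assumes A: "A \<in> carrier_mat n n" and sing: "det A = 0"
    and ker: "\<And>u. u \<in> carrier_vec n \<Longrightarrow> A *\<^sub>v u = 0\<^sub>v n \<Longrightarrow> vec_index u 0 = 0 \<Longrightarrow> u = 0\<^sub>v n"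
  shows "\<exists>i<n. det (pin_row n i A) \<noteq> 0"
proof -
  have "det (transpose_mat A) = 0" using det_transpose[OF A] sing by simp
  then obtain w where w: "w \<in> carrier_vec n" "w \<noteq> 0\<^sub>v n" "transpose_mat A *\<^sub>v w = 0\<^sub>v n"
    using det_0_iff_vec_prod_zero[of "transpose_mat A" n] A by auto
  then obtain i where i: "i < n" "vec_index w i \<noteq> 0"
    by (metis carrier_vecD eq_vecI index_zero_vec(1) index_zero_vec(2))
  have "det (pin_row n i A) \<noteq> 0"
  proof
    assume "det (pin_row n i A) = 0"
    then obtain u where u: "u \<in> carrier_vec n" "u \<noteq> 0\<^sub>v n" "pin_row n i A *\<^sub>v u = 0\<^sub>v n"
      using det_0_iff_vec_prod_zero[OF pin_row_carrier] by blast
    have rows: "(if r = i then vec_index u 0 else vec_index (A *\<^sub>v u) r) = 0" if "r < n" for r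
      using pin_row_mult_vec[OF A u(1) that, of i] u(3) that by simp
    have Au: "vec_index (A *\<^sub>v u) r = 0" if "r < n" "r \<noteq> i" for r using rows[of r] that by simp
    have u0: "vec_index u 0 = 0" using rows[OF i(1)] by simp
    have "scalar_prod w (A *\<^sub>v u) = scalar_prod (transpose_mat A *\<^sub>v w) u"
      using transpose_vec_mult_scalar[OF A u(1) w(1)] by simp
    also have "\<dots> = 0" unfolding w(3) using u(1) by simp
    finally have "(\<Sum>r\<in>{0..<n}. vec_index w r * vec_index (A *\<^sub>v u) r) = 0"
      using A by (simp add: scalar_prod_def)
    moreover have "(\<Sum>r\<in>{0..<n}. vec_index w r * vec_index (A *\<^sub>v u) r) =
      (\<Sum>r\<in>{0..<n}. if r = i then vec_index w r * vec_index (A *\<^sub>v u) r else 0)"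
      by (rule sum.cong) (use Au in auto)
    ultimately have "vec_index (A *\<^sub>v u) i = 0" using i by (simp add: sum.delta)
    then have "vec_index (A *\<^sub>v u) r = 0" if "r < n" for r using Au[OF that] by (cases "r = i") auto
    then have "A *\<^sub>v u = 0\<^sub>v n" using A by (intro eq_vecI) (auto simp del: index_mult_mat_vec)
    then show False using ker[OF u(1) _ u0] u(2) by blast
  qed
  then show ?thesis using i by blast
qed

text \<open>At the root z belonging to q_k the first k - 1 factors are invertible, since their q_i
  differ from q_k. The kernel is thus that of the last whirl, where each entry is determined by the
  preceding one; \<open>v\<close> is its element with first entry 1, and the choice of z closes the
  cycle.\<close>

lemma whirl_mat_prod_kernel:
  assumes n: "n > 1" and x: "x \<in> torus n m" and k: "1 \<le> k" "k \<le> m"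
    and inj: "inj_on (norm_prod n x) {1..m}" and z: "z = (-1) ^ n / norm_prod n x k"
    and A: "A = whirl_mat_prod n x k z"
    and v: "v = vec n (\<lambda>s. \<Prod>l<s. - 1 / x (k, int l))"
  shows "A *\<^sub>v v = 0\<^sub>v n" and "det A = 0"
    and "\<And>u. u \<in> carrier_vec n \<Longrightarrow> A *\<^sub>v u = 0\<^sub>v n \<Longrightarrow> vec_index u 0 = 0 \<Longrightarrow> u = 0\<^sub>v n"
proof -
  obtain k' where k': "k = Suc k'" using k by (cases k) auto
  have q: "norm_prod n x k \<noteq> 0" by (rule norm_prod_nonzero[OF x k])
  have ee: "(-1) ^ n * (-1) ^ n = (1 :: complex)" by (simp flip: power_mult_distrib)
  have xn: "x (k, r) \<noteq> 0" for r using torus_nonzero[OF x k] .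
  have Ak: "A = whirl_mat_prod n x k' z * whirl_mat n x k z" using A k' by simp
  have split: "A *\<^sub>v u = whirl_mat_prod n x k' z *\<^sub>v (whirl_mat n x k z *\<^sub>v u)" if "u \<in> carrier_vec n" for u
    unfolding Ak using that by (intro assoc_mult_mat_vec[of _ n n _ n]) auto
  have vc: "v \<in> carrier_vec n" by (simp add: v)
  have Mv: "whirl_mat n x k z *\<^sub>v v = 0\<^sub>v n"
  proof (rule eq_vecI)
    fix r assume "r < dim_vec (0\<^sub>v n :: complex vec)"
    then have r: "r < n" by simp
    show "vec_index (whirl_mat n x k z *\<^sub>v v) r = vec_index (0\<^sub>v n) r"
    proof (cases "Suc r < n")
      case True
      then show ?thesis unfolding whirl_mat_mult_vec[OF vc r n] using r xn[of "int r"] by (simp add: v)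
    next
      case False
      then have rn: "n = Suc r" using r by simp
      have p: "(\<Prod>l<r. - 1 / x (k, int l)) = (-1) ^ r / (\<Prod>l<r. x (k, int l))"
        unfolding prod_dividef by simp
      have p0: "(\<Prod>l<r. x (k, int l)) \<noteq> 0" using xn by simp
      have nq: "norm_prod n x k = (\<Prod>l<r. x (k, int l)) * x (k, int r)" by (simp add: norm_prod_def rn)
      have "vec_index v r + z * x (k, int r) * vec_index v 0 = 0"
        unfolding z nq using r p p0 xn[of "int r"] by (simp add: v rn field_simps)
      then show ?thesis unfolding whirl_mat_mult_vec[OF vc r n] using False r by simp
    qed
  qed (simp add: whirl_mat_def)
  show "A *\<^sub>v v = 0\<^sub>v n" unfolding split[OF vc] Mv
    by (rule eq_vecI) (auto simp: scalar_prod_def)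
  show "det A = 0"
    unfolding A det_whirl_mat_prod[OF n] using k q ee by (intro prod_zero) (auto simp: z intro!: bexI[of _ k])
  fix u assume u: "u \<in> carrier_vec n" "A *\<^sub>v u = 0\<^sub>v n" "vec_index u 0 = 0"
  have "det (whirl_mat_prod n x k' z) \<noteq> 0"
    unfolding det_whirl_mat_prod[OF n]
  proof (subst prod_zero_iff, simp, intro notI)
    assume "\<exists>i\<in>{1..k'}. 1 - (-1) ^ n * z * norm_prod n x i = 0"
    then obtain i where i: "i \<in> {1..k'}" "1 - (-1) ^ n * z * norm_prod n x i = 0" by blast
    have e: "(-1) ^ n * ((-1) ^ n / b) * a = a / b" for a b :: complex
      using ee by (metis mult.assoc mult.commute mult_1 times_divide_eq_right)
    have "norm_prod n x i / norm_prod n x k = 1" using i(2) unfolding z e by simp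
    then have "norm_prod n x i = norm_prod n x k" using q by (simp add: divide_eq_1_iff)
    moreover have "i \<in> {1..m}" "k \<in> {1..m}" using i(1) k k' by simp_all
    ultimately have "i = k" by (rule inj_onD[OF inj])
    then show False using i(1) k' by simp
  qed
  then have Mu: "whirl_mat n x k z *\<^sub>v u = 0\<^sub>v n"
  proof -
    have "whirl_mat n x k z *\<^sub>v u \<in> carrier_vec n" by (rule mult_mat_vec_carrier[OF whirl_mat_carrier u(1)])
    moreover have "whirl_mat_prod n x k' z *\<^sub>v (whirl_mat n x k z *\<^sub>v u) = 0\<^sub>v n"
      using u(2) by (simp only: split[OF u(1)])
    ultimately show ?thesis
      using \<open>det (whirl_mat_prod n x k' z) \<noteq> 0\<close> det_0_iff_vec_prod_zero[OF whirl_mat_prod_carrier[of n x k' z]]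
      by blast
  qed
  have "vec_index u r = 0" if "r < n" for r
    using that
  proof (induction r)
    case (Suc r)
    then have r: "r < n" "Suc r < n" by auto
    have "vec_index (whirl_mat n x k z *\<^sub>v u) r = 0" using Mu r by simp
    then show ?case unfolding whirl_mat_mult_vec[OF u(1) r(1) n] using Suc.IH[OF r(1)] r(2) xn by simp
  qed (use u in simp)
  then show "u = 0\<^sub>v n" using u(1) by (intro eq_vecI) auto
qed

section \<open>The fixed field\<close>

lemma rat_over_det:
  assumes "\<And>x. A x \<in> carrier_mat N N"
    and "\<And>r s. r < N \<Longrightarrow> s < N \<Longrightarrow> (\<lambda>x. A x $$ (r, s)) \<in> rat_over V F"
  shows "(\<lambda>x. det (A x)) \<in> rat_over V F"
  unfolding det_def'[OF assms(1)]
proof (intro rat_over_sum rat_over_mult rat_over_const rat_over_prod assms(2))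
  fix p i assume "p \<in> {p. p permutes {0..<N}}" "i \<in> {0..<N}"
  then show "p i < N" using permutes_in_image[of p "{0..<N}" i] by simp
qed simp

text \<open>Polynomials in an auxiliary w with coefficients in \<open>alg F\<close>, agreeing with
  the given function only for x in S, because periodicity of x is used to compute the
  entries.\<close>

definition alg_poly :: "'i pt set \<Rightarrow> ('i pt \<Rightarrow> complex) set \<Rightarrow> ('i pt \<Rightarrow> complex \<Rightarrow> complex) \<Rightarrow> bool" where
  "alg_poly S F a \<longleftrightarrow>
     (\<exists>P. (\<forall>j. (\<lambda>x. coeff (P x) j) \<in> alg F) \<and> (\<forall>x\<in>S. \<forall>w. a x w = poly (P x) w))"

lemma alg_polyI:
  "(\<And>j. (\<lambda>x. coeff (P x) j) \<in> alg F) \<Longrightarrow> (\<And>x w. x \<in> S \<Longrightarrow> a x w = poly (P x) w) \<Longrightarrow> alg_poly S F a"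
  unfolding alg_poly_def by blast

lemma alg_poly_const: "alg_poly S F (\<lambda>_ _. c)"
proof (rule alg_polyI[of "\<lambda>_. [:c:]"])
  show "(\<lambda>x. coeff [:c:] j) \<in> alg F" for j by (rule alg.const)
qed simp

lemma alg_poly_add: "alg_poly S F a \<Longrightarrow> alg_poly S F b \<Longrightarrow> alg_poly S F (\<lambda>x w. a x w + b x w)"
  unfolding alg_poly_def
  by (elim exE conjE, rule_tac x = "\<lambda>x. P x + Pa x" in exI) (auto intro: alg.add)

lemma alg_poly_mult: "alg_poly S F a \<Longrightarrow> alg_poly S F b \<Longrightarrow> alg_poly S F (\<lambda>x w. a x w * b x w)"
  unfolding alg_poly_def
  by (elim exE conjE, rule_tac x = "\<lambda>x. P x * Pa x" in exI)
    (auto simp: coeff_mult intro!: alg_sum alg.mult)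

lemma alg_poly_sum: "(\<And>i. i \<in> I \<Longrightarrow> alg_poly S F (a i)) \<Longrightarrow> alg_poly S F (\<lambda>x w. \<Sum>i\<in>I. a i x w)"
  by (induction I rule: infinite_finite_induct) (auto intro: alg_poly_const alg_poly_add)

lemma alg_poly_prod: "(\<And>i. i \<in> I \<Longrightarrow> alg_poly S F (a i)) \<Longrightarrow> alg_poly S F (\<lambda>x w. \<Prod>i\<in>I. a i x w)"
  by (induction I rule: infinite_finite_induct) (auto intro: alg_poly_const alg_poly_mult)

lemma alg_poly_det:
  assumes "\<And>x w. A x w \<in> carrier_mat N N"
    and "\<And>r s. r < N \<Longrightarrow> s < N \<Longrightarrow> alg_poly S F (\<lambda>x w. A x w $$ (r, s))"
  shows "alg_poly S F (\<lambda>x w. det (A x w))"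
  unfolding det_def'[OF assms(1)]
proof (intro alg_poly_sum alg_poly_mult alg_poly_const alg_poly_prod assms(2))
  fix p i assume "p \<in> {p. p permutes {0..<N}}" "i \<in> {0..<N}"
  then show "p i < N" using permutes_in_image[of p "{0..<N}" i] by simp
qed simp

definition whirl_entries :: "nat \<Rightarrow> ((nat \<times> int) pt \<Rightarrow> complex) set" where
  "whirl_entries k = (\<lambda>p x. whirl_prod k x p) ` UNIV"

text \<open>Generators of the field K_k of the overview.\<close>

definition tower_gens :: "nat \<Rightarrow> ((nat \<times> int) pt \<Rightarrow> complex) set" where
  "tower_gens k = whirl_entries k \<union> (\<lambda>p x. x p) ` {p. fst p > k}"

lemma whirl_entries_polyfun: "whirl_entries k \<subseteq> polyfun UNIV"
  unfolding whirl_entries_def using polyfun_whirl_prod[of k] by auto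

lemma tower_gens_polyfun: "tower_gens k \<subseteq> polyfun UNIV"
  unfolding tower_gens_def using whirl_entries_polyfun polyfun_coord by auto

lemma whirl_entry: "(\<lambda>x. whirl_prod k x p) \<in> alg (whirl_entries k)"
  by (rule alg.gen) (auto simp: whirl_entries_def)

lemma alg_mono: "F \<subseteq> G \<Longrightarrow> f \<in> alg F \<Longrightarrow> f \<in> alg G"
  by (rotate_tac, induction rule: alg.induct) (auto intro: alg.intros)

text \<open>The substitution z = (-1)^n w absorbs the sign, so that the determinant becomes the
  product of the factors 1 - w q_i.\<close>

lemma whirl_mat_prod_alg_poly:
  assumes n: "n > 1" and "r < n" "s < n"
  shows "alg_poly (torus n m) (whirl_entries k) (\<lambda>x w. whirl_mat_prod n x k ((-1) ^ n * w) $$ (r, s))"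
proof -
  let ?W = "\<lambda>l x. whirl_prod k x (int r, int s + int l * int n) * ((-1) ^ n) ^ l"
  show ?thesis
  proof (rule alg_polyI[of "\<lambda>x. \<Sum>l\<le>k. monom (?W l x) l"])
    fix j
    have "(\<lambda>x. coeff (monom (?W l x) l) j) \<in> alg (whirl_entries k)" for l
      by (cases "l = j") (auto intro!: alg.const alg.mult whirl_entry)
    then show "(\<lambda>x. coeff (\<Sum>l\<le>k. monom (?W l x) l) j) \<in> alg (whirl_entries k)"
      unfolding coeff_sum by (rule alg_sum)
  next
    fix x w assume "x \<in> torus n m"
    then show "whirl_mat_prod n x k ((-1) ^ n * w) $$ (r, s) = poly (\<Sum>l\<le>k. monom (?W l x) l) w"
      using whirl_mat_prod_entry[OF n _ assms(2,3)]
      by (simp add: poly_sum poly_monom power_mult_distrib mult.assoc)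
  qed
qed

text \<open>
  The determinant of the product of whirls is \<open>\<Prod>i. 1 - w * norm_prod n x i\<close>; hence its coefficients,
  functions of the entries of the product, are the elementary symmetric functions of the \<open>norm_prod\<close>.
\<close>

lemma norm_prod_equation:
  assumes n: "n > 1" and k: "1 \<le> k" "k \<le> m"
  shows "\<exists>e. (\<forall>j. e j \<in> alg (whirl_entries k)) \<and>
    (\<forall>x\<in>torus n m. norm_prod n x k ^ k = (\<Sum>j<k. e j x * norm_prod n x k ^ j))"
proof -
  have "alg_poly (torus n m) (whirl_entries k) (\<lambda>x w. det (whirl_mat_prod n x k ((-1) ^ n * w)))"
    by (rule alg_poly_det[OF whirl_mat_prod_carrier whirl_mat_prod_alg_poly[OF n]])
  then obtain P where P: "\<And>j. (\<lambda>x. coeff (P x) j) \<in> alg (whirl_entries k)"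
    "\<And>x w. x \<in> torus n m \<Longrightarrow> det (whirl_mat_prod n x k ((-1) ^ n * w)) = poly (P x) w"
    unfolding alg_poly_def by blast
  have ee: "(-1) ^ n * ((-1) ^ n * w) = w" for w :: complex
    by (simp flip: mult.assoc power_mult_distrib)
  have Peq: "P x = (\<Prod>i=1..k. [:1, - norm_prod n x i:])" if "x \<in> torus n m" for x
  proof -
    have "poly (P x) w = poly (\<Prod>i=1..k. [:1, - norm_prod n x i:]) w" for w
      unfolding P(2)[OF that, symmetric] det_whirl_mat_prod[OF n] ee by (simp add: poly_prod)
    then show ?thesis by (metis poly_eq_poly_eq_iff ext)
  qed
  \<comment> \<open>The polynomial vanishes at w = 1/q. Multiplying by q^k reverses the
    coefficients, and the constant coefficient 1 becomes the leading one: the equation is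
    monic.\<close>
  have "norm_prod n x k ^ k = (\<Sum>j<k. - coeff (P x) (k - j) * norm_prod n x k ^ j)" if x: "x \<in> torus n m" for x
  proof -
    let ?q = "norm_prod n x k"
    have q: "?q \<noteq> 0" by (rule norm_prod_nonzero[OF x k])
    have deg: "degree (P x) \<le> k"
    proof -
      have "degree (P x) \<le> (\<Sum>i=1..k. degree [:1, - norm_prod n x i:])"
        unfolding Peq[OF x] using degree_prod_sum_le[of "{1..k}" "\<lambda>i. [:1, - norm_prod n x i:]"]
        by (simp add: o_def)
      also have "\<dots> \<le> (\<Sum>i=1..k. 1)" by (rule sum_mono) simp
      finally show ?thesis by simp
    qed
    have "poly (P x) 0 = 1" unfolding Peq[OF x] by (simp add: poly_prod)
    then have c0: "coeff (P x) 0 = 1" by (simp add: poly_0_coeff_0)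
    have "poly (P x) (1 / ?q) = 0"
      unfolding Peq[OF x] poly_prod by (rule prod_zero) (use k q in \<open>auto intro!: bexI[of _ k]\<close>)
    then have "(\<Sum>l\<le>k. coeff (P x) l * (1 / ?q) ^ l) = 0"
      using arg_cong[OF poly_as_sum_of_monoms'[OF deg], of "\<lambda>p. poly p (1 / ?q)"]
      by (simp only: poly_sum poly_monom)
    then have "0 = ?q ^ k * (\<Sum>l\<le>k. coeff (P x) l * (1 / ?q) ^ l)" by simp
    also have "\<dots> = (\<Sum>l\<le>k. coeff (P x) l * ?q ^ (k - l))"
      unfolding sum_distrib_left
    proof (rule sum.cong[OF refl])
      fix l assume "l \<in> {..k}"
      then have "?q ^ k = ?q ^ (k - l) * ?q ^ l" by (simp flip: power_add)
      then show "?q ^ k * (coeff (P x) l * (1 / ?q) ^ l) = coeff (P x) l * ?q ^ (k - l)"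
        using q by (simp add: field_simps)
    qed
    also have "\<dots> = (\<Sum>j\<le>k. coeff (P x) (k - j) * ?q ^ j)"
      by (rule sum.reindex_bij_witness[of _ "\<lambda>j. k - j" "\<lambda>j. k - j"]) auto
    also have "\<dots> = (\<Sum>j<k. coeff (P x) (k - j) * ?q ^ j) + ?q ^ k"
      using c0 by (simp flip: lessThan_Suc_atMost)
    finally show ?thesis by (simp add: sum_negf add_eq_0_iff)
  qed
  moreover have "(\<lambda>x. - coeff (P x) (k - j)) \<in> alg (whirl_entries k)" for j
    by (rule alg_uminus[OF P(1)])
  ultimately show ?thesis by (intro exI[of _ "\<lambda>j x. - coeff (P x) (k - j)"]) blast
qed

lemma last_factor_rational:
  assumes n: "n > 1" and k: "1 \<le> k" "k \<le> m"
  defines "F \<equiv> insert (\<lambda>x. norm_prod n x k) (whirl_entries k)"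
  shows "(\<lambda>x. x (k, r)) \<in> rat_over (torus n m) F"
proof -
  let ?T = "torus n m" and ?q = "\<lambda>x. norm_prod n x k"
  have n0: "n > 0" using n by simp
  note irr = torus_irreducible[OF n0, of m]
  have Fp: "F \<subseteq> polyfun UNIV" unfolding F_def using whirl_entries_polyfun polyfun_norm_prod by auto
  have qF: "?q \<in> rat_over ?T F" by (rule alg_rat_over, rule alg.gen) (simp add: F_def)
  have WF: "(\<lambda>x. whirl_prod k x p) \<in> rat_over ?T F" for p
    by (rule alg_rat_over, rule alg.gen) (auto simp: F_def whirl_entries_def)
  \<comment> \<open>The root of the determinant attached to q_k; it lies in the field because q_k
    was adjoined.\<close>
  define z where "z x = (-1) ^ n / ?q x" for x
  have zF: "z \<in> rat_over ?T F" unfolding z_def by (rule rat_over_divide[OF irr Fp rat_over_const qF])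
  define A where "A x = whirl_mat_prod n x k (z x)" for x
  have Ac: "A x \<in> carrier_mat n n" for x by (simp add: A_def)
  have AF: "(\<lambda>x. A x $$ (r, s)) \<in> rat_over ?T F" if "r < n" "s < n" for r s
  proof (rule rat_over_cong)
    show "(\<lambda>x. \<Sum>l\<le>k. whirl_prod k x (int r, int s + int l * int n) * z x ^ l) \<in> rat_over ?T F"
      by (intro rat_over_sum rat_over_mult rat_over_power WF zF)
    show "\<forall>\<^sub>F x in generic ?T. (\<Sum>l\<le>k. whirl_prod k x (int r, int s + int l * int n) * z x ^ l) = A x $$ (r, s)"
      using eventually_generic_in[OF irr]
    proof eventually_elim
      case (elim x)
      then show ?case unfolding A_def using whirl_mat_prod_entry[OF n _ that] by simp
    qed
  qed
  have PF: "(\<lambda>x. pin_row n i (A x) $$ (r, s)) \<in> rat_over ?T F" if "r < n" "s < n" for i r s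
    using that AF[OF that] by (cases "r = i"; cases "s = 0") (simp_all add: pin_row_def rat_over_const)
  have gF: "(\<lambda>x. det (pin_row n i (A x))) \<in> rat_over ?T F" for i
    by (rule rat_over_det[OF pin_row_carrier PF])
  have cF: "(\<lambda>x. cofactor (pin_row n i (A x)) i s) \<in> rat_over ?T F" if "i < n" "s < n" for i s
    unfolding cofactor_def
  proof (intro rat_over_mult rat_over_const rat_over_det[where N = "n - 1"])
    show "mat_delete (pin_row n i (A x)) i s \<in> carrier_mat (n - 1) (n - 1)" for x
      by (simp add: mat_delete_def pin_row_def)
    fix a b assume ab: "a < n - 1" "b < n - 1"
    have "(\<lambda>x. pin_row n i (A x) $$ (if a < i then a else Suc a, if b < s then b else Suc b)) \<in> rat_over ?T F"
      by (rule PF) (use ab in auto)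
    then show "(\<lambda>x. mat_delete (pin_row n i (A x)) i s $$ (a, b)) \<in> rat_over ?T F"
      using ab by (simp add: mat_delete_def pin_row_def)
  qed
  define v where "v s x = (\<Prod>l<s. - 1 / x (k, int l))" for s and x :: "(nat \<times> int) pt"
  have key: "(\<exists>i<n. det (pin_row n i (A x)) \<noteq> 0) \<and>
      (\<forall>i<n. \<forall>s<n. det (pin_row n i (A x)) * v s x = cofactor (pin_row n i (A x)) i s)"
    if x: "x \<in> ?T" "inj_on (norm_prod n x) {1..m}" for x
  proof -
    note K = whirl_mat_prod_kernel[OF n x(1) k x(2) z_def A_def refl]
    have v: "vec n (\<lambda>s. \<Prod>l<s. - 1 / x (k, int l)) \<in> carrier_vec n" by simp
    have "vec_index (vec n (\<lambda>s. \<Prod>l<s. - 1 / x (k, int l))) 0 = 1" using n by simp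
    note sol = pin_row_solution[OF Ac v K(1) this]
    have "det (pin_row n i (A x)) * v s x = cofactor (pin_row n i (A x)) i s" if "i < n" "s < n" for i s
      using sol[OF that] that(2) by (simp add: v_def)
    moreover have "\<exists>i<n. det (pin_row n i (A x)) \<noteq> 0"
      by (rule pin_row_det_nonzero[OF Ac K(2,3)])
    ultimately show ?thesis by blast
  qed
  have key': "\<forall>\<^sub>F x in generic ?T. x \<in> ?T \<and> (\<exists>i<n. det (pin_row n i (A x)) \<noteq> 0) \<and>
      (\<forall>i<n. \<forall>s<n. det (pin_row n i (A x)) * v s x = cofactor (pin_row n i (A x)) i s)"
    using eventually_generic_in[OF irr] eventually_norm_prod_inj[OF n0, of m]
    by eventually_elim (use key in blast)
  \<comment> \<open>So far the index of the pinned row depends on x. Each of the finitely many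
    determinants is generically zero or generically nonzero, so one index serves
    generically.\<close>
  have "\<exists>i<n. \<forall>\<^sub>F x in generic ?T. det (pin_row n i (A x)) \<noteq> 0"
  proof (rule ccontr)
    assume no: "\<not> (\<exists>i<n. \<forall>\<^sub>F x in generic ?T. det (pin_row n i (A x)) \<noteq> 0)"
    have "\<forall>i\<in>{..<n}. \<forall>\<^sub>F x in generic ?T. det (pin_row n i (A x)) = 0"
      using rat_over_dichotomy[OF irr Fp gF] no by blast
    then have "\<forall>\<^sub>F x in generic ?T. \<forall>i\<in>{..<n}. det (pin_row n i (A x)) = 0"
      by (intro eventually_ball_finite) auto
    with key' have "\<forall>\<^sub>F x in generic ?T. False" by eventually_elim auto
    then show False using generic_nonbot[OF irr] by simp
  qed
  then obtain i where i: "i < n" "\<forall>\<^sub>F x in generic ?T. det (pin_row n i (A x)) \<noteq> 0" by blast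
  have vF: "v s \<in> rat_over ?T F" if "s < n" for s
  proof (rule rat_over_cong[OF rat_over_divide[OF irr Fp cF[OF i(1) that] gF[of i]]])
    show "\<forall>\<^sub>F x in generic ?T. cofactor (pin_row n i (A x)) i s / det (pin_row n i (A x)) = v s x"
      using key' i(2)
    proof eventually_elim
      case (elim x)
      then have "det (pin_row n i (A x)) * v s x = cofactor (pin_row n i (A x)) i s" using i(1) that by blast
      then show ?case using elim by (simp add: field_simps)
    qed
  qed
  have small: "(\<lambda>x. x (k, int l)) \<in> rat_over ?T F" if "Suc l < n" for l
  proof (rule rat_over_cong)
    show "(\<lambda>x. - (v l x / v (Suc l) x)) \<in> rat_over ?T F"
      using that by (intro rat_over_uminus rat_over_divide[OF irr Fp] vF) auto
    show "\<forall>\<^sub>F x in generic ?T. - (v l x / v (Suc l) x) = x (k, int l)"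
      using eventually_generic_in[OF irr]
    proof eventually_elim
      case (elim x)
      have "x (k, r) \<noteq> 0" for r using torus_nonzero[OF elim k] .
      then show ?case by (simp add: v_def)
    qed
  qed
  \<comment> \<open>Ratios of consecutive entries of the kernel vector give only the first n - 1
    coordinates; the last one is recovered from their product and q_k.\<close>
  have all: "(\<lambda>x. x (k, int l)) \<in> rat_over ?T F" if "l < n" for l
  proof (cases "Suc l < n")
    case False
    then have ln: "n = Suc l" using that by simp
    show ?thesis
    proof (rule rat_over_cong)
      show "(\<lambda>x. ?q x / (\<Prod>i<l. x (k, int i))) \<in> rat_over ?T F"
        by (intro rat_over_divide[OF irr Fp] qF rat_over_prod small) (simp add: ln)
      show "\<forall>\<^sub>F x in generic ?T. ?q x / (\<Prod>i<l. x (k, int i)) = x (k, int l)"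
        using eventually_generic_in[OF irr]
      proof eventually_elim
        case (elim x)
        have "(\<Prod>i<l. x (k, int i)) \<noteq> 0" using torus_nonzero[OF elim k] by simp
        then show ?case by (simp add: norm_prod_def ln)
      qed
    qed
  qed (rule small)
  show ?thesis
  proof (rule rat_over_cong[OF all])
    show "nat (r mod int n) < n" using n by (simp add: nat_less_iff)
    show "\<forall>\<^sub>F x in generic ?T. x (k, int (nat (r mod int n))) = x (k, r)"
      using eventually_generic_in[OF irr]
    proof eventually_elim
      case (elim x)
      have "int (nat (r mod int n)) = r mod int n" using n by simp
      then show ?case using torus_dvd[OF elim, of "r mod int n" r k] by (simp add: mod_eq_dvd_iff[symmetric])
    qed
  qed
qed

section \<open>Descent along the tower of fields\<close>

lemma alg_eqI:
  assumes "a \<in> alg B" "\<And>b. b \<in> B \<Longrightarrow> b y = b x" shows "a y = a x"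
  using assms by induction auto

text \<open>Dominance in terms of filters, so that generic statements can be transported along
  composites of the \<open>s_j\<close> by \<open>filterlim_compose\<close>.\<close>

lemma filterlim_R_fun:
  assumes "n > 0" "1 \<le> j" "j < m"
  shows "filterlim (R_fun n j) (generic (torus n m)) (generic (torus n m))"
  unfolding filterlim_iff
proof (intro allI impI)
  fix P assume "\<forall>\<^sub>F x in generic (torus n m). P x"
  from permuting_eventually[OF assms(1) permuting_R[OF assms] this]
  show "\<forall>\<^sub>F x in generic (torus n m). P (R_fun n j x)"
    by eventually_elim (auto simp: R_map_def restrict_map_def split: if_splits)
qed

lemma tower_gens_R_fun:
  assumes "x \<in> R_domain n m j" "1 \<le> j" "j < k" "k \<le> m" "n > 0" "b \<in> tower_gens k"
  shows "b (R_fun n j x) = b x"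
proof -
  have "whirl_prod k (R_fun n j x) = whirl_prod k x"
    using whirl_prod_R_fun[OF assms(1,2) _ assms(5), of k] assms(3,4) by simp
  moreover have "R_fun n j x p = x p" if "fst p > k" for p
    using that assms(3) by (auto simp: R_fun_def split_beta)
  ultimately show ?thesis using assms(6) by (auto simp: tower_gens_def whirl_entries_def)
qed

text \<open>Transitivity in usable form: successive involutions carry q_i through the positions i +
  1, ..., k. Each has index below k, so it fixes f and the generators of K_k.\<close>

lemma ex_moving_map:
  assumes n: "n > 0" and k: "k \<le> m" and i: "1 \<le> i" "i \<le> k"
    and inv: "\<And>j. 1 \<le> j \<Longrightarrow> j < k \<Longrightarrow> \<forall>\<^sub>F x in generic (torus n m). f (R_fun n j x) = f x"
  shows "\<exists>g. filterlim g (generic (torus n m)) (generic (torus n m)) \<and>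
    (\<forall>\<^sub>F x in generic (torus n m). norm_prod n (g x) k = norm_prod n x i \<and>
      (\<forall>b\<in>tower_gens k. b (g x) = b x) \<and> f (g x) = f x)"
  using i(2,1)
proof (induction i rule: inc_induct)
  case base
  show ?case by (rule exI[of _ "\<lambda>x. x"]) (simp add: filterlim_ident)
next
  case (step i)
  note irr = torus_irreducible[OF n, of m]
  have ij: "1 \<le> i" "i < m" "i < k" using step k by auto
  obtain g where g: "filterlim g (generic (torus n m)) (generic (torus n m))"
    "\<forall>\<^sub>F x in generic (torus n m). norm_prod n (g x) k = norm_prod n x (Suc i) \<and>
      (\<forall>b\<in>tower_gens k. b (g x) = b x) \<and> f (g x) = f x" using step by auto
  note R = filterlim_R_fun[OF n ij(1,2)]
  have dom: "\<forall>\<^sub>F x in generic (torus n m). x \<in> R_domain n m i"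
    using rational_map_eventually_dom[OF irr rational_map_R[OF n ij(1,2)]]
    by eventually_elim (auto simp: R_map_def)
  show ?case
  proof (intro exI[of _ "\<lambda>x. g (R_fun n i x)"] conjI filterlim_compose[OF g(1) R])
    show "\<forall>\<^sub>F x in generic (torus n m). norm_prod n (g (R_fun n i x)) k = norm_prod n x i \<and>
      (\<forall>b\<in>tower_gens k. b (g (R_fun n i x)) = b x) \<and> f (g (R_fun n i x)) = f x"
      using R[unfolded filterlim_iff, rule_format, OF g(2)] inv[OF ij(1,3)] dom
    proof eventually_elim
      case (elim x)
      have "norm_prod n (R_fun n i x) (Suc i) = norm_prod n x i"
        using norm_prod_R_fun[OF elim(3) ij(1,2), of "Suc i"] by simp
      moreover have "b (R_fun n i x) = b x" if "b \<in> tower_gens k" for b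
        by (rule tower_gens_R_fun[OF elim(3) ij(1,3) k n that])
      ultimately show ?case using elim(1,2) by auto
    qed
  qed
qed

lemma poly_coeffs_zero:
  fixes c :: "nat \<Rightarrow> complex"
  assumes "inj_on q {1..k}" "\<And>i. i \<in> {1..k} \<Longrightarrow> (\<Sum>j<k. c j * q i ^ j) = 0" "j < k"
  shows "c j = 0"
proof (rule ccontr)
  assume "c j \<noteq> 0"
  obtain K where K: "k = Suc K" using assms(3) by (cases k) auto
  have b: "finite {z. (\<Sum>i\<le>K. c i * z ^ i) = 0}" "card {z. (\<Sum>i\<le>K. c i * z ^ i) = 0} \<le> K"
    using Transcendental.polyfun_rootbound[of c j K] \<open>c j \<noteq> 0\<close> assms(3) K by auto
  have "q ` {1..k} \<subseteq> {z. (\<Sum>i\<le>K. c i * z ^ i) = 0}"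
    using assms(2) by (auto simp: K lessThan_Suc_atMost)
  then have "card (q ` {1..k}) \<le> K" using b card_mono order_trans by blast
  then show False using card_image[OF assms(1)] K by simp
qed

lemma tower_descend:
  assumes n: "n > 1" and k: "1 \<le> k" "k \<le> m"
    and inv: "\<And>j. 1 \<le> j \<Longrightarrow> j < k \<Longrightarrow> \<forall>\<^sub>F x in generic (torus n m). f (R_fun n j x) = f x"
    and f: "f \<in> rat_over (torus n m) (insert (\<lambda>x. norm_prod n x k) (tower_gens k))"
  shows "f \<in> rat_over (torus n m) (tower_gens k)"
  using f
proof (rule rat_overE)
  let ?T = "torus n m" and ?B = "tower_gens k"
  have n0: "n > 0" using n by simp
  note irr = torus_irreducible[OF n0, of m]
  fix p d assume p: "p \<in> alg (insert (\<lambda>x. norm_prod n x k) ?B)" "d \<in> alg (insert (\<lambda>x. norm_prod n x k) ?B)"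
    and pd: "\<forall>\<^sub>F x in generic ?T. d x \<noteq> 0 \<and> f x = p x / d x"
  obtain e where e: "\<And>j. e j \<in> alg (whirl_entries k)"
    "\<And>x. x \<in> ?T \<Longrightarrow> norm_prod n x k ^ k = (\<Sum>j<k. e j x * norm_prod n x k ^ j)"
    using norm_prod_equation[OF n k] by blast
  have eB: "e j \<in> alg ?B" for j by (rule alg_mono[OF _ e(1)]) (auto simp: tower_gens_def)
  have red: "\<exists>P. (\<forall>j. P j \<in> alg ?B) \<and> (\<forall>x\<in>?T. g x = (\<Sum>j<k. P j x * norm_prod n x k ^ j))"
    if "g \<in> alg (insert (\<lambda>x. norm_prod n x k) ?B)" for g
    by (rule alg_insert_reduce[where q = "\<lambda>x. norm_prod n x k", OF eB e(2) k(1) that])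
  obtain P where "(\<forall>j. P j \<in> alg ?B) \<and> (\<forall>x\<in>?T. p x = (\<Sum>j<k. P j x * norm_prod n x k ^ j))"
    using red[OF p(1)] ..
  then have P: "P j \<in> alg ?B" "x \<in> ?T \<Longrightarrow> p x = (\<Sum>j<k. P j x * norm_prod n x k ^ j)" for j x
    by simp_all
  obtain D where "(\<forall>j. D j \<in> alg ?B) \<and> (\<forall>x\<in>?T. d x = (\<Sum>j<k. D j x * norm_prod n x k ^ j))"
    using red[OF p(2)] ..
  then have D: "D j \<in> alg ?B" "x \<in> ?T \<Longrightarrow> d x = (\<Sum>j<k. D j x * norm_prod n x k ^ j)" for j x
    by simp_all
  \<comment> \<open>The relation f d = p is evaluated at the moved point: f and the coefficients
    \<open>P\<close>, \<open>D\<close> are unchanged there, while q_k has become q_i.\<close>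
  have conj: "\<forall>\<^sub>F x in generic ?T. (\<Sum>j<k. (P j x - f x * D j x) * norm_prod n x i ^ j) = 0"
    if i: "i \<in> {1..k}" for i
  proof -
    obtain g where g: "filterlim g (generic ?T) (generic ?T)"
      "\<forall>\<^sub>F x in generic ?T. norm_prod n (g x) k = norm_prod n x i \<and> (\<forall>b\<in>?B. b (g x) = b x) \<and> f (g x) = f x"
      using ex_moving_map[OF n0 k(2) _ _ inv, of i] i by auto
    from g(2) g(1)[unfolded filterlim_iff, rule_format, OF pd]
      g(1)[unfolded filterlim_iff, rule_format, OF eventually_generic_in[OF irr]]
    show ?thesis
    proof eventually_elim
      case (elim x)
      have PD: "P j (g x) = P j x" "D j (g x) = D j x" for j
        using alg_eqI[OF P(1)] alg_eqI[OF D(1)] elim(1) by blast+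
      have "f x * d (g x) = p (g x)" using elim(1,2) by (simp add: field_simps)
      then show ?case
        unfolding P(2)[OF elim(3)] D(2)[OF elim(3)] PD using elim(1)
        by (simp add: left_diff_distrib sum_subtractf sum_distrib_left mult.assoc)
    qed
  qed
  have all: "\<forall>\<^sub>F x in generic ?T. \<forall>i\<in>{1..k}. (\<Sum>j<k. (P j x - f x * D j x) * norm_prod n x i ^ j) = 0"
    by (rule eventually_ball_finite) (use conj in auto)
  have main: "\<forall>\<^sub>F x in generic ?T. (\<forall>j<k. P j x = f x * D j x) \<and> (\<exists>j<k. D j x \<noteq> 0)"
    using all eventually_norm_prod_inj[OF n0, of m] pd eventually_generic_in[OF irr]
  proof eventually_elim
    case (elim x)
    have inj: "inj_on (norm_prod n x) {1..k}" by (rule inj_on_subset[OF elim(2)]) (use k in auto)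
    have "P j x - f x * D j x = 0" if "j < k" for j
      by (rule poly_coeffs_zero[OF inj _ that]) (use elim(1) in blast)
    moreover have "\<exists>j<k. D j x \<noteq> 0"
    proof (rule ccontr)
      assume "\<not> (\<exists>j<k. D j x \<noteq> 0)"
      then have "d x = 0" unfolding D(2)[OF elim(4)] by simp
      then show False using elim(3) by simp
    qed
    ultimately show ?case by simp
  qed
  \<comment> \<open>Some coefficient of the denominator is nonzero at each generic x; the dichotomy
    makes the choice of j uniform.\<close>
  have "\<exists>j<k. \<forall>\<^sub>F x in generic ?T. D j x \<noteq> 0"
  proof (rule ccontr)
    assume no: "\<not> (\<exists>j<k. \<forall>\<^sub>F x in generic ?T. D j x \<noteq> 0)"
    have "\<forall>j\<in>{..<k}. \<forall>\<^sub>F x in generic ?T. D j x = 0"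
      using polyfun_dichotomy[OF irr alg_polyfun[OF tower_gens_polyfun D(1)]] no by blast
    then have "\<forall>\<^sub>F x in generic ?T. \<forall>j\<in>{..<k}. D j x = 0"
      by (intro eventually_ball_finite) auto
    with main have "\<forall>\<^sub>F x in generic ?T. False" by eventually_elim auto
    then show False using generic_nonbot[OF irr] by simp
  qed
  then obtain j where j: "j < k" "\<forall>\<^sub>F x in generic ?T. D j x \<noteq> 0" by blast
  show ?thesis
  proof (rule rat_overI[OF P(1)[of j] D(1)[of j]])
    show "\<forall>\<^sub>F x in generic ?T. D j x \<noteq> 0 \<and> f x = P j x / D j x"
      using main j(2) by eventually_elim (use j(1) in auto)
  qed
qed

text \<open>The nontrivial inclusion of K_k in K_{k+1}(q_{k+1}): with the whirl k + 1 known, the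
  shorter product is the longer one with its last factor divided off.\<close>

lemma tower_step:
  assumes n: "n > 1" and k: "Suc k \<le> m" and b: "b \<in> tower_gens k"
  shows "b \<in> rat_over (torus n m) (insert (\<lambda>x. norm_prod n x (Suc k)) (tower_gens (Suc k)))"
    (is "_ \<in> rat_over ?T ?F")
proof -
  have n0: "n > 0" using n by simp
  note irr = torus_irreducible[OF n0, of m]
  have Fp: "?F \<subseteq> polyfun UNIV" using tower_gens_polyfun polyfun_norm_prod by auto
  have sub: "insert (\<lambda>x. norm_prod n x (Suc k)) (whirl_entries (Suc k)) \<subseteq> ?F" by (auto simp: tower_gens_def)
  have last: "(\<lambda>x. x (Suc k, r)) \<in> rat_over ?T ?F" for r
    by (rule rat_over_trans[OF irr Fp last_factor_rational[OF n _ k]])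
      (use sub in \<open>auto intro!: alg_rat_over alg.gen\<close>)
  have W: "(\<lambda>x. whirl_prod (Suc k) x p) \<in> rat_over ?T ?F" for p
    by (rule alg_rat_over, rule alg.gen) (auto simp: tower_gens_def whirl_entries_def)
  have Wk: "(\<lambda>x. whirl_prod k x (r, s)) \<in> rat_over ?T ?F" for r s
  proof (cases "s < r")
    case True
    then show ?thesis by (simp add: whirl_prod_lower rat_over_const)
  next
    case False
    then have "r \<le> s" by simp
    then show ?thesis
    proof (induction s rule: int_ge_induct)
      case base
      then show ?case by (simp add: rat_over_const)
    next
      case (step s)
      \<comment> \<open>Division by the last whirl, carried out along a row from the
        diagonal.\<close>
      have e: "whirl_prod k x (r, s + 1) = whirl_prod (Suc k) x (r, s + 1) + - (whirl_prod k x (r, s) * x (Suc k, s))" for x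
        by (simp add: whirl_prod_Suc)
      show ?case unfolding e by (intro rat_over_add rat_over_uminus rat_over_mult W step.IH last)
    qed
  qed
  from b consider r s where "b = (\<lambda>x. whirl_prod k x (r, s))" | i r where "b = (\<lambda>x. x (i, r))" "i > k"
    by (auto simp: tower_gens_def whirl_entries_def)
  then show ?thesis
  proof cases
    case 1
    then show ?thesis using Wk by simp
  next
    case 2
    show ?thesis
    proof (cases "i = Suc k")
      case True
      then show ?thesis using last 2 by simp
    next
      case False
      then have "b \<in> ?F" using 2 by (auto simp: tower_gens_def)
      then show ?thesis by (intro alg_rat_over alg.gen)
    qed
  qed
qed

lemma invariant_rat_over_tower:
  assumes n: "n > 1" and f: "f \<in> rat_over (torus n m) (range (\<lambda>p x. x p))"
  shows "k \<le> m \<Longrightarrow> (\<And>j. 1 \<le> j \<Longrightarrow> j < k \<Longrightarrow> \<forall>\<^sub>F x in generic (torus n m). f (R_fun n j x) = f x) \<Longrightarrow>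
    f \<in> rat_over (torus n m) (tower_gens k)"
proof (induction k)
  case 0
  have n0: "n > 0" using n by simp
  note irr = torus_irreducible[OF n0, of m]
  show ?case
  proof (rule rat_over_trans[OF irr tower_gens_polyfun f])
    fix g assume "g \<in> range (\<lambda>p x :: (nat \<times> int) pt. x p)"
    then obtain i r where g: "g = (\<lambda>x. x (i, r))" by auto
    \<comment> \<open>At the bottom of the tower every coordinate with i > 0 is a generator, and
      those with i = 0 vanish on the torus.\<close>
    show "g \<in> rat_over (torus n m) (tower_gens 0)"
    proof (cases "i = 0")
      case True
      have "\<forall>\<^sub>F x in generic (torus n m). 0 = g x"
        using eventually_generic_in[OF irr] by eventually_elim (simp add: g True torus_zero)
      then show ?thesis by (rule rat_over_cong[OF rat_over_const])
    next
      case False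
      then show ?thesis unfolding g by (intro alg_rat_over alg.gen) (auto simp: tower_gens_def)
    qed
  qed
next
  case (Suc k)
  have n0: "n > 0" using n by simp
  note irr = torus_irreducible[OF n0, of m]
  have Fp: "insert (\<lambda>x. norm_prod n x (Suc k)) (tower_gens (Suc k)) \<subseteq> polyfun UNIV"
    using tower_gens_polyfun polyfun_norm_prod by auto
  have "f \<in> rat_over (torus n m) (tower_gens k)" by (rule Suc.IH) (use Suc.prems in auto)
  then have "f \<in> rat_over (torus n m) (insert (\<lambda>x. norm_prod n x (Suc k)) (tower_gens (Suc k)))"
    by (rule rat_over_trans[OF irr Fp _ tower_step[OF n Suc.prems(1)]])
  then show ?case by (intro tower_descend[OF n _ Suc.prems(1)] Suc.prems(2)) auto
qed

text \<open>At the top of the tower the remaining coordinates belong to blocks beyond m and vanish,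
  so only entries of the product are left.\<close>

lemma alg_tower_gens_polyfun:
  assumes "a \<in> alg (tower_gens m)"
  shows "\<exists>P\<in>polyfun UNIV. \<forall>x\<in>torus n m. a x = P (whirl_prod m x)"
  using assms
proof induction
  case (const a)
  show ?case by (rule bexI[OF _ polyfun.const[of a]]) simp
next
  case (gen b)
  then consider r s where "b = (\<lambda>x. whirl_prod m x (r, s))" | i r where "b = (\<lambda>x. x (i, r))" "i > m"
    by (auto simp: tower_gens_def whirl_entries_def)
  then show ?case
  proof cases
    case 1
    then show ?thesis by (intro bexI[OF _ polyfun_coord[of "(r, s)"]]) simp
  next
    case 2
    then show ?thesis by (intro bexI[OF _ polyfun.const[of 0]]) (auto simp: torus_zero)
  qed
next
  case (add f g)
  then obtain P Q where PQ: "P \<in> polyfun UNIV" "Q \<in> polyfun UNIV"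
    "\<forall>x\<in>torus n m. f x = P (whirl_prod m x)" "\<forall>x\<in>torus n m. g x = Q (whirl_prod m x)" by blast
  then show ?case by (intro bexI[OF _ polyfun.add[OF PQ(1,2)]]) simp
next
  case (mult f g)
  then obtain P Q where PQ: "P \<in> polyfun UNIV" "Q \<in> polyfun UNIV"
    "\<forall>x\<in>torus n m. f x = P (whirl_prod m x)" "\<forall>x\<in>torus n m. g x = Q (whirl_prod m x)" by blast
  then show ?case by (intro bexI[OF _ polyfun.mult[OF PQ(1,2)]]) simp
qed

section \<open>The group of automorphisms and the quotient property\<close>

lemma permuting_automorphism_group:
  assumes n: "n > 1" and m: "m \<ge> 1" and \<rho>: "\<And>w. w permutes {1..m} \<Longrightarrow> permuting n m w (\<rho> w)"
  shows "crystal_automorphism_group (X_crystal n m) (\<rho> ` carrier (sym_group m))"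
proof -
  let ?T = "torus n m" and ?\<Gamma> = "\<rho> ` {w. w permutes {1..m}}"
  have n0: "n > 0" using n by simp
  note irr = torus_irreducible[OF n0, of m]
  have pts: "points (X_crystal n m) = ?T" by (simp add: X_crystal_explicit[OF m] X_explicit_def)
  have G: "carrier (sym_group m) = {w. w permutes {1..m}}" by (simp add: sym_group_def)
  \<comment> \<open>The group axioms compare with \<open>Some\<close>, which is defined everywhere;
    on the torus it coincides with the identity used so far.\<close>
  have to_Some: "rat_eq ?T F Some" if "permuting n m id F" for F
  proof -
    from permuting_rat_eq[OF n0 that permuting_id[OF n0]] show ?thesis
      unfolding rat_eq_iff[OF irr] by eventually_elim (auto simp: restrict_map_def split: if_splits)
  qed
  show ?thesis
    unfolding crystal_automorphism_group_def pts G
  proof (intro conjI ballI)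
    fix g assume "g \<in> ?\<Gamma>"
    then obtain w where w: "w permutes {1..m}" "g = \<rho> w" by blast
    show "crystal_map (X_crystal n m) (X_crystal n m) g"
      unfolding w(2) by (rule permuting_crystal_map[OF n m \<rho>[OF w(1)] w(1)])
    have w': "inv_into UNIV w permutes {1..m}" by (rule permutes_inv[OF w(1)])
    have "rat_eq ?T (g \<circ>\<^sub>m \<rho> (inv_into UNIV w)) Some"
      using to_Some[OF permuting_comp[OF n0 \<rho>[OF w'] \<rho>[OF w(1)] w(1), unfolded permutes_inv_o(2)[OF w(1)]]] w(2)
      by simp
    moreover have "rat_eq ?T (\<rho> (inv_into UNIV w) \<circ>\<^sub>m g) Some"
      using to_Some[OF permuting_comp[OF n0 \<rho>[OF w(1)] \<rho>[OF w'] w', unfolded permutes_inv_o(1)[OF w(1)]]] w(2)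
      by simp
    ultimately show "\<exists>h\<in>?\<Gamma>. rat_eq ?T (g \<circ>\<^sub>m h) Some \<and> rat_eq ?T (h \<circ>\<^sub>m g) Some"
      using w' by blast
    fix h assume "h \<in> ?\<Gamma>"
    then obtain v where v: "v permutes {1..m}" "h = \<rho> v" by blast
    have vw: "v \<circ> w permutes {1..m}" by (rule permutes_compose[OF w(1) v(1)])
    have "rat_eq ?T (\<rho> (v \<circ> w)) (g \<circ>\<^sub>m h)"
      unfolding w(2) v(2)
      by (rule permuting_rat_eq[OF n0 \<rho>[OF vw] permuting_comp[OF n0 \<rho>[OF v(1)] \<rho>[OF w(1)] w(1)]])
    then show "\<exists>k\<in>?\<Gamma>. rat_eq ?T k (g \<circ>\<^sub>m h)" using vw by blast
  next
    have "id permutes {1..m}" by (rule permutes_id)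
    then show "\<exists>e\<in>?\<Gamma>. rat_eq ?T e Some" using to_Some[OF \<rho>] by blast
  qed
qed

lemma pullback_proj_invariant:
  assumes n: "n > 0" and F: "permuting n m w F" and g: "rational_fun (U_le n m) g"
  shows "rat_eq (torus n m) ((g \<circ>\<^sub>m (\<lambda>x. Some (whirl_prod m x)) |` torus n m) \<circ>\<^sub>m F)
    (g \<circ>\<^sub>m (\<lambda>x. Some (whirl_prod m x)) |` torus n m)"
proof -
  let ?T = "torus n m" and ?p = "(\<lambda>x. Some (whirl_prod m x)) |` torus n m"
  note irr = torus_irreducible[OF n, of m]
  have irrU: "irreducible_set (U_le n m)" by (rule variety_irreducible[OF U_le_variety[OF n]])
  show ?thesis
    unfolding rat_eq_iff[OF irr]
    using permutingD(3)[OF F] eventually_generic_in[OF irr]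
      dominant_rational_fun(2)[OF irr irrU rational_map_whirl_prod[OF n] dominant_proj[OF n] g]
  proof eventually_elim
    case (elim x)
    then have Fx: "the (F x) \<in> ?T" using rational_map_in[OF permutingD(1)[OF F]] by blast
    obtain y where y: "F x = Some y" using elim(1) by auto
    have "((g \<circ>\<^sub>m ?p) \<circ>\<^sub>m F) x = (g \<circ>\<^sub>m ?p) x"
      using y elim(1,2) Fx by (simp add: map_comp_def)
    then show ?case using elim(3) by (auto simp: domIff)
  qed
qed

lemma rational_fun_rat_over_coords:
  assumes irr: "irreducible_set V" and f: "rational_fun V f"
  shows "(\<lambda>x. the (f x)) \<in> rat_over V (range (\<lambda>p x. x p))"
proof -
  obtain x where x: "x \<in> dom f" using f by (auto simp: rational_fun_def)
  obtain p q where pq: "p \<in> polyfun UNIV" "q \<in> polyfun UNIV" "q x \<noteq> 0"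
    "\<And>y. y \<in> V \<Longrightarrow> q y \<noteq> 0 \<Longrightarrow> y \<in> dom f \<and> the (f y) = p y / q y"
    by (rule regular_on_openE[OF rational_fun_regular[OF f subset_refl] rational_fun_dom[OF f] x])
      (rule that, assumption+)
  have xV: "x \<in> V" using x rational_fun_dom[OF f] by (auto simp: openin_zariski_on_iff)
  have poly_alg: "h \<in> polyfun UNIV \<Longrightarrow> h \<in> alg (range (\<lambda>p x. x p))" for h :: "'a pt \<Rightarrow> complex"
    by (induction rule: polyfun.induct) (auto intro: alg.intros)
  show ?thesis
  proof (rule rat_overI[OF poly_alg[OF pq(1)] poly_alg[OF pq(2)]])
    show "\<forall>\<^sub>F y in generic V. q y \<noteq> 0 \<and> the (f y) = p y / q y"
      using eventually_generic_nonzero[OF irr pq(2) xV pq(3)] eventually_generic_in[OF irr]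
      by eventually_elim (use pq(4) in blast)
  qed
qed

text \<open>Invariance under adjacent transpositions places f in the top field of the tower, so
  numerator and denominator are polynomials in the product of whirls; their quotient on U is the
  required function.\<close>

lemma invariant_pullback_proj:
  assumes n: "n > 1" and f: "rational_fun (torus n m) f"
    and inv: "\<And>j. 1 \<le> j \<Longrightarrow> j < m \<Longrightarrow> rat_eq (torus n m) (f \<circ>\<^sub>m R_map n m j) f"
  shows "\<exists>g. rational_fun (U_le n m) g \<and>
    rat_eq (torus n m) (g \<circ>\<^sub>m (\<lambda>x. Some (whirl_prod m x)) |` torus n m) f"
proof -
  let ?T = "torus n m" and ?p = "(\<lambda>x. Some (whirl_prod m x)) |` torus n m"
  have n0: "n > 0" using n by simp
  note irr = torus_irreducible[OF n0, of m]
  have irrU: "irreducible_set (U_le n m)" by (rule variety_irreducible[OF U_le_variety[OF n0]])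
  have "(\<lambda>x. the (f x)) \<in> rat_over ?T (tower_gens m)"
  proof (rule invariant_rat_over_tower[OF n rational_fun_rat_over_coords[OF irr f] order_refl])
    fix j assume j: "1 \<le> j" "j < m"
    show "\<forall>\<^sub>F x in generic ?T. the (f (R_fun n j x)) = the (f x)"
      using inv[OF j, unfolded rat_eq_iff[OF irr]]
        rational_map_eventually_dom[OF irr rational_map_R[OF n0 j]]
      by eventually_elim (auto simp: R_map_def restrict_map_def split: if_splits)
  qed
  then obtain a b where ab: "a \<in> alg (tower_gens m)" "b \<in> alg (tower_gens m)"
    "\<forall>\<^sub>F x in generic ?T. b x \<noteq> 0 \<and> the (f x) = a x / b x" by (rule rat_overE)
  obtain P where P: "P \<in> polyfun UNIV" "\<And>x. x \<in> ?T \<Longrightarrow> a x = P (whirl_prod m x)"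
    using alg_tower_gens_polyfun[OF ab(1)] by blast
  obtain D where D: "D \<in> polyfun UNIV" "\<And>x. x \<in> ?T \<Longrightarrow> b x = D (whirl_prod m x)"
    using alg_tower_gens_polyfun[OF ab(2)] by blast
  let ?P = "(\<lambda>Y. Some (P Y)) |` U_le n m" and ?D = "(\<lambda>Y. Some (D Y)) |` U_le n m"
  have ev: "\<forall>\<^sub>F x in generic ?T. x \<in> ?T \<and> x \<in> dom f \<and> D (whirl_prod m x) \<noteq> 0 \<and>
      the (f x) = P (whirl_prod m x) / D (whirl_prod m x)"
    using ab(3) eventually_generic_in[OF irr] rational_fun_eventually_dom[OF irr f]
    by eventually_elim (simp add: P(2) D(2))
  have eq: "(pdiv ?P ?D \<circ>\<^sub>m ?p) x = Some (P (whirl_prod m x) / D (whirl_prod m x))"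
    if "x \<in> ?T" "D (whirl_prod m x) \<noteq> 0" for x
    using that whirl_prod_U_le[OF that(1)] n0 by (simp add: map_comp_def pdiv_def)
  obtain x0 where x0: "x0 \<in> ?T" "D (whirl_prod m x0) \<noteq> 0"
    using eventually_generic_ex[OF irr ev] by blast
  have "dom (pdiv ?P ?D) \<noteq> {}"
    using eq[OF x0] x0(1) by (force simp: map_comp_def split: option.splits)
  then have "rational_fun (U_le n m) (pdiv ?P ?D)"
    by (intro rational_fun_pdiv rational_fun_polyfun irrU P(1) D(1))
  moreover have "rat_eq ?T (pdiv ?P ?D \<circ>\<^sub>m ?p) f"
    unfolding rat_eq_iff[OF irr] using ev
  proof eventually_elim
    case (elim x)
    then have "(pdiv ?P ?D \<circ>\<^sub>m ?p) x = f x" using eq[of x] by auto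
    then show ?case using elim by (auto simp: domIff)
  qed
  ultimately show ?thesis by blast
qed

lemma pullback_proj_iso:
  assumes n: "n > 1" and \<rho>: "\<And>w. w permutes {1..m} \<Longrightarrow> permuting n m w (\<rho> w)"
  defines "p \<equiv> (\<lambda>x. Some (whirl_prod m x)) |` torus n m"
  shows "pullback (torus n m) p \<in> ring_iso (function_field (U_le n m))
    (function_field (torus n m)\<lparr>carrier := invariants (torus n m) (\<rho> ` carrier (sym_group m))\<rparr>)"
proof -
  let ?T = "torus n m" and ?U = "U_le n m" and ?\<Gamma> = "\<rho> ` carrier (sym_group m)"
  have n0: "n > 0" using n by simp
  note irr = torus_irreducible[OF n0, of m]
  have irrU: "irreducible_set ?U" by (rule variety_irreducible[OF U_le_variety[OF n0]])
  have G: "carrier (sym_group m) = {w. w permutes {1..m}}" by (simp add: sym_group_def)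
  have proj: "rational_map ?T ?U p" "dominant ?T ?U p"
    unfolding p_def by (rule rational_map_whirl_prod[OF n0], rule dominant_proj[OF n0])
  note pb = pullback_rat_class[OF irr irrU proj] and rf = dominant_rational_fun(1)[OF irr irrU proj]
  have pbF: "pullback ?T (\<rho> w) (rat_class ?T f) = rat_class ?T (f \<circ>\<^sub>m \<rho> w)"
    if "w permutes {1..m}" "rational_fun ?T f" for w f
    by (rule pullback_rat_class[OF irr irr permutingD(1,2)[OF \<rho>[OF that(1)]] that(2)])
  have hom: "pullback ?T p \<in> Ring.ring_hom (function_field ?U) (function_field ?T)"
    by (rule pullback_ring_hom[OF irr irrU proj])
  have into: "pullback ?T p a \<in> invariants ?T ?\<Gamma>" if a: "a \<in> carrier (function_field ?U)" for a
  proof -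
    obtain g where g: "rational_fun ?U g" "a = rat_class ?U g" using a by (auto simp: carrier_function_field)
    have "pullback ?T h (rat_class ?T (g \<circ>\<^sub>m p)) = rat_class ?T (g \<circ>\<^sub>m p)" if h: "h \<in> ?\<Gamma>" for h
    proof -
      obtain w where w: "w permutes {1..m}" "h = \<rho> w" using h G by blast
      show ?thesis unfolding w(2) pbF[OF w(1) rf[OF g(1)]]
        by (rule rat_class_cong[OF irr pullback_proj_invariant[OF n0 \<rho>[OF w(1)] g(1), folded p_def]])
    qed
    then show ?thesis using rf[OF g(1)] by (auto simp: invariants_def g(2) pb[OF g(1)] carrier_function_field)
  qed
  have onto: "a \<in> pullback ?T p ` carrier (function_field ?U)" if a: "a \<in> invariants ?T ?\<Gamma>" for a
  proof -
    obtain f where f: "rational_fun ?T f" "a = rat_class ?T f"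
      using a by (auto simp: invariants_def carrier_function_field)
    have "rat_eq ?T (f \<circ>\<^sub>m R_map n m j) f" if j: "1 \<le> j" "j < m" for j
    proof -
      let ?s = "Transposition.transpose j (j + 1)"
      have s: "?s permutes {1..m}" by (rule permutes_swap_id) (use j in auto)
      note dom = dominant_rational_fun[OF irr irr permutingD(1,2)[OF \<rho>[OF s]] f(1)]
      have "rat_class ?T (f \<circ>\<^sub>m \<rho> ?s) = rat_class ?T f"
        using a s pbF[OF s f(1)] by (auto simp: invariants_def G f(2))
      then have "rat_eq ?T (f \<circ>\<^sub>m \<rho> ?s) f" by (rule rat_class_eqD[OF irr dom(1)])
      moreover have "rat_eq ?T (f \<circ>\<^sub>m \<rho> ?s) (f \<circ>\<^sub>m R_map n m j)"
        by (rule rat_eq_comp_left[OF irr permuting_rat_eq[OF n0 \<rho>[OF s] permuting_R[OF n0 j]] dom(2)])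
      ultimately show ?thesis using rat_eq_trans[OF irr rat_eq_sym] by blast
    qed
    then obtain g where g: "rational_fun ?U g" "rat_eq ?T (g \<circ>\<^sub>m p) f"
      using invariant_pullback_proj[OF n f(1)] unfolding p_def by blast
    have "a = pullback ?T p (rat_class ?U g)"
      unfolding pb[OF g(1)] f(2) by (rule rat_class_cong[OF irr g(2), symmetric])
    then show ?thesis using g(1) by (auto simp: carrier_function_field)
  qed
  have "pullback ?T p \<in> Ring.ring_hom (function_field ?U) (function_field ?T\<lparr>carrier := invariants ?T ?\<Gamma>\<rparr>)"
    using hom into by (auto simp: Ring.ring_hom_def Pi_iff)
  moreover have "bij_betw (pullback ?T p) (carrier (function_field ?U)) (invariants ?T ?\<Gamma>)"
    unfolding bij_betw_def using pullback_inj_on[OF irr irrU proj] into onto by blast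
  ultimately show ?thesis by (simp add: ring_iso_def)
qed

theorem corollary4p4:
  fixes n m :: nat
  assumes "n > 1" and "m \<ge> 1"
  shows "(\<exists>\<rho>. R_matrix_action n m \<rho>) \<and>
         (\<forall>\<rho>. R_matrix_action n m \<rho> \<longrightarrow>
            is_quotient n (X_crystal n m) (\<rho> ` carrier (sym_group m)) (U_crystal n m) (proj n m))"
proof (intro conjI allI impI)
  have n0: "n > 0" using assms(1) by simp
  show "\<exists>\<rho>. R_matrix_action n m \<rho>" by (rule ex_R_matrix_action[OF n0 assms(2)])
  fix \<rho> assume A: "R_matrix_action n m \<rho>"
  note \<rho> = R_matrix_action_permuting[OF n0 assms(2) A]
  have pts: "points (X_crystal n m) = torus n m"
    by (simp add: X_crystal_explicit[OF assms(2)] X_explicit_def)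
  have proj: "proj n m = (\<lambda>x. Some (whirl_prod m x)) |` torus n m" by (simp add: proj_def pts)
  show "is_quotient n (X_crystal n m) (\<rho> ` carrier (sym_group m)) (U_crystal n m) (proj n m)"
    unfolding is_quotient_def
  proof (intro conjI)
    show "geometric_crystal n (X_crystal n m)"
      unfolding X_crystal_explicit[OF assms(2)] by (rule geometric_crystal_X(1)[OF assms])
    show "crystal_automorphism_group (X_crystal n m) (\<rho> ` carrier (sym_group m))"
      by (rule permuting_automorphism_group[OF assms \<rho>])
    show "geometric_crystal n (U_crystal n m)" by (rule geometric_crystal_U[OF assms])
    show "crystal_map (X_crystal n m) (U_crystal n m) (proj n m)" by (rule crystal_map_proj[OF assms])
    show "pullback (points (X_crystal n m)) (proj n m) \<in> ring_iso (function_field (points (U_crystal n m)))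
      (function_field (points (X_crystal n m))
        \<lparr>carrier := invariants (points (X_crystal n m)) (\<rho> ` carrier (sym_group m))\<rparr>)"
      unfolding pts proj U_crystal_points by (rule pullback_proj_iso[OF assms(1) \<rho>])
  qed
qed

end
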